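(* Let $s\ge1/2$ and let $\sigma\in C^\infty(\mathbb{R}^{2d})$ satisfy, for some constants $c,C>0$, $$|\partial^\alpha\sigma(z)|\le c\,C^{|\alpha|}(\alpha!)^s\qquad\text{for all }z\in\mathbb{R}^{2d},\ \alpha\in\mathbb{N}^{2d}.$$ Let $v$ be a submultiplicative weight on $\mathbb{R}^{2d}$, $m\in\mathcal{M}_v(\mathbb{R}^{2d})$ and, if $s\ge1$, assume that for every $\epsilon>0$ there is $c_\epsilon>0$ such that $v(z)\le c_\epsilon\exp(\epsilon|z|^{1/s})$ for all $z\in\mathbb{R}^{2d}$. Let $1\le p,q\le\infty$. Then the Weyl operator $\sigma^w$ extends to a bounded operator on $M^{p,q}_m(\mathbb{R}^d)$.
   Context: Weights: a submultiplicative weight $v$ on $\mathbb{R}^{n}$ is a continuous, positive, even function with $v(0)=1$, $v(z_1+z_2)\le v(z_1)v(z_2)$. $\mathcal{M}_v(\mathbb{R}^n)$ is the set of measurable positive functions $m$ for which there is $C>0$ with $m(z+\zeta)\le Cv(z)m(\zeta)$ for all $z,\zeta$. $\Sigma^1_1(\mathbb{R}^d)$ is the space of $f\in\mathcal{S}(\mathbb{R}^d)$ such that for every $A,B>0$ there is $c>0$ with $|x^\alpha\partial^\beta f(x)|\le cA^{|\alpha|}B^{|\beta|}\alpha!\beta!$ for all $x,\alpha,\beta$; $(\Sigma^1_1)'(\mathbb{R}^d)$ is its strong dual. Modulation spaces: for $z=(x,\xi)\in\mathbb{R}^{2d}$ let $\pi(z)g(t)=e^{2\pi i\xi\cdot t}g(t-x)$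 and $V_gf(z)=\langle f,\pi(z)g\rangle$ (short-time Fourier transform), where brackets extend $\langle f,g\rangle=\int f\overline g$. Fix $g\in\Sigma^1_1(\mathbb{R}^d)\setminus\{0\}$. For $m\in\mathcal{M}_v(\mathbb{R}^{2d})$ and $1\le p,q\le\infty$, $M^{p,q}_m(\mathbb{R}^d)$ is the Banach space of $f\in(\Sigma^1_1)'(\mathbb{R}^d)$ such that $$\|f\|_{M^{p,q}_m}=\Big(\int_{\mathbb{R}^d}\Big(\int_{\mathbb{R}^d}|V_gf(x,\xi)|^pm(x,\xi)^p\,dx\Big)^{q/p}d\xi\Big)^{1/q}<\infty$$ (usual modification if $p$ or $q$ is $\infty$); different choices of $g$ give equivalent norms. Weyl operator: formally $\sigma^wf(x)=\int\int\sigma\big(\tfrac{x+y}{2},\xi\big)e^{2\pi i(x-y)\cdot\xi}f(y)\,dy\,d\xi$; rigorously it is the continuous map $\Sigma^1_1(\mathbb{R}^d)\to(\Sigma^1_1)'(\mathbb{R}^d)$ with $\langle\sigma^wf,h\rangle=\langle\sigma,W(h,f)\rangle$, $W(f,h)(x,\xi)=\int_{\mathbb{R}^d}f(x+\tfrac t2)\overline{h(x-\tfrac t2)}e^{-2\pi it\cdot\xi}\,dt$. *)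

theory Defs
  imports "HOL-Analysis.Analysis" "HOL-Probability.Essential_Supremum"
begin

subsection \<open>Multi-indices and partial derivatives\<close>

text \<open>A multi-index is a function \<open>\<alpha> :: 'a \<Rightarrow> nat\<close>, of which only the values on the coordinate
  directions \<^term>\<open>Basis\<close> are used.\<close>

definition mi_size :: "('a::euclidean_space \<Rightarrow> nat) \<Rightarrow> nat"
  where "mi_size \<alpha> = (\<Sum>b\<in>Basis. \<alpha> b)"

definition mi_fact :: "('a::euclidean_space \<Rightarrow> nat) \<Rightarrow> real"
  where "mi_fact \<alpha> = (\<Prod>b\<in>Basis. fact (\<alpha> b))"

definition mi_power :: "'a::euclidean_space \<Rightarrow> ('a \<Rightarrow> nat) \<Rightarrow> real"
  where "mi_power x \<alpha> = (\<Prod>b\<in>Basis. (x \<bullet> b) ^ \<alpha> b)"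

definition partial_deriv ::
    "'a::euclidean_space \<Rightarrow> ('a \<Rightarrow> 'b::real_normed_vector) \<Rightarrow> 'a \<Rightarrow> 'b"
  where "partial_deriv b f = (\<lambda>x. frechet_derivative f (at x) b)"

text \<open>Every iterated partial derivative is (totally) differentiable, hence continuous; by the
  \<open>C\<^sup>1\<close> criterion this is the same as \<open>f \<in> C\<^sup>\<infinity>\<close>.\<close>

definition smooth :: "('a::euclidean_space \<Rightarrow> 'b::real_normed_vector) \<Rightarrow> bool"
  where "smooth f \<longleftrightarrow>
    (\<forall>bs. set bs \<subseteq> Basis \<longrightarrow> (\<forall>x. foldr partial_deriv bs f differentiable (at x)))"

text \<open>\<open>mi_deriv \<alpha> f\<close> is \<open>\<partial>\<^sup>\<alpha> f\<close>. The coordinates are taken in a fixed but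
  unspecified order, which is irrelevant for smooth \<open>f\<close>.\<close>

definition basis_list :: "'a::euclidean_space list"
  where "basis_list = (SOME bs. distinct bs \<and> set bs = Basis)"

definition mi_deriv ::
    "('a::euclidean_space \<Rightarrow> nat) \<Rightarrow> ('a \<Rightarrow> 'b::real_normed_vector) \<Rightarrow> 'a \<Rightarrow> 'b"
  where "mi_deriv \<alpha> f = foldr (\<lambda>b. partial_deriv b ^^ \<alpha> b) basis_list f"


subsection \<open>Weights\<close>

definition submult_weight :: "('a::euclidean_space \<Rightarrow> real) \<Rightarrow> bool"
  where "submult_weight v \<longleftrightarrow>
    continuous_on UNIV v \<and> (\<forall>z. 0 < v z) \<and> (\<forall>z. v (- z) = v z) \<and> v 0 = 1 \<and>
    (\<forall>z\<^sub>1 z\<^sub>2. v (z\<^sub>1 + z\<^sub>2) \<le> v z\<^sub>1 * v z\<^sub>2)"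

definition moderate_weights :: "('a::euclidean_space \<Rightarrow> real) \<Rightarrow> ('a \<Rightarrow> real) set"
  where "moderate_weights v =
    {m. m \<in> borel_measurable lebesgue \<and> (\<forall>z. 0 < m z) \<and>
        (\<exists>C>0. \<forall>z \<zeta>. m (z + \<zeta>) \<le> C * v z * m \<zeta>)}"


subsection \<open>The space \<open>\<Sigma>\<^sup>1\<^sub>1\<close> and its dual\<close>

definition schwartz :: "('a::euclidean_space \<Rightarrow> complex) set"
  where "schwartz =
    {f. smooth f \<and> (\<forall>\<alpha> \<beta>. \<exists>c. \<forall>x. \<bar>mi_power x \<alpha>\<bar> * norm (mi_deriv \<beta> f x) \<le> c)}"

definition gelfand_shilov :: "('a::euclidean_space \<Rightarrow> complex) set"
  where "gelfand_shilov =
    {f \<in> schwartz. \<forall>A>0. \<forall>B>0. \<exists>c>0. \<forall>x \<alpha> \<beta>.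
       \<bar>mi_power x \<alpha>\<bar> * norm (mi_deriv \<beta> f x)
         \<le> c * A ^ mi_size \<alpha> * B ^ mi_size \<beta> * mi_fact \<alpha> * mi_fact \<beta>}"

definition gs_seminorm :: "real \<Rightarrow> real \<Rightarrow> ('a::euclidean_space \<Rightarrow> complex) \<Rightarrow> real"
  where "gs_seminorm A B f =
    (SUP (x, \<alpha>, \<beta>) \<in> UNIV. \<bar>mi_power x \<alpha>\<bar> * norm (mi_deriv \<beta> f x)
        / (A ^ mi_size \<alpha> * B ^ mi_size \<beta> * mi_fact \<alpha> * mi_fact \<beta>))"

text \<open>Continuous linear functionals on \<open>\<Sigma>\<^sup>1\<^sub>1\<close>. The topology is that of the seminorms
  \<^term>\<open>gs_seminorm A B\<close> with \<open>A, B > 0\<close>; the family is directed, so a linear functional is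
  continuous iff it is bounded by a multiple of one of them. Functionals are normalised to vanish
  outside \<open>\<Sigma>\<^sup>1\<^sub>1\<close>, so that two of them are equal iff they agree on \<open>\<Sigma>\<^sup>1\<^sub>1\<close>, and the vector
  space operations are pointwise.\<close>

definition gs_dual :: "(('a::euclidean_space \<Rightarrow> complex) \<Rightarrow> complex) set"
  where "gs_dual =
    {u. (\<forall>\<phi>\<in>gelfand_shilov. \<forall>\<psi>\<in>gelfand_shilov. u (\<lambda>x. \<phi> x + \<psi> x) = u \<phi> + u \<psi>) \<and>
        (\<forall>a. \<forall>\<phi>\<in>gelfand_shilov. u (\<lambda>x. a * \<phi> x) = a * u \<phi>) \<and>
        (\<exists>A>0. \<exists>B>0. \<exists>K. \<forall>\<phi>\<in>gelfand_shilov. norm (u \<phi>) \<le> K * gs_seminorm A B \<phi>) \<and>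
        (\<forall>\<phi>. \<phi> \<notin> gelfand_shilov \<longrightarrow> u \<phi> = 0)}"

text \<open>\<open>l2_bracket\<close> is the sesquilinear bracket on functions, and \<open>pairing\<close> its extension to
  a functional in the first argument: if \<open>u \<in> gs_dual\<close> is the embedded function \<open>f\<close>, that is
  \<open>u \<phi> = \<integral> f \<phi>\<close>, then \<open>pairing u g = l2_bracket f g\<close>.\<close>

definition l2_bracket ::
    "('a::euclidean_space \<Rightarrow> complex) \<Rightarrow> ('a \<Rightarrow> complex) \<Rightarrow> complex"
  where "l2_bracket f g = (LINT x|lborel. f x * cnj (g x))"

definition pairing ::
    "(('a::euclidean_space \<Rightarrow> complex) \<Rightarrow> complex) \<Rightarrow> ('a \<Rightarrow> complex) \<Rightarrow> complex"
  where "pairing u g = u (\<lambda>x. cnj (g x))"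

definition gs_embed ::
    "('a::euclidean_space \<Rightarrow> complex) \<Rightarrow> ('a \<Rightarrow> complex) \<Rightarrow> complex"
  where "gs_embed f =
    (\<lambda>\<phi>. if \<phi> \<in> gelfand_shilov then l2_bracket f (\<lambda>x. cnj (\<phi> x)) else 0)"


subsection \<open>Modulation spaces\<close>

definition tf_shift ::
    "'a::euclidean_space \<times> 'a \<Rightarrow> ('a \<Rightarrow> complex) \<Rightarrow> 'a \<Rightarrow> complex"
  where "tf_shift = (\<lambda>(x, \<xi>) g t. cis (2 * pi * (\<xi> \<bullet> t)) * g (t - x))"

definition stft ::
    "('a::euclidean_space \<Rightarrow> complex) \<Rightarrow> (('a \<Rightarrow> complex) \<Rightarrow> complex) \<Rightarrow> 'a \<times> 'a \<Rightarrow> complex"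
  where "stft g u z = pairing u (tf_shift z g)"

definition ennreal_powr :: "ennreal \<Rightarrow> real \<Rightarrow> ennreal"
  where "ennreal_powr x a = (if x = \<infinity> then \<infinity> else ennreal (enn2real x powr a))"

definition lp_enorm :: "'a measure \<Rightarrow> ennreal \<Rightarrow> ('a \<Rightarrow> ennreal) \<Rightarrow> ennreal"
  where "lp_enorm M p f =
    (if p = \<infinity> then esssup M f
     else ennreal_powr (\<integral>\<^sup>+x. ennreal_powr (f x) (enn2real p) \<partial>M) (1 / enn2real p))"

definition mod_enorm ::
    "('a::euclidean_space \<Rightarrow> complex) \<Rightarrow> ('a \<times> 'a \<Rightarrow> real) \<Rightarrow> ennreal \<Rightarrow> ennreal \<Rightarrow>
     (('a \<Rightarrow> complex) \<Rightarrow> complex) \<Rightarrow> ennreal"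
  where "mod_enorm g m p q u =
    lp_enorm lebesgue q
      (\<lambda>\<xi>. lp_enorm lebesgue p (\<lambda>x. ennreal (norm (stft g u (x, \<xi>)) * m (x, \<xi>))))"

definition mod_space ::
    "('a::euclidean_space \<Rightarrow> complex) \<Rightarrow> ('a \<times> 'a \<Rightarrow> real) \<Rightarrow> ennreal \<Rightarrow> ennreal \<Rightarrow>
     (('a \<Rightarrow> complex) \<Rightarrow> complex) set"
  where "mod_space g m p q = {u \<in> gs_dual. mod_enorm g m p q u < \<infinity>}"

definition mod_norm ::
    "('a::euclidean_space \<Rightarrow> complex) \<Rightarrow> ('a \<times> 'a \<Rightarrow> real) \<Rightarrow> ennreal \<Rightarrow> ennreal \<Rightarrow>
     (('a \<Rightarrow> complex) \<Rightarrow> complex) \<Rightarrow> real"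
  where "mod_norm g m p q u = enn2real (mod_enorm g m p q u)"

definition mod_bounded_operator ::
    "('a::euclidean_space \<Rightarrow> complex) \<Rightarrow> ('a \<times> 'a \<Rightarrow> real) \<Rightarrow> ennreal \<Rightarrow> ennreal \<Rightarrow>
     ((('a \<Rightarrow> complex) \<Rightarrow> complex) \<Rightarrow> (('a \<Rightarrow> complex) \<Rightarrow> complex)) \<Rightarrow> bool"
  where "mod_bounded_operator g m p q T \<longleftrightarrow>
    (\<forall>u\<in>mod_space g m p q. T u \<in> mod_space g m p q) \<and>
    (\<forall>u\<in>mod_space g m p q. \<forall>w\<in>mod_space g m p q.
       T (\<lambda>\<phi>. u \<phi> + w \<phi>) = (\<lambda>\<phi>. T u \<phi> + T w \<phi>)) \<and>
    (\<forall>a. \<forall>u\<in>mod_space g m p q. T (\<lambda>\<phi>. a * u \<phi>) = (\<lambda>\<phi>. a * T u \<phi>)) \<and>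
    (\<exists>K. \<forall>u\<in>mod_space g m p q. mod_norm g m p q (T u) \<le> K * mod_norm g m p q u)"


subsection \<open>Weyl operators\<close>

definition wigner ::
    "('a::euclidean_space \<Rightarrow> complex) \<Rightarrow> ('a \<Rightarrow> complex) \<Rightarrow> 'a \<times> 'a \<Rightarrow> complex"
  where "wigner f h = (\<lambda>(x, \<xi>).
    LINT t|lborel. f (x + t /\<^sub>R 2) * cnj (h (x - t /\<^sub>R 2)) * cis (- (2 * pi * (t \<bullet> \<xi>))))"

text \<open>The functional \<open>\<sigma>\<^sup>w f\<close> determined by
  \<open>pairing (\<sigma>\<^sup>w f) h = l2_bracket \<sigma> (W(h, f))\<close> for \<open>h \<in> \<Sigma>\<^sup>1\<^sub>1\<close>, for symbols \<open>\<sigma>\<close> that are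
  functions; its value at \<open>\<phi>\<close> is obtained by taking for \<open>h\<close> the conjugate of \<open>\<phi>\<close>.\<close>

definition weyl_op ::
    "('a::euclidean_space \<times> 'a \<Rightarrow> complex) \<Rightarrow> ('a \<Rightarrow> complex) \<Rightarrow> ('a \<Rightarrow> complex) \<Rightarrow> complex"
  where "weyl_op \<sigma> f =
    (\<lambda>\<phi>. if \<phi> \<in> gelfand_shilov then l2_bracket \<sigma> (wigner (\<lambda>x. cnj (\<phi> x)) f) else 0)"

text \<open>\<open>T\<close> extends \<open>\<sigma>\<^sup>w : \<Sigma>\<^sup>1\<^sub>1 \<rightarrow> (\<Sigma>\<^sup>1\<^sub>1)'\<close>, where \<open>\<Sigma>\<^sup>1\<^sub>1\<close> is regarded as a subspace of
  the modulation space.\<close>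

definition extends_weyl_op ::
    "('a::euclidean_space \<Rightarrow> complex) \<Rightarrow> ('a \<times> 'a \<Rightarrow> real) \<Rightarrow> ennreal \<Rightarrow> ennreal \<Rightarrow>
     ('a \<times> 'a \<Rightarrow> complex) \<Rightarrow>
     ((('a \<Rightarrow> complex) \<Rightarrow> complex) \<Rightarrow> (('a \<Rightarrow> complex) \<Rightarrow> complex)) \<Rightarrow> bool"
  where "extends_weyl_op g m p q \<sigma> T \<longleftrightarrow>
    (\<forall>f\<in>gelfand_shilov. gs_embed f \<in> mod_space g m p q \<and> T (gs_embed f) = weyl_op \<sigma> f)"

end

theory Submission
  imports Defs "HOL-Probability.Sinc_Integral" "HOL-Probability.Characteristic_Functions"
begin

text \<open>
  Since \<open>\<parallel>g\<parallel>\<^sup>2 \<langle>f, k\<rangle> = \<integral> V\<^sub>g f(z) \<langle>\<pi>(z)g, k\<rangle> dz\<close> (Moyal), the Weyl operator is recovered from its matrix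
  with respect to the time-frequency shifts of \<open>g\<close>, and
  \<open>\<langle>T u, h\<rangle> = \<parallel>g\<parallel>\<^sup>-\<^sup>2 \<integral> V\<^sub>g u(z) \<langle>\<sigma>\<^sup>w \<pi>(z)g, h\<rangle> dz\<close> makes sense for every \<open>u\<close> in the modulation space,
  because the matrix is concentrated near the diagonal. Indeed, multiplying
  \<open>\<langle>\<sigma>\<^sup>w \<pi>(z)g, \<pi>(w)h\<rangle>\<close> by a coordinate of \<open>w - z\<close> amounts to differentiating \<open>\<sigma>\<close> once, or to applying one
  derivative or one multiplication by a coordinate to \<open>g\<close> or \<open>h\<close>. Iterating \<open>n\<close> times bounds the \<open>n\<close>-th
  moments in \<open>w - z\<close> by \<open>K R\<^sup>n (n!)\<^sup>p\<close> with \<open>p = max 1 s\<close>, which means decay like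
  \<open>exp (- \<epsilon> |w - z|\<^bsup>1/p\<^esup>)\<close>: enough to absorb \<open>v(w - z)\<close> and still leave an integrable function of
  \<open>w - z\<close>. Hence \<open>|V\<^sub>g (T u)| m\<close> is dominated by the convolution of \<open>|V\<^sub>g u| m\<close> with an integrable function,
  and Minkowski's inequality for the mixed norm (a version with constant 2 suffices) concludes.
\<close>

section \<open>Iterated partial derivatives\<close>

text \<open>The operator is given by an integral, not by extension from a dense subspace: for
  \<open>p = \<infinity>\<close> or \<open>q = \<infinity>\<close> the test functions are in general
  not dense in the modulation space. The integral has to depend continuously on \<open>h\<close>, so
  the estimates are linear in the explicit constant \<open>S\<close> of
  \<open>gs_bound A B S h\<close> and end in one seminorm \<open>gs_seminorm A A h\<close>. The
  resulting bound then serves twice: at \<open>w = 0\<close> with arbitrary \<open>h\<close> it puts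
  \<open>T u\<close> into the dual, at \<open>h = g\<close> with arbitrary \<open>w\<close> it
  bounds the norm. The symbol comes with one fixed rate \<open>C\<close>, whereas test functions
  satisfy factorial bounds at every rate. The parameters of \<open>g\<close> and \<open>h\<close>
  are therefore fitted to the symbol, and the decay that remains, hence the admissible growth of
  \<open>v\<close>, is dictated by the symbol alone. Integrability is measured against the product
  weight \<open>rho\<close>, which factors over coordinates and obeys a Peetre-type inequality. The
  weight \<open>m\<close> is merely Lebesgue measurable; it is exchanged for an equivalent
  continuous weight before any convolution is estimated.\<close>

lemma smooth_differentiable: "smooth f \<Longrightarrow> f differentiable (at x)"
  unfolding smooth_def by (drule spec[of _ "[]"]) auto

lemma smooth_partial_deriv: "smooth f \<Longrightarrow> b \<in> Basis \<Longrightarrow> smooth (partial_deriv b f)"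
  unfolding smooth_def
proof (intro allI impI)
  fix bs :: "'a list" and x assume *: "\<forall>bs. set bs \<subseteq> Basis \<longrightarrow> (\<forall>x. foldr partial_deriv bs f differentiable at x)"
    and b: "b \<in> Basis" and bs: "set bs \<subseteq> Basis"
  then show "foldr partial_deriv bs (partial_deriv b f) differentiable at x"
    using *[rule_format, of "bs @ [b]" x] by simp
qed

text \<open>\<open>smooth\<close> quantifies over all lists of directions, so induction on the list
  reduces it to any class of differentiable functions closed under partial derivatives. Later uses
  take the functions of a given shape as this class.\<close>

lemma smooth_coinduct:
  assumes "P f" and step: "\<And>f. P f \<Longrightarrow> (\<forall>x. f differentiable (at x)) \<and> (\<forall>b\<in>Basis. P (partial_deriv b f))"
  shows "smooth f"
proof -
  have "P (foldr partial_deriv bs f)" if "set bs \<subseteq> Basis" for bs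
    using that by (induction bs) (use \<open>P f\<close> step in auto)
  with step show ?thesis unfolding smooth_def by blast
qed

lemma partial_deriv_eq: "(f has_derivative f') (at x) \<Longrightarrow> partial_deriv b f x = f' b"
  unfolding partial_deriv_def using frechet_derivative_at by metis

lemma smooth_has_derivative: "smooth f \<Longrightarrow> (f has_derivative frechet_derivative f (at x)) (at x)"
  using smooth_differentiable frechet_derivative_works by blast

lemma has_vector_derivative_line:
  assumes "f differentiable (at (x + s *\<^sub>R b))"
  shows "((\<lambda>s. f (x + s *\<^sub>R b)) has_vector_derivative partial_deriv b f (x + s *\<^sub>R b)) (at s)"
proof -
  let ?D = "frechet_derivative f (at (x + s *\<^sub>R b))"
  have f: "(f has_derivative ?D) (at (x + s *\<^sub>R b))"
    using assms frechet_derivative_works by blast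
  then have lin: "linear ?D" by (rule has_derivative_linear)
  have "((\<lambda>s. x + s *\<^sub>R b) has_derivative (\<lambda>s. s *\<^sub>R b)) (at s)"
    by (auto intro!: derivative_eq_intros)
  from has_derivative_compose[OF this f] show ?thesis
    by (simp add: has_vector_derivative_def linear_scale[OF lin] partial_deriv_def)
qed

text \<open>The mean value inequality along \<open>b\<close> reduces the second difference to two
  values of \<open>partial_deriv b f\<close> near \<open>x\<close>, and both are replaced by the
  same linearisation at \<open>x\<close>. Total differentiability at this single point takes the
  place of continuous second derivatives.\<close>

lemma second_difference_limit:
  fixes f :: "'a::euclidean_space \<Rightarrow> 'b::euclidean_space"
  assumes f: "\<And>x. f differentiable (at x)"
    and fb: "partial_deriv b f differentiable (at x)"
  shows "((\<lambda>h. (f (x + h *\<^sub>R b + h *\<^sub>R c) - f (x + h *\<^sub>R b) - f (x + h *\<^sub>R c) + f x) /\<^sub>R h\<^sup>2)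
      \<longlongrightarrow> partial_deriv c (partial_deriv b f) x) (at_right 0)"
proof (rule tendstoI)
  fix e :: real assume e: "0 < e"
  let ?g = "partial_deriv b f" let ?D = "frechet_derivative ?g (at x)"
  \<comment> \<open>\<open>h * N\<close> bounds the displacements \<open>h c + s b\<close> and
    \<open>s b\<close> for \<open>0 \<le> s \<le> h\<close>. Two linearisation errors of size
    \<open>e' * h * N\<close> occur, and \<open>2 * e' * N = e / 2\<close>.\<close>
  define N where "N = 2 * norm b + norm c + 1"
  define e' where "e' = e / (4 * N)"
  have N: "N > 0" unfolding N_def by (smt (verit) norm_ge_zero)
  have e': "e' > 0" using e N by (simp add: e'_def)
  have gD: "(?g has_derivative ?D) (at x)" using fb frechet_derivative_works by blast
  then have lin: "linear ?D" by (rule has_derivative_linear)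
  from gD e' obtain d where d: "d > 0"
    and gd: "\<And>y. norm (y - x) < d \<Longrightarrow> norm (?g y - ?g x - ?D (y - x)) \<le> e' * norm (y - x)"
    unfolding has_derivative_at_alt by blast
  have "norm ((f (x + h *\<^sub>R b + h *\<^sub>R c) - f (x + h *\<^sub>R b) - f (x + h *\<^sub>R c) + f x) /\<^sub>R h\<^sup>2 - ?D c) < e"
    if h: "0 < h" "h < d / N" for h
  proof -
    \<comment> \<open>The subtracted term is the predicted increment; what is left has only
      linearisation errors as its derivative.\<close>
    define \<phi> where "\<phi> s = f (x + h *\<^sub>R c + s *\<^sub>R b) - f (x + s *\<^sub>R b) - (s * h) *\<^sub>R ?D c" for s
    define \<phi>' where "\<phi>' s = ?g (x + h *\<^sub>R c + s *\<^sub>R b) - ?g (x + s *\<^sub>R b) - h *\<^sub>R ?D c" for s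
    have der: "(\<phi> has_vector_derivative \<phi>' s) (at s)" for s
      unfolding \<phi>_def \<phi>'_def
      by (intro has_vector_derivative_diff has_vector_derivative_line f)
         (auto intro!: derivative_eq_intros simp: has_vector_derivative_def)
    have bd: "norm (\<phi>' s) \<le> 2 * e' * (h * N)" if s: "0 \<le> s" "s \<le> h" for s
    proof -
      have n1: "norm (h *\<^sub>R c + s *\<^sub>R b) \<le> h * (norm b + norm c)"
        using s h by (intro order.trans[OF norm_triangle_ineq]) (auto simp: algebra_simps intro: mult_right_mono)
      have n2: "norm (s *\<^sub>R b) \<le> h * norm b" using s h by (auto intro: mult_right_mono)
      have hN: "h * N < d" using h N by (simp add: field_simps)
      have le: "h * (norm b + norm c) \<le> h * N" "h * norm b \<le> h * N"
        using h by (auto simp: N_def intro!: mult_left_mono)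
      have "\<phi>' s = (?g (x + (h *\<^sub>R c + s *\<^sub>R b)) - ?g x - ?D (h *\<^sub>R c + s *\<^sub>R b))
          - (?g (x + s *\<^sub>R b) - ?g x - ?D (s *\<^sub>R b))"
        unfolding \<phi>'_def by (simp add: linear_add[OF lin] linear_scale[OF lin] algebra_simps)
      also have "norm \<dots> \<le> e' * norm (h *\<^sub>R c + s *\<^sub>R b) + e' * norm (s *\<^sub>R b)"
        by (rule order.trans[OF norm_triangle_ineq4], rule add_mono)
           (use gd[of "x + (h *\<^sub>R c + s *\<^sub>R b)"] gd[of "x + s *\<^sub>R b"] n1 n2 le hN in auto)
      also have "\<dots> \<le> e' * (h * N) + e' * (h * N)"
        using e' n1 n2 le by (intro add_mono mult_left_mono) auto
      finally show ?thesis by (simp add: ac_simps)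
    qed
    have "norm (\<phi> h - \<phi> 0) \<le> 2 * e' * (h * N) * \<bar>h - 0\<bar>"
      using field_differentiable_bound[of "{0..h}"] h
    proof -
      have "norm (\<phi> h - \<phi> 0) \<le> 2 * e' * (h * N) * norm (h - 0)"
      proof (rule differentiable_bound[where S = "{0..h}" and f' = "\<lambda>s t. t *\<^sub>R \<phi>' s"])
        show "onorm (\<lambda>t. t *\<^sub>R \<phi>' s) \<le> 2 * e' * (h * N)" if "s \<in> {0..h}" for s
        proof (rule onorm_le)
          fix t :: real
          show "norm (t *\<^sub>R \<phi>' s) \<le> 2 * e' * (h * N) * norm t"
            using mult_left_mono[OF bd[of s], of "\<bar>t\<bar>"] that by (simp add: mult.commute)
        qed
      qed (use h der in \<open>auto simp: has_vector_derivative_def intro: has_derivative_at_withinI\<close>)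
      then show ?thesis by simp
    qed
    then have "norm (\<phi> h - \<phi> 0) / h\<^sup>2 \<le> 2 * e' * N"
      using h by (simp add: field_simps power2_eq_square)
    moreover have "(f (x + h *\<^sub>R b + h *\<^sub>R c) - f (x + h *\<^sub>R b) - f (x + h *\<^sub>R c) + f x) /\<^sub>R h\<^sup>2 - ?D c
        = (\<phi> h - \<phi> 0) /\<^sub>R h\<^sup>2"
    proof -
      have "f (x + h *\<^sub>R b + h *\<^sub>R c) - f (x + h *\<^sub>R b) - f (x + h *\<^sub>R c) + f x = (\<phi> h - \<phi> 0) + h\<^sup>2 *\<^sub>R ?D c"
        unfolding \<phi>_def by (simp add: algebra_simps power2_eq_square)
      then show ?thesis using h by (simp add: scaleR_add_right)
    qed
    moreover have "2 * e' * N < e" using e N by (simp add: e'_def)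
    ultimately show ?thesis using h by (simp add: divide_inverse mult.commute)
  qed
  moreover have "0 < d / N" using d N by simp
  ultimately show "\<forall>\<^sub>F h in at_right 0. dist ((f (x + h *\<^sub>R b + h *\<^sub>R c) - f (x + h *\<^sub>R b) - f (x + h *\<^sub>R c) + f x) /\<^sub>R h\<^sup>2)
      (partial_deriv c ?g x) < e"
    unfolding eventually_at_right_field dist_norm partial_deriv_def by blast
qed

text \<open>Schwarz's theorem: the second difference is symmetric in \<open>b\<close> and
  \<open>c\<close>, while its limit takes the two derivatives in the order given by their
  roles.\<close>

lemma partial_deriv_commute:
  fixes f :: "'a::euclidean_space \<Rightarrow> 'b::euclidean_space"
  assumes f: "smooth f" and b: "b \<in> Basis" and c: "c \<in> Basis"
  shows "partial_deriv b (partial_deriv c f) = partial_deriv c (partial_deriv b f)"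
proof
  fix x
  let ?\<Delta> = "\<lambda>b c h. (f (x + h *\<^sub>R b + h *\<^sub>R c) - f (x + h *\<^sub>R b) - f (x + h *\<^sub>R c) + f x) /\<^sub>R h\<^sup>2"
  have "(?\<Delta> b c \<longlongrightarrow> partial_deriv c (partial_deriv b f) x) (at_right 0)"
    using f b by (intro second_difference_limit smooth_differentiable smooth_partial_deriv)
  moreover have "(?\<Delta> c b \<longlongrightarrow> partial_deriv b (partial_deriv c f) x) (at_right 0)"
    using f c by (intro second_difference_limit smooth_differentiable smooth_partial_deriv)
  moreover have "?\<Delta> b c = ?\<Delta> c b"
  proof
    fix h
    have 1: "x + h *\<^sub>R b + h *\<^sub>R c = x + h *\<^sub>R c + h *\<^sub>R b" by (simp only: add.assoc add.commute[of "h *\<^sub>R b" "h *\<^sub>R c"])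
    have 2: "p - q - r + t = p - r - q + t" for p q r t :: 'b by simp
    show "?\<Delta> b c h = ?\<Delta> c b h" unfolding 1 by (simp only: 2[of _ "f (x + h *\<^sub>R b)"])
  qed
  ultimately show "partial_deriv b (partial_deriv c f) x = partial_deriv c (partial_deriv b f) x"
    by (intro tendsto_unique[OF trivial_limit_at_right_real]) auto
qed

lemma basis_list: "distinct (basis_list :: 'a::euclidean_space list)" "set (basis_list :: 'a list) = Basis"
proof -
  obtain bs :: "'a list" where "set bs = Basis \<and> distinct bs"
    using finite_distinct_list[OF finite_Basis] by blast
  then have "\<exists>bs :: 'a list. distinct bs \<and> set bs = Basis" by blast
  from someI_ex[OF this] show "distinct (basis_list :: 'a list)" "set (basis_list :: 'a list) = Basis"
    unfolding basis_list_def by auto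
qed

lemma smooth_funpow: "smooth f \<Longrightarrow> b \<in> Basis \<Longrightarrow> smooth ((partial_deriv b ^^ n) f)"
  by (induction n) (auto intro: smooth_partial_deriv)

lemma smooth_foldr:
  "smooth f \<Longrightarrow> set bs \<subseteq> Basis \<Longrightarrow> smooth (foldr (\<lambda>b. partial_deriv b ^^ \<alpha> b) bs f)"
  by (induction bs) (auto intro: smooth_funpow)

lemma smooth_mi_deriv: "smooth f \<Longrightarrow> smooth (mi_deriv \<alpha> f)"
  unfolding mi_deriv_def by (rule smooth_foldr) (auto simp: basis_list)

lemma partial_deriv_funpow_commute:
  fixes f :: "'a::euclidean_space \<Rightarrow> 'b::euclidean_space"
  assumes "smooth f" "b \<in> Basis" "c \<in> Basis"
  shows "partial_deriv b ((partial_deriv c ^^ n) f) = (partial_deriv c ^^ n) (partial_deriv b f)"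
proof (induction n)
  case (Suc n)
  have "partial_deriv b (partial_deriv c ((partial_deriv c ^^ n) f))
      = partial_deriv c (partial_deriv b ((partial_deriv c ^^ n) f))"
    using assms by (intro partial_deriv_commute smooth_funpow)
  with Suc show ?case by simp
qed simp

lemma partial_deriv_foldr_commute:
  fixes f :: "'a::euclidean_space \<Rightarrow> 'b::euclidean_space"
  assumes "smooth f" "b \<in> Basis" "set bs \<subseteq> Basis"
  shows "partial_deriv b (foldr (\<lambda>b. partial_deriv b ^^ \<alpha> b) bs f)
    = foldr (\<lambda>b. partial_deriv b ^^ \<alpha> b) bs (partial_deriv b f)"
  using assms(3)
  by (induction bs) (use assms in \<open>auto simp: partial_deriv_funpow_commute smooth_foldr\<close>)

text \<open>The extra derivative sits in the slot of \<open>b\<close>; commuting it through the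
  slots to the right moves it onto \<open>f\<close>. As the list is distinct, exactly one slot sees
  the raised exponent.\<close>

lemma foldr_partial_deriv_Suc:
  fixes f :: "'a::euclidean_space \<Rightarrow> 'b::euclidean_space"
  assumes f: "smooth f" and b: "b \<in> Basis"
  shows "set bs \<subseteq> Basis \<Longrightarrow> distinct bs \<Longrightarrow> b \<in> set bs \<Longrightarrow>
    foldr (\<lambda>c. partial_deriv c ^^ (\<alpha>(b := Suc (\<alpha> b))) c) bs f
    = foldr (\<lambda>c. partial_deriv c ^^ \<alpha> c) bs (partial_deriv b f)"
proof (induction bs)
  case (Cons c bs)
  show ?case
  proof (cases "c = b")
    case True
    with Cons have "b \<notin> set bs" by simp
    then have "foldr (\<lambda>c. partial_deriv c ^^ (\<alpha>(b := Suc (\<alpha> b))) c) bs f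
        = foldr (\<lambda>c. partial_deriv c ^^ \<alpha> c) bs f"
      by (intro foldr_cong) auto
    then show ?thesis using Cons True f b
      by (simp add: partial_deriv_foldr_commute[symmetric] funpow_swap1 del: funpow.simps)
         (simp add: funpow_swap1)
  next
    case False
    then show ?thesis using Cons by auto
  qed
qed simp

lemma mi_deriv_partial_deriv:
  fixes f :: "'a::euclidean_space \<Rightarrow> 'b::euclidean_space"
  assumes "smooth f" "b \<in> Basis"
  shows "mi_deriv \<alpha> (partial_deriv b f) = mi_deriv (\<alpha>(b := Suc (\<alpha> b))) f"
  unfolding mi_deriv_def
  by (rule foldr_partial_deriv_Suc[symmetric]) (use assms in \<open>auto simp: basis_list\<close>)

lemma partial_deriv_mi_deriv:
  fixes f :: "'a::euclidean_space \<Rightarrow> 'b::euclidean_space"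
  assumes "smooth f" "b \<in> Basis"
  shows "partial_deriv b (mi_deriv \<alpha> f) = mi_deriv \<alpha> (partial_deriv b f)"
  unfolding mi_deriv_def
  by (rule partial_deriv_foldr_commute) (use assms in \<open>auto simp: basis_list\<close>)

lemma mi_deriv_zero: "(\<And>b. b \<in> Basis \<Longrightarrow> \<alpha> b = 0) \<Longrightarrow> mi_deriv \<alpha> f = f"
proof -
  assume *: "\<And>b. b \<in> Basis \<Longrightarrow> \<alpha> b = 0"
  have "foldr (\<lambda>b. partial_deriv b ^^ \<alpha> b) bs f = f" if "set bs \<subseteq> Basis" for bs
    using that * by (induction bs) auto
  then show ?thesis unfolding mi_deriv_def by (simp add: basis_list)
qed

section \<open>Size, factorial, monomials and induction for multi-indices\<close>

lemma mi_size_Suc: "b \<in> Basis \<Longrightarrow> mi_size (\<alpha>(b := Suc (\<alpha> b))) = Suc (mi_size \<alpha>)"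
  unfolding mi_size_def by (subst (1 2) sum.remove[of _ b]) (auto intro: sum.cong)

lemma mi_power_Suc: "b \<in> Basis \<Longrightarrow> mi_power x (\<alpha>(b := Suc (\<alpha> b))) = (x \<bullet> b) * mi_power x \<alpha>"
  unfolding mi_power_def
  by (subst (1 2) prod.remove[of _ b]) (auto intro: prod.cong simp: algebra_simps)

text \<open>Multi-indices are total functions of which only the values on \<open>Basis\<close>
  matter, so the base case is vanishing on \<open>Basis\<close> and not one particular function. The
  induction runs over \<open>mi_size\<close> and lowers a positive entry.\<close>

lemma mi_induct [case_names zero Suc]:
  fixes \<alpha> :: "'a::euclidean_space \<Rightarrow> nat"
  assumes zero: "\<And>\<alpha>. (\<And>b. b \<in> Basis \<Longrightarrow> \<alpha> b = 0) \<Longrightarrow> P \<alpha>"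
    and Suc: "\<And>\<alpha> b. b \<in> Basis \<Longrightarrow> P \<alpha> \<Longrightarrow> P (\<alpha>(b := Suc (\<alpha> b)))"
  shows "P \<alpha>"
proof (induction "mi_size \<alpha>" arbitrary: \<alpha>)
  case 0
  then show ?case by (intro zero) (simp add: mi_size_def)
next
  case (Suc n)
  then obtain b where b: "b \<in> Basis" "\<alpha> b > 0"
    unfolding mi_size_def by (metis finite_Basis gr_zeroI sum.neutral nat.distinct(1))
  define \<alpha>' where "\<alpha>' = \<alpha>(b := \<alpha> b - 1)"
  have eq: "\<alpha> = \<alpha>'(b := Suc (\<alpha>' b))" using b by (auto simp: \<alpha>'_def)
  then have "n = mi_size \<alpha>'" using Suc(2) mi_size_Suc[OF b(1), of \<alpha>'] by simp
  then show ?case using Suc(1)[of \<alpha>'] assms(2)[OF b(1), of \<alpha>'] eq by simp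
qed

definition mi_single :: "'a \<Rightarrow> nat \<Rightarrow> 'a \<Rightarrow> nat"
  where "mi_single b n = (\<lambda>c. if c = b then n else 0)"

lemma mi_single_Suc: "mi_single b (Suc n) = (mi_single b n)(b := Suc (mi_single b n b))"
  by (auto simp: mi_single_def)

lemma mi_size_single: "b \<in> Basis \<Longrightarrow> mi_size (mi_single b n) = n"
  by (simp add: mi_size_def mi_single_def)

lemma mi_fact_single: "b \<in> Basis \<Longrightarrow> mi_fact (mi_single b n) = fact n"
  unfolding mi_fact_def mi_single_def by (subst prod.remove[of _ b]) auto

lemma mi_power_single: "b \<in> Basis \<Longrightarrow> mi_power x (mi_single b n) = (x \<bullet> b) ^ n"
  unfolding mi_power_def mi_single_def by (subst prod.remove[of _ b]) auto

lemma mi_deriv_single: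
  fixes f :: "'a::euclidean_space \<Rightarrow> 'b::euclidean_space"
  shows "smooth f \<Longrightarrow> b \<in> Basis \<Longrightarrow> mi_deriv (mi_single b n) f = (partial_deriv b ^^ n) f"
proof (induction n arbitrary: f)
  case 0
  then show ?case by (simp add: mi_deriv_zero mi_single_def)
next
  case (Suc n)
  then show ?case
    by (simp only: mi_single_Suc mi_deriv_partial_deriv[symmetric] smooth_partial_deriv)
       (simp add: funpow_swap1)
qed

lemma mi_size_zero: "(\<And>b. b \<in> Basis \<Longrightarrow> \<alpha> b = 0) \<Longrightarrow> mi_size \<alpha> = 0"
  by (simp add: mi_size_def)

lemma mi_fact_zero: "(\<And>b. b \<in> Basis \<Longrightarrow> \<alpha> b = 0) \<Longrightarrow> mi_fact \<alpha> = 1"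
  by (simp add: mi_fact_def)

lemma mi_fact_pos: "0 < mi_fact \<alpha>"
  unfolding mi_fact_def by (rule prod_pos) auto

section \<open>The Gelfand--Shilov space\<close>

lemma
  fixes f h :: "'a::euclidean_space \<Rightarrow> 'b::real_normed_vector"
  assumes "smooth f" "smooth h"
  shows smooth_add: "smooth (\<lambda>x. f x + h x)"
    and partial_deriv_add: "partial_deriv b (\<lambda>x. f x + h x) = (\<lambda>x. partial_deriv b f x + partial_deriv b h x)"
proof -
  have pd: "partial_deriv b (\<lambda>x. f x + h x) = (\<lambda>x. partial_deriv b f x + partial_deriv b h x)"
    if "smooth f" "smooth h" for f h :: "'a \<Rightarrow> 'b" and b
    unfolding partial_deriv_def[of b f] partial_deriv_def[of b h]
    by (rule ext, rule partial_deriv_eq) (intro has_derivative_add smooth_has_derivative that)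
  then show "partial_deriv b (\<lambda>x. f x + h x) = (\<lambda>x. partial_deriv b f x + partial_deriv b h x)"
    using assms by blast
  show "smooth (\<lambda>x. f x + h x)"
  proof (rule smooth_coinduct[where P = "\<lambda>F. \<exists>f h. smooth f \<and> smooth h \<and> F = (\<lambda>x. f x + h x)"])
    fix F :: "'a \<Rightarrow> 'b" assume "\<exists>f h. smooth f \<and> smooth h \<and> F = (\<lambda>x. f x + h x)"
    then obtain f h where f: "smooth f" and h: "smooth h" and F: "F = (\<lambda>x. f x + h x)" by blast
    have "F differentiable (at x)" for x
      unfolding F by (intro differentiable_add smooth_differentiable f h)
    then show "(\<forall>x. F differentiable at x) \<and>
        (\<forall>b\<in>Basis. \<exists>f h. smooth f \<and> smooth h \<and> partial_deriv b F = (\<lambda>x. f x + h x))"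
      using pd[OF f h] smooth_partial_deriv[OF f] smooth_partial_deriv[OF h] unfolding F by blast
  qed (use assms in blast)
qed

lemma mi_deriv_add:
  fixes f h :: "'a::euclidean_space \<Rightarrow> 'b::euclidean_space"
  shows "smooth f \<Longrightarrow> smooth h \<Longrightarrow> mi_deriv \<alpha> (\<lambda>x. f x + h x) = (\<lambda>x. mi_deriv \<alpha> f x + mi_deriv \<alpha> h x)"
proof (induction \<alpha> arbitrary: f h rule: mi_induct)
  case (Suc \<alpha> b)
  then show ?case
    by (simp add: mi_deriv_partial_deriv[symmetric] smooth_add partial_deriv_add smooth_partial_deriv del: fun_upd_apply)
qed (simp add: mi_deriv_zero)

lemma
  fixes f :: "'c::euclidean_space \<Rightarrow> 'a::real_normed_vector" and L :: "'a \<Rightarrow> 'b::real_normed_vector"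
  assumes "bounded_linear L" "smooth f"
  shows smooth_linear: "smooth (\<lambda>x. L (f x))"
    and partial_deriv_linear: "partial_deriv b (\<lambda>x. L (f x)) = (\<lambda>x. L (partial_deriv b f x))"
proof -
  have pd: "partial_deriv b (\<lambda>x. L (f x)) = (\<lambda>x. L (partial_deriv b f x))"
    if "smooth f" for f :: "'c \<Rightarrow> 'a" and b
    unfolding partial_deriv_def[of b f]
    by (rule ext, rule partial_deriv_eq)
       (intro bounded_linear.has_derivative[OF assms(1)] smooth_has_derivative that)
  then show "partial_deriv b (\<lambda>x. L (f x)) = (\<lambda>x. L (partial_deriv b f x))"
    using assms by blast
  show "smooth (\<lambda>x. L (f x))"
  proof (rule smooth_coinduct[where P = "\<lambda>F. \<exists>f. smooth f \<and> F = (\<lambda>x. L (f x))"])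
    fix F :: "'c \<Rightarrow> 'b" assume "\<exists>f. smooth f \<and> F = (\<lambda>x. L (f x))"
    then obtain f where f: "smooth f" and F: "F = (\<lambda>x. L (f x))" by blast
    have "F differentiable (at x)" for x
      unfolding F differentiable_def
      using bounded_linear.has_derivative[OF assms(1) smooth_has_derivative[OF f]] by blast
    then show "(\<forall>x. F differentiable at x) \<and> (\<forall>b\<in>Basis. \<exists>f. smooth f \<and> partial_deriv b F = (\<lambda>x. L (f x)))"
      using pd[OF f] smooth_partial_deriv[OF f] unfolding F by blast
  qed (use assms in auto)
qed

lemmas smooth_cmult = smooth_linear[OF bounded_linear_mult_right]
lemmas smooth_scaleR = smooth_linear[OF bounded_linear_scaleR_right]

lemma mi_deriv_linear:
  fixes f :: "'a::euclidean_space \<Rightarrow> 'b::euclidean_space" and L :: "'b \<Rightarrow> 'c::euclidean_space"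
  assumes L: "bounded_linear L"
  shows "smooth f \<Longrightarrow> mi_deriv \<alpha> (\<lambda>x. L (f x)) = (\<lambda>x. L (mi_deriv \<alpha> f x))"
proof (induction \<alpha> arbitrary: f rule: mi_induct)
  case (Suc \<alpha> b)
  then show ?case
    by (simp add: mi_deriv_partial_deriv[symmetric] smooth_linear[OF L] partial_deriv_linear[OF L]
        smooth_partial_deriv del: fun_upd_apply)
qed (simp add: mi_deriv_zero)

lemma
  fixes f :: "'a::euclidean_space \<Rightarrow> 'b::real_normed_vector"
  assumes "smooth f"
  shows smooth_affine: "smooth (\<lambda>x. f (c *\<^sub>R x + a))"
    and partial_deriv_affine: "partial_deriv b (\<lambda>x. f (c *\<^sub>R x + a)) = (\<lambda>x. c *\<^sub>R partial_deriv b f (c *\<^sub>R x + a))"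
proof -
  have hd: "((\<lambda>x. f (c *\<^sub>R x + a)) has_derivative (\<lambda>y. frechet_derivative f (at (c *\<^sub>R x + a)) (c *\<^sub>R y))) (at x)"
    if "smooth f" for f :: "'a \<Rightarrow> 'b" and x
    by (rule has_derivative_compose[OF _ smooth_has_derivative[OF that]]) (auto intro!: derivative_eq_intros)
  have pd: "partial_deriv b (\<lambda>x. f (c *\<^sub>R x + a)) = (\<lambda>x. c *\<^sub>R partial_deriv b f (c *\<^sub>R x + a))"
    if "smooth f" for f :: "'a \<Rightarrow> 'b" and b
    unfolding partial_deriv_def[of b f] using partial_deriv_eq[OF hd[OF that]]
      linear_scale[OF has_derivative_linear[OF smooth_has_derivative[OF that]]]
    by (simp add: fun_eq_iff)
  then show "partial_deriv b (\<lambda>x. f (c *\<^sub>R x + a)) = (\<lambda>x. c *\<^sub>R partial_deriv b f (c *\<^sub>R x + a))"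
    using assms by blast
  show "smooth (\<lambda>x. f (c *\<^sub>R x + a))"
  proof (rule smooth_coinduct[where P = "\<lambda>F. \<exists>f. smooth f \<and> F = (\<lambda>x. f (c *\<^sub>R x + a))"])
    fix F :: "'a \<Rightarrow> 'b" assume "\<exists>f. smooth f \<and> F = (\<lambda>x. f (c *\<^sub>R x + a))"
    then obtain f where f: "smooth f" and F: "F = (\<lambda>x. f (c *\<^sub>R x + a))" by blast
    have "F differentiable (at x)" for x
      unfolding F differentiable_def using hd[OF f] by blast
    moreover have "\<exists>f. smooth f \<and> partial_deriv b F = (\<lambda>x. f (c *\<^sub>R x + a))" if "b \<in> Basis" for b
      unfolding F pd[OF f]
      by (rule exI[of _ "\<lambda>x. c *\<^sub>R partial_deriv b f x"])
         (intro conjI smooth_scaleR smooth_partial_deriv f that, simp)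
    ultimately show "(\<forall>x. F differentiable at x) \<and> (\<forall>b\<in>Basis. \<exists>f. smooth f \<and> partial_deriv b F = (\<lambda>x. f (c *\<^sub>R x + a)))"
      by blast
  qed (use assms in auto)
qed

lemma mi_deriv_affine:
  fixes f :: "'a::euclidean_space \<Rightarrow> 'b::euclidean_space"
  shows "smooth f \<Longrightarrow> mi_deriv \<alpha> (\<lambda>x. f (c *\<^sub>R x + a)) = (\<lambda>x. c ^ mi_size \<alpha> *\<^sub>R mi_deriv \<alpha> f (c *\<^sub>R x + a))"
proof (induction \<alpha> arbitrary: f rule: mi_induct)
  case (Suc \<alpha> b)
  have "mi_deriv (\<alpha>(b := Suc (\<alpha> b))) (\<lambda>x. f (c *\<^sub>R x + a))
      = mi_deriv \<alpha> (\<lambda>x. c *\<^sub>R partial_deriv b f (c *\<^sub>R x + a))"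
    using Suc by (simp add: mi_deriv_partial_deriv[symmetric] smooth_affine partial_deriv_affine)
  also have "\<dots> = (\<lambda>x. c *\<^sub>R mi_deriv \<alpha> (\<lambda>x. partial_deriv b f (c *\<^sub>R x + a)) x)"
    using Suc by (intro mi_deriv_linear[OF bounded_linear_scaleR_right] smooth_affine smooth_partial_deriv)
  finally show ?case
    using Suc by (simp add: smooth_partial_deriv mi_size_Suc mi_deriv_partial_deriv del: fun_upd_apply)
qed (simp add: mi_deriv_zero mi_size_zero)

section \<open>Coordinate multiplication and modulation of smooth functions\<close>

definition mult_coord :: "'a::euclidean_space \<Rightarrow> ('a \<Rightarrow> complex) \<Rightarrow> 'a \<Rightarrow> complex"
  where "mult_coord j f = (\<lambda>t. of_real (t \<bullet> j) * f t)"

definition modulate :: "'a::euclidean_space \<Rightarrow> ('a \<Rightarrow> complex) \<Rightarrow> 'a \<Rightarrow> complex"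
  where "modulate \<xi> f = (\<lambda>t. cis (\<xi> \<bullet> t) * f t)"

lemma
  assumes f: "smooth f" and j: "j \<in> Basis"
  shows smooth_mult_coord: "smooth (mult_coord j f)"
    and partial_deriv_mult_coord: "b \<in> Basis \<Longrightarrow>
      partial_deriv b (mult_coord j f) = (\<lambda>t. of_bool (b = j) * f t + mult_coord j (partial_deriv b f) t)"
proof -
  have hd: "(mult_coord j f has_derivative
      (\<lambda>y. of_real (y \<bullet> j) * f t + of_real (t \<bullet> j) * frechet_derivative f (at t) y)) (at t)"
    if "smooth f" for f t
    unfolding mult_coord_def
    by (auto intro!: derivative_eq_intros smooth_has_derivative[OF that])
  have pd: "partial_deriv b (mult_coord j f) = (\<lambda>t. of_bool (b = j) * f t + mult_coord j (partial_deriv b f) t)"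
    if "smooth f" "b \<in> Basis" for f b
    using partial_deriv_eq[OF hd[OF that(1)], of b] that(2) j
    by (auto simp: fun_eq_iff mult_coord_def partial_deriv_def inner_Basis)
  then show "b \<in> Basis \<Longrightarrow>
      partial_deriv b (mult_coord j f) = (\<lambda>t. of_bool (b = j) * f t + mult_coord j (partial_deriv b f) t)"
    using f by blast
  show "smooth (mult_coord j f)"
  \<comment> \<open>By the product rule the functions \<open>mult_coord j f\<close> alone are not
    closed under \<open>partial_deriv j\<close>; the smooth summand \<open>h\<close> absorbs the
    term in which the coordinate is differentiated.\<close>
  proof (rule smooth_coinduct[where P = "\<lambda>F. \<exists>f h. smooth f \<and> smooth h \<and> F = (\<lambda>t. h t + mult_coord j f t)"])
    fix F assume "\<exists>f h. smooth f \<and> smooth h \<and> F = (\<lambda>t. h t + mult_coord j f t)"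
    then obtain f h where f: "smooth f" and h: "smooth h" and F: "F = (\<lambda>t. h t + mult_coord j f t)" by blast
    have hF: "(F has_derivative (\<lambda>y. frechet_derivative h (at t) y +
        (of_real (y \<bullet> j) * f t + of_real (t \<bullet> j) * frechet_derivative f (at t) y))) (at t)" for t
      unfolding F by (intro has_derivative_add smooth_has_derivative h hd f)
    have "\<exists>f h. smooth f \<and> smooth h \<and> partial_deriv b F = (\<lambda>t. h t + mult_coord j f t)" if b: "b \<in> Basis" for b
    proof (intro exI conjI)
      show "smooth (partial_deriv b f)" using f b by (rule smooth_partial_deriv)
      show "smooth (\<lambda>t. partial_deriv b h t + of_bool (b = j) * f t)"
        by (intro smooth_add smooth_partial_deriv h b smooth_cmult f)
      show "partial_deriv b F = (\<lambda>t. (partial_deriv b h t + of_bool (b = j) * f t) + mult_coord j (partial_deriv b f) t)"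
        using partial_deriv_eq[OF hF, of b] b j
        by (auto simp: fun_eq_iff mult_coord_def partial_deriv_def inner_Basis)
    qed
    then show "(\<forall>x. F differentiable at x) \<and> (\<forall>b\<in>Basis. \<exists>f h. smooth f \<and> smooth h \<and> partial_deriv b F = (\<lambda>t. h t + mult_coord j f t))"
      using hF unfolding differentiable_def by blast
  next
    have "smooth (\<lambda>t. 0 * f t)" by (intro smooth_cmult f)
    then show "\<exists>fa h. smooth fa \<and> smooth h \<and> mult_coord j f = (\<lambda>t. h t + mult_coord j fa t)"
      using f by (intro exI[of _ f] exI[of _ "\<lambda>t. 0 * f t"]) auto
  qed
qed

text \<open>Leibniz' rule with a linear factor, so it stops after one correction. For
  \<open>\<alpha> j = 0\<close> the truncated \<open>\<alpha> j - 1\<close> does no harm because its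
  coefficient is zero.\<close>

lemma mi_deriv_mult_coord:
  assumes j: "j \<in> Basis"
  shows "smooth f \<Longrightarrow> mi_deriv \<alpha> (mult_coord j f)
    = (\<lambda>t. of_real (t \<bullet> j) * mi_deriv \<alpha> f t + of_nat (\<alpha> j) * mi_deriv (\<alpha>(j := \<alpha> j - 1)) f t)"
proof (induction \<alpha> arbitrary: f rule: mi_induct)
  case (zero \<alpha>)
  then show ?case using j by (simp add: mi_deriv_zero mult_coord_def)
next
  case (Suc \<alpha> b)
  note smf = Suc(3)
  have sm: "smooth (\<lambda>t. of_bool (b = j) * f t)" "smooth (mult_coord j (partial_deriv b f))"
    by (intro smooth_cmult smooth_mult_coord smooth_partial_deriv Suc j)+
  have "mi_deriv (\<alpha>(b := Suc (\<alpha> b))) (mult_coord j f) = mi_deriv \<alpha> (partial_deriv b (mult_coord j f))"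
    using Suc j by (simp add: mi_deriv_partial_deriv smooth_mult_coord)
  also have "\<dots> = mi_deriv \<alpha> (\<lambda>t. of_bool (b = j) * f t + mult_coord j (partial_deriv b f) t)"
    using Suc j by (simp add: partial_deriv_mult_coord)
  also have "\<dots> = (\<lambda>t. of_bool (b = j) * mi_deriv \<alpha> f t + mi_deriv \<alpha> (mult_coord j (partial_deriv b f)) t)"
    unfolding mi_deriv_add[OF sm] mi_deriv_linear[OF bounded_linear_mult_right, OF Suc(3)] ..
  also have "mi_deriv \<alpha> (mult_coord j (partial_deriv b f)) = (\<lambda>t. of_real (t \<bullet> j) * mi_deriv \<alpha> (partial_deriv b f) t
      + of_nat (\<alpha> j) * mi_deriv (\<alpha>(j := \<alpha> j - 1)) (partial_deriv b f) t)"
    by (intro Suc.IH smooth_partial_deriv Suc)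
  finally have eq: "mi_deriv (\<alpha>(b := Suc (\<alpha> b))) (mult_coord j f) = (\<lambda>t. of_bool (b = j) * mi_deriv \<alpha> f t +
      (of_real (t \<bullet> j) * mi_deriv \<alpha> (partial_deriv b f) t
        + of_nat (\<alpha> j) * mi_deriv (\<alpha>(j := \<alpha> j - 1)) (partial_deriv b f) t))" .
  have "mi_deriv (\<alpha>(b := Suc (\<alpha> b))) (mult_coord j f)
      = (\<lambda>t. of_real (t \<bullet> j) * mi_deriv (\<alpha>(b := Suc (\<alpha> b))) f t
        + of_nat ((\<alpha>(b := Suc (\<alpha> b))) j) * mi_deriv ((\<alpha>(b := Suc (\<alpha> b)))(j := (\<alpha>(b := Suc (\<alpha> b))) j - 1)) f t)"
  proof (cases "b = j")
    case True
    have "of_nat (\<alpha> j) * mi_deriv (\<alpha>(j := \<alpha> j - 1)) (partial_deriv j f) t = of_nat (\<alpha> j) * mi_deriv \<alpha> f t" for t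
    proof (cases "\<alpha> j")
      case (Suc m)
      have "mi_deriv (\<alpha>(j := m)) (partial_deriv j f) = mi_deriv (\<alpha>(j := Suc m)) f"
        using mi_deriv_partial_deriv[OF smf j, of "\<alpha>(j := m)"] by simp
      then show ?thesis using Suc by (simp add: fun_upd_idem)
    qed simp
    note * = this
    show ?thesis
      unfolding eq unfolding True * unfolding mi_deriv_partial_deriv[OF Suc(3) j, of \<alpha>]
      by (simp add: algebra_simps fun_upd_idem)
  next
    case False
    then have "(\<alpha>(b := Suc (\<alpha> b)))(j := \<alpha> j - 1) = (\<alpha>(j := \<alpha> j - 1))(b := Suc ((\<alpha>(j := \<alpha> j - 1)) b))"
      by (auto simp: fun_eq_iff)
    then show ?thesis
      unfolding eq mi_deriv_partial_deriv[OF Suc(3,1)] using False by simp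
  qed
  then show ?case .
qed

lemma has_derivative_cis_inner:
  "((\<lambda>t. cis (\<xi> \<bullet> t)) has_derivative (\<lambda>y. \<i> * of_real (\<xi> \<bullet> y) * cis (\<xi> \<bullet> t))) (at t)"
proof -
  have "cis r = of_real (cos r) + \<i> * of_real (sin r)" for r by (simp add: complex_eq_iff)
  then show ?thesis
    by (auto intro!: derivative_eq_intros simp: fun_eq_iff complex_eq_iff)
qed

lemma modulate_add: "modulate (\<xi> + \<eta>) f = modulate \<xi> (modulate \<eta> f)"
  by (simp add: modulate_def inner_add_left cis_mult[symmetric] mult.assoc)

lemma
  assumes f: "smooth f" and j: "j \<in> Basis"
  shows smooth_modulate_Basis: "smooth (modulate (s *\<^sub>R j) f)"
    and partial_deriv_modulate: "b \<in> Basis \<Longrightarrow> partial_deriv b (modulate (s *\<^sub>R j) f)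
      = modulate (s *\<^sub>R j) (\<lambda>t. partial_deriv b f t + of_bool (b = j) * \<i> * of_real s * f t)"
proof -
  have hd: "(modulate (s *\<^sub>R j) f has_derivative
      (\<lambda>y. cis ((s *\<^sub>R j) \<bullet> t) * (frechet_derivative f (at t) y + of_real (y \<bullet> j) * \<i> * of_real s * f t))) (at t)"
    if "smooth f" for f t
    unfolding modulate_def
    by (rule has_derivative_eq_rhs, rule has_derivative_mult[OF has_derivative_cis_inner smooth_has_derivative[OF that]])
       (simp add: fun_eq_iff algebra_simps inner_commute)
  have pd: "partial_deriv b (modulate (s *\<^sub>R j) f)
      = modulate (s *\<^sub>R j) (\<lambda>t. partial_deriv b f t + of_bool (b = j) * \<i> * of_real s * f t)"
    if "smooth f" "b \<in> Basis" for f b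
    using partial_deriv_eq[OF hd[OF that(1)], of b] that(2) j
    by (auto simp: fun_eq_iff modulate_def partial_deriv_def inner_Basis)
  then show "b \<in> Basis \<Longrightarrow> partial_deriv b (modulate (s *\<^sub>R j) f)
      = modulate (s *\<^sub>R j) (\<lambda>t. partial_deriv b f t + of_bool (b = j) * \<i> * of_real s * f t)"
    using f by blast
  show "smooth (modulate (s *\<^sub>R j) f)"
  proof (rule smooth_coinduct[where P = "\<lambda>F. \<exists>f. smooth f \<and> F = modulate (s *\<^sub>R j) f"])
    fix F assume "\<exists>f. smooth f \<and> F = modulate (s *\<^sub>R j) f"
    then obtain f where f: "smooth f" and F: "F = modulate (s *\<^sub>R j) f" by blast
    have "F differentiable (at x)" for x
      unfolding F differentiable_def using hd[OF f] by blast
    moreover have "\<exists>f. smooth f \<and> partial_deriv b F = modulate (s *\<^sub>R j) f" if "b \<in> Basis" for b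
      unfolding F pd[OF f that]
      by (rule exI[of _ "\<lambda>t. partial_deriv b f t + of_bool (b = j) * \<i> * of_real s * f t"])
         (intro conjI smooth_add smooth_cmult smooth_partial_deriv f that, simp)
    ultimately show "(\<forall>x. F differentiable at x) \<and> (\<forall>b\<in>Basis. \<exists>f. smooth f \<and> partial_deriv b F = modulate (s *\<^sub>R j) f)"
      by blast
  qed (use f in auto)
qed

text \<open>Pascal's rule for the expansion of \<open>(D + c) ^ n\<close>: \<open>M k\<close> stands
  for the \<open>k\<close>-th derivative, and the left side is the effect of one more factor
  \<open>D + c\<close>.\<close>

lemma binomial_shift:
  fixes c :: "'a::comm_ring_1"
  shows "(\<Sum>k\<le>n. of_nat (n choose k) * c ^ (n - k) * M (Suc k)) + c * (\<Sum>k\<le>n. of_nat (n choose k) * c ^ (n - k) * M k)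
    = (\<Sum>k\<le>Suc n. of_nat (Suc n choose k) * c ^ (Suc n - k) * M k)"
proof -
  have "(\<Sum>k\<le>Suc n. of_nat (Suc n choose k) * c ^ (Suc n - k) * M k)
      = c ^ Suc n * M 0 + (\<Sum>k\<le>n. of_nat (n choose k) * c ^ (n - k) * M (Suc k))
        + (\<Sum>k\<le>n. of_nat (n choose Suc k) * c ^ (n - k) * M (Suc k))"
    by (subst sum.atMost_Suc_shift) (simp add: algebra_simps sum.distrib)
  moreover have "c ^ Suc n * M 0 + (\<Sum>k\<le>n. of_nat (n choose Suc k) * c ^ (n - k) * M (Suc k))
      = c * (\<Sum>k\<le>n. of_nat (n choose k) * c ^ (n - k) * M k)"
  proof (cases n)
    case (Suc m)
    have 0: "of_nat (Suc m choose Suc (Suc m)) = (0::'a)" by (simp add: binomial_eq_0 del: binomial_Suc_Suc)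
    have "(\<Sum>k\<le>n. of_nat (n choose Suc k) * c ^ (n - k) * M (Suc k))
        = (\<Sum>k\<le>m. c * (of_nat (n choose Suc k) * c ^ (n - Suc k) * M (Suc k)))"
      unfolding Suc sum.atMost_Suc by (simp add: 0 Suc_diff_le algebra_simps del: binomial_Suc_Suc)
    then show ?thesis
      unfolding Suc by (subst (2) sum.atMost_Suc_shift) (simp add: sum_distrib_left algebra_simps binomial_eq_0)
  qed simp
  ultimately show ?thesis by (simp add: algebra_simps)
qed

text \<open>On modulated functions the derivative along \<open>j\<close> acts as
  \<open>partial_deriv j\<close> plus the constant \<open>\<i> s\<close>, while the other directions
  commute with the modulation. The sum is the binomial expansion of the power of this
  operator.\<close>

lemma mi_deriv_modulate:
  assumes j: "j \<in> Basis"
  shows "smooth f \<Longrightarrow> mi_deriv \<beta> (modulate (s *\<^sub>R j) f)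
    = modulate (s *\<^sub>R j) (\<lambda>t. \<Sum>k\<le>\<beta> j. of_nat (\<beta> j choose k) * (\<i> * of_real s) ^ (\<beta> j - k) * mi_deriv (\<beta>(j := k)) f t)"
proof (induction \<beta> arbitrary: f rule: mi_induct)
  case (zero \<beta>)
  then show ?case using j by (simp add: mi_deriv_zero)
next
  case (Suc \<beta> b)
  let ?c = "\<i> * complex_of_real s"
  let ?S = "\<lambda>f t. \<Sum>k\<le>\<beta> j. of_nat (\<beta> j choose k) * ?c ^ (\<beta> j - k) * mi_deriv (\<beta>(j := k)) f t"
  have sm: "smooth (partial_deriv b f)" "smooth (\<lambda>t. (of_bool (b = j) * \<i> * of_real s) * f t)"
    by (intro smooth_partial_deriv smooth_cmult Suc)+
  have "mi_deriv (\<beta>(b := Suc (\<beta> b))) (modulate (s *\<^sub>R j) f) = mi_deriv \<beta> (partial_deriv b (modulate (s *\<^sub>R j) f))"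
    using Suc j by (simp add: mi_deriv_partial_deriv smooth_modulate_Basis)
  also have "\<dots> = mi_deriv \<beta> (modulate (s *\<^sub>R j) (\<lambda>t. partial_deriv b f t + (of_bool (b = j) * \<i> * of_real s) * f t))"
    using Suc j by (simp add: partial_deriv_modulate)
  also have "\<dots> = modulate (s *\<^sub>R j) (?S (\<lambda>t. partial_deriv b f t + (of_bool (b = j) * \<i> * of_real s) * f t))"
    by (rule Suc.IH) (intro smooth_add sm)
  also have "?S (\<lambda>t. partial_deriv b f t + (of_bool (b = j) * \<i> * of_real s) * f t)
      = (\<lambda>t. ?S (partial_deriv b f) t + of_bool (b = j) * ?c * ?S f t)"
    unfolding mi_deriv_add[OF sm] mi_deriv_linear[OF bounded_linear_mult_right, OF Suc(3)]
    by (simp add: fun_eq_iff algebra_simps sum.distrib sum_distrib_left)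
  also have "\<dots> = (\<lambda>t. \<Sum>k\<le>(\<beta>(b := Suc (\<beta> b))) j. of_nat ((\<beta>(b := Suc (\<beta> b))) j choose k) * ?c ^ ((\<beta>(b := Suc (\<beta> b))) j - k)
        * mi_deriv ((\<beta>(b := Suc (\<beta> b)))(j := k)) f t)"
  proof (cases "b = j")
    case True
    then show ?thesis
      using binomial_shift[of "\<beta> j" ?c "\<lambda>k. mi_deriv (\<beta>(j := k)) f t" for t] Suc(1,3)
      by (simp add: mi_deriv_partial_deriv fun_eq_iff)
  next
    case False
    then show ?thesis using Suc(1,3) by (simp add: mi_deriv_partial_deriv fun_upd_twist)
  qed
  finally show ?case .
qed

text \<open>The constant \<open>S\<close> is an explicit argument because later estimates have to
  depend linearly on it. For positive \<open>A\<close>, \<open>B\<close> and \<open>f\<close> in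
  \<open>gelfand_shilov\<close>, the least admissible \<open>S\<close> is
  \<open>gs_seminorm A B f\<close>.\<close>

definition gs_bound :: "real \<Rightarrow> real \<Rightarrow> real \<Rightarrow> ('a::euclidean_space \<Rightarrow> complex) \<Rightarrow> bool"
  where "gs_bound A B S f \<longleftrightarrow> smooth f \<and>
    (\<forall>x \<alpha> \<beta>. \<bar>mi_power x \<alpha>\<bar> * norm (mi_deriv \<beta> f x)
      \<le> S * A ^ mi_size \<alpha> * B ^ mi_size \<beta> * mi_fact \<alpha> * mi_fact \<beta>)"

lemma gs_boundI:
  assumes "smooth f" "\<And>x \<alpha> \<beta>. \<bar>mi_power x \<alpha>\<bar> * norm (mi_deriv \<beta> f x)
      \<le> S * A ^ mi_size \<alpha> * B ^ mi_size \<beta> * mi_fact \<alpha> * mi_fact \<beta>"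
  shows "gs_bound A B S f"
  using assms unfolding gs_bound_def by blast

lemma gs_bound_smooth: "gs_bound A B S f \<Longrightarrow> smooth f"
  unfolding gs_bound_def by blast

lemma gs_boundD:
  "gs_bound A B S f \<Longrightarrow> \<bar>mi_power x \<alpha>\<bar> * norm (mi_deriv \<beta> f x)
      \<le> S * A ^ mi_size \<alpha> * B ^ mi_size \<beta> * mi_fact \<alpha> * mi_fact \<beta>"
  unfolding gs_bound_def by blast

lemma gs_bound_nonneg: "gs_bound A B S f \<Longrightarrow> 0 \<le> S"
  using gs_boundD[of A B S f 0 "\<lambda>_. 0" "\<lambda>_. 0"]
  by (simp add: mi_size_zero mi_fact_zero) (meson abs_ge_zero norm_ge_zero mult_nonneg_nonneg order.trans)

lemma gs_bound_mono:
  assumes "gs_bound A B S f" "0 < A" "A \<le> A'" "0 < B" "B \<le> B'" "S \<le> S'"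
  shows "gs_bound A' B' S' f"
proof (rule gs_boundI)
  fix x :: 'a and \<alpha> \<beta> :: "'a \<Rightarrow> nat"
  have S: "0 \<le> S" using assms(1) by (rule gs_bound_nonneg)
  have "\<bar>mi_power x \<alpha>\<bar> * norm (mi_deriv \<beta> f x) \<le> S * A ^ mi_size \<alpha> * B ^ mi_size \<beta> * mi_fact \<alpha> * mi_fact \<beta>"
    using assms(1) by (rule gs_boundD)
  also have "\<dots> \<le> S' * A' ^ mi_size \<alpha> * B' ^ mi_size \<beta> * mi_fact \<alpha> * mi_fact \<beta>"
    using assms S mi_fact_pos[of \<alpha>] mi_fact_pos[of \<beta>]
    by (intro mult_mono power_mono) (auto intro!: mult_nonneg_nonneg)
  finally show "\<bar>mi_power x \<alpha>\<bar> * norm (mi_deriv \<beta> f x)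
      \<le> S' * A' ^ mi_size \<alpha> * B' ^ mi_size \<beta> * mi_fact \<alpha> * mi_fact \<beta>" .
qed (use assms(1) in \<open>rule gs_bound_smooth\<close>)

lemma gs_bound_add:
  assumes "gs_bound A B S f" "gs_bound A B S' h"
  shows "gs_bound A B (S + S') (\<lambda>x. f x + h x)"
proof (rule gs_boundI)
  have sm: "smooth f" "smooth h" using assms gs_bound_smooth by auto
  then show "smooth (\<lambda>x. f x + h x)" by (rule smooth_add)
  fix x :: 'a and \<alpha> \<beta> :: "'a \<Rightarrow> nat"
  have "\<bar>mi_power x \<alpha>\<bar> * norm (mi_deriv \<beta> (\<lambda>x. f x + h x) x)
      \<le> \<bar>mi_power x \<alpha>\<bar> * norm (mi_deriv \<beta> f x) + \<bar>mi_power x \<alpha>\<bar> * norm (mi_deriv \<beta> h x)"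
    unfolding mi_deriv_add[OF sm] distrib_left[symmetric] by (intro mult_left_mono norm_triangle_ineq) auto
  also have "\<dots> \<le> S * A ^ mi_size \<alpha> * B ^ mi_size \<beta> * mi_fact \<alpha> * mi_fact \<beta>
      + S' * A ^ mi_size \<alpha> * B ^ mi_size \<beta> * mi_fact \<alpha> * mi_fact \<beta>"
    by (intro add_mono gs_boundD assms)
  finally show "\<bar>mi_power x \<alpha>\<bar> * norm (mi_deriv \<beta> (\<lambda>x. f x + h x) x)
      \<le> (S + S') * A ^ mi_size \<alpha> * B ^ mi_size \<beta> * mi_fact \<alpha> * mi_fact \<beta>"
    by (simp add: algebra_simps)
qed

lemma gs_bound_linear:
  assumes f: "gs_bound A B S f" and L: "bounded_linear L" "\<And>z. norm (L z) = c * norm z" "0 \<le> c"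
  shows "gs_bound A B (c * S) (\<lambda>x. L (f x))"
proof (rule gs_boundI)
  have sm: "smooth f" using f by (rule gs_bound_smooth)
  then show "smooth (\<lambda>x. L (f x))" by (rule smooth_linear[OF L(1)])
  fix x :: 'a and \<alpha> \<beta> :: "'a \<Rightarrow> nat"
  have "\<bar>mi_power x \<alpha>\<bar> * norm (mi_deriv \<beta> (\<lambda>x. L (f x)) x) = c * (\<bar>mi_power x \<alpha>\<bar> * norm (mi_deriv \<beta> f x))"
    by (simp only: mi_deriv_linear[OF L(1) sm] L(2) mult.left_commute)
  also have "\<dots> \<le> c * (S * A ^ mi_size \<alpha> * B ^ mi_size \<beta> * mi_fact \<alpha> * mi_fact \<beta>)"
    by (intro mult_left_mono gs_boundD f L)
  finally show "\<bar>mi_power x \<alpha>\<bar> * norm (mi_deriv \<beta> (\<lambda>x. L (f x)) x)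
      \<le> (c * S) * A ^ mi_size \<alpha> * B ^ mi_size \<beta> * mi_fact \<alpha> * mi_fact \<beta>"
    by (simp only: mult.assoc)
qed

lemma gs_bound_cmult: "gs_bound A B S f \<Longrightarrow> gs_bound A B (norm c * S) (\<lambda>x. c * f x)"
  by (rule gs_bound_linear) (auto simp: bounded_linear_mult_right norm_mult)

lemma gs_bound_cnj: "gs_bound A B S f \<Longrightarrow> gs_bound A B S (\<lambda>x. cnj (f x))"
  using gs_bound_linear[where L = cnj and c = 1] bounded_linear_cnj by auto

lemma mi_power_minus: "\<bar>mi_power (- x) \<alpha>\<bar> = \<bar>mi_power x \<alpha>\<bar>"
  by (simp add: mi_power_def abs_prod power_abs)

lemma gs_bound_reflect:
  assumes f: "gs_bound A B S f" shows "gs_bound A B S (\<lambda>x. f (- x))"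
proof (rule gs_boundI)
  have sm: "smooth f" using f by (rule gs_bound_smooth)
  from smooth_affine[OF this, of "-1" 0] show "smooth (\<lambda>x. f (- x))" by simp
  have "mi_deriv \<beta> (\<lambda>x. f (- x)) = (\<lambda>x. (-1) ^ mi_size \<beta> *\<^sub>R mi_deriv \<beta> f (- x))" for \<beta>
    using mi_deriv_affine[OF sm, of \<beta> "-1" 0] by simp
  then show "\<bar>mi_power x \<alpha>\<bar> * norm (mi_deriv \<beta> (\<lambda>x. f (- x)) x)
      \<le> S * A ^ mi_size \<alpha> * B ^ mi_size \<beta> * mi_fact \<alpha> * mi_fact \<beta>" for x \<alpha> \<beta>
    using gs_boundD[OF f, of "- x" \<alpha> \<beta>] by (simp add: mi_power_minus)
qed

lemma fact_add_le: "fact (k + n) \<le> (2 ^ (k + n) * fact k * fact n :: real)"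
proof -
  have "fact (k + n) = (fact k * fact n * real ((k + n) choose k))"
    using binomial_fact_lemma[of k "k + n"] by (metis add_diff_cancel_left' le_add1 of_nat_fact of_nat_mult)
  moreover have "real ((k + n) choose k) \<le> 2 ^ (k + n)"
    using binomial_le_pow2[of "k + n" k] by (metis of_nat_le_iff of_nat_numeral of_nat_power)
  ultimately show ?thesis by (simp add: mult.commute mult_left_mono)
qed

lemma fact_mult_le: "fact k * fact n \<le> (fact (k + n) :: real)"
proof -
  have "fact k * fact n dvd (fact (k + n) :: nat)" by (rule fact_fact_dvd_fact)
  then have "fact k * fact n \<le> (fact (k + n) :: nat)" by (rule dvd_imp_le) simp
  then show ?thesis by (metis of_nat_fact of_nat_le_iff of_nat_mult)
qed

lemma mi_size_upd: "j \<in> Basis \<Longrightarrow> mi_size (\<beta>(j := k)) = mi_size (\<beta>(j := 0)) + k"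
  unfolding mi_size_def by (subst (1 2) sum.remove[of _ j]) auto

lemma mi_fact_upd: "j \<in> Basis \<Longrightarrow> mi_fact (\<beta>(j := k)) = mi_fact (\<beta>(j := 0)) * fact k"
  unfolding mi_fact_def by (subst (1 2) prod.remove[of _ j]) auto

lemma mi_power_upd: "j \<in> Basis \<Longrightarrow> mi_power x (\<beta>(j := k)) = mi_power x (\<beta>(j := 0)) * (x \<bullet> j) ^ k"
  unfolding mi_power_def by (subst (1 2) prod.remove[of _ j]) auto

text \<open>Since \<open>(n choose k) * k! = n! / (n - k)!\<close>, dividing by
  \<open>A ^ n * n!\<close> leaves a partial sum of the series of \<open>exp (r / A)\<close>. This
  is why a shift costs only an exponential factor and leaves the rates unchanged.\<close>

lemma binomial_exp_sum:
  fixes A r :: real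
  assumes "0 < A" "0 \<le> r"
  shows "(\<Sum>k\<le>n. real (n choose k) * r ^ (n - k) * (A ^ k * fact k)) \<le> A ^ n * fact n * exp (r / A)"
proof -
  have "(\<Sum>k\<le>n. real (n choose k) * r ^ (n - k) * (A ^ k * fact k))
      = (\<Sum>k\<le>n. A ^ n * fact n * ((r / A) ^ (n - k) / fact (n - k)))"
  proof (intro sum.cong refl)
    fix k assume "k \<in> {..n}"
    then have k: "k \<le> n" by simp
    have "A ^ n = A ^ k * A ^ (n - k)" using k by (simp add: power_add[symmetric])
    then show "real (n choose k) * r ^ (n - k) * (A ^ k * fact k) = A ^ n * fact n * ((r / A) ^ (n - k) / fact (n - k))"
      using assms k by (simp add: binomial_fact power_divide field_simps)
  qed
  also have "\<dots> = A ^ n * fact n * (\<Sum>m<Suc n. (r / A) ^ m / fact m)"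
  proof -
    have "(\<Sum>k\<le>n. (r / A) ^ (n - k) / fact (n - k)) = (\<Sum>m<Suc n. (r / A) ^ m / fact m)"
      using sum.nat_diff_reindex[of "\<lambda>m. (r / A) ^ m / fact m" "Suc n"] by (simp add: lessThan_Suc_atMost)
    then show ?thesis by (simp only: sum_distrib_left[symmetric])
  qed
  also have "(\<Sum>m<Suc n. (r / A) ^ m / fact m) \<le> exp (r / A)"
    using sum_le_suminf[OF summable_exp[of "r / A"], of "{..<Suc n}"] assms
    by (simp add: exp_def divide_inverse mult.commute)
  finally show ?thesis using assms by (simp add: mult_left_mono)
qed

lemma gs_bound_modulate_Basis:
  assumes f: "gs_bound A B S f" and AB: "0 < A" "0 < B" and j: "j \<in> Basis"
  shows "gs_bound A B (S * exp (\<bar>s\<bar> / B)) (modulate (s *\<^sub>R j) f)"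
proof (rule gs_boundI)
  have sm: "smooth f" using f by (rule gs_bound_smooth)
  then show "smooth (modulate (s *\<^sub>R j) f)" using j by (rule smooth_modulate_Basis)
  have S: "0 \<le> S" using f by (rule gs_bound_nonneg)
  fix x :: 'a and \<alpha> \<beta> :: "'a \<Rightarrow> nat"
  define K where "K = S * A ^ mi_size \<alpha> * B ^ mi_size (\<beta>(j := 0)) * mi_fact \<alpha> * mi_fact (\<beta>(j := 0))"
  have K: "K \<ge> 0" unfolding K_def using S AB mi_fact_pos[of \<alpha>] mi_fact_pos[of "\<beta>(j := 0)"] by auto
  let ?n = "\<beta> j"
  have bd: "\<bar>mi_power x \<alpha>\<bar> * norm (mi_deriv (\<beta>(j := k)) f x) \<le> K * (B ^ k * fact k)" for k
    using gs_boundD[OF f, of x \<alpha> "\<beta>(j := k)"] j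
    unfolding K_def by (simp add: mi_size_upd[OF j, of \<beta> k] mi_fact_upd[OF j, of \<beta> k] power_add ac_simps)
  have "\<bar>mi_power x \<alpha>\<bar> * norm (mi_deriv \<beta> (modulate (s *\<^sub>R j) f) x)
      \<le> \<bar>mi_power x \<alpha>\<bar> * (\<Sum>k\<le>?n. real (?n choose k) * \<bar>s\<bar> ^ (?n - k) * norm (mi_deriv (\<beta>(j := k)) f x))"
    unfolding mi_deriv_modulate[OF j sm] unfolding modulate_def norm_mult norm_cis mult_1
    by (intro mult_left_mono order.trans[OF norm_sum] sum_mono) (auto simp: norm_mult norm_power)
  also have "\<dots> = (\<Sum>k\<le>?n. real (?n choose k) * \<bar>s\<bar> ^ (?n - k) * (\<bar>mi_power x \<alpha>\<bar> * norm (mi_deriv (\<beta>(j := k)) f x)))"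
    by (simp add: sum_distrib_left ac_simps)
  also have "\<dots> \<le> (\<Sum>k\<le>?n. real (?n choose k) * \<bar>s\<bar> ^ (?n - k) * (K * (B ^ k * fact k)))"
    by (intro sum_mono mult_left_mono bd) auto
  also have "\<dots> = K * (\<Sum>k\<le>?n. real (?n choose k) * \<bar>s\<bar> ^ (?n - k) * (B ^ k * fact k))"
    by (simp add: sum_distrib_left ac_simps)
  also have "\<dots> \<le> K * (B ^ ?n * fact ?n * exp (\<bar>s\<bar> / B))"
    using AB by (intro mult_left_mono binomial_exp_sum K) auto
  also have "\<dots> = (S * exp (\<bar>s\<bar> / B)) * A ^ mi_size \<alpha> * B ^ mi_size \<beta> * mi_fact \<alpha> * mi_fact \<beta>"
    using mi_size_upd[OF j, of \<beta> "\<beta> j"] mi_fact_upd[OF j, of \<beta> "\<beta> j"]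
    unfolding K_def by (simp add: power_add ac_simps)
  finally show "\<bar>mi_power x \<alpha>\<bar> * norm (mi_deriv \<beta> (modulate (s *\<^sub>R j) f) x)
      \<le> (S * exp (\<bar>s\<bar> / B)) * A ^ mi_size \<alpha> * B ^ mi_size \<beta> * mi_fact \<alpha> * mi_fact \<beta>" .
qed

definition translate :: "'a::euclidean_space \<Rightarrow> ('a \<Rightarrow> complex) \<Rightarrow> 'a \<Rightarrow> complex"
  where "translate x f = (\<lambda>t. f (t - x))"

lemma smooth_translate: "smooth f \<Longrightarrow> smooth (translate x f)"
  using smooth_affine[of f 1 "- x"] by (simp add: translate_def)

lemma partial_deriv_translate: "smooth f \<Longrightarrow> partial_deriv b (translate x f) = translate x (partial_deriv b f)"
  using partial_deriv_affine[of f b 1 "- x"] by (simp add: translate_def)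

lemma mi_deriv_translate: "smooth f \<Longrightarrow> mi_deriv \<beta> (translate x f) = translate x (mi_deriv \<beta> f)"
  using mi_deriv_affine[of f \<beta> 1 "- x"] by (simp add: translate_def)

text \<open>Dual to modulation: the monomial in \<open>x\<close> is expanded around the shifted
  point, with \<open>s\<close> as the increment of its \<open>j\<close>-th coordinate, so the
  exponential now carries the rate \<open>A\<close> instead of \<open>B\<close>.\<close>

lemma gs_bound_translate_Basis:
  assumes f: "gs_bound A B S f" and AB: "0 < A" "0 < B" and j: "j \<in> Basis"
  shows "gs_bound A B (S * exp (\<bar>s\<bar> / A)) (translate (s *\<^sub>R j) f)"
proof (rule gs_boundI)
  have sm: "smooth f" using f by (rule gs_bound_smooth)
  then show "smooth (translate (s *\<^sub>R j) f)" by (rule smooth_translate)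
  have S: "0 \<le> S" using f by (rule gs_bound_nonneg)
  fix x :: 'a and \<alpha> \<beta> :: "'a \<Rightarrow> nat"
  let ?y = "x - s *\<^sub>R j" let ?n = "\<alpha> j"
  define K where "K = S * A ^ mi_size (\<alpha>(j := 0)) * B ^ mi_size \<beta> * mi_fact (\<alpha>(j := 0)) * mi_fact \<beta>"
  have K: "K \<ge> 0" unfolding K_def using S AB mi_fact_pos[of \<beta>] mi_fact_pos[of "\<alpha>(j := 0)"] by auto
  have eq: "mi_power x (\<alpha>(j := 0)) = mi_power ?y (\<alpha>(j := 0))"
    unfolding mi_power_def using j by (intro prod.cong) (auto simp: inner_diff_left inner_Basis)
  have bd: "\<bar>mi_power x (\<alpha>(j := 0))\<bar> * \<bar>?y \<bullet> j\<bar> ^ k * norm (mi_deriv \<beta> f ?y) \<le> K * (A ^ k * fact k)" for k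
    using gs_boundD[OF f, of ?y "\<alpha>(j := k)" \<beta>] unfolding K_def eq
    by (simp add: mi_power_upd[OF j, of ?y \<alpha> k] mi_size_upd[OF j, of \<alpha> k] mi_fact_upd[OF j, of \<alpha> k]
        power_add abs_mult power_abs ac_simps)
  have xj: "\<bar>x \<bullet> j\<bar> \<le> \<bar>?y \<bullet> j\<bar> + \<bar>s\<bar>" using j by (auto simp: inner_diff_left)
  have "\<bar>mi_power x \<alpha>\<bar> = \<bar>mi_power x (\<alpha>(j := 0))\<bar> * \<bar>x \<bullet> j\<bar> ^ ?n"
    using mi_power_upd[OF j, of x \<alpha> ?n] by (simp add: abs_mult power_abs)
  also have "\<dots> \<le> \<bar>mi_power x (\<alpha>(j := 0))\<bar> * (\<bar>?y \<bullet> j\<bar> + \<bar>s\<bar>) ^ ?n"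
    by (intro mult_left_mono power_mono xj) auto
  finally have "\<bar>mi_power x \<alpha>\<bar> * norm (mi_deriv \<beta> f ?y)
      \<le> \<bar>mi_power x (\<alpha>(j := 0))\<bar> * (\<bar>?y \<bullet> j\<bar> + \<bar>s\<bar>) ^ ?n * norm (mi_deriv \<beta> f ?y)"
    by (rule mult_right_mono) simp
  also have "\<dots> = (\<Sum>k\<le>?n. real (?n choose k) * \<bar>s\<bar> ^ (?n - k) *
      (\<bar>mi_power x (\<alpha>(j := 0))\<bar> * \<bar>?y \<bullet> j\<bar> ^ k * norm (mi_deriv \<beta> f ?y)))"
    unfolding binomial_ring by (simp add: sum_distrib_left sum_distrib_right ac_simps)
  also have "\<dots> \<le> (\<Sum>k\<le>?n. real (?n choose k) * \<bar>s\<bar> ^ (?n - k) * (K * (A ^ k * fact k)))"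
    by (intro sum_mono mult_left_mono bd) auto
  also have "\<dots> = K * (\<Sum>k\<le>?n. real (?n choose k) * \<bar>s\<bar> ^ (?n - k) * (A ^ k * fact k))"
    by (simp add: sum_distrib_left ac_simps)
  also have "\<dots> \<le> K * (A ^ ?n * fact ?n * exp (\<bar>s\<bar> / A))"
    using AB by (intro mult_left_mono binomial_exp_sum K) auto
  also have "\<dots> = (S * exp (\<bar>s\<bar> / A)) * A ^ mi_size \<alpha> * B ^ mi_size \<beta> * mi_fact \<alpha> * mi_fact \<beta>"
    using mi_size_upd[OF j, of \<alpha> "\<alpha> j"] mi_fact_upd[OF j, of \<alpha> "\<alpha> j"]
    unfolding K_def by (simp add: power_add ac_simps)
  finally show "\<bar>mi_power x \<alpha>\<bar> * norm (mi_deriv \<beta> (translate (s *\<^sub>R j) f) x)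
      \<le> (S * exp (\<bar>s\<bar> / A)) * A ^ mi_size \<alpha> * B ^ mi_size \<beta> * mi_fact \<alpha> * mi_fact \<beta>"
    unfolding mi_deriv_translate[OF sm] unfolding translate_def .
qed

text \<open>Every multiplication raises \<open>\<alpha> j\<close> by one; the Leibniz correction
  lowers \<open>\<beta> j\<close> by one, its coefficient \<open>\<beta> j\<close> being absorbed by
  \<open>mi_fact \<beta>\<close> at relative cost \<open>1 / (A * B)\<close>. The factorial of
  \<open>\<alpha> j + n\<close> stays unsplit during the induction, since splitting it in every step
  would enlarge the rate \<open>A\<close> each time.\<close>

lemma gs_bound_mult_coord_power:
  assumes f: "gs_bound A B S f" and AB: "0 < A" "0 < B" and j: "j \<in> Basis"
  shows "smooth ((mult_coord j ^^ n) f) \<and> (\<forall>x \<alpha> \<beta>. \<bar>mi_power x \<alpha>\<bar> * norm (mi_deriv \<beta> ((mult_coord j ^^ n) f) x)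
    \<le> S * A ^ (mi_size \<alpha> + n) * mi_fact (\<alpha>(j := \<alpha> j + n)) * B ^ mi_size \<beta> * mi_fact \<beta> * (1 + 1 / (A * B)) ^ n)"
proof (induction n)
  case 0
  then show ?case using f j by (auto simp: gs_bound_def fun_upd_idem ac_simps)
next
  case (Suc n)
  let ?F = "(mult_coord j ^^ n) f" let ?k = "1 + 1 / (A * B)"
  have sm: "smooth ?F" using Suc by blast
  have IH: "\<bar>mi_power x \<alpha>\<bar> * norm (mi_deriv \<beta> ?F x)
    \<le> S * A ^ (mi_size \<alpha> + n) * mi_fact (\<alpha>(j := \<alpha> j + n)) * B ^ mi_size \<beta> * mi_fact \<beta> * ?k ^ n" for x \<alpha> \<beta>
    using Suc by blast
  have S: "0 \<le> S" using f by (rule gs_bound_nonneg)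
  have k0: "?k \<ge> 0" using AB by simp
  have "\<bar>mi_power x \<alpha>\<bar> * norm (mi_deriv \<beta> (mult_coord j ?F) x)
    \<le> S * A ^ (mi_size \<alpha> + Suc n) * mi_fact (\<alpha>(j := \<alpha> j + Suc n)) * B ^ mi_size \<beta> * mi_fact \<beta> * ?k ^ Suc n"
    for x \<alpha> \<beta>
  proof -
    define Z where "Z = S * A ^ (mi_size \<alpha> + Suc n) * mi_fact (\<alpha>(j := \<alpha> j + Suc n)) * B ^ mi_size \<beta> * mi_fact \<beta> * ?k ^ n"
    have "\<bar>mi_power x \<alpha>\<bar> * norm (mi_deriv \<beta> (mult_coord j ?F) x)
        \<le> \<bar>mi_power x \<alpha>\<bar> * (\<bar>x \<bullet> j\<bar> * norm (mi_deriv \<beta> ?F x) + real (\<beta> j) * norm (mi_deriv (\<beta>(j := \<beta> j - 1)) ?F x))"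
      unfolding mi_deriv_mult_coord[OF j sm]
      by (intro mult_left_mono order.trans[OF norm_triangle_ineq]) (auto simp: norm_mult)
    also have "\<dots> = \<bar>mi_power x (\<alpha>(j := Suc (\<alpha> j)))\<bar> * norm (mi_deriv \<beta> ?F x)
        + real (\<beta> j) * (\<bar>mi_power x \<alpha>\<bar> * norm (mi_deriv (\<beta>(j := \<beta> j - 1)) ?F x))"
      by (simp add: mi_power_Suc[OF j] abs_mult algebra_simps del: fun_upd_apply)
    also have "\<dots> \<le> Z + Z * (1 / (A * B))"
    proof (rule add_mono)
      show "\<bar>mi_power x (\<alpha>(j := Suc (\<alpha> j)))\<bar> * norm (mi_deriv \<beta> ?F x) \<le> Z"
        using IH[of x "\<alpha>(j := Suc (\<alpha> j))" \<beta>] j unfolding Z_def by (simp add: mi_size_Suc del: fun_upd_apply) (simp add: ac_simps)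
      show "real (\<beta> j) * (\<bar>mi_power x \<alpha>\<bar> * norm (mi_deriv (\<beta>(j := \<beta> j - 1)) ?F x)) \<le> Z * (1 / (A * B))"
      proof (cases "\<beta> j")
        case 0
        then show ?thesis using S AB mi_fact_pos[of \<beta>] mi_fact_pos[of "\<alpha>(j := \<alpha> j + Suc n)"] k0
          unfolding Z_def by auto
      next
        case (Suc m)
        have id: "\<beta>(j := Suc m) = \<beta>" using Suc by auto
        have sz: "mi_size \<beta> = Suc (mi_size (\<beta>(j := m)))"
          using mi_size_upd[OF j, of \<beta> "Suc m"] mi_size_upd[OF j, of \<beta> m] unfolding id by simp
        have fc: "mi_fact \<beta> = real (\<beta> j) * mi_fact (\<beta>(j := m))"
          using mi_fact_upd[OF j, of \<beta> "Suc m"] mi_fact_upd[OF j, of \<beta> m] Suc unfolding id by (simp add: algebra_simps)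
        have le: "mi_fact (\<alpha>(j := \<alpha> j + n)) \<le> mi_fact (\<alpha>(j := \<alpha> j + Suc n))"
          unfolding mi_fact_upd[OF j, of \<alpha> "\<alpha> j + n"] mi_fact_upd[OF j, of \<alpha> "\<alpha> j + Suc n"]
          using mi_fact_pos[of "\<alpha>(j := 0)"] by (intro mult_left_mono fact_mono) auto
        have "real (\<beta> j) * (\<bar>mi_power x \<alpha>\<bar> * norm (mi_deriv (\<beta>(j := m)) ?F x))
          \<le> real (\<beta> j) * (S * A ^ (mi_size \<alpha> + n) * mi_fact (\<alpha>(j := \<alpha> j + n)) * B ^ mi_size (\<beta>(j := m)) * mi_fact (\<beta>(j := m)) * ?k ^ n)"
          by (intro mult_left_mono IH) auto
        also have "\<dots> \<le> real (\<beta> j) * (S * A ^ (mi_size \<alpha> + n) * mi_fact (\<alpha>(j := \<alpha> j + Suc n)) * B ^ mi_size (\<beta>(j := m)) * mi_fact (\<beta>(j := m)) * ?k ^ n)"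
          using S AB k0 mi_fact_pos[of "\<beta>(j := m)"] by (intro mult_left_mono mult_right_mono le) auto
        also have "\<dots> = Z * (1 / (A * B))"
          unfolding Z_def fc sz using AB by (simp add: field_simps)
        finally show ?thesis using Suc by simp
      qed
    qed
    also have "\<dots> = S * A ^ (mi_size \<alpha> + Suc n) * mi_fact (\<alpha>(j := \<alpha> j + Suc n)) * B ^ mi_size \<beta> * mi_fact \<beta> * ?k ^ Suc n"
      unfolding Z_def by (simp add: algebra_simps)
    finally show ?thesis .
  qed
  then show ?case using smooth_mult_coord[OF sm j] by (simp del: fun_upd_apply power_Suc)
qed

text \<open>The shifted factorial is split only now, by
  \<open>(k + n)! \<le> 2 ^ (k + n) * k! * n!\<close>, so \<open>A\<close> is doubled once for all
  \<open>n\<close>. The growth rate is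
  \<open>2 * A * (1 + 1 / (A * B)) = 2 * A + 2 / B\<close>.\<close>

lemma gs_bound_mult_coord:
  assumes f: "gs_bound A B S f" and AB: "0 < A" "0 < B" and j: "j \<in> Basis"
  shows "gs_bound (2 * A) B (S * (2 * A + 2 / B) ^ n * fact n) ((mult_coord j ^^ n) f)"
proof (rule gs_boundI)
  note * = gs_bound_mult_coord_power[OF assms, of n]
  then show "smooth ((mult_coord j ^^ n) f)" by blast
  have S: "0 \<le> S" using f by (rule gs_bound_nonneg)
  fix x :: 'a and \<alpha> \<beta> :: "'a \<Rightarrow> nat"
  have fa: "mi_fact (\<alpha>(j := \<alpha> j + n)) \<le> 2 ^ (mi_size \<alpha> + n) * mi_fact \<alpha> * fact n"
  proof -
    have "mi_fact (\<alpha>(j := \<alpha> j + n)) = mi_fact (\<alpha>(j := 0)) * fact (\<alpha> j + n)" by (rule mi_fact_upd[OF j])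
    also have "\<dots> \<le> mi_fact (\<alpha>(j := 0)) * (2 ^ (\<alpha> j + n) * fact (\<alpha> j) * fact n)"
      using mi_fact_pos[of "\<alpha>(j := 0)"] by (intro mult_left_mono fact_add_le) auto
    also have "\<dots> = 2 ^ (\<alpha> j + n) * mi_fact \<alpha> * fact n"
      using mi_fact_upd[OF j, of \<alpha> "\<alpha> j"] by simp
    also have "\<dots> \<le> 2 ^ (mi_size \<alpha> + n) * mi_fact \<alpha> * fact n"
      using mi_fact_pos[of \<alpha>] mi_size_upd[OF j, of \<alpha> "\<alpha> j"]
      by (intro mult_right_mono power_increasing) auto
    finally show ?thesis .
  qed
  have "\<bar>mi_power x \<alpha>\<bar> * norm (mi_deriv \<beta> ((mult_coord j ^^ n) f) x)
    \<le> S * A ^ (mi_size \<alpha> + n) * mi_fact (\<alpha>(j := \<alpha> j + n)) * B ^ mi_size \<beta> * mi_fact \<beta> * (1 + 1 / (A * B)) ^ n"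
    using * by blast
  also have "\<dots> \<le> S * A ^ (mi_size \<alpha> + n) * (2 ^ (mi_size \<alpha> + n) * mi_fact \<alpha> * fact n) * B ^ mi_size \<beta> * mi_fact \<beta> * (1 + 1 / (A * B)) ^ n"
    using S AB mi_fact_pos[of \<beta>] by (intro mult_left_mono mult_right_mono fa) auto
  also have "\<dots> = (S * (2 * A * (1 + 1 / (A * B))) ^ n * fact n) * (2 * A) ^ mi_size \<alpha> * B ^ mi_size \<beta> * mi_fact \<alpha> * mi_fact \<beta>"
    by (simp add: power_add power_mult_distrib)
  also have "2 * A * (1 + 1 / (A * B)) = 2 * A + 2 / B"
    using AB by (simp add: field_simps)
  finally show "\<bar>mi_power x \<alpha>\<bar> * norm (mi_deriv \<beta> ((mult_coord j ^^ n) f) x)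
    \<le> (S * (2 * A + 2 / B) ^ n * fact n) * (2 * A) ^ mi_size \<alpha> * B ^ mi_size \<beta> * mi_fact \<alpha> * mi_fact \<beta>" .
qed

text \<open>The derivatives merely shift \<open>\<beta> j\<close> by \<open>n\<close>; splitting the
  factorial doubles \<open>B\<close> once, uniformly in \<open>n\<close>.\<close>

lemma gs_bound_partial_deriv:
  assumes f: "gs_bound A B S f" and AB: "0 < A" "0 < B" and j: "j \<in> Basis"
  shows "gs_bound A (2 * B) (S * (2 * B) ^ n * fact n) ((partial_deriv j ^^ n) f)"
proof (rule gs_boundI)
  have sm: "smooth f" using f by (rule gs_bound_smooth)
  then show "smooth ((partial_deriv j ^^ n) f)" using j by (rule smooth_funpow)
  have S: "0 \<le> S" using f by (rule gs_bound_nonneg)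
  have eq: "smooth f \<Longrightarrow> mi_deriv \<beta> ((partial_deriv j ^^ n) f) = mi_deriv (\<beta>(j := \<beta> j + n)) f"
    for \<beta> and f :: "'a \<Rightarrow> complex"
  proof (induction n arbitrary: f)
    case (Suc n)
    have "mi_deriv \<beta> ((partial_deriv j ^^ Suc n) f) = mi_deriv \<beta> ((partial_deriv j ^^ n) (partial_deriv j f))"
      by (simp add: funpow_swap1)
    also have "\<dots> = mi_deriv (\<beta>(j := \<beta> j + n)) (partial_deriv j f)"
      using Suc j by (intro Suc.IH smooth_partial_deriv)
    also have "\<dots> = mi_deriv (\<beta>(j := \<beta> j + Suc n)) f"
      using Suc.prems j by (simp add: mi_deriv_partial_deriv)
    finally show ?case .
  qed simp
  fix x :: 'a and \<alpha> \<beta> :: "'a \<Rightarrow> nat"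
  have fb: "mi_fact (\<beta>(j := \<beta> j + n)) \<le> 2 ^ (mi_size \<beta> + n) * mi_fact \<beta> * fact n"
  proof -
    have "mi_fact (\<beta>(j := \<beta> j + n)) = mi_fact (\<beta>(j := 0)) * fact (\<beta> j + n)" by (rule mi_fact_upd[OF j])
    also have "\<dots> \<le> mi_fact (\<beta>(j := 0)) * (2 ^ (\<beta> j + n) * fact (\<beta> j) * fact n)"
      using mi_fact_pos[of "\<beta>(j := 0)"] by (intro mult_left_mono fact_add_le) auto
    also have "\<dots> = 2 ^ (\<beta> j + n) * mi_fact \<beta> * fact n"
      using mi_fact_upd[OF j, of \<beta> "\<beta> j"] by simp
    also have "\<dots> \<le> 2 ^ (mi_size \<beta> + n) * mi_fact \<beta> * fact n"
      using mi_fact_pos[of \<beta>] mi_size_upd[OF j, of \<beta> "\<beta> j"]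
      by (intro mult_right_mono power_increasing) auto
    finally show ?thesis .
  qed
  have sz: "mi_size (\<beta>(j := \<beta> j + n)) = mi_size \<beta> + n"
    using mi_size_upd[OF j, of \<beta> "\<beta> j"] mi_size_upd[OF j, of \<beta> "\<beta> j + n"] by simp
  have "\<bar>mi_power x \<alpha>\<bar> * norm (mi_deriv \<beta> ((partial_deriv j ^^ n) f) x)
    \<le> S * A ^ mi_size \<alpha> * B ^ (mi_size \<beta> + n) * mi_fact \<alpha> * mi_fact (\<beta>(j := \<beta> j + n))"
    using gs_boundD[OF f, of x \<alpha> "\<beta>(j := \<beta> j + n)"] unfolding eq[OF sm] sz .
  also have "\<dots> \<le> S * A ^ mi_size \<alpha> * B ^ (mi_size \<beta> + n) * mi_fact \<alpha> * (2 ^ (mi_size \<beta> + n) * mi_fact \<beta> * fact n)"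
    using S AB mi_fact_pos[of \<alpha>] by (intro mult_left_mono fb) auto
  also have "\<dots> = (S * (2 * B) ^ n * fact n) * A ^ mi_size \<alpha> * (2 * B) ^ mi_size \<beta> * mi_fact \<alpha> * mi_fact \<beta>"
    by (simp add: power_add power_mult_distrib)
  finally show "\<bar>mi_power x \<alpha>\<bar> * norm (mi_deriv \<beta> ((partial_deriv j ^^ n) f) x)
    \<le> (S * (2 * B) ^ n * fact n) * A ^ mi_size \<alpha> * (2 * B) ^ mi_size \<beta> * mi_fact \<alpha> * mi_fact \<beta>" .
qed

lemma gelfand_shilov_iff: "f \<in> gelfand_shilov \<longleftrightarrow> (\<forall>A>0. \<forall>B>0. \<exists>S. gs_bound A B S f)"
proof
  assume "f \<in> gelfand_shilov"
  then show "\<forall>A>0. \<forall>B>0. \<exists>S. gs_bound A B S f"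
    unfolding gelfand_shilov_def schwartz_def gs_bound_def by blast
next
  assume R: "\<forall>A>0. \<forall>B>0. \<exists>S. gs_bound A B S f"
  then obtain S where S: "gs_bound 1 1 S f" by (meson zero_less_one)
  show "f \<in> gelfand_shilov"
    unfolding gelfand_shilov_def schwartz_def
  proof (intro CollectI conjI allI impI)
    show "smooth f" using S by (rule gs_bound_smooth)
    show "\<exists>c. \<forall>x. \<bar>mi_power x \<alpha>\<bar> * norm (mi_deriv \<beta> f x) \<le> c" for \<alpha> \<beta>
      using gs_boundD[OF S] by blast
    fix A B :: real assume AB: "A > 0" "B > 0"
    with R obtain S where S: "gs_bound A B S f" by blast
    show "\<exists>c>0. \<forall>x \<alpha> \<beta>. \<bar>mi_power x \<alpha>\<bar> * norm (mi_deriv \<beta> f x)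
         \<le> c * A ^ mi_size \<alpha> * B ^ mi_size \<beta> * mi_fact \<alpha> * mi_fact \<beta>"
      using gs_bound_nonneg[OF S] gs_boundD[OF gs_bound_mono[OF S, of A B "S + 1"]] AB
      by (intro exI[of _ "S + 1"]) auto
  qed
qed

lemma gelfand_shilovD: "f \<in> gelfand_shilov \<Longrightarrow> 0 < A \<Longrightarrow> 0 < B \<Longrightarrow> \<exists>S. gs_bound A B S f"
  by (simp add: gelfand_shilov_iff)

lemma gelfand_shilov_smooth: "f \<in> gelfand_shilov \<Longrightarrow> smooth f"
  by (simp add: gelfand_shilov_def schwartz_def)

context
  fixes f :: "'a::euclidean_space \<Rightarrow> complex" and A B :: real
  assumes AB: "0 < A" "0 < B"
begin

private lemma weight_pos: "0 < A ^ mi_size (\<alpha> :: 'a \<Rightarrow> nat) * B ^ mi_size (\<beta> :: 'a \<Rightarrow> nat) * mi_fact \<alpha> * mi_fact \<beta>"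
  using AB mi_fact_pos by (intro mult_pos_pos) auto

lemma gs_bound_quotient:
  "gs_bound A B S f \<Longrightarrow> \<bar>mi_power x \<alpha>\<bar> * norm (mi_deriv \<beta> f x)
        / (A ^ mi_size \<alpha> * B ^ mi_size \<beta> * mi_fact \<alpha> * mi_fact \<beta>) \<le> S"
  using gs_boundD[of A B S f x \<alpha> \<beta>] weight_pos[of \<alpha> \<beta>] by (simp add: pos_divide_le_eq mult.assoc)

lemma gs_seminorm_le: "gs_bound A B S f \<Longrightarrow> gs_seminorm A B f \<le> S"
  unfolding gs_seminorm_def by (intro cSUP_least) (auto intro: gs_bound_quotient)

text \<open>A real-valued \<open>SUP\<close> is an upper bound only for a bounded family; membership
  in \<open>gelfand_shilov\<close> supplies that bound.\<close>

lemma gs_bound_seminorm: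
  assumes "f \<in> gelfand_shilov" shows "gs_bound A B (gs_seminorm A B f) f"
proof (rule gs_boundI)
  show "smooth f" using assms by (rule gelfand_shilov_smooth)
  obtain S where S: "gs_bound A B S f" using assms AB by (meson gelfand_shilovD)
  fix x and \<alpha> \<beta> :: "'a \<Rightarrow> nat"
  let ?F = "\<lambda>(x, \<alpha>, \<beta>). \<bar>mi_power x \<alpha>\<bar> * norm (mi_deriv \<beta> f x)
        / (A ^ mi_size \<alpha> * B ^ mi_size \<beta> * mi_fact \<alpha> * mi_fact \<beta>)"
  have "?F (x, \<alpha>, \<beta>) \<le> gs_seminorm A B f"
    unfolding gs_seminorm_def
    by (rule cSUP_upper) (auto intro!: bdd_aboveI2[where M = S] gs_bound_quotient[OF S])
  then show "\<bar>mi_power x \<alpha>\<bar> * norm (mi_deriv \<beta> f x)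
      \<le> gs_seminorm A B f * A ^ mi_size \<alpha> * B ^ mi_size \<beta> * mi_fact \<alpha> * mi_fact \<beta>"
    using weight_pos[of \<alpha> \<beta>] by (simp add: pos_divide_le_eq mult.assoc)
qed

end

lemma gs_I: "(\<And>A B. 0 < A \<Longrightarrow> 0 < B \<Longrightarrow> \<exists>S. gs_bound A B S f) \<Longrightarrow> f \<in> gelfand_shilov"
  by (simp add: gelfand_shilov_iff)

lemma gs_add: "f \<in> gelfand_shilov \<Longrightarrow> h \<in> gelfand_shilov \<Longrightarrow> (\<lambda>x. f x + h x) \<in> gelfand_shilov"
  by (rule gs_I, frule (2) gelfand_shilovD[of f], frule (2) gelfand_shilovD[of h], elim exE, rule exI, rule gs_bound_add)

lemma gs_cmult: "f \<in> gelfand_shilov \<Longrightarrow> (\<lambda>x. c * f x) \<in> gelfand_shilov"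
  by (rule gs_I, drule (2) gelfand_shilovD, elim exE, rule exI, rule gs_bound_cmult)

lemma gs_cnj: "f \<in> gelfand_shilov \<Longrightarrow> (\<lambda>x. cnj (f x)) \<in> gelfand_shilov"
  by (rule gs_I, drule (2) gelfand_shilovD, elim exE, rule exI, rule gs_bound_cnj)

lemma gs_reflect: "f \<in> gelfand_shilov \<Longrightarrow> (\<lambda>x. f (- x)) \<in> gelfand_shilov"
  by (rule gs_I, drule (2) gelfand_shilovD, elim exE, rule exI, rule gs_bound_reflect)

lemma gs_mult_coord: "f \<in> gelfand_shilov \<Longrightarrow> j \<in> Basis \<Longrightarrow> mult_coord j f \<in> gelfand_shilov"
  unfolding gelfand_shilov_iff
proof (intro allI impI)
  fix A B :: real assume f: "\<forall>A>0. \<forall>B>0. \<exists>S. gs_bound A B S f" and j: "j \<in> Basis" and AB: "A > 0" "B > 0"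
  then obtain S where "gs_bound (A/2) B S f" by (meson half_gt_zero)
  from gs_bound_mult_coord[OF this _ _ j, of 1] AB show "\<exists>S. gs_bound A B S (mult_coord j f)" by auto
qed

lemma gs_partial_deriv: "f \<in> gelfand_shilov \<Longrightarrow> j \<in> Basis \<Longrightarrow> partial_deriv j f \<in> gelfand_shilov"
  unfolding gelfand_shilov_iff
proof (intro allI impI)
  fix A B :: real assume f: "\<forall>A>0. \<forall>B>0. \<exists>S. gs_bound A B S f" and j: "j \<in> Basis" and AB: "A > 0" "B > 0"
  then obtain S where "gs_bound A (B/2) S f" by (meson half_gt_zero)
  from gs_bound_partial_deriv[OF this _ _ j, of 1] AB show "\<exists>S. gs_bound A B S (partial_deriv j f)" by auto
qed

lemma translate_add: "translate (x + y) f = translate x (translate y f)"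
  by (simp add: translate_def algebra_simps)

text \<open>One coordinate at a time: the exponential costs multiply, and for the full basis their
  exponents add up to the \<open>l1\<close> norm of the shift divided by \<open>A\<close>.\<close>

lemma gs_bound_translate_sum:
  assumes f: "gs_bound A B S f" and AB: "0 < A" "0 < B" and "finite J" "J \<subseteq> Basis"
  shows "gs_bound A B (S * exp ((\<Sum>j\<in>J. \<bar>x \<bullet> j\<bar>) / A)) (translate (\<Sum>j\<in>J. (x \<bullet> j) *\<^sub>R j) f)"
  using assms(4,5)
proof (induction J)
  case empty
  then show ?case using f by (simp add: translate_def)
next
  case (insert j J)
  then have "gs_bound A B (S * exp ((\<Sum>j\<in>J. \<bar>x \<bullet> j\<bar>) / A)) (translate (\<Sum>j\<in>J. (x \<bullet> j) *\<^sub>R j) f)" by auto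
  from gs_bound_translate_Basis[OF this AB, of j "x \<bullet> j"] insert show ?case
    by (simp add: translate_add add_divide_distrib exp_add ac_simps)
qed

lemma gs_bound_translate:
  assumes "gs_bound A B S f" "0 < A" "0 < B"
  shows "gs_bound A B (S * exp ((\<Sum>j\<in>Basis. \<bar>x \<bullet> j\<bar>) / A)) (translate x f)"
  using gs_bound_translate_sum[OF assms finite_Basis order_refl, of x] by (simp add: euclidean_representation)

lemma gs_bound_modulate_sum:
  assumes f: "gs_bound A B S f" and AB: "0 < A" "0 < B" and "finite J" "J \<subseteq> Basis"
  shows "gs_bound A B (S * exp ((\<Sum>j\<in>J. \<bar>x \<bullet> j\<bar>) / B)) (modulate (\<Sum>j\<in>J. (x \<bullet> j) *\<^sub>R j) f)"
  using assms(4,5)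
proof (induction J)
  case empty
  then show ?case using f by (simp add: modulate_def)
next
  case (insert j J)
  then have "gs_bound A B (S * exp ((\<Sum>j\<in>J. \<bar>x \<bullet> j\<bar>) / B)) (modulate (\<Sum>j\<in>J. (x \<bullet> j) *\<^sub>R j) f)" by auto
  from gs_bound_modulate_Basis[OF this AB, of j "x \<bullet> j"] insert show ?case
    by (simp add: modulate_add add_divide_distrib exp_add ac_simps)
qed

lemma gs_bound_modulate:
  assumes "gs_bound A B S f" "0 < A" "0 < B"
  shows "gs_bound A B (S * exp ((\<Sum>j\<in>Basis. \<bar>x \<bullet> j\<bar>) / B)) (modulate x f)"
  using gs_bound_modulate_sum[OF assms finite_Basis order_refl, of x] by (simp add: euclidean_representation)

lemma tf_shift_eq: "tf_shift z f = modulate ((2 * pi) *\<^sub>R snd z) (translate (fst z) f)"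
  by (simp add: tf_shift_def modulate_def translate_def split_beta)

lemma gs_translate: "f \<in> gelfand_shilov \<Longrightarrow> translate x f \<in> gelfand_shilov"
  unfolding gelfand_shilov_iff by (meson gs_bound_translate)

lemma gs_modulate: "f \<in> gelfand_shilov \<Longrightarrow> modulate x f \<in> gelfand_shilov"
  unfolding gelfand_shilov_iff by (meson gs_bound_modulate)

lemma gs_tf_shift: "f \<in> gelfand_shilov \<Longrightarrow> tf_shift z f \<in> gelfand_shilov"
  unfolding tf_shift_eq by (intro gs_modulate gs_translate)

lemma cnj_tf_shift: "(\<lambda>t. cnj (tf_shift z g t)) = tf_shift (fst z, - snd z) (\<lambda>t. cnj (g t))"
  by (simp add: tf_shift_def split_beta cis_cnj)

section \<open>Continuity of time-frequency shifts in the topology of test functions\<close>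

lemma translate_has_vector_derivative:
  assumes f: "smooth f" and j: "j \<in> Basis"
  shows "((\<lambda>s. mi_deriv \<beta> (translate (s *\<^sub>R j) f) t) has_vector_derivative
    mi_deriv \<beta> (translate (s *\<^sub>R j) (\<lambda>t. - 1 * partial_deriv j f t)) t) (at s)"
proof -
  let ?g = "mi_deriv \<beta> f"
  have g: "smooth ?g" using f by (rule smooth_mi_deriv)
  have "((\<lambda>s. ?g (t + s *\<^sub>R (- j))) has_vector_derivative partial_deriv (- j) ?g (t + s *\<^sub>R (- j))) (at s)"
    by (rule has_vector_derivative_line) (rule smooth_differentiable[OF g])
  moreover have "partial_deriv (- j) ?g y = - 1 * mi_deriv \<beta> (partial_deriv j f) y" for y
    unfolding partial_deriv_mi_deriv[OF f j, symmetric] partial_deriv_def[of "- j"] partial_deriv_def[of j "mi_deriv \<beta> f"]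
    using linear_neg[OF has_derivative_linear[OF smooth_has_derivative[OF g]]] by simp
  ultimately show ?thesis
    unfolding mi_deriv_translate[OF f] mi_deriv_translate[OF smooth_cmult[OF smooth_partial_deriv[OF f j]]]
      mi_deriv_linear[OF bounded_linear_mult_right, OF smooth_partial_deriv[OF f j]]
    by (simp add: translate_def)
qed

text \<open>Derivatives do not commute with modulation, so the derivative in \<open>s\<close> of
  each \<open>mi_deriv \<beta>\<close> is found by induction on \<open>\<beta>\<close>. The factor
  \<open>s\<close> that a derivative along \<open>j\<close> produces contributes the additional term
  of the product rule in \<open>s\<close>.\<close>

lemma modulate_has_vector_derivative:
  assumes j: "j \<in> Basis"
  shows "smooth f \<Longrightarrow> ((\<lambda>s. mi_deriv \<beta> (modulate (s *\<^sub>R j) f) t) has_vector_derivative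
    mi_deriv \<beta> (modulate (s *\<^sub>R j) (\<lambda>t. \<i> * mult_coord j f t)) t) (at s)"
proof (induction \<beta> arbitrary: f s rule: mi_induct)
  case (zero \<beta>)
  have "((\<lambda>s. modulate (s *\<^sub>R j) f t) has_vector_derivative modulate (s *\<^sub>R j) (\<lambda>t. \<i> * mult_coord j f t) t) (at s)"
    using has_derivative_mult_left[OF has_derivative_cis_inner[of "j \<bullet> t" s], of "f t"]
    unfolding modulate_def mult_coord_def has_vector_derivative_def
    by (simp add: inner_commute scaleR_conv_of_real ac_simps)
  with zero show ?case by (simp add: mi_deriv_zero)
next
  case (Suc \<beta> b)
  let ?d = "of_bool (b = j) * \<i>"
  note sm = smooth_cmult[OF smooth_mult_coord[OF Suc(3) j]] smooth_modulate_Basis[OF _ j] smooth_add smooth_cmult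
    smooth_partial_deriv[OF Suc(3,1)] Suc(3) smooth_mult_coord[OF _ j]
  have eq: "mi_deriv (\<beta>(b := Suc (\<beta> b))) (modulate (s *\<^sub>R j) h)
      = (\<lambda>t. mi_deriv \<beta> (modulate (s *\<^sub>R j) (partial_deriv b h)) t + of_real s * ?d * mi_deriv \<beta> (modulate (s *\<^sub>R j) h) t)"
    if h: "smooth h" for h s
  proof -
    have "mi_deriv (\<beta>(b := Suc (\<beta> b))) (modulate (s *\<^sub>R j) h) = mi_deriv \<beta> (partial_deriv b (modulate (s *\<^sub>R j) h))"
      by (rule mi_deriv_partial_deriv[symmetric]) (use h j Suc(1) smooth_modulate_Basis in auto)
    also have "partial_deriv b (modulate (s *\<^sub>R j) h)
        = (\<lambda>t. modulate (s *\<^sub>R j) (partial_deriv b h) t + (of_real s * ?d) * modulate (s *\<^sub>R j) h t)"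
      unfolding partial_deriv_modulate[OF h j Suc(1)] by (simp add: modulate_def algebra_simps)
    also have "mi_deriv \<beta> \<dots> = (\<lambda>t. mi_deriv \<beta> (modulate (s *\<^sub>R j) (partial_deriv b h)) t
        + (of_real s * ?d) * mi_deriv \<beta> (modulate (s *\<^sub>R j) h) t)"
      unfolding mi_deriv_add[OF smooth_modulate_Basis[OF smooth_partial_deriv[OF h Suc(1)] j] smooth_cmult[OF smooth_modulate_Basis[OF h j]]]
        mi_deriv_linear[OF bounded_linear_mult_right, OF smooth_modulate_Basis[OF h j]] ..
    finally show ?thesis .
  qed
  have pd: "partial_deriv b (\<lambda>t. \<i> * mult_coord j f t) = (\<lambda>t. ?d * f t + \<i> * mult_coord j (partial_deriv b f) t)"
    unfolding partial_deriv_linear[OF bounded_linear_mult_right, OF smooth_mult_coord[OF Suc(3) j]]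
      partial_deriv_mult_coord[OF Suc(3) j Suc(1)] by (simp add: algebra_simps)
  have "((\<lambda>s. mi_deriv \<beta> (modulate (s *\<^sub>R j) (partial_deriv b f)) t + of_real s * ?d * mi_deriv \<beta> (modulate (s *\<^sub>R j) f) t)
      has_vector_derivative
      mi_deriv \<beta> (modulate (s *\<^sub>R j) (\<lambda>t. \<i> * mult_coord j (partial_deriv b f) t)) t
      + (of_real s * ?d * mi_deriv \<beta> (modulate (s *\<^sub>R j) (\<lambda>t. \<i> * mult_coord j f t)) t + ?d * mi_deriv \<beta> (modulate (s *\<^sub>R j) f) t)) (at s)"
  proof (intro has_vector_derivative_add Suc.IH sm has_vector_derivative_mult)
    show "((\<lambda>s. of_real s * ?d) has_vector_derivative ?d) (at s)"
      by (auto intro!: derivative_eq_intros simp: has_vector_derivative_def scaleR_conv_of_real)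
  qed
  also have "mi_deriv \<beta> (modulate (s *\<^sub>R j) (\<lambda>t. \<i> * mult_coord j (partial_deriv b f) t)) t
      + (of_real s * ?d * mi_deriv \<beta> (modulate (s *\<^sub>R j) (\<lambda>t. \<i> * mult_coord j f t)) t + ?d * mi_deriv \<beta> (modulate (s *\<^sub>R j) f) t)
      = mi_deriv (\<beta>(b := Suc (\<beta> b))) (modulate (s *\<^sub>R j) (\<lambda>t. \<i> * mult_coord j f t)) t"
  proof -
    have "modulate (s *\<^sub>R j) (\<lambda>t. ?d * f t + \<i> * mult_coord j (partial_deriv b f) t)
       = (\<lambda>t. ?d * modulate (s *\<^sub>R j) f t + modulate (s *\<^sub>R j) (\<lambda>t. \<i> * mult_coord j (partial_deriv b f) t) t)"
      by (simp add: modulate_def algebra_simps)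
    moreover have "mi_deriv \<beta> \<dots> = (\<lambda>t. ?d * mi_deriv \<beta> (modulate (s *\<^sub>R j) f) t
        + mi_deriv \<beta> (modulate (s *\<^sub>R j) (\<lambda>t. \<i> * mult_coord j (partial_deriv b f) t)) t)"
      by (subst mi_deriv_add, intro sm, intro sm,
          subst mi_deriv_linear[OF bounded_linear_mult_right, OF smooth_modulate_Basis[OF Suc(3) j]]) simp
    ultimately show ?thesis
      unfolding eq[OF sm(1)] pd by (simp add: algebra_simps)
  qed
  finally show ?case unfolding eq[OF Suc(3)] .
qed

text \<open>Mean value inequality in \<open>s\<close>, applied to each monomial times derivative
  separately: a bound for \<open>U'\<close> on \<open>[-1, 1]\<close> becomes a Lipschitz bound for
  \<open>U\<close> at 0. The difference is written with a factor \<open>- 1\<close> to fit the rules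
  for sums and scalar multiples.\<close>

lemma gs_bound_flow:
  fixes U U' :: "real \<Rightarrow> 'a::euclidean_space \<Rightarrow> complex"
  assumes sm: "\<And>s. smooth (U s)"
    and der: "\<And>\<beta> t s. ((\<lambda>s. mi_deriv \<beta> (U s) t) has_vector_derivative mi_deriv \<beta> (U' s) t) (at s)"
    and bd: "\<And>s. \<bar>s\<bar> \<le> 1 \<Longrightarrow> gs_bound A B S (U' s)" and s: "\<bar>s\<bar> \<le> 1"
  shows "gs_bound A B (\<bar>s\<bar> * S) (\<lambda>t. U s t + (- 1) * U 0 t)"
proof (rule gs_boundI)
  show "smooth (\<lambda>t. U s t + (- 1) * U 0 t)" by (intro smooth_add smooth_cmult sm)
  fix x :: 'a and \<alpha> \<beta> :: "'a \<Rightarrow> nat"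
  let ?W = "S * A ^ mi_size \<alpha> * B ^ mi_size \<beta> * mi_fact \<alpha> * mi_fact \<beta>"
  let ?F = "\<lambda>s. \<bar>mi_power x \<alpha>\<bar> *\<^sub>R mi_deriv \<beta> (U s) x"
  have "norm (?F s - ?F 0) \<le> ?W * norm (s - 0)"
  proof (rule differentiable_bound[where S = "{-1..1}" and f' = "\<lambda>r t. t *\<^sub>R (\<bar>mi_power x \<alpha>\<bar> *\<^sub>R mi_deriv \<beta> (U' r) x)"])
    fix r :: real assume r: "r \<in> {-1..1}"
    show "(?F has_derivative (\<lambda>t. t *\<^sub>R (\<bar>mi_power x \<alpha>\<bar> *\<^sub>R mi_deriv \<beta> (U' r) x))) (at r within {-1..1})"
      using has_derivative_scaleR_right[OF der[of \<beta> x r, unfolded has_vector_derivative_def], of "\<bar>mi_power x \<alpha>\<bar>"]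
      by (simp add: has_derivative_at_withinI mult.commute)
    show "onorm (\<lambda>t. t *\<^sub>R (\<bar>mi_power x \<alpha>\<bar> *\<^sub>R mi_deriv \<beta> (U' r) x)) \<le> ?W"
    proof (rule onorm_le)
      fix t :: real
      show "norm (t *\<^sub>R (\<bar>mi_power x \<alpha>\<bar> *\<^sub>R mi_deriv \<beta> (U' r) x)) \<le> ?W * norm t"
        using mult_left_mono[OF gs_boundD[OF bd, of r x \<alpha> \<beta>], of "\<bar>t\<bar>"] r by (simp add: abs_mult abs_le_iff ac_simps)
    qed
  qed (use s in auto)
  moreover have "mi_deriv \<beta> (\<lambda>t. U s t + (- 1) * U 0 t) x = mi_deriv \<beta> (U s) x - mi_deriv \<beta> (U 0) x"
    using mi_deriv_add[OF sm smooth_cmult[OF sm], of \<beta> s "- 1" 0]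
      mi_deriv_linear[OF bounded_linear_mult_right, OF sm, of \<beta> "- 1" 0] by simp
  ultimately show "\<bar>mi_power x \<alpha>\<bar> * norm (mi_deriv \<beta> (\<lambda>t. U s t + (- 1) * U 0 t) x)
      \<le> \<bar>s\<bar> * S * A ^ mi_size \<alpha> * B ^ mi_size \<beta> * mi_fact \<alpha> * mi_fact \<beta>"
    by (simp add: scaleR_diff_right[symmetric] ac_simps)
qed

text \<open>Telescoping over coordinates:
  \<open>G (a + b) f - f = G a (G b f - f) + (G a f - f)\<close>, where \<open>a\<close> is the new
  coordinate and the induction hypothesis handles \<open>b\<close>. An abstract \<open>G\<close>
  covers translations and modulations at once.\<close>

lemma gs_bound_group:
  fixes G :: "'a::euclidean_space \<Rightarrow> ('a \<Rightarrow> complex) \<Rightarrow> 'a \<Rightarrow> complex"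
  assumes add: "\<And>x y f. G (x + y) f = G x (G y f)" and zero: "G 0 f = f"
    and lin: "\<And>x f h. G x (\<lambda>t. f t + (- 1) * h t) = (\<lambda>t. G x f t + (- 1) * G x h t)"
    and bd: "\<And>S f j s. gs_bound A B S f \<Longrightarrow> j \<in> Basis \<Longrightarrow> \<bar>s\<bar> \<le> 1 \<Longrightarrow> gs_bound A B (S * E) (G (s *\<^sub>R j) f)"
    and gen: "\<And>j. j \<in> Basis \<Longrightarrow> \<exists>C\<ge>0. \<forall>s. \<bar>s\<bar> \<le> 1 \<longrightarrow> gs_bound A B (\<bar>s\<bar> * C) (\<lambda>t. G (s *\<^sub>R j) f t + (- 1) * f t)"
    and E: "0 \<le> E" and AB: "0 < A" "0 < B"
  shows "finite J \<Longrightarrow> J \<subseteq> Basis \<Longrightarrow> \<exists>C\<ge>0. \<forall>x. norm x \<le> 1 \<longrightarrow>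
    gs_bound A B (norm x * C) (\<lambda>t. G (\<Sum>j\<in>J. (x \<bullet> j) *\<^sub>R j) f t + (- 1) * f t)"
proof (induction J rule: finite_induct)
  case empty
  have "gs_bound A B 0 (\<lambda>t. G (0 *\<^sub>R j) f t + (- 1) * f t)" if "j \<in> Basis" for j
    using gen[OF that] by (auto dest: spec[of _ 0])
  moreover obtain j :: 'a where "j \<in> Basis" using nonempty_Basis by blast
  ultimately show ?case by (intro exI[of _ 0]) (auto simp: zero)
next
  case (insert j J)
  then have j: "j \<in> Basis" by simp
  obtain C where C: "C \<ge> 0" and b1: "\<And>x. norm x \<le> 1 \<Longrightarrow>
    gs_bound A B (norm x * C) (\<lambda>t. G (\<Sum>j\<in>J. (x \<bullet> j) *\<^sub>R j) f t + (- 1) * f t)" using insert by auto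
  obtain D where D: "D \<ge> 0" and b2: "\<And>s. \<bar>s\<bar> \<le> 1 \<Longrightarrow> gs_bound A B (\<bar>s\<bar> * D) (\<lambda>t. G (s *\<^sub>R j) f t + (- 1) * f t)"
    using gen[OF j] by blast
  have "gs_bound A B (norm x * (C * E + D)) (\<lambda>t. G (\<Sum>j\<in>insert j J. (x \<bullet> j) *\<^sub>R j) f t + (- 1) * f t)"
    if x: "norm x \<le> 1" for x
  proof -
    have xj: "\<bar>x \<bullet> j\<bar> \<le> norm x" using Basis_le_norm[OF j] .
    have 1: "gs_bound A B (norm x * C * E) (G ((x \<bullet> j) *\<^sub>R j) (\<lambda>t. G (\<Sum>j\<in>J. (x \<bullet> j) *\<^sub>R j) f t + (- 1) * f t))"
      using xj x by (intro bd b1 j) auto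
    have 2: "gs_bound A B (norm x * D) (\<lambda>t. G ((x \<bullet> j) *\<^sub>R j) f t + (- 1) * f t)"
      using xj x D AB by (intro gs_bound_mono[OF b2[of "x \<bullet> j"]] mult_right_mono) auto
    show ?thesis
      using gs_bound_add[OF 1 2, unfolded lin] insert.hyps by (simp add: add algebra_simps)
  qed
  moreover have "0 \<le> C * E + D" using C D E by simp
  ultimately show ?case by blast
qed

lemma translate_small:
  assumes f: "f \<in> gelfand_shilov" and AB: "0 < A" "0 < B"
  shows "\<exists>C\<ge>0. \<forall>x. norm x \<le> 1 \<longrightarrow> gs_bound A B (norm x * C) (\<lambda>t. translate x f t + (- 1) * f t)"
proof -
  have bd: "gs_bound A B (S * exp (1 / A)) (translate (s *\<^sub>R j) h)"
    if "gs_bound A B S h" "j \<in> Basis" "\<bar>s\<bar> \<le> 1" for S h j s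
    using gs_bound_nonneg[OF that(1)] AB that(3)
    by (intro gs_bound_mono[OF gs_bound_translate_Basis[OF that(1) AB that(2)]] mult_left_mono) (auto simp: divide_right_mono)
  have "\<exists>C\<ge>0. \<forall>x. norm x \<le> 1 \<longrightarrow>
    gs_bound A B (norm x * C) (\<lambda>t. translate (\<Sum>j\<in>Basis. (x \<bullet> j) *\<^sub>R j) f t + (- 1) * f t)"
  proof (rule gs_bound_group[where E = "exp (1 / A)"])
    fix j :: 'a assume j: "j \<in> Basis"
    have "(\<lambda>t. - 1 * partial_deriv j f t) \<in> gelfand_shilov" by (intro gs_cmult gs_partial_deriv f j)
    then obtain S where S: "gs_bound A B S (\<lambda>t. - 1 * partial_deriv j f t)" using AB gelfand_shilovD by blast
    have "gs_bound A B (\<bar>s\<bar> * (S * exp (1 / A))) (\<lambda>t. translate (s *\<^sub>R j) f t + (- 1) * translate (0 *\<^sub>R j) f t)"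
      if "\<bar>s\<bar> \<le> 1" for s
      by (rule gs_bound_flow[of "\<lambda>s. translate (s *\<^sub>R j) f", OF smooth_translate translate_has_vector_derivative bd[OF S j] that])
         (auto intro: gelfand_shilov_smooth f j)
    then show "\<exists>C\<ge>0. \<forall>s. \<bar>s\<bar> \<le> 1 \<longrightarrow> gs_bound A B (\<bar>s\<bar> * C) (\<lambda>t. translate (s *\<^sub>R j) f t + (- 1) * f t)"
      using gs_bound_nonneg[OF S] by (intro exI[of _ "S * exp (1 / A)"]) (auto simp: translate_def)
  qed (use bd AB in \<open>auto simp: translate_add, auto simp: translate_def\<close>)
  then show ?thesis by (simp add: euclidean_representation)
qed

lemma modulate_small:
  assumes f: "f \<in> gelfand_shilov" and AB: "0 < A" "0 < B"
  shows "\<exists>C\<ge>0. \<forall>x. norm x \<le> 1 \<longrightarrow> gs_bound A B (norm x * C) (\<lambda>t. modulate x f t + (- 1) * f t)"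
proof -
  have bd: "gs_bound A B (S * exp (1 / B)) (modulate (s *\<^sub>R j) h)"
    if "gs_bound A B S h" "j \<in> Basis" "\<bar>s\<bar> \<le> 1" for S h j s
    using gs_bound_nonneg[OF that(1)] AB that(3)
    by (intro gs_bound_mono[OF gs_bound_modulate_Basis[OF that(1) AB that(2)]] mult_left_mono) (auto simp: divide_right_mono)
  have "\<exists>C\<ge>0. \<forall>x. norm x \<le> 1 \<longrightarrow>
    gs_bound A B (norm x * C) (\<lambda>t. modulate (\<Sum>j\<in>Basis. (x \<bullet> j) *\<^sub>R j) f t + (- 1) * f t)"
  proof (rule gs_bound_group[where E = "exp (1 / B)"])
    fix j :: 'a assume j: "j \<in> Basis"
    have "(\<lambda>t. \<i> * mult_coord j f t) \<in> gelfand_shilov" by (intro gs_cmult gs_mult_coord f j)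
    then obtain S where S: "gs_bound A B S (\<lambda>t. \<i> * mult_coord j f t)" using AB gelfand_shilovD by blast
    have "gs_bound A B (\<bar>s\<bar> * (S * exp (1 / B))) (\<lambda>t. modulate (s *\<^sub>R j) f t + (- 1) * modulate (0 *\<^sub>R j) f t)"
      if "\<bar>s\<bar> \<le> 1" for s
      by (rule gs_bound_flow[of "\<lambda>s. modulate (s *\<^sub>R j) f", OF smooth_modulate_Basis modulate_has_vector_derivative bd[OF S j] that])
         (auto intro: gelfand_shilov_smooth f j)
    then show "\<exists>C\<ge>0. \<forall>s. \<bar>s\<bar> \<le> 1 \<longrightarrow> gs_bound A B (\<bar>s\<bar> * C) (\<lambda>t. modulate (s *\<^sub>R j) f t + (- 1) * f t)"
      using gs_bound_nonneg[OF S] by (intro exI[of _ "S * exp (1 / B)"]) (auto simp: modulate_def)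
  qed (use bd AB in \<open>auto simp: modulate_add, auto simp: modulate_def algebra_simps\<close>)
  then show ?thesis by (simp add: euclidean_representation)
qed

text \<open>\<open>u\<close> is bounded by one seminorm, and in that seminorm the time-frequency
  shifts of \<open>f\<close> are Lipschitz near each point. This is what makes \<open>stft\<close>
  measurable for an arbitrary functional.\<close>

lemma continuous_gs_dual_tf_shift:
  fixes f :: "'a::euclidean_space \<Rightarrow> complex"
  assumes u: "u \<in> gs_dual" and f: "f \<in> gelfand_shilov"
  shows "continuous_on UNIV (\<lambda>z. u (tf_shift z f))"
proof (rule continuous_at_imp_continuous_on, rule ballI)
  fix z0 :: "'a \<times> 'a"
  obtain x0 \<xi>0 where z0: "z0 = (x0, \<xi>0)" by (cases z0)
  have uadd: "u (\<lambda>x. \<phi> x + \<psi> x) = u \<phi> + u \<psi>" if "\<phi> \<in> gelfand_shilov" "\<psi> \<in> gelfand_shilov" for \<phi> \<psi>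
    using u that unfolding gs_dual_def by blast
  have ucm: "u (\<lambda>x. a * \<phi> x) = a * u \<phi>" if "\<phi> \<in> gelfand_shilov" for \<phi> a
    using u that unfolding gs_dual_def by blast
  obtain A B K where AB: "A > 0" "B > 0" and uK: "\<And>\<phi>. \<phi> \<in> gelfand_shilov \<Longrightarrow> norm (u \<phi>) \<le> K * gs_seminorm A B \<phi>"
    using u unfolding gs_dual_def by blast
  let ?F = "translate x0 f" let ?\<xi> = "(2 * pi) *\<^sub>R \<xi>0"
  have F: "?F \<in> gelfand_shilov" by (intro gs_translate f)
  obtain C where C: "C \<ge> 0" and bC: "\<And>x. norm x \<le> 1 \<Longrightarrow> gs_bound A B (norm x * C) (\<lambda>t. translate x ?F t + (- 1) * ?F t)"
    using translate_small[OF F AB] by blast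
  obtain D where D: "D \<ge> 0" and bD: "\<And>x. norm x \<le> 1 \<Longrightarrow> gs_bound A B (norm x * D) (\<lambda>t. modulate x ?F t + (- 1) * ?F t)"
    using modulate_small[OF F AB] by blast
  define E where "E = exp (real DIM('a) / B)"
  define E0 where "E0 = exp ((\<Sum>j\<in>Basis. \<bar>?\<xi> \<bullet> j\<bar>) / B)"
  define L where "L = (C * E + 2 * pi * D) * E0"
  \<comment> \<open>The radius \<open>1 / (2 * pi)\<close> keeps both increments, \<open>x\<close>
    in position and \<open>\<eta>\<close> in frequency, within norm 1. Up to the common modulation
    by \<open>?\<xi>\<close>, the difference of the shifts is \<open>M (T F - F) + (M F - F)\<close>
    with \<open>T\<close> the translation by \<open>x\<close> and \<open>M\<close> the modulation by
    \<open>\<eta>\<close>.\<close>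
  have bd: "gs_bound A B (norm (z - z0) * L) (\<lambda>t. tf_shift z f t + (- 1) * tf_shift z0 f t)"
    if z: "norm (z - z0) < 1 / (2 * pi)" for z
  proof -
    define x \<eta> where "x = fst z - x0" and "\<eta> = (2 * pi) *\<^sub>R (snd z - \<xi>0)"
    have nx: "norm x \<le> norm (z - z0)" and n\<eta>: "norm \<eta> \<le> 2 * pi * norm (z - z0)"
      using norm_fst_le[of "fst z - x0" "snd z - \<xi>0"] norm_snd_le[of "snd z - \<xi>0" "fst z - x0"]
      by (auto simp: x_def \<eta>_def z0 minus_prod_def)
    have "1 / (2 * pi) \<le> 1" using pi_gt3 by (simp add: field_simps)
    then have nx1: "norm x \<le> 1" using nx z by linarith
    have n\<eta>1: "norm \<eta> \<le> 1" using n\<eta> z by (simp add: field_simps)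
    have "(\<Sum>j\<in>Basis. \<bar>\<eta> \<bullet> j\<bar>) \<le> (\<Sum>j\<in>(Basis::'a set). 1)"
      using n\<eta>1 by (intro sum_mono) (meson Basis_le_norm order.trans)
    then have e1: "exp ((\<Sum>j\<in>Basis. \<bar>\<eta> \<bullet> j\<bar>) / B) \<le> E"
      using AB by (simp add: E_def divide_right_mono)
    have "gs_bound A B (norm x * C * exp ((\<Sum>j\<in>Basis. \<bar>\<eta> \<bullet> j\<bar>) / B)) (modulate \<eta> (\<lambda>t. translate x ?F t + (- 1) * ?F t))"
      by (intro gs_bound_modulate bC nx1 AB)
    then have 1: "gs_bound A B (norm (z - z0) * C * E) (modulate \<eta> (\<lambda>t. translate x ?F t + (- 1) * ?F t))"
      by (rule gs_bound_mono) (use AB C e1 nx in \<open>auto intro!: mult_mono\<close>)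
    have 2: "gs_bound A B (2 * pi * norm (z - z0) * D) (\<lambda>t. modulate \<eta> ?F t + (- 1) * ?F t)"
      by (rule gs_bound_mono[OF bD[OF n\<eta>1]]) (use AB D n\<eta> in \<open>auto intro!: mult_right_mono\<close>)
    from gs_bound_modulate[OF gs_bound_add[OF 1 2] AB, of ?\<xi>]
    have "gs_bound A B (norm (z - z0) * L) (modulate ?\<xi> (\<lambda>t. modulate \<eta> (\<lambda>t. translate x ?F t + (- 1) * ?F t) t
        + (modulate \<eta> ?F t + (- 1) * ?F t)))"
      by (simp add: L_def E0_def algebra_simps)
    moreover have "tf_shift z f t + (- 1) * tf_shift z0 f t = modulate ?\<xi> (\<lambda>t. modulate \<eta> (\<lambda>t. translate x ?F t + (- 1) * ?F t) t
        + (modulate \<eta> ?F t + (- 1) * ?F t)) t" for t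
    proof -
      have "(2 * pi) *\<^sub>R snd z = ?\<xi> + \<eta>" "fst z = x + x0" by (auto simp: \<eta>_def x_def algebra_simps)
      then have "tf_shift z f = modulate ?\<xi> (modulate \<eta> (translate x ?F))"
        unfolding tf_shift_eq by (simp only: modulate_add translate_add)
      then show ?thesis unfolding z0 tf_shift_eq by (simp add: modulate_def algebra_simps)
    qed
    ultimately show ?thesis by simp
  qed
  have "norm (u (tf_shift z f) - u (tf_shift z0 f)) \<le> norm (z - z0) * (\<bar>K\<bar> * L)" if z: "norm (z - z0) < 1 / (2 * pi)" for z
  proof -
    have gs: "tf_shift z f \<in> gelfand_shilov" "tf_shift z0 f \<in> gelfand_shilov" by (intro gs_tf_shift f)+
    let ?d = "\<lambda>t. tf_shift z f t + (- 1) * tf_shift z0 f t"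
    have d: "?d \<in> gelfand_shilov" by (intro gs_add gs_cmult gs)
    have "u (tf_shift z f) - u (tf_shift z0 f) = u ?d"
      using uadd[OF gs(1) gs_cmult[OF gs(2), of "- 1"]] ucm[OF gs(2), of "- 1"] by simp
    also have "norm \<dots> \<le> K * gs_seminorm A B ?d" using d by (rule uK)
    also have "\<dots> \<le> \<bar>K\<bar> * gs_seminorm A B ?d"
      using gs_bound_nonneg[OF gs_bound_seminorm[OF AB d]] by (intro mult_right_mono) auto
    also have "\<dots> \<le> \<bar>K\<bar> * (norm (z - z0) * L)"
      by (intro mult_left_mono gs_seminorm_le AB bd z) auto
    finally show ?thesis by (simp add: ac_simps)
  qed
  then have "\<forall>\<^sub>F z in at z0. norm (u (tf_shift z f) - u (tf_shift z0 f)) \<le> norm (z - z0) * (\<bar>K\<bar> * L)"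
    unfolding eventually_at by (intro exI[of _ "1 / (2 * pi)"]) (auto simp: dist_norm)
  moreover have "((\<lambda>z. z - z0) \<longlongrightarrow> 0) (at z0)" by (auto intro!: tendsto_eq_intros)
  ultimately have "((\<lambda>z. u (tf_shift z f) - u (tf_shift z0 f)) \<longlongrightarrow> 0) (at z0)"
    by (rule tendsto_0_le[rotated])
  then show "isCont (\<lambda>z. u (tf_shift z f)) z0"
    unfolding isCont_def by (rule LIM_zero_cancel)
qed

section \<open>Integration on Euclidean space\<close>

lemma continuous_on_borel_measurable:
  "continuous_on UNIV f \<Longrightarrow> f \<in> borel_measurable borel"
  by (rule borel_measurable_continuous_onI)

lemma
  fixes f :: "'a::euclidean_space \<Rightarrow> 'b::{banach, second_countable_topology}"
  assumes [measurable]: "f \<in> borel_measurable borel" and c: "c \<noteq> 0"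
  shows lborel_integral_affine: "(LINT x|lborel. f x) = \<bar>c\<bar> ^ DIM('a) *\<^sub>R (LINT x|lborel. f (a + c *\<^sub>R x))"
    and lborel_integrable_affine: "integrable lborel (\<lambda>x. f (a + c *\<^sub>R x)) \<longleftrightarrow> integrable lborel f"
proof -
  let ?D = "density (distr lborel borel (\<lambda>x. a + c *\<^sub>R x)) (\<lambda>_. \<bar>c\<bar> ^ DIM('a))"
  have eq: "lborel = ?D" using c by (rule lborel_affine)
  have "(LINT x|?D. f x) = \<bar>c\<bar> ^ DIM('a) *\<^sub>R (LINT x|lborel. f (a + c *\<^sub>R x))"
    by (subst integral_density) (auto simp: integral_distr)
  then show "(LINT x|lborel. f x) = \<bar>c\<bar> ^ DIM('a) *\<^sub>R (LINT x|lborel. f (a + c *\<^sub>R x))"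
    using eq by simp
  have sc: "integrable lborel (\<lambda>x. k *\<^sub>R h x) \<longleftrightarrow> integrable lborel h" if "k \<noteq> 0" for k :: real and h :: "'a \<Rightarrow> 'b"
  proof
    assume "integrable lborel (\<lambda>x. k *\<^sub>R h x)"
    then have "integrable lborel (\<lambda>x. inverse k *\<^sub>R (k *\<^sub>R h x))" by (rule integrable_scaleR_right)
    with that show "integrable lborel h" by simp
  qed simp
  have "integrable ?D f \<longleftrightarrow> integrable lborel (\<lambda>x. f (a + c *\<^sub>R x))"
    using c by (subst integrable_density) (auto simp: integrable_distr_eq sc)
  then show "integrable lborel (\<lambda>x. f (a + c *\<^sub>R x)) \<longleftrightarrow> integrable lborel f"
    using eq by simp
qed

lemma
  fixes f :: "'a::euclidean_space \<Rightarrow> 'b::{banach, second_countable_topology}"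
  assumes "f \<in> borel_measurable borel"
  shows lborel_integral_shift: "(LINT x|lborel. f (x + a)) = (LINT x|lborel. f x)"
    and lborel_integrable_shift: "integrable lborel (\<lambda>x. f (x + a)) \<longleftrightarrow> integrable lborel f"
  using lborel_integral_affine[OF assms, of 1 a] lborel_integrable_affine[OF assms, of 1 a]
  by (simp_all add: add.commute)

lemma nn_integral_lborel_shift:
  fixes f :: "'a::euclidean_space \<Rightarrow> ennreal"
  assumes [measurable]: "f \<in> borel_measurable borel"
  shows "(\<integral>\<^sup>+x. f (x + a) \<partial>lborel) = (\<integral>\<^sup>+x. f x \<partial>lborel)"
  using lborel_distr_plus[of a] nn_integral_distr[of "(+) a" lborel borel f] by (simp add: add.commute)

lemma nn_integral_lborel_reflect:
  fixes f :: "'a::euclidean_space \<Rightarrow> ennreal"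
  assumes [measurable]: "f \<in> borel_measurable borel"
  shows "(\<integral>\<^sup>+x. f (a - x) \<partial>lborel) = (\<integral>\<^sup>+x. f x \<partial>lborel)"
proof -
  have "(\<integral>\<^sup>+x. f x \<partial>lborel) = (\<integral>\<^sup>+x. f x \<partial>density (distr lborel borel (\<lambda>x. a + (- 1) *\<^sub>R x)) (\<lambda>_. ennreal (\<bar>- 1\<bar> ^ DIM('a))))"
    using lborel_affine[of "- 1" a] by simp
  also have "\<dots> = (\<integral>\<^sup>+x. f (a - x) \<partial>lborel)"
    by (subst nn_integral_density) (auto simp: nn_integral_distr one_ennreal_def[symmetric])
  finally show ?thesis ..
qed

text \<open>\<open>lborel_eq\<close> presents \<open>lborel\<close> as the image of a product of
  one-dimensional measures, under which the integrand separates.\<close>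

lemma
  fixes f :: "'a::euclidean_space \<Rightarrow> real \<Rightarrow> complex"
  assumes f: "\<And>b. b \<in> Basis \<Longrightarrow> integrable lborel (f b)"
  shows integrable_lborel_prod: "integrable lborel (\<lambda>x. \<Prod>b\<in>Basis. f b (x \<bullet> b))"
    and integral_lborel_prod: "(LINT x|lborel. (\<Prod>b\<in>Basis. f b (x \<bullet> b))) = (\<Prod>b\<in>Basis. (LINT x|lborel. f b x))"
proof -
  interpret product_sigma_finite "\<lambda>_::'a. lborel :: real measure" ..
  have [measurable]: "f b \<in> borel_measurable borel" if "b \<in> Basis" for b
    using borel_measurable_integrable[OF f[OF that]] by simp
  let ?P = "\<Pi>\<^sub>M b\<in>(Basis::'a set). (lborel :: real measure)"
  have meas: "(\<lambda>x. \<Prod>b\<in>Basis. f b (x \<bullet> b)) \<in> borel_measurable borel" by measurable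
  have proj: "(\<Sum>b\<in>Basis. g b *\<^sub>R b) \<bullet> c = g c" if "c \<in> Basis" for g :: "'a \<Rightarrow> real" and c
    using that by (simp add: inner_sum_left inner_Basis sum.delta if_distrib[of "\<lambda>x. _ * x"] cong: if_cong)
  have eq: "(\<Prod>c\<in>Basis. f c ((\<Sum>b\<in>Basis. g b *\<^sub>R b) \<bullet> c)) = (\<Prod>c\<in>Basis. f c (g c))" for g
    by (intro prod.cong refl) (simp only: proj)
  have m2: "(\<lambda>g. \<Sum>b\<in>Basis. g b *\<^sub>R b) \<in> measurable ?P borel" by measurable
  show "integrable lborel (\<lambda>x. \<Prod>b\<in>Basis. f b (x \<bullet> b))"
    unfolding lborel_eq[where 'a='a] integrable_distr_eq[OF m2 meas] eq
    by (rule product_integrable_prod) (auto intro: f)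
  show "(LINT x|lborel. (\<Prod>b\<in>Basis. f b (x \<bullet> b))) = (\<Prod>b\<in>Basis. (LINT x|lborel. f b x))"
    unfolding lborel_eq[where 'a='a] integral_distr[OF m2 meas] eq
    by (rule product_integral_prod) (auto intro: f)
qed

text \<open>A product of unnormalised Cauchy densities: integrable, bounded by 1, multiplicative on
  product spaces by \<open>rho_prod\<close>, and subject to the Peetre-type inequality
  \<open>rho_shift_le\<close>. It is the standard integrable majorant below.\<close>

definition rho :: "'a::euclidean_space \<Rightarrow> real"
  where "rho x = (\<Prod>b\<in>Basis. 1 / (1 + (x \<bullet> b)\<^sup>2))"

lemma one_plus_square_pos [simp]: "0 < 1 + (r::real)\<^sup>2" "1 + (r::real)\<^sup>2 \<noteq> 0"
  by (smt (verit) zero_le_power2)+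

lemma rho_pos: "0 < rho x"
  unfolding rho_def by (intro prod_pos) auto

lemma rho_nonneg: "0 \<le> rho x"
  using rho_pos[of x] by simp

lemma rho_le_1: "rho x \<le> 1"
  unfolding rho_def by (intro prod_le_1) (auto simp: divide_le_eq)

lemma rho_minus: "rho (- x) = rho x"
  by (simp add: rho_def)

lemma continuous_rho: "continuous_on UNIV rho"
  unfolding rho_def by (intro continuous_intros) (auto simp: add_nonneg_eq_0_iff)

lemma rho_measurable [measurable]: "rho \<in> borel_measurable borel"
  by (rule continuous_on_borel_measurable[OF continuous_rho])

lemma integrable_rho: "integrable lborel rho"
proof -
  have "integrable lborel (\<lambda>x. inverse (1 + x\<^sup>2) :: real)"
    using integrable_inverse_1_plus_square by (simp add: set_integrable_def)
  then have "integrable lborel (\<lambda>x. complex_of_real (inverse (1 + x\<^sup>2)))" by (rule integrable_of_real)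
  then have "integrable lborel (\<lambda>x::'a. norm (\<Prod>b\<in>Basis. complex_of_real (inverse (1 + (x \<bullet> b)\<^sup>2))))"
    by (intro integrable_norm integrable_lborel_prod)
  moreover have "norm (\<Prod>b\<in>Basis. complex_of_real (inverse (1 + (x \<bullet> b)\<^sup>2))) = rho x" for x :: 'a
    unfolding prod_norm[symmetric] norm_of_real rho_def
    by (intro prod.cong refl) (auto intro!: abs_of_nonneg simp: inverse_eq_divide)
  ultimately show ?thesis by simp
qed

lemma integrable_lborel_pairI:
  fixes f :: "'a::euclidean_space \<times> 'b::euclidean_space \<Rightarrow> 'c::{banach, second_countable_topology}"
  assumes f: "f \<in> borel_measurable borel"
    and h: "integrable lborel h" "\<And>x. 0 \<le> h x" and k: "integrable lborel k" "\<And>x. 0 \<le> k x"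
    and bd: "\<And>x y. norm (f (x, y)) \<le> h x * k y"
  shows "integrable lborel f"
proof -
  have [measurable]: "h \<in> borel_measurable borel" "k \<in> borel_measurable borel"
    using borel_measurable_integrable[OF h(1)] borel_measurable_integrable[OF k(1)] by auto
  have "integrable (lborel \<Otimes>\<^sub>M lborel) (\<lambda>(x, y). h x * k y)"
  proof (rule lborel_pair.Fubini_integrable)
    show "integrable lborel (\<lambda>x. LINT y|lborel. norm (case (x, y) of (x, y) \<Rightarrow> h x * k y))"
      using h k by simp
  qed (use k in auto)
  then have "integrable lborel (\<lambda>(x, y). h x * k y)" unfolding lborel_prod .
  then show ?thesis
    by (rule Bochner_Integration.integrable_bound)
       (use f bd h k in \<open>auto intro!: AE_I2 order.trans[OF bd]\<close>)
qed

lemma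
  fixes f :: "'a::euclidean_space \<times> 'b::euclidean_space \<Rightarrow> 'c::{banach, second_countable_topology}"
  assumes "integrable lborel f"
  shows lborel_integral_fst: "(LINT x|lborel. LINT y|lborel. f (x, y)) = (LINT z|lborel. f z)"
    and lborel_integral_snd: "(LINT y|lborel. LINT x|lborel. f (x, y)) = (LINT z|lborel. f z)"
proof -
  have *: "integrable (lborel \<Otimes>\<^sub>M lborel) f" using assms unfolding lborel_prod .
  from lborel_pair.integral_fst'[OF this] show "(LINT x|lborel. LINT y|lborel. f (x, y)) = (LINT z|lborel. f z)"
    unfolding lborel_prod .
  from lborel_pair.integral_snd[of "curry f"] * show "(LINT y|lborel. LINT x|lborel. f (x, y)) = (LINT z|lborel. f z)"
    unfolding lborel_prod by simp
qed

text \<open>Integrate \<open>f (x + b) - f x = \<integral>\<^sub>0\<^sup>1 g (x + \<tau> b) d\<tau>\<close> over \<open>x\<close>.\<close>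

lemma integral_directional_derivative:
  fixes f g :: "'a::euclidean_space \<Rightarrow> complex"
  assumes der: "\<And>x s. ((\<lambda>s. f (x + s *\<^sub>R b)) has_vector_derivative g (x + s *\<^sub>R b)) (at s)"
    and f: "integrable lborel f" and g: "integrable lborel g" and gc: "\<And>x. continuous_on UNIV (\<lambda>s. g (x + s *\<^sub>R b))"
  shows "(LINT x|lborel. g x) = 0"
proof -
  have [measurable]: "f \<in> borel_measurable borel" "g \<in> borel_measurable borel"
    using borel_measurable_integrable[OF f] borel_measurable_integrable[OF g] by auto
  have ftc: "(LINT s|lborel. indicator {0..1} s *\<^sub>R g (x + s *\<^sub>R b)) = f (x + b) - f x" for x
  proof -
    have "continuous_on {0..1} (\<lambda>s. g (x + s *\<^sub>R b))"
      using gc continuous_on_subset by blast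
    from integral_FTC_Icc[OF zero_le_one has_vector_derivative_at_within[OF der] this] show ?thesis by simp
  qed
  have int: "integrable (lborel \<Otimes>\<^sub>M lborel) (\<lambda>(s::real, x). indicator {0..1} s *\<^sub>R g (x + s *\<^sub>R b))"
  proof (rule lborel_pair.Fubini_integrable)
    have "(LINT y|lborel. norm (case (s, y) of (s::real, x) \<Rightarrow> indicator {0..1} s *\<^sub>R g (x + s *\<^sub>R b)))
        = indicator {0..1} s *\<^sub>R (LINT y|lborel. norm (g y))" for s
      using lborel_integral_shift[of "\<lambda>x. norm (g x)" "s *\<^sub>R b"] by (simp add: abs_indicator)
    moreover have "integrable lborel (\<lambda>s. indicator {0..1::real} s *\<^sub>R (LINT y|lborel. norm (g y)))"
      by (intro integrable_scaleR_left) auto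
    ultimately show "integrable lborel (\<lambda>x. LINT y|lborel. norm (case (x, y) of (s::real, x) \<Rightarrow> indicator {0..1} s *\<^sub>R g (x + s *\<^sub>R b)))"
      by (simp only:)
    show "AE x in lborel. integrable lborel (\<lambda>y. case (x, y) of (s::real, x) \<Rightarrow> indicator {0..1} s *\<^sub>R g (x + s *\<^sub>R b))"
      using g lborel_integrable_shift[of g] by auto
  qed measurable
  have "(LINT x|lborel. g x) = (LINT s|lborel. indicator {0..1::real} s *\<^sub>R (LINT x|lborel. g x))"
    by simp
  also have "\<dots> = (LINT s|lborel. LINT x|lborel. indicator {0..1::real} s *\<^sub>R g (x + s *\<^sub>R b))"
    using lborel_integral_shift[of g] by simp
  also have "\<dots> = (LINT x|lborel. LINT s|lborel. indicator {0..1::real} s *\<^sub>R g (x + s *\<^sub>R b))"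
    by (rule lborel_pair.Fubini_integral[symmetric]) (rule int)
  also have "\<dots> = (LINT x|lborel. f (x + b)) - (LINT x|lborel. f x)"
    unfolding ftc using f lborel_integrable_shift[of f b] by (intro Bochner_Integration.integral_diff) auto
  also have "\<dots> = 0" using lborel_integral_shift[of f b] by simp
  finally show ?thesis .
qed

section \<open>Differentiation under the integral sign\<close>

lemma has_vector_derivative_iff_quotient:
  fixes f :: "real \<Rightarrow> 'a::real_normed_vector"
  shows "(f has_vector_derivative D) (at s) \<longleftrightarrow> ((\<lambda>h. (f (s + h) - f s) /\<^sub>R h) \<longlongrightarrow> D) (at 0)"
proof -
  have eq: "norm (f (s + h) - f s - h *\<^sub>R D) / norm h = norm ((f (s + h) - f s) /\<^sub>R h - D)" if "h \<noteq> 0" for h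
  proof -
    have "(f (s + h) - f s) /\<^sub>R h - D = (f (s + h) - f s - h *\<^sub>R D) /\<^sub>R h"
      using that by (simp add: scaleR_diff_right)
    then show ?thesis by (simp add: divide_inverse mult.commute)
  qed
  have "(f has_vector_derivative D) (at s) \<longleftrightarrow> ((\<lambda>h. norm (f (s + h) - f s - h *\<^sub>R D) / norm h) \<longlongrightarrow> 0) (at 0)"
    unfolding has_vector_derivative_def has_derivative_at by (simp add: bounded_linear_scaleR_left)
  also have "\<dots> \<longleftrightarrow> ((\<lambda>h. norm ((f (s + h) - f s) /\<^sub>R h - D)) \<longlongrightarrow> 0) (at 0)"
    by (rule LIM_cong) (use eq in auto)
  also have "\<dots> \<longleftrightarrow> ((\<lambda>h. (f (s + h) - f s) /\<^sub>R h) \<longlongrightarrow> D) (at 0)"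
    unfolding tendsto_norm_zero_iff LIM_zero_iff ..
  finally show ?thesis .
qed

text \<open>The majorant \<open>G\<close> of \<open>f'\<close> is uniform in \<open>s\<close>, so by
  the mean value inequality it also dominates every difference quotient, and dominated convergence
  applies along each sequence tending to 0.\<close>

lemma has_vector_derivative_integral:
  fixes f f' :: "real \<Rightarrow> 'a::euclidean_space \<Rightarrow> complex"
  assumes der: "\<And>s t. ((\<lambda>s. f s t) has_vector_derivative f' s t) (at s)"
    and bd: "\<And>s t. norm (f' s t) \<le> G t" and G: "integrable lborel G"
    and f: "\<And>s. integrable lborel (f s)" and f': "\<And>s. f' s \<in> borel_measurable borel"
  shows "((\<lambda>s. LINT t|lborel. f s t) has_vector_derivative (LINT t|lborel. f' s t)) (at s)"
proof -
  note [measurable] = f'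
  have [measurable]: "f s \<in> borel_measurable borel" for s
    using borel_measurable_integrable[OF f[of s]] by auto
  let ?q = "\<lambda>h t. (f (s + h) t - f s t) /\<^sub>R h"
  have qlim: "((\<lambda>h. ?q h t) \<longlongrightarrow> f' s t) (at 0)" for t
    using der[of t s] unfolding has_vector_derivative_iff_quotient .
  have qbd: "norm (?q h t) \<le> G t" for h t
  proof -
    have "norm (f (s + h) t - f s t) \<le> G t * norm (s + h - s)"
    proof (rule differentiable_bound[where S = UNIV and f' = "\<lambda>s r. r *\<^sub>R f' s t"])
      show "onorm (\<lambda>r. r *\<^sub>R f' x t) \<le> G t" for x
      proof (rule onorm_le)
        fix r :: real
        show "norm (r *\<^sub>R f' x t) \<le> G t * norm r"
          using mult_left_mono[OF bd[of x t], of "\<bar>r\<bar>"] by (simp add: mult.commute)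
      qed
    qed (use der in \<open>auto simp: has_vector_derivative_def\<close>)
    moreover have "0 \<le> G t" using bd norm_ge_zero order.trans by blast
    ultimately show ?thesis by (cases "h = 0") (auto simp: divide_inverse[symmetric] pos_divide_le_eq mult.commute[of "inverse _"] add.commute)
  qed
  have "((\<lambda>h. LINT t|lborel. ?q h t) \<longlongrightarrow> (LINT t|lborel. f' s t)) (at 0)"
    unfolding LIMSEQ_SEQ_conv[symmetric]
  proof (intro allI impI)
    fix S :: "nat \<Rightarrow> real" assume S: "(\<forall>n. S n \<noteq> 0) \<and> S \<longlonglongrightarrow> 0"
    show "(\<lambda>n. LINT t|lborel. ?q (S n) t) \<longlonglongrightarrow> (LINT t|lborel. f' s t)"
    proof (rule integral_dominated_convergence[where w = G])
      show "AE t in lborel. (\<lambda>n. ?q (S n) t) \<longlonglongrightarrow> f' s t"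
        using qlim S unfolding LIMSEQ_SEQ_conv[symmetric] by auto
    qed (use G qbd in auto)
  qed
  moreover have "(LINT t|lborel. ?q h t) = ((LINT t|lborel. f (s + h) t) - (LINT t|lborel. f s t)) /\<^sub>R h" for h
    using f by (simp add: Bochner_Integration.integral_diff)
  ultimately show ?thesis unfolding has_vector_derivative_iff_quotient by (simp only:)
qed

section \<open>Parseval's identity\<close>

text \<open>A rescaled form of the characteristic function of the standard normal
  distribution.\<close>

lemma integral_cis_gauss_real:
  "integrable lborel (\<lambda>x. cis (x * t) * complex_of_real (exp (- x\<^sup>2 / 2)))"
  "(LINT x|lborel. cis (x * t) * complex_of_real (exp (- x\<^sup>2 / 2))) = complex_of_real (sqrt (2 * pi) * exp (- t\<^sup>2 / 2))"
proof -
  have g: "integrable lborel (\<lambda>x. std_normal_density x)" by (rule integrable_normal_density) simp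
  have "integrable lborel (\<lambda>x. sqrt (2 * pi) * std_normal_density x)" using g by simp
  then have "integrable lborel (\<lambda>x::real. exp (- x\<^sup>2 / 2))" by (simp add: std_normal_density_def)
  from integrable_of_real[OF this, where 'a=complex]
  show "integrable lborel (\<lambda>x. cis (x * t) * complex_of_real (exp (- x\<^sup>2 / 2)))"
    by (rule Bochner_Integration.integrable_bound) (auto simp: norm_mult cis_conv_exp intro!: borel_measurable_continuous_onI continuous_intros)
  have "complex_of_real (exp (- t\<^sup>2 / 2)) = (CLINT x|std_normal_distribution. iexp (t * x))"
    using char_std_normal_distribution by (simp add: char_def fun_eq_iff)
  also have "\<dots> = (LINT x|lborel. std_normal_density x *\<^sub>R iexp (t * x))"
    by (rule integral_density) (auto simp: normal_density_nonneg)
  also have "\<dots> = (LINT x|lborel. (1 / sqrt (2 * pi)) *\<^sub>R (cis (x * t) * complex_of_real (exp (- x\<^sup>2 / 2))))"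
    by (simp add: std_normal_density_def cis_conv_exp scaleR_conv_of_real ac_simps)
  finally have "complex_of_real (exp (- t\<^sup>2 / 2))
      = (1 / sqrt (2 * pi)) *\<^sub>R (LINT x|lborel. cis (x * t) * complex_of_real (exp (- x\<^sup>2 / 2)))" by simp
  then have "complex_of_real (sqrt (2 * pi)) * complex_of_real (exp (- t\<^sup>2 / 2))
      = complex_of_real (sqrt (2 * pi)) * ((1 / sqrt (2 * pi)) *\<^sub>R (LINT x|lborel. cis (x * t) * complex_of_real (exp (- x\<^sup>2 / 2))))"
    by simp
  then show "(LINT x|lborel. cis (x * t) * complex_of_real (exp (- x\<^sup>2 / 2))) = complex_of_real (sqrt (2 * pi) * exp (- t\<^sup>2 / 2))"
    by (simp add: scaleR_conv_of_real)
qed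

lemma cis_sum: "finite A \<Longrightarrow> cis (sum f A) = (\<Prod>x\<in>A. cis (f x))"
  by (induction A rule: finite_induct) (auto simp: cis_mult[symmetric])

definition gauss :: "'a::euclidean_space \<Rightarrow> real" where "gauss x = exp (- (x \<bullet> x) / 2)"

lemma continuous_gauss: "continuous_on UNIV gauss"
  unfolding gauss_def[abs_def] by (intro continuous_intros) auto

lemma gauss_measurable [measurable]: "gauss \<in> borel_measurable borel"
  by (rule continuous_on_borel_measurable[OF continuous_gauss])

lemma gauss_nonneg [simp]: "0 \<le> gauss x" by (simp add: gauss_def)

lemma gauss_bounds: "0 < gauss x" "gauss x \<le> 1" by (auto simp: gauss_def)

lemma
  fixes t :: "'a::euclidean_space"
  shows integrable_cis_gauss: "integrable lborel (\<lambda>x. cis (x \<bullet> t) * complex_of_real (gauss x))"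
    and integral_cis_gauss: "(LINT x|lborel. cis (x \<bullet> t) * complex_of_real (gauss x))
      = complex_of_real (sqrt (2 * pi) ^ DIM('a) * gauss t)"
proof -
  have g: "gauss x = (\<Prod>b\<in>Basis. exp (- (x \<bullet> b)\<^sup>2 / 2))" for x :: 'a
    unfolding gauss_def
    by (simp add: exp_sum[symmetric] euclidean_inner[of x x] power2_eq_square sum_negf sum_divide_distrib)
  have eq: "cis (x \<bullet> t) * complex_of_real (gauss x) = (\<Prod>b\<in>Basis. cis ((x \<bullet> b) * (t \<bullet> b)) * complex_of_real (exp (- (x \<bullet> b)\<^sup>2 / 2)))" for x
    unfolding g by (simp add: euclidean_inner[of x t] cis_sum prod.distrib)
  show "integrable lborel (\<lambda>x. cis (x \<bullet> t) * complex_of_real (gauss x))"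
    unfolding eq by (rule integrable_lborel_prod) (rule integral_cis_gauss_real)
  have "(LINT x|lborel. cis (x \<bullet> t) * complex_of_real (gauss x))
      = (\<Prod>b\<in>Basis. complex_of_real (sqrt (2 * pi) * exp (- (t \<bullet> b)\<^sup>2 / 2)))"
    unfolding eq by (subst integral_lborel_prod[OF integral_cis_gauss_real(1)]) (simp only: integral_cis_gauss_real(2))
  then show "(LINT x|lborel. cis (x \<bullet> t) * complex_of_real (gauss x)) = complex_of_real (sqrt (2 * pi) ^ DIM('a) * gauss t)"
    by (simp add: g prod.distrib del: of_real_mult flip: of_real_prod) 
qed

lemma integrable_gauss: "integrable lborel (gauss :: 'a::euclidean_space \<Rightarrow> real)"
  using integrable_norm[OF integrable_cis_gauss[of "0 :: 'a"]] by (simp add: norm_mult abs_of_pos gauss_bounds)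

lemma integral_gauss: "(LINT x|lborel. gauss (x :: 'a::euclidean_space)) = sqrt (2 * pi) ^ DIM('a)"
proof -
  have "complex_of_real (LINT x|lborel. gauss (x :: 'a)) = complex_of_real (sqrt (2 * pi) ^ DIM('a))"
    using integral_cis_gauss[of "0 :: 'a"] by (simp add: gauss_def del: of_real_power)
  then show ?thesis by (simp only: of_real_eq_iff)
qed


definition fourier :: "('a::euclidean_space \<Rightarrow> complex) \<Rightarrow> 'a \<Rightarrow> complex"
  where "fourier F \<xi> = (LINT t|lborel. F t * cis (- (2 * pi * (\<xi> \<bullet> t))))"

lemma cis_measurable [measurable]: "cis \<in> borel_measurable borel"
  by (rule continuous_on_borel_measurable) (simp add: cis_conv_exp continuous_intros)

lemma cnj_measurable [measurable]: "cnj \<in> borel_measurable borel"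
  by (rule continuous_on_borel_measurable) (intro continuous_intros)

lemma fourier_measurable [measurable]:
  assumes [measurable]: "F \<in> borel_measurable borel"
  shows "fourier F \<in> borel_measurable borel"
  unfolding fourier_def[abs_def] by measurable

lemma norm_fourier_le: "norm (fourier F \<xi>) \<le> (LINT t|lborel. norm (F t))"
  unfolding fourier_def by (rule order.trans[OF integral_norm_bound]) (simp add: norm_mult)

text \<open>\<open>fourier F\<close> need not be integrable, hence the Gaussian factor: it makes the
  double integral absolutely convergent, and integrating over \<open>\<xi>\<close> first yields a
  Gaussian of width \<open>e\<close> around \<open>t\<close>. The result averages \<open>F\<close>
  near \<open>t\<close> against the standard normal density.\<close>

lemma fourier_gauss_inverse:
  fixes F :: "'a::euclidean_space \<Rightarrow> complex"
  assumes F: "integrable lborel F" and e: "0 < e"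
  shows "(LINT \<xi>|lborel. of_real (gauss ((2 * pi * e) *\<^sub>R \<xi>)) * fourier F \<xi> * cis (2 * pi * (\<xi> \<bullet> t)))
    = (LINT y|lborel. F (t + e *\<^sub>R y) * of_real (gauss y / sqrt (2 * pi) ^ DIM('a)))"
proof -
  have [measurable]: "F \<in> borel_measurable borel" using borel_measurable_integrable[OF F] by simp
  let ?c = "2 * pi * e" let ?d = "DIM('a)"
  have c: "?c \<noteq> 0" "?c > 0" using e by auto
  have gi: "integrable lborel (\<lambda>\<xi>::'a. gauss (?c *\<^sub>R \<xi>))"
    using lborel_integrable_affine[OF gauss_measurable[where 'a='a], of ?c 0] c integrable_gauss[where 'a='a] by simp
  \<comment> \<open>The scale \<open>2 * pi * e\<close> compensates the \<open>2 * pi\<close> in the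
    exponent, so that the transform is again a \<open>gauss\<close>, now of width
    \<open>e\<close>.\<close>
  have G: "(LINT \<xi>|lborel. of_real (gauss (?c *\<^sub>R \<xi>)) * cis (2 * pi * (\<xi> \<bullet> r)))
      = of_real (sqrt (2 * pi) ^ ?d * gauss ((1 / e) *\<^sub>R r) / ?c ^ ?d)" for r :: 'a
  proof -
    have "of_real (sqrt (2 * pi) ^ ?d * gauss ((1 / e) *\<^sub>R r))
        = (LINT x|lborel. cis (x \<bullet> ((1 / e) *\<^sub>R r)) * complex_of_real (gauss x))"
      by (rule integral_cis_gauss[symmetric])
    also have "\<dots> = \<bar>?c\<bar> ^ ?d *\<^sub>R (LINT x|lborel. cis ((0 + ?c *\<^sub>R x) \<bullet> ((1 / e) *\<^sub>R r)) * complex_of_real (gauss (0 + ?c *\<^sub>R x)))"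
      by (rule lborel_integral_affine) (use c in auto)
    also have "\<dots> = ?c ^ ?d *\<^sub>R (LINT \<xi>|lborel. of_real (gauss (?c *\<^sub>R \<xi>)) * cis (2 * pi * (\<xi> \<bullet> r)))"
      using e by (simp add: mult.commute)
    finally show ?thesis using c by (simp add: scaleR_conv_of_real field_simps)
  qed
  let ?f = "\<lambda>(\<xi>, s). of_real (gauss (?c *\<^sub>R \<xi>)) * F s * cis (2 * pi * (\<xi> \<bullet> (t - s)))"
  have int: "integrable lborel ?f"
  proof (rule integrable_lborel_pairI[where h = "\<lambda>\<xi>. gauss (?c *\<^sub>R \<xi>)" and k = "\<lambda>s. norm (F s)"])
    show "?f \<in> borel_measurable borel" unfolding borel_prod[symmetric] by measurable
  qed (use gi F in \<open>auto simp: norm_mult\<close>)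
  have "(LINT \<xi>|lborel. of_real (gauss (?c *\<^sub>R \<xi>)) * fourier F \<xi> * cis (2 * pi * (\<xi> \<bullet> t)))
      = (LINT \<xi>|lborel. LINT s|lborel. ?f (\<xi>, s))"
  proof (intro Bochner_Integration.integral_cong refl)
    fix \<xi> :: 'a
    have "of_real (gauss (?c *\<^sub>R \<xi>)) * fourier F \<xi> * cis (2 * pi * (\<xi> \<bullet> t))
        = (of_real (gauss (?c *\<^sub>R \<xi>)) * cis (2 * pi * (\<xi> \<bullet> t))) * fourier F \<xi>"
      by (simp only: ac_simps)
    also have "\<dots> = (LINT s|lborel. (of_real (gauss (?c *\<^sub>R \<xi>)) * cis (2 * pi * (\<xi> \<bullet> t))) * (F s * cis (- (2 * pi * (\<xi> \<bullet> s)))))"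
      unfolding fourier_def by (simp only: integral_mult_right_zero)
    also have "\<dots> = (LINT s|lborel. ?f (\<xi>, s))"
      by (intro Bochner_Integration.integral_cong refl)
         (simp add: cis_divide[symmetric] inner_diff_right right_diff_distrib cis_cnj[symmetric] divide_inverse)
    finally show "of_real (gauss (?c *\<^sub>R \<xi>)) * fourier F \<xi> * cis (2 * pi * (\<xi> \<bullet> t)) = (LINT s|lborel. ?f (\<xi>, s))" .
  qed
  also have "\<dots> = (LINT s|lborel. LINT \<xi>|lborel. ?f (\<xi>, s))"
    using lborel_integral_fst[OF int] lborel_integral_snd[OF int] by simp
  also have "\<dots> = (LINT s|lborel. F s * of_real (sqrt (2 * pi) ^ ?d * gauss ((1 / e) *\<^sub>R (t - s)) / ?c ^ ?d))"
  proof (intro Bochner_Integration.integral_cong refl)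
    fix s
    have "(LINT \<xi>|lborel. ?f (\<xi>, s)) = (LINT \<xi>|lborel. F s * (of_real (gauss (?c *\<^sub>R \<xi>)) * cis (2 * pi * (\<xi> \<bullet> (t - s)))))"
      by (simp add: ac_simps)
    also have "\<dots> = F s * (LINT \<xi>|lborel. of_real (gauss (?c *\<^sub>R \<xi>)) * cis (2 * pi * (\<xi> \<bullet> (t - s))))"
      by simp
    finally show "(LINT \<xi>|lborel. ?f (\<xi>, s)) = F s * of_real (sqrt (2 * pi) ^ ?d * gauss ((1 / e) *\<^sub>R (t - s)) / ?c ^ ?d)"
      unfolding G .
  qed
  also have "\<dots> = \<bar>e\<bar> ^ ?d *\<^sub>R (LINT y|lborel. F (t + e *\<^sub>R y) * of_real (sqrt (2 * pi) ^ ?d * gauss ((1 / e) *\<^sub>R (t - (t + e *\<^sub>R y))) / ?c ^ ?d))"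
    by (rule lborel_integral_affine) (use e in auto)
  also have "\<dots> = (LINT y|lborel. F (t + e *\<^sub>R y) * of_real (gauss y / sqrt (2 * pi) ^ ?d))"
  proof -
    have "sqrt (2 * pi) * sqrt (2 * pi) = 2 * pi" by simp
    then have p: "(2 * pi) ^ ?d = sqrt (2 * pi) ^ ?d * sqrt (2 * pi) ^ ?d" by (metis power_mult_distrib)
    have "e ^ ?d * (sqrt (2 * pi) ^ ?d * gauss ((1 / e) *\<^sub>R (t - (t + e *\<^sub>R y))) / ?c ^ ?d) = gauss y / sqrt (2 * pi) ^ ?d" for y
      using e unfolding power_mult_distrib[of "2 * pi" e] p by (simp add: gauss_def)
    note q = this
    have "F (t + e *\<^sub>R y) * of_real (gauss y / sqrt (2 * pi) ^ ?d)
      = (e ^ ?d) *\<^sub>R (F (t + e *\<^sub>R y) * of_real (sqrt (2 * pi) ^ ?d * gauss ((1 / e) *\<^sub>R (t - (t + e *\<^sub>R y))) / ?c ^ ?d))" for y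
      unfolding q[of y, symmetric] by (simp only: scaleR_conv_of_real of_real_mult[of "e ^ ?d"] mult.left_commute)
    then show ?thesis using e by simp
  qed
  finally show ?thesis .
qed

text \<open>Gaussian regularisation replaces \<open>L2\<close> theory. As the width
  \<open>1 / Suc n\<close> tends to 0, the left side converges because the product of the transforms
  is integrable; the right side converges because \<open>F\<close> is bounded and continuous, so its
  Gaussian averages converge pointwise and boundedly.\<close>

lemma parseval:
  fixes F K :: "'a::euclidean_space \<Rightarrow> complex"
  assumes F: "integrable lborel F" "continuous_on UNIV F" "\<And>t. norm (F t) \<le> M"
    and K: "integrable lborel K" and FK: "integrable lborel (\<lambda>\<xi>. fourier F \<xi> * cnj (fourier K \<xi>))"
  shows "(LINT \<xi>|lborel. fourier F \<xi> * cnj (fourier K \<xi>)) = (LINT t|lborel. F t * cnj (K t))"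
proof -
  have [measurable]: "F \<in> borel_measurable borel" "K \<in> borel_measurable borel"
    using borel_measurable_integrable[OF F(1)] borel_measurable_integrable[OF K] by auto
  let ?e = "\<lambda>n. 1 / real (Suc n)"
  let ?N = "sqrt (2 * pi) ^ DIM('a)"
  let ?g = "\<lambda>n \<xi>. gauss ((2 * pi * ?e n) *\<^sub>R \<xi>)"
  let ?J = "\<lambda>n t. LINT y|lborel. F (t + ?e n *\<^sub>R y) * of_real (gauss y / ?N)"
  have N: "?N > 0" by simp
  have M: "M \<ge> 0" using F(3) norm_ge_zero order.trans by blast
  have e0: "?e \<longlonglongrightarrow> 0" using LIMSEQ_inverse_real_of_nat by (simp add: inverse_eq_divide)
  have gN: "integrable lborel (\<lambda>y::'a. M * (gauss y / ?N))" using integrable_gauss[where 'a='a] by simp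
  have step: "(LINT \<xi>|lborel. of_real (?g n \<xi>) * (fourier F \<xi> * cnj (fourier K \<xi>))) = (LINT t|lborel. cnj (K t) * ?J n t)" for n
  proof -
    have gi: "integrable lborel (\<lambda>\<xi>::'a. ?g n \<xi> * (LINT t|lborel. norm (F t)))"
      using lborel_integrable_affine[OF gauss_measurable[where 'a='a], of "2 * pi * ?e n" 0] integrable_gauss[where 'a='a] by (intro integrable_mult_left) simp
    let ?f = "\<lambda>(\<xi>, t). of_real (?g n \<xi>) * fourier F \<xi> * cis (2 * pi * (\<xi> \<bullet> t)) * cnj (K t)"
    have int: "integrable lborel ?f"
    proof (rule integrable_lborel_pairI[where h = "\<lambda>\<xi>. ?g n \<xi> * (LINT t|lborel. norm (F t))" and k = "\<lambda>s. norm (K s)"])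
      show "?f \<in> borel_measurable borel" unfolding borel_prod[symmetric] by measurable
      show "norm (?f (\<xi>, t)) \<le> ?g n \<xi> * (LINT t|lborel. norm (F t)) * norm (K t)" for \<xi> t
        using norm_fourier_le[of F \<xi>] gauss_bounds(1)[of "(2 * pi * ?e n) *\<^sub>R \<xi>"]
        by (auto simp: norm_mult less_imp_le intro!: mult_right_mono mult_left_mono)
    qed (use gi K in \<open>auto intro!: mult_nonneg_nonneg\<close>)
    have "(LINT \<xi>|lborel. of_real (?g n \<xi>) * (fourier F \<xi> * cnj (fourier K \<xi>))) = (LINT \<xi>|lborel. LINT t|lborel. ?f (\<xi>, t))"
    proof (intro Bochner_Integration.integral_cong refl)
      fix \<xi> :: 'a
      have "cnj (fourier K \<xi>) = (LINT t|lborel. cnj (K t * cis (- (2 * pi * (\<xi> \<bullet> t)))))"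
        unfolding fourier_def by (simp only: Bochner_Integration.integral_cnj)
      then have "of_real (?g n \<xi>) * (fourier F \<xi> * cnj (fourier K \<xi>))
          = (LINT t|lborel. (of_real (?g n \<xi>) * fourier F \<xi>) * cnj (K t * cis (- (2 * pi * (\<xi> \<bullet> t)))))"
        by (simp only: integral_mult_right_zero mult.assoc)
      then show "of_real (?g n \<xi>) * (fourier F \<xi> * cnj (fourier K \<xi>)) = (LINT t|lborel. ?f (\<xi>, t))"
        by (simp add: cis_cnj ac_simps)
    qed
    also have "\<dots> = (LINT t|lborel. LINT \<xi>|lborel. ?f (\<xi>, t))"
      using lborel_integral_fst[OF int] lborel_integral_snd[OF int] by simp
    also have "\<dots> = (LINT t|lborel. cnj (K t) * ?J n t)"
    proof (intro Bochner_Integration.integral_cong refl)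
      fix t :: 'a
      have "(LINT \<xi>|lborel. ?f (\<xi>, t)) = (LINT \<xi>|lborel. of_real (?g n \<xi>) * fourier F \<xi> * cis (2 * pi * (\<xi> \<bullet> t))) * cnj (K t)"
        by (simp only: prod.case integral_mult_left_zero)
      also have "\<dots> = cnj (K t) * ?J n t"
        by (subst fourier_gauss_inverse[OF F(1)]) (auto simp: mult.commute)
      finally show "(LINT \<xi>|lborel. ?f (\<xi>, t)) = cnj (K t) * ?J n t" .
    qed
    finally show ?thesis .
  qed
  have lim1: "(\<lambda>n. LINT \<xi>|lborel. of_real (?g n \<xi>) * (fourier F \<xi> * cnj (fourier K \<xi>)))
      \<longlonglongrightarrow> (LINT \<xi>|lborel. fourier F \<xi> * cnj (fourier K \<xi>))"
  proof (rule integral_dominated_convergence[where w = "\<lambda>\<xi>. norm (fourier F \<xi> * cnj (fourier K \<xi>))"])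
    show "AE \<xi> in lborel. (\<lambda>n. of_real (?g n \<xi>) * (fourier F \<xi> * cnj (fourier K \<xi>))) \<longlonglongrightarrow> fourier F \<xi> * cnj (fourier K \<xi>)"
    proof (rule AE_I2)
      fix \<xi> :: 'a
      have "(\<lambda>n. (2 * pi * ?e n) *\<^sub>R \<xi>) \<longlonglongrightarrow> (2 * pi * 0) *\<^sub>R \<xi>"
        by (intro tendsto_intros e0)
      then have "(\<lambda>n. ?g n \<xi>) \<longlonglongrightarrow> gauss ((2 * pi * 0) *\<^sub>R \<xi>)"
        by (rule continuous_on_tendsto_compose[OF continuous_gauss]) auto
      then have "(\<lambda>n. of_real (?g n \<xi>) * (fourier F \<xi> * cnj (fourier K \<xi>)))
          \<longlonglongrightarrow> of_real (gauss ((2 * pi * 0) *\<^sub>R \<xi>)) * (fourier F \<xi> * cnj (fourier K \<xi>))"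
        by (intro tendsto_intros)
      then show "(\<lambda>n. of_real (?g n \<xi>) * (fourier F \<xi> * cnj (fourier K \<xi>))) \<longlonglongrightarrow> fourier F \<xi> * cnj (fourier K \<xi>)"
        by (simp add: gauss_def)
    qed
    show "AE \<xi> in lborel. norm (of_real (?g n \<xi>) * (fourier F \<xi> * cnj (fourier K \<xi>))) \<le> norm (fourier F \<xi> * cnj (fourier K \<xi>))" for n
    proof (rule AE_I2)
      fix \<xi> :: 'a
      have "?g n \<xi> * (norm (fourier F \<xi>) * norm (fourier K \<xi>)) \<le> norm (fourier F \<xi>) * norm (fourier K \<xi>)"
        by (rule mult_left_le_one_le) (auto intro: gauss_bounds)
      then show "norm (of_real (?g n \<xi>) * (fourier F \<xi> * cnj (fourier K \<xi>))) \<le> norm (fourier F \<xi> * cnj (fourier K \<xi>))"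
        by (simp add: norm_mult)
    qed
  qed (use FK in auto)
  have lim2: "(\<lambda>n. LINT t|lborel. cnj (K t) * ?J n t) \<longlonglongrightarrow> (LINT t|lborel. cnj (K t) * F t)"
  proof (rule integral_dominated_convergence[where w = "\<lambda>t. norm (K t) * M"])
    have J: "(\<lambda>n. ?J n t) \<longlonglongrightarrow> F t" for t
    proof -
      have "(\<lambda>n. ?J n t) \<longlonglongrightarrow> (LINT y|lborel. F t * complex_of_real (gauss (y::'a) / ?N))"
      proof (rule integral_dominated_convergence[OF _ _ gN])
        show "AE y in lborel. (\<lambda>n. F (t + ?e n *\<^sub>R y) * of_real (gauss y / ?N)) \<longlonglongrightarrow> F t * of_real (gauss y / ?N)"
        proof (rule AE_I2)
          fix y :: 'a
          have "(\<lambda>n. t + ?e n *\<^sub>R y) \<longlonglongrightarrow> t + 0 *\<^sub>R y" by (intro tendsto_intros e0)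
          then have "(\<lambda>n. F (t + ?e n *\<^sub>R y)) \<longlonglongrightarrow> F (t + 0 *\<^sub>R y)"
            by (rule continuous_on_tendsto_compose[OF F(2)]) auto
          then show "(\<lambda>n. F (t + ?e n *\<^sub>R y) * of_real (gauss y / ?N)) \<longlonglongrightarrow> F t * of_real (gauss y / ?N)"
            by (intro tendsto_intros) simp
        qed
        show "AE y in lborel. norm (F (t + ?e n *\<^sub>R y) * of_real (gauss y / ?N)) \<le> M * (gauss y / ?N)" for n
          using F(3) gauss_bounds(1) N
          by (intro AE_I2) (auto simp: norm_mult norm_divide norm_power less_imp_le intro!: mult_right_mono divide_right_mono)
      qed measurable
      also have "(LINT y|lborel. F t * complex_of_real (gauss (y::'a) / ?N)) = F t * of_real (LINT y|lborel. gauss (y::'a) / ?N)"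
        by (simp only: integral_mult_right_zero integral_complex_of_real)
      also have "\<dots> = F t" using N by (simp add: integral_gauss)
      finally show ?thesis .
    qed
    show "AE t in lborel. (\<lambda>n. cnj (K t) * ?J n t) \<longlonglongrightarrow> cnj (K t) * F t"
      by (intro AE_I2 tendsto_intros J)
    have JM: "norm (?J n t) \<le> M" for n t
    proof -
      have "norm (?J n t) \<le> (LINT y|lborel. M * (gauss (y::'a) / ?N))"
        using F(3) gauss_bounds(1) N
        by (intro order.trans[OF integral_norm_bound] integral_mono')
           (use gN M in \<open>auto simp: norm_mult norm_divide norm_power less_imp_le intro!: mult_right_mono divide_right_mono\<close>)
      also have "\<dots> = M" using N by (simp add: integral_gauss)
      finally show ?thesis .
    qed
    show "AE t in lborel. norm (cnj (K t) * ?J n t) \<le> norm (K t) * M" for n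
      unfolding norm_mult complex_mod_cnj by (intro AE_I2 mult_left_mono JM) auto
  qed (use K in auto)
  show ?thesis
    using LIMSEQ_unique[OF lim1[unfolded step] lim2] by (simp add: mult.commute)
qed

section \<open>The short-time Fourier transform of test functions\<close>

lemma smooth_continuous: "smooth f \<Longrightarrow> continuous_on UNIV f"
  by (simp add: continuous_at_imp_continuous_on differentiable_imp_continuous_within smooth_differentiable)

lemma smooth_measurable: "smooth f \<Longrightarrow> f \<in> borel_measurable borel"
  by (intro continuous_on_borel_measurable smooth_continuous)

lemma Basis_max_exists:
  fixes t :: "'a::euclidean_space"
  obtains b where "b \<in> Basis" "\<And>c. c \<in> Basis \<Longrightarrow> \<bar>t \<bullet> c\<bar> \<le> \<bar>t \<bullet> b\<bar>"
proof -
  have "Max ((\<lambda>c. \<bar>t \<bullet> c\<bar>) ` Basis) \<in> (\<lambda>c. \<bar>t \<bullet> c\<bar>) ` Basis" by (intro Max_in) auto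
  then obtain b where b: "Max ((\<lambda>c. \<bar>t \<bullet> c\<bar>) ` Basis) = \<bar>t \<bullet> b\<bar>" "b \<in> Basis" by (rule imageE)
  moreover have "\<bar>t \<bullet> c\<bar> \<le> Max ((\<lambda>c. \<bar>t \<bullet> c\<bar>) ` Basis)" if "c \<in> Basis" for c
    using that by (intro Max_ge) auto
  ultimately show ?thesis using that by auto
qed

text \<open>Each of the \<open>DIM('a)\<close> factors of \<open>1 / rho t\<close> is at most the
  one of the largest coordinate \<open>b\<close>. Decay in \<open>rho\<close> thus follows from
  moments in a single coordinate.\<close>

lemma inverse_rho_le_max:
  fixes t :: "'a::euclidean_space"
  obtains b where "b \<in> Basis" "\<And>c. c \<in> Basis \<Longrightarrow> \<bar>t \<bullet> c\<bar> \<le> \<bar>t \<bullet> b\<bar>"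
    "1 / rho t ^ k \<le> 2 ^ (k * DIM('a)) * (1 + \<bar>t \<bullet> b\<bar> ^ (2 * (k * DIM('a))))"
proof -
  obtain b :: 'a where b: "b \<in> Basis" "\<And>c. c \<in> Basis \<Longrightarrow> \<bar>t \<bullet> c\<bar> \<le> \<bar>t \<bullet> b\<bar>" using Basis_max_exists by blast
  let ?M = "(t \<bullet> b)\<^sup>2" let ?d = "DIM('a)"
  have "1 / rho t = (\<Prod>c\<in>Basis. 1 + (t \<bullet> c)\<^sup>2)"
    by (simp add: rho_def prod_dividef)
  also have "\<dots> \<le> (\<Prod>c\<in>(Basis :: 'a set). 1 + ?M)"
    using b by (intro prod_mono) (auto simp: abs_le_square_iff)
  finally have "(1 / rho t) ^ k \<le> ((1 + ?M) ^ ?d) ^ k"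
    using rho_pos[of t] by (intro power_mono) auto
  also have "\<dots> = (1 + ?M) ^ (k * ?d)" by (simp add: power_mult[symmetric] mult.commute)
  also have "\<dots> \<le> (2 * max 1 ?M) ^ (k * ?d)" by (intro power_mono) auto
  also have "\<dots> \<le> 2 ^ (k * ?d) * (1 + ?M ^ (k * ?d))"
    by (cases "?M \<le> 1") (auto simp: power_mult_distrib max_def)
  also have "?M ^ (k * ?d) = \<bar>t \<bullet> b\<bar> ^ (2 * (k * ?d))"
    by (simp only: power_mult power2_abs)
  finally show ?thesis using that[OF b] by (simp add: power_divide)
qed

lemma inverse_rho_le:
  fixes t :: "'a::euclidean_space"
  obtains b where "b \<in> Basis" "1 / rho t ^ k \<le> 2 ^ (k * DIM('a)) * (1 + \<bar>t \<bullet> b\<bar> ^ (2 * (k * DIM('a))))"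
  by (rule inverse_rho_le_max[of t k]) (rule that)

text \<open>The constant of \<open>inverse_rho_le\<close> at \<open>k = 2\<close>, with the moment
  of order \<open>4 * d\<close> bounded by \<open>A ^ (4 * d) * (4 * d)!\<close>.\<close>

definition cdec :: "real \<Rightarrow> nat \<Rightarrow> real"
  where "cdec A d = 2 ^ (2 * d) * (1 + A ^ (4 * d) * fact (4 * d))"

lemma cdec_nonneg: "0 < A \<Longrightarrow> 0 \<le> cdec A d"
  unfolding cdec_def by (simp add: less_imp_le)

text \<open>The square of \<open>rho\<close> is kept because \<open>product_decay\<close> spends it
  twice: once for decay in the shift, once for integrability.\<close>

lemma gs_bound_decay:
  fixes f :: "'a::euclidean_space \<Rightarrow> complex"
  assumes f: "gs_bound A B S f" and AB: "0 < A" "0 < B" and j: "j \<in> Basis"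
  shows "norm ((partial_deriv j ^^ n) f t) \<le> cdec A DIM('a) * S * (B ^ n * fact n) * rho t ^ 2"
proof -
  obtain b where b: "b \<in> Basis" "1 / rho t ^ 2 \<le> 2 ^ (2 * DIM('a)) * (1 + \<bar>t \<bullet> b\<bar> ^ (2 * (2 * DIM('a))))"
    using inverse_rho_le by blast
  let ?F = "norm ((partial_deriv j ^^ n) f t)" let ?d = "DIM('a)"
  have eq: "mi_deriv (mi_single j n) f = (partial_deriv j ^^ n) f"
    using gs_bound_smooth[OF f] j by (rule mi_deriv_single)
  have 0: "?F \<le> S * (B ^ n * fact n)"
    using gs_boundD[OF f, of t "mi_single b 0" "mi_single j n"] unfolding eq
    by (simp add: mi_size_single mi_fact_single mi_power_single b j ac_simps)
  have 1: "\<bar>t \<bullet> b\<bar> ^ (4 * ?d) * ?F \<le> S * (B ^ n * fact n) * (A ^ (4 * ?d) * fact (4 * ?d))"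
    using gs_boundD[OF f, of t "mi_single b (4 * ?d)" "mi_single j n"] unfolding eq
    by (simp add: mi_size_single mi_fact_single mi_power_single b j ac_simps power_abs)
  have "?F * (1 / rho t ^ 2) \<le> ?F * (2 ^ (2 * ?d) * (1 + \<bar>t \<bullet> b\<bar> ^ (2 * (2 * ?d))))"
    by (intro mult_left_mono b) auto
  also have "\<dots> = 2 ^ (2 * ?d) * (?F + \<bar>t \<bullet> b\<bar> ^ (4 * ?d) * ?F)" by (simp add: algebra_simps)
  also have "\<dots> \<le> 2 ^ (2 * ?d) * (S * (B ^ n * fact n) + S * (B ^ n * fact n) * (A ^ (4 * ?d) * fact (4 * ?d)))"
    by (intro mult_left_mono add_mono 0 1) auto
  also have "\<dots> = cdec A ?d * S * (B ^ n * fact n)" unfolding cdec_def by (simp add: algebra_simps)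
  finally show ?thesis using rho_pos[of t] by (simp add: pos_divide_le_eq)
qed

lemma gs_bound_decay0:
  fixes f :: "'a::euclidean_space \<Rightarrow> complex"
  assumes "gs_bound A B S f" "0 < A" "0 < B"
  shows "norm (f t) \<le> cdec A DIM('a) * S * rho t ^ 2"
proof -
  obtain j :: 'a where "j \<in> Basis" using nonempty_Basis by blast
  from gs_bound_decay[OF assms this, of 0] show ?thesis by simp
qed

text \<open>Peetre's inequality in each coordinate:
  \<open>1 + (p - q)^2 \<le> 2 (1 + p^2) (1 + q^2)\<close>, a consequence of
  \<open>(p + q)^2 \<ge> 0\<close>.\<close>

lemma rho_shift_le: "rho t * rho (t - x) \<le> 2 ^ DIM('a) * rho (x :: 'a::euclidean_space)"
proof -
  have le: "1 + (x \<bullet> b)\<^sup>2 \<le> 2 * ((1 + (t \<bullet> b)\<^sup>2) * (1 + ((t - x) \<bullet> b)\<^sup>2))" for b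
  proof -
    define p q where "p = t \<bullet> b" and "q = (t - x) \<bullet> b"
    have "x \<bullet> b = p - q" by (simp add: p_def q_def inner_diff_left)
    moreover have "1 + (p - q)\<^sup>2 \<le> 2 * ((1 + p\<^sup>2) * (1 + q\<^sup>2))"
    proof -
      have "0 \<le> (p + q)\<^sup>2" "0 \<le> p\<^sup>2 * q\<^sup>2" by auto
      then show ?thesis by (simp add: power2_eq_square algebra_simps)
    qed
    ultimately show ?thesis by (simp add: p_def q_def)
  qed
  have aux: "1 / p \<le> 2 * (1 / l)" if "l \<le> 2 * p" "0 < l" "0 < p" for l p :: real
    using that by (simp add: field_simps)
  have "rho t * rho (t - x) = (\<Prod>b\<in>Basis. 1 / ((1 + (t \<bullet> b)\<^sup>2) * (1 + ((t - x) \<bullet> b)\<^sup>2)))"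
    by (simp add: rho_def prod.distrib[symmetric])
  also have "\<dots> \<le> (\<Prod>b\<in>Basis. 2 * (1 / (1 + (x \<bullet> b)\<^sup>2)))"
  proof (intro prod_mono conjI)
    fix b :: 'a
    show "1 / ((1 + (t \<bullet> b)\<^sup>2) * (1 + ((t - x) \<bullet> b)\<^sup>2)) \<le> 2 * (1 / (1 + (x \<bullet> b)\<^sup>2))"
      using le[of b] by (intro aux) (auto intro!: mult_pos_pos)
  qed auto
  also have "\<dots> = 2 ^ DIM('a) * rho x" by (simp add: rho_def prod.distrib prod_dividef)
  finally show ?thesis .
qed

text \<open>The transform of a function, as opposed to \<open>stft\<close> of a functional;
  \<open>stft_gs_embed\<close> identifies the two. Written as \<open>fourier\<close> of a product,
  it is ready for \<open>parseval\<close> at fixed position.\<close>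

definition stf :: "('a::euclidean_space \<Rightarrow> complex) \<Rightarrow> ('a \<Rightarrow> complex) \<Rightarrow> 'a \<times> 'a \<Rightarrow> complex"
  where "stf g f z = fourier (\<lambda>t. f t * cnj (g (t - fst z))) (snd z)"

lemma stf_eq_bracket: "stf g f z = l2_bracket f (tf_shift z g)"
  by (simp add: stf_def fourier_def l2_bracket_def tf_shift_def split_beta cis_cnj ac_simps)

abbreviation rho_int :: "'a::euclidean_space itself \<Rightarrow> real"
  where "rho_int _ \<equiv> (LINT t|lborel. rho (t :: 'a))"

lemma rho_int_nonneg: "0 \<le> rho_int TYPE('a::euclidean_space)"
  by (intro integral_nonneg_AE AE_I2 rho_nonneg)

text \<open>One factor \<open>rho t * rho (t - x)\<close> is traded for \<open>rho x\<close> by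
  \<open>rho_shift_le\<close>; of the other one only the integrable \<open>rho t\<close> is
  kept.\<close>

lemma product_decay:
  fixes f g :: "'a::euclidean_space \<Rightarrow> complex"
  assumes f: "\<And>t. norm (f t) \<le> a * rho t ^ 2" and g: "\<And>t. norm (g t) \<le> b * rho t ^ 2"
  shows "norm (f t * cnj (g (t - x))) \<le> (a * b * 2 ^ DIM('a) * rho x) * rho t"
proof -
  have a: "0 \<le> a" using f[of 0] rho_pos[of "0::'a"]
    by (smt (verit) norm_ge_zero mult_neg_pos zero_less_power)
  have b: "0 \<le> b" using g[of 0] rho_pos[of "0::'a"]
    by (smt (verit) norm_ge_zero mult_neg_pos zero_less_power)
  have "norm (f t * cnj (g (t - x))) \<le> (a * rho t ^ 2) * (b * rho (t - x) ^ 2)"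
    unfolding norm_mult using f g a b by (intro mult_mono) auto
  also have "\<dots> = a * b * (rho t * rho (t - x)) * (rho t * rho (t - x))" by (simp add: power2_eq_square)
  also have "\<dots> \<le> a * b * (2 ^ DIM('a) * rho x) * (rho t * 1)"
  proof (rule mult_mono)
    show "a * b * (rho t * rho (t - x)) \<le> a * b * (2 ^ DIM('a) * rho x)"
      using a b rho_shift_le[of t x] by (intro mult_left_mono) auto
    show "rho t * rho (t - x) \<le> rho t * 1" using rho_nonneg rho_le_1 by (intro mult_left_mono) auto
  qed (use a b rho_nonneg in \<open>auto intro!: mult_nonneg_nonneg\<close>)
  finally show ?thesis by (simp add: ac_simps)
qed

lemma integrable_rho_bound:
  fixes f :: "'a::euclidean_space \<Rightarrow> complex"
  assumes "f \<in> borel_measurable borel" "\<And>t. norm (f t) \<le> c * rho t"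
  shows "integrable lborel f"
  by (rule Bochner_Integration.integrable_bound[OF integrable_mult_right[OF integrable_rho, of c]])
     (use assms order.trans[OF assms(2) abs_ge_self] in \<open>auto simp: abs_mult\<close>)

lemma integral_rho_bound:
  fixes f :: "'a::euclidean_space \<Rightarrow> complex"
  assumes "f \<in> borel_measurable borel" "\<And>t. norm (f t) \<le> c * rho t"
  shows "(LINT t|lborel. norm (f t)) \<le> c * rho_int TYPE('a)"
proof -
  have "(LINT t|lborel. norm (f t)) \<le> (LINT t|lborel. c * rho (t::'a))"
    using integrable_rho_bound[OF assms] integrable_rho assms(2) by (intro integral_mono) auto
  then show ?thesis by simp
qed

lemma stf_decay_x:
  fixes f g :: "'a::euclidean_space \<Rightarrow> complex"
  assumes [measurable]: "f \<in> borel_measurable borel" "g \<in> borel_measurable borel"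
    and f: "\<And>t. norm (f t) \<le> a * rho t ^ 2" and g: "\<And>t. norm (g t) \<le> b * rho t ^ 2"
  shows "norm (stf g f z) \<le> a * b * (2 ^ DIM('a) * rho_int TYPE('a)) * rho (fst z)"
proof -
  have "norm (stf g f z) \<le> (LINT t|lborel. norm (f t * cnj (g (t - fst z))))"
    unfolding stf_def by (rule norm_fourier_le)
  also have "\<dots> \<le> (a * b * 2 ^ DIM('a) * rho (fst z)) * rho_int TYPE('a)"
    by (rule integral_rho_bound) (measurable, rule product_decay[OF f g])
  finally show ?thesis by (simp add: ac_simps)
qed

lemma rho_sq_le: "rho t ^ 2 \<le> rho t"
  using rho_nonneg[of t] rho_le_1[of t] by (simp add: power2_eq_square mult_left_le)

text \<open>The derivative of the whole integrand along \<open>j\<close> integrates to zero; the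
  product rule splits it into the three terms of the identity.\<close>

lemma stf_partial_deriv:
  fixes f g :: "'a::euclidean_space \<Rightarrow> complex"
  assumes sm: "smooth f" "smooth g" and j: "j \<in> Basis"
    and f: "\<And>t. norm (f t) \<le> a * rho t ^ 2" and f': "\<And>t. norm (partial_deriv j f t) \<le> a' * rho t ^ 2"
    and g: "\<And>t. norm (g t) \<le> b * rho t ^ 2" and g': "\<And>t. norm (partial_deriv j g t) \<le> b' * rho t ^ 2"
  shows "(\<i> * of_real (2 * pi * (snd z \<bullet> j))) * stf g f z = stf g (partial_deriv j f) z + stf (partial_deriv j g) f z"
proof -
  let ?x = "fst z" let ?\<xi> = "snd z"
  let ?e = "\<lambda>t. cis (- (2 * pi * (?\<xi> \<bullet> t)))"
  have sm': "smooth (partial_deriv j f)" "smooth (partial_deriv j g)" using sm j by (auto intro: smooth_partial_deriv)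
  note [measurable] = sm[THEN smooth_measurable] sm'[THEN smooth_measurable]
  let ?F = "\<lambda>t. f t * cnj (g (t - ?x)) * ?e t"
  let ?F1 = "\<lambda>t. partial_deriv j f t * cnj (g (t - ?x)) * ?e t"
  let ?F2 = "\<lambda>t. f t * cnj (partial_deriv j g (t - ?x)) * ?e t"
  let ?c = "\<i> * of_real (2 * pi * (?\<xi> \<bullet> j))"
  have nm: "norm (w * cis r) = norm w" for w r by (simp add: norm_mult)
  have i: "integrable lborel ?F" "integrable lborel ?F1" "integrable lborel ?F2"
    by (rule integrable_rho_bound, measurable, unfold nm, rule product_decay, rule f, rule g,
        rule integrable_rho_bound, measurable, unfold nm, rule product_decay, rule f', rule g,
        rule integrable_rho_bound, measurable, unfold nm, rule product_decay, rule f, rule g')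
  have "(LINT t|lborel. ?F1 t + ?F2 t - ?c * ?F t) = 0"
  proof (rule integral_directional_derivative[where f = ?F and b = j])
    show "integrable lborel ?F" by (rule i)
    show "integrable lborel (\<lambda>t. ?F1 t + ?F2 t - ?c * ?F t)"
      using i by (intro Bochner_Integration.integrable_add Bochner_Integration.integrable_diff integrable_mult_right) auto
    show "continuous_on UNIV (\<lambda>s. ?F1 (t + s *\<^sub>R j) + ?F2 (t + s *\<^sub>R j) - ?c * ?F (t + s *\<^sub>R j))" for t
    proof (rule continuous_on_compose2[of UNIV "\<lambda>t. ?F1 t + ?F2 t - ?c * ?F t"])
      have "continuous_on UNIV (\<lambda>t. g (t - ?x))" "continuous_on UNIV (\<lambda>t. partial_deriv j g (t - ?x))"
        by (rule continuous_on_compose2[OF smooth_continuous[OF sm(2)]], auto intro!: continuous_intros)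
          (rule continuous_on_compose2[OF smooth_continuous[OF sm'(2)]], auto intro!: continuous_intros)
      then show "continuous_on UNIV (\<lambda>t. ?F1 t + ?F2 t - ?c * ?F t)" unfolding cis_conv_exp
        by (intro continuous_intros smooth_continuous[OF sm(1)] smooth_continuous[OF sm'(1)])
    qed (auto intro!: continuous_intros)
    fix t s
    have 1: "((\<lambda>s. f (t + s *\<^sub>R j)) has_vector_derivative partial_deriv j f (t + s *\<^sub>R j)) (at s)"
      by (rule has_vector_derivative_line[OF smooth_differentiable[OF sm(1)]])
    have 2: "((\<lambda>s. cnj (g (t - ?x + s *\<^sub>R j))) has_vector_derivative cnj (partial_deriv j g (t - ?x + s *\<^sub>R j))) (at s)"
      by (rule bounded_linear.has_vector_derivative[OF bounded_linear_cnj has_vector_derivative_line[OF smooth_differentiable[OF sm(2)]]])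
    have 3: "((\<lambda>s. ?e (t + s *\<^sub>R j)) has_vector_derivative - ?c * ?e (t + s *\<^sub>R j)) (at s)"
    proof -
      have "((\<lambda>s. ?e t * cis (- (2 * pi * (?\<xi> \<bullet> j)) \<bullet> s)) has_derivative
          (\<lambda>y. ?e t * (\<i> * of_real (- (2 * pi * (?\<xi> \<bullet> j)) \<bullet> y) * cis (- (2 * pi * (?\<xi> \<bullet> j)) \<bullet> s)))) (at s)"
        by (intro has_derivative_mult_right has_derivative_cis_inner)
      moreover have "?e (t + s *\<^sub>R j) = ?e t * cis (- (2 * pi * (?\<xi> \<bullet> j)) \<bullet> s)" for s
        by (simp add: cis_mult inner_add_right algebra_simps)
      ultimately show ?thesis unfolding has_vector_derivative_def
        by (simp add: scaleR_conv_of_real ac_simps)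
    qed
    from has_vector_derivative_mult[OF has_vector_derivative_mult[OF 1 2] 3]
    show "((\<lambda>s. ?F (t + s *\<^sub>R j)) has_vector_derivative
        (?F1 (t + s *\<^sub>R j) + ?F2 (t + s *\<^sub>R j) - ?c * ?F (t + s *\<^sub>R j))) (at s)"
      by (simp add: algebra_simps)
  qed
  moreover have "(LINT t|lborel. ?F1 t + ?F2 t - ?c * ?F t) = (LINT t|lborel. ?F1 t) + (LINT t|lborel. ?F2 t) - ?c * (LINT t|lborel. ?F t)"
    using i by (subst Bochner_Integration.integral_diff Bochner_Integration.integral_add, auto)+
  ultimately show ?thesis unfolding stf_def fourier_def by simp
qed

text \<open>Under the integral
  \<open>fst z \<bullet> j = t \<bullet> j - (t - fst z) \<bullet> j\<close>: the first part is
  multiplied into \<open>f\<close>, the second into \<open>g\<close>.\<close>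

lemma stf_mult_coord:
  fixes f g :: "'a::euclidean_space \<Rightarrow> complex"
  assumes sm: "smooth f" "smooth g" and j: "j \<in> Basis"
    and f: "\<And>t. norm (f t) \<le> a * rho t ^ 2" and f': "\<And>t. norm (mult_coord j f t) \<le> a' * rho t ^ 2"
    and g: "\<And>t. norm (g t) \<le> b * rho t ^ 2" and g': "\<And>t. norm (mult_coord j g t) \<le> b' * rho t ^ 2"
  shows "of_real (fst z \<bullet> j) * stf g f z = stf g (mult_coord j f) z - stf (mult_coord j g) f z"
proof -
  let ?x = "fst z" let ?\<xi> = "snd z"
  let ?e = "\<lambda>t. cis (- (2 * pi * (?\<xi> \<bullet> t)))"
  have sm': "smooth (mult_coord j f)" "smooth (mult_coord j g)" using sm j by (auto intro: smooth_mult_coord)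
  note [measurable] = sm[THEN smooth_measurable] sm'[THEN smooth_measurable]
  let ?F1 = "\<lambda>t. mult_coord j f t * cnj (g (t - ?x)) * ?e t"
  let ?F2 = "\<lambda>t. f t * cnj (mult_coord j g (t - ?x)) * ?e t"
  have nm: "norm (w * cis r) = norm w" for w r by (simp add: norm_mult)
  have i: "integrable lborel ?F1" "integrable lborel ?F2"
    by (rule integrable_rho_bound, measurable, unfold nm, rule product_decay, rule f', rule g,
        rule integrable_rho_bound, measurable, unfold nm, rule product_decay, rule f, rule g')
  have "of_real (?x \<bullet> j) * stf g f z = (LINT t|lborel. of_real (?x \<bullet> j) * (f t * cnj (g (t - ?x)) * ?e t))"
    by (simp add: stf_def fourier_def)
  also have "\<dots> = (LINT t|lborel. ?F1 t - ?F2 t)"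
    by (intro Bochner_Integration.integral_cong refl) (simp add: mult_coord_def inner_diff_left algebra_simps)
  also have "\<dots> = (LINT t|lborel. ?F1 t) - (LINT t|lborel. ?F2 t)"
    by (rule Bochner_Integration.integral_diff[OF i])
  finally show ?thesis unfolding stf_def fourier_def .
qed

text \<open>The indices count the operations applied to three objects, later the symbol and the two
  windows. Multiplying by \<open>\<tau>\<close> raises one count by one, so
  \<open>\<tau> ^ n\<close> produces \<open>3 ^ n\<close> terms, each controlled by the total
  count.\<close>

lemma recursion_bound:
  fixes X :: "nat \<Rightarrow> nat \<Rightarrow> nat \<Rightarrow> complex"
  assumes rec: "\<And>a b c. \<tau> * X a b c = c0 * X (Suc a) b c + c1 * X a (Suc b) c + c2 * X a b (Suc c)"
    and c: "norm c0 \<le> 1" "norm c1 \<le> 1" "norm c2 \<le> 1"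
    and bd: "\<And>a b c. norm (X a b c) \<le> G (a + b + c)"
  shows "norm \<tau> ^ n * norm (X a b c) \<le> 3 ^ n * G (n + a + b + c)"
proof (induction n arbitrary: a b c)
  case 0
  then show ?case using bd by simp
next
  case (Suc n)
  have le: "norm (c' * y) \<le> norm y" if "norm c' \<le> 1" for c' y :: complex
    using that by (simp add: norm_mult mult_left_le_one_le)
  have "norm \<tau> ^ Suc n * norm (X a b c) = norm \<tau> ^ n * norm (\<tau> * X a b c)"
    by (simp add: norm_mult)
  also have "\<dots> \<le> norm \<tau> ^ n * (norm (X (Suc a) b c) + norm (X a (Suc b) c) + norm (X a b (Suc c)))"
    unfolding rec
    by (intro mult_left_mono order.trans[OF norm_triangle_ineq] add_mono le c) auto
  also have "\<dots> \<le> 3 ^ n * G (n + Suc a + b + c) + 3 ^ n * G (n + a + Suc b + c) + 3 ^ n * G (n + a + b + Suc c)"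
    unfolding distrib_left by (intro add_mono Suc.IH)
  also have "\<dots> = 3 ^ Suc n * G (Suc n + a + b + c)" by simp
  finally show ?case .
qed

lemma stf_frequency_decay:
  fixes f g :: "'a::euclidean_space \<Rightarrow> complex"
  assumes f: "gs_bound A B S f" and g: "gs_bound A B S' g" and AB: "0 < A" "0 < B" and j: "j \<in> Basis"
  shows "\<bar>snd z \<bullet> j\<bar> ^ n * norm (stf g f z)
    \<le> (cdec A DIM('a)) ^ 2 * S * S' * (2 ^ DIM('a) * rho_int TYPE('a)) * rho (fst z) * ((3 * B) ^ n * fact n)"
proof -
  let ?C = "cdec A DIM('a)"
  let ?K = "?C ^ 2 * S * S' * (2 ^ DIM('a) * rho_int TYPE('a)) * rho (fst z)"
  let ?\<tau> = "\<i> * of_real (2 * pi * (snd z \<bullet> j))"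
  have sm: "smooth f" "smooth g" using f g gs_bound_smooth by auto
  have smn: "smooth ((partial_deriv j ^^ n) f)" "smooth ((partial_deriv j ^^ n) g)" for n
    using sm j by (auto intro: smooth_funpow)
  note df = gs_bound_decay[OF f AB j] and dg = gs_bound_decay[OF g AB j]
  have S: "0 \<le> S" "0 \<le> S'" using f g gs_bound_nonneg by auto
  have K: "0 \<le> ?K" using S rho_int_nonneg[where 'a='a] rho_nonneg by (intro mult_nonneg_nonneg) auto
  \<comment> \<open>There is no symbol here, so the first slot of \<open>recursion_bound\<close> is
    idle: its coefficient is 0, and \<open>X\<close> vanishes off \<open>a = 0\<close>.\<close>
  define X where "X a b c = (if a = 0 then stf ((partial_deriv j ^^ c) g) ((partial_deriv j ^^ b) f) z else 0)" for a b c :: nat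
  have rec: "?\<tau> * X a b c = 0 * X (Suc a) b c + 1 * X a (Suc b) c + 1 * X a b (Suc c)" for a b c
    using stf_partial_deriv[OF smn(1)[of b] smn(2)[of c] j df[of b] df[of "Suc b", simplified funpow.simps o_apply]
        dg[of c] dg[of "Suc c", simplified funpow.simps o_apply]]
    by (simp add: X_def)
  have bd: "norm (X a b c) \<le> ?K * (B ^ (a + b + c) * fact (a + b + c))" for a b c
  proof (cases "a = 0")
    case True
    then have X: "X a b c = stf ((partial_deriv j ^^ c) g) ((partial_deriv j ^^ b) f) z" by (simp add: X_def)
    have "norm (X a b c) \<le> (?C * S * (B ^ b * fact b)) * (?C * S' * (B ^ c * fact c)) * (2 ^ DIM('a) * rho_int TYPE('a)) * rho (fst z)"
      unfolding X by (intro stf_decay_x smooth_measurable smn df dg)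
    also have "\<dots> = ?K * (B ^ (b + c) * (fact b * fact c))"
      by (simp add: power2_eq_square power_add ac_simps)
    also have "\<dots> \<le> ?K * (B ^ (b + c) * fact (b + c))"
      using AB by (intro mult_left_mono fact_mult_le K) auto
    finally show ?thesis using True by simp
  next
    case False
    then show ?thesis using K AB by (simp add: X_def)
  qed
  have "\<bar>snd z \<bullet> j\<bar> ^ n * norm (stf g f z) \<le> norm ?\<tau> ^ n * norm (X 0 0 0)"
  proof -
    have "\<bar>snd z \<bullet> j\<bar> * 1 \<le> \<bar>snd z \<bullet> j\<bar> * (2 * pi)" using pi_gt3 by (intro mult_left_mono) auto
    then have "\<bar>snd z \<bullet> j\<bar> \<le> norm ?\<tau>" by (simp add: norm_mult abs_mult ac_simps)
    then show ?thesis by (simp add: X_def mult_right_mono power_mono)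
  qed
  also have "\<dots> \<le> 3 ^ n * (?K * (B ^ (n + 0 + 0 + 0) * fact (n + 0 + 0 + 0)))"
    by (rule recursion_bound[OF rec _ _ _ bd]) auto
  finally show ?thesis by (simp add: power_mult_distrib ac_simps)
qed

lemma stf_position_decay:
  fixes f g :: "'a::euclidean_space \<Rightarrow> complex"
  assumes f: "gs_bound A B S f" and g: "gs_bound A B S' g" and AB: "0 < A" "0 < B" and j: "j \<in> Basis"
  shows "\<bar>fst z \<bullet> j\<bar> ^ n * norm (stf g f z)
    \<le> (cdec (2 * A) DIM('a)) ^ 2 * S * S' * (2 ^ DIM('a) * rho_int TYPE('a)) * rho (fst z) * ((3 * (2 * A + 2 / B)) ^ n * fact n)"
proof -
  let ?C = "cdec (2 * A) DIM('a)" let ?B = "2 * A + 2 / B"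
  let ?K = "?C ^ 2 * S * S' * (2 ^ DIM('a) * rho_int TYPE('a)) * rho (fst z)"
  let ?\<tau> = "of_real (fst z \<bullet> j) :: complex"
  have B0: "0 \<le> ?B" using AB by simp
  have smn: "smooth ((mult_coord j ^^ n) f)" "smooth ((mult_coord j ^^ n) g)" for n
    using gs_bound_smooth[OF gs_bound_mult_coord[OF f AB j]] gs_bound_smooth[OF gs_bound_mult_coord[OF g AB j]] by auto
  have df: "norm ((mult_coord j ^^ n) f t) \<le> (?C * (S * ?B ^ n * fact n)) * rho t ^ 2" for n t
    using gs_bound_decay0[OF gs_bound_mult_coord[OF f AB j]] AB by simp
  have dg: "norm ((mult_coord j ^^ n) g t) \<le> (?C * (S' * ?B ^ n * fact n)) * rho t ^ 2" for n t
    using gs_bound_decay0[OF gs_bound_mult_coord[OF g AB j]] AB by simp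
  have S: "0 \<le> S" "0 \<le> S'" using f g gs_bound_nonneg by auto
  have K: "0 \<le> ?K" using S rho_int_nonneg[where 'a='a] rho_nonneg by (intro mult_nonneg_nonneg) auto
  define X where "X a b c = (if a = 0 then stf ((mult_coord j ^^ c) g) ((mult_coord j ^^ b) f) z else 0)" for a b c :: nat
  have rec: "?\<tau> * X a b c = 0 * X (Suc a) b c + 1 * X a (Suc b) c + (- 1) * X a b (Suc c)" for a b c
    using stf_mult_coord[OF smn(1)[of b] smn(2)[of c] j df[of b] df[of "Suc b", simplified funpow.simps o_apply]
        dg[of c] dg[of "Suc c", simplified funpow.simps o_apply]]
    by (simp add: X_def)
  have bd: "norm (X a b c) \<le> ?K * (?B ^ (a + b + c) * fact (a + b + c))" for a b c
  proof (cases "a = 0")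
    case True
    then have X: "X a b c = stf ((mult_coord j ^^ c) g) ((mult_coord j ^^ b) f) z" by (simp add: X_def)
    have "norm (X a b c) \<le> (?C * (S * ?B ^ b * fact b)) * (?C * (S' * ?B ^ c * fact c)) * (2 ^ DIM('a) * rho_int TYPE('a)) * rho (fst z)"
      unfolding X by (intro stf_decay_x smooth_measurable smn df dg)
    also have "\<dots> = ?K * (?B ^ (b + c) * (fact b * fact c))"
      by (simp add: power2_eq_square power_add ac_simps)
    also have "\<dots> \<le> ?K * (?B ^ (b + c) * fact (b + c))"
      using B0 by (intro mult_left_mono fact_mult_le K) auto
    finally show ?thesis using True by simp
  next
    case False
    then show ?thesis using K B0 by (simp add: X_def)
  qed
  have "norm ?\<tau> ^ n * norm (X 0 0 0) \<le> 3 ^ n * (?K * (?B ^ (n + 0 + 0 + 0) * fact (n + 0 + 0 + 0)))"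
    by (rule recursion_bound[OF rec _ _ _ bd]) auto
  moreover have "(3 * ?B) ^ n = 3 ^ n * ?B ^ n" by (rule power_mult_distrib)
  ultimately show ?thesis by (simp only: X_def) (simp add: ac_simps)
qed

text \<open>Collected from \<open>stf_decay_x\<close>, with one \<open>cdec\<close> for each
  function, and from \<open>inverse_rho_le\<close> at \<open>k = 1\<close>, with frequency moments
  of order 0 and \<open>2 * DIM('a)\<close>.\<close>

definition cstf :: "real \<Rightarrow> real \<Rightarrow> 'a::euclidean_space itself \<Rightarrow> real"
  where "cstf A B T = cdec A DIM('a) ^ 2 * (2 ^ DIM('a) * rho_int TYPE('a))
    * (2 ^ DIM('a) * (1 + (3 * B) ^ (2 * DIM('a)) * fact (2 * DIM('a))))"

lemma cstf_nonneg: "0 < B \<Longrightarrow> 0 \<le> cstf A B TYPE('a::euclidean_space)"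
  unfolding cstf_def using rho_int_nonneg[where 'a='a] by (intro mult_nonneg_nonneg) auto

text \<open>\<open>stf_frequency_decay\<close> already carries the factor
  \<open>rho (fst z)\<close>; its moments of order 0 and \<open>2 * DIM('a)\<close> in a suitable
  frequency coordinate add the factor \<open>rho (snd z)\<close>.\<close>

lemma stf_bound:
  fixes f g :: "'a::euclidean_space \<Rightarrow> complex"
  assumes f: "gs_bound A B S f" and g: "gs_bound A B S' g" and AB: "0 < A" "0 < B"
  shows "norm (stf g f z) \<le> cstf A B TYPE('a) * S * S' * (rho (fst z) * rho (snd z))"
proof -
  let ?d = "DIM('a)"
  let ?K = "(cdec A ?d) ^ 2 * S * S' * (2 ^ ?d * rho_int TYPE('a)) * rho (fst z)"
  obtain b where b: "b \<in> Basis" "1 / rho (snd z) ^ 1 \<le> 2 ^ (1 * ?d) * (1 + \<bar>snd z \<bullet> b\<bar> ^ (2 * (1 * ?d)))"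
    using inverse_rho_le by blast
  have "norm (stf g f z) * (1 / rho (snd z)) \<le> norm (stf g f z) * (2 ^ ?d * (1 + \<bar>snd z \<bullet> b\<bar> ^ (2 * ?d)))"
    using b by (intro mult_left_mono) auto
  also have "\<dots> = 2 ^ ?d * (norm (stf g f z) + \<bar>snd z \<bullet> b\<bar> ^ (2 * ?d) * norm (stf g f z))"
    by (simp add: algebra_simps)
  also have "\<dots> \<le> 2 ^ ?d * (?K + ?K * ((3 * B) ^ (2 * ?d) * fact (2 * ?d)))"
    using stf_frequency_decay[OF f g AB b(1), of z 0]
    by (intro mult_left_mono add_mono stf_frequency_decay[OF f g AB b(1)]) auto
  also have "\<dots> = cstf A B TYPE('a) * S * S' * rho (fst z)"
    unfolding cstf_def by (simp add: algebra_simps)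
  finally show ?thesis using rho_pos[of "snd z"] by (simp add: pos_divide_le_eq ac_simps)
qed

lemma stf_measurable [measurable]:
  assumes [measurable]: "f \<in> borel_measurable borel" "g \<in> borel_measurable borel"
  shows "stf g f \<in> borel_measurable borel"
proof -
  have "(\<lambda>z. LINT t|lborel. f t * cnj (g (t - fst z)) * cis (- (2 * pi * (snd z \<bullet> t)))) \<in> borel_measurable (borel \<Otimes>\<^sub>M borel)"
    by measurable
  then show ?thesis unfolding borel_prod stf_def[abs_def] fourier_def .
qed

lemma gs_measurable: "f \<in> gelfand_shilov \<Longrightarrow> f \<in> borel_measurable borel"
  by (intro smooth_measurable gelfand_shilov_smooth)

lemma gs_bounds1:
  fixes f g :: "'a::euclidean_space \<Rightarrow> complex"
  assumes "f \<in> gelfand_shilov" "g \<in> gelfand_shilov"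
  obtains C where "0 \<le> C" "\<And>t. norm (f t) \<le> C * rho t ^ 2" "\<And>t. norm (g t) \<le> C * rho t ^ 2"
    "\<And>z. norm (stf g f z) \<le> C * (rho (fst z) * rho (snd z))"
proof -
  obtain S S' where S: "gs_bound 1 1 S f" "gs_bound 1 1 S' g" using assms gelfand_shilovD zero_less_one by metis
  let ?c = "cdec 1 DIM('a)"
  define C where "C = max (?c * S) (max (?c * S') (cstf 1 1 TYPE('a) * S * S'))"
  have le: "c * x \<le> C * x" if "c \<le> C" "0 \<le> x" for c x :: real using that by (rule mult_right_mono)
  show ?thesis
  proof (rule that[of C])
    show "0 \<le> C" unfolding C_def using cdec_nonneg[of 1] gs_bound_nonneg[OF S(1)]
      by (intro max.coboundedI1 mult_nonneg_nonneg) auto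
    show "norm (f t) \<le> C * rho t ^ 2" for t
      by (rule order.trans[OF gs_bound_decay0[OF S(1)] le]) (auto simp: C_def)
    show "norm (g t) \<le> C * rho t ^ 2" for t
      by (rule order.trans[OF gs_bound_decay0[OF S(2)] le]) (auto simp: C_def)
    show "norm (stf g f z) \<le> C * (rho (fst z) * rho (snd z))" for z
      by (rule order.trans[OF stf_bound[OF S] le]) (auto simp: C_def rho_nonneg)
  qed
qed

lemma gs_integrable: "f \<in> gelfand_shilov \<Longrightarrow> integrable lborel f"
proof -
  assume f: "f \<in> gelfand_shilov"
  obtain C where C: "0 \<le> C" "\<And>t. norm (f t) \<le> C * rho t ^ 2" by (rule gs_bounds1[OF f f]) (rule that)
  show ?thesis
    by (rule integrable_rho_bound[OF gs_measurable[OF f], of C])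
       (use order.trans[OF C(2) mult_left_mono[OF rho_sq_le C(1)]] in auto)
qed

lemma integrable_rho_rho:
  fixes f :: "'a::euclidean_space \<times> 'a \<Rightarrow> complex"
  assumes "f \<in> borel_measurable borel" "\<And>z. norm (f z) \<le> C * (rho (fst z) * rho (snd z))"
  shows "integrable lborel f"
proof (rule integrable_lborel_pairI[OF assms(1), where h = "\<lambda>x. \<bar>C\<bar> * rho x" and k = rho])
  show "norm (f (x, y)) \<le> \<bar>C\<bar> * rho x * rho y" for x y
    using assms(2)[of "(x, y)"] mult_right_mono[OF abs_ge_self[of C] mult_nonneg_nonneg[OF rho_nonneg[of x] rho_nonneg[of y]]]
    by (simp add: ac_simps)
qed (use integrable_rho rho_nonneg in \<open>auto intro!: mult_nonneg_nonneg\<close>)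

lemma stf_integrable:
  assumes "f \<in> gelfand_shilov" "g \<in> gelfand_shilov"
  shows "integrable lborel (stf g f)"
proof -
  obtain C where "\<And>z. norm (stf g f z) \<le> C * (rho (fst z) * rho (snd z))" by (rule gs_bounds1[OF assms]) (rule that)
  then show ?thesis by (intro integrable_rho_rho stf_measurable gs_measurable assms)
qed

text \<open>Test functions satisfy their bounds for all \<open>A\<close> and \<open>B\<close>, so
  the rate \<open>Q\<close> can be prescribed. Frequency decay has rate \<open>3 * B\<close>, whence
  \<open>B = Q / 3\<close>; position decay has rate \<open>3 * (2 * A + 2 / B)\<close>, which equals
  \<open>Q\<close> for \<open>A = Q / 12\<close> and \<open>B = 12 / Q\<close>.\<close>

lemma stf_exponential_decay:
  fixes f g :: "'a::euclidean_space \<Rightarrow> complex"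
  assumes f: "f \<in> gelfand_shilov" and g: "g \<in> gelfand_shilov" and Q: "0 < Q"
  shows "\<exists>K\<ge>0. \<forall>z. \<forall>b\<in>Basis. \<forall>n. \<bar>z \<bullet> b\<bar> ^ n * norm (stf g f z) \<le> K * (Q ^ n * fact n)"
proof -
  obtain S S' where S: "gs_bound 1 (Q / 3) S f" "gs_bound 1 (Q / 3) S' g"
    using f g Q gelfand_shilovD[of f 1 "Q / 3"] gelfand_shilovD[of g 1 "Q / 3"] by auto
  obtain R R' where R: "gs_bound (Q / 12) (12 / Q) R f" "gs_bound (Q / 12) (12 / Q) R' g"
    using f g Q gelfand_shilovD[of f "Q / 12" "12 / Q"] gelfand_shilovD[of g "Q / 12" "12 / Q"] by auto
  define c where "c = 2 ^ DIM('a) * rho_int TYPE('a)"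
  define K1 where "K1 = cdec 1 DIM('a) ^ 2 * S * S' * c"
  define K2 where "K2 = cdec (2 * (Q / 12)) DIM('a) ^ 2 * R * R' * c"
  have c: "0 \<le> c" using rho_int_nonneg[where 'a='a] by (simp add: c_def)
  have K: "0 \<le> K1" "0 \<le> K2" unfolding K1_def K2_def
    using gs_bound_nonneg[OF S(1)] gs_bound_nonneg[OF S(2)] gs_bound_nonneg[OF R(1)] gs_bound_nonneg[OF R(2)] c
    by (simp_all add: mult_nonneg_nonneg)
  have bd: "K' * rho x * (Q ^ n * fact n) \<le> (K1 + K2) * (Q ^ n * fact n)" if "K' = K1 \<or> K' = K2" for K' n and x :: 'a
  proof (rule mult_right_mono)
    have "K' * rho x \<le> K' * 1" using that K rho_le_1 by (intro mult_left_mono) auto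
    then show "K' * rho x \<le> K1 + K2" using that K by auto
  qed (use Q in auto)
  have "\<bar>z \<bullet> b\<bar> ^ n * norm (stf g f z) \<le> (K1 + K2) * (Q ^ n * fact n)" if "b \<in> Basis" for z b n
  proof -
    from that consider j where "j \<in> Basis" "b = (j, 0)" | j where "j \<in> Basis" "b = (0, j)"
      by (auto simp: Basis_prod_def)
    then show ?thesis
    proof cases
      case 1
      have q: "3 * (2 * (Q / 12) + 2 / (12 / Q)) = Q" using Q by (simp add: field_simps)
      show ?thesis
        using order.trans[OF stf_position_decay[OF R _ _ 1(1), of z n, unfolded q c_def[symmetric] K2_def[symmetric]] bd[of K2]] Q 1(2)
        by (simp add: inner_prod_def)
    next
      case 2
      have q: "3 * (Q / 3) = Q" by simp
      show ?thesis
        using order.trans[OF stf_frequency_decay[OF S _ _ 2(1), of z n, unfolded q c_def[symmetric] K1_def[symmetric]] bd[of K1]] Q 2(2)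
        by (simp add: inner_prod_def)
    qed
  qed
  then show ?thesis using K by (intro exI[of _ "K1 + K2"]) auto
qed

lemma continuous_compose_shift: "continuous_on UNIV g \<Longrightarrow> continuous_on UNIV (\<lambda>t. g (t - x))"
  for g :: "'a::real_normed_vector \<Rightarrow> 'b::topological_space"
  by (erule continuous_on_compose2) (auto intro!: continuous_intros)

text \<open>At fixed position \<open>stf\<close> is the Fourier transform of the function times a
  shifted window, so \<open>parseval\<close> in frequency removes both transforms. Integrating over
  the position then turns the shifted windows into the squared norm of \<open>g\<close>.\<close>

lemma moyal:
  fixes f g k :: "'a::euclidean_space \<Rightarrow> complex"
  assumes f: "f \<in> gelfand_shilov" and g: "g \<in> gelfand_shilov" and k: "k \<in> gelfand_shilov"
  shows "(LINT z|lborel. stf g f z * cnj (stf g k z)) = of_real (LINT t|lborel. (norm (g t))\<^sup>2) * l2_bracket f k"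
proof -
  obtain C where C: "0 \<le> C" "\<And>t. norm (f t) \<le> C * rho t ^ 2" "\<And>t. norm (g t) \<le> C * rho t ^ 2"
    "\<And>z. norm (stf g f z) \<le> C * (rho (fst z) * rho (snd z))" by (rule gs_bounds1[OF f g]) (rule that)
  obtain D where D: "0 \<le> D" "\<And>t. norm (k t) \<le> D * rho t ^ 2" "\<And>t. norm (g t) \<le> D * rho t ^ 2"
    "\<And>z. norm (stf g k z) \<le> D * (rho (fst z) * rho (snd z))" by (rule gs_bounds1[OF k g]) (rule that)
  note [measurable] = f[THEN gs_measurable] g[THEN gs_measurable] k[THEN gs_measurable]
  have bd: "norm (stf g f z * cnj (stf g k z)) \<le> (C * D) * (rho (fst z) * rho (snd z))" for z
  proof -
    have "norm (stf g f z * cnj (stf g k z)) \<le> (C * (rho (fst z) * rho (snd z))) * (D * (1 * 1))"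
      unfolding norm_mult complex_mod_cnj
    proof (rule mult_mono[OF C(4)])
      have "rho (fst z) * rho (snd z) \<le> 1 * 1" by (intro mult_mono rho_le_1) (auto simp: rho_nonneg)
      then show "norm (stf g k z) \<le> D * (1 * 1)" by (intro order.trans[OF D(4)] mult_left_mono D) auto
    qed (use C(1) rho_nonneg in \<open>auto intro!: mult_nonneg_nonneg\<close>)
    then show ?thesis by (simp add: ac_simps)
  qed
  have int: "integrable lborel (\<lambda>z. stf g f z * cnj (stf g k z))"
    by (rule integrable_rho_rho[OF _ bd]) measurable
  let ?F = "\<lambda>f x t. f t * cnj (g (t - x))"
  have Fint: "integrable lborel (?F f x)" "integrable lborel (?F k x)" for x
    by (rule integrable_rho_bound, measurable, rule product_decay[OF C(2,3)])
       (rule integrable_rho_bound, measurable, rule product_decay[OF D(2,3)])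
  have cont: "continuous_on UNIV f" "continuous_on UNIV g"
    using f g by (auto intro: smooth_continuous gelfand_shilov_smooth)
  have pars: "(LINT \<xi>|lborel. stf g f (x, \<xi>) * cnj (stf g k (x, \<xi>))) = (LINT t|lborel. ?F f x t * cnj (?F k x t))" for x
    unfolding stf_def fst_conv snd_conv
  proof (rule parseval[OF Fint(1) _ _ Fint(2)])
    show "continuous_on UNIV (?F f x)" using cont by (intro continuous_intros continuous_compose_shift)
    show "norm (?F f x t) \<le> C * C * 2 ^ DIM('a) * rho x * 1" for t
      by (rule order.trans[OF product_decay[OF C(2,3)] mult_left_mono[OF rho_le_1]]) (use C(1) rho_nonneg in \<open>auto intro!: mult_nonneg_nonneg\<close>)
    have "integrable lborel (\<lambda>\<xi>. stf g f (x, \<xi>) * cnj (stf g k (x, \<xi>)))"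
    proof (rule integrable_rho_bound)
      show "(\<lambda>\<xi>. stf g f (x, \<xi>) * cnj (stf g k (x, \<xi>))) \<in> borel_measurable borel"
        unfolding stf_def fst_conv snd_conv by measurable
      show "norm (stf g f (x, \<xi>) * cnj (stf g k (x, \<xi>))) \<le> (C * D * rho x) * rho \<xi>" for \<xi>
        using bd[of "(x, \<xi>)"] by (simp add: ac_simps)
    qed
    then show "integrable lborel (\<lambda>\<xi>. fourier (?F f x) \<xi> * cnj (fourier (?F k x) \<xi>))"
      unfolding stf_def fst_conv snd_conv .
  qed
  let ?G = "\<lambda>(x, t). ?F f x t * cnj (?F k x t)"
  have Gint: "integrable lborel ?G"
  proof (rule integrable_rho_rho[where C = "(C * C * 2 ^ DIM('a)) * (D * D * 2 ^ DIM('a))"])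
    show "?G \<in> borel_measurable borel" unfolding borel_prod[symmetric] by measurable
    fix z :: "'a \<times> 'a"
    obtain x t where z: "z = (x, t)" by (cases z)
    have "norm (?G z) \<le> (C * C * 2 ^ DIM('a) * rho x * rho t) * (D * D * 2 ^ DIM('a) * 1 * 1)"
      unfolding z prod.case norm_mult[of "?F f x t"] complex_mod_cnj
    proof (rule mult_mono)
      show "norm (?F f x t) \<le> C * C * 2 ^ DIM('a) * rho x * rho t" by (rule product_decay[OF C(2,3)])
      show "norm (?F k x t) \<le> D * D * 2 ^ DIM('a) * 1 * 1"
        by (rule order.trans[OF product_decay[OF D(2,3)]], intro mult_mono rho_le_1) (use D(1) rho_nonneg in \<open>auto intro!: mult_nonneg_nonneg\<close>)
    qed (use C(1) rho_nonneg in \<open>auto intro!: mult_nonneg_nonneg\<close>)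
    then show "norm (?G z) \<le> ((C * C * 2 ^ DIM('a)) * (D * D * 2 ^ DIM('a))) * (rho (fst z) * rho (snd z))"
      by (simp add: z ac_simps)
  qed
  have "(LINT z|lborel. stf g f z * cnj (stf g k z)) = (LINT x|lborel. LINT \<xi>|lborel. stf g f (x, \<xi>) * cnj (stf g k (x, \<xi>)))"
    by (rule lborel_integral_fst[OF int, symmetric])
  also have "\<dots> = (LINT x|lborel. LINT t|lborel. ?G (x, t))"
    by (simp add: pars)
  also have "\<dots> = (LINT t|lborel. LINT x|lborel. ?G (x, t))"
    using lborel_integral_fst[OF Gint] lborel_integral_snd[OF Gint] by simp
  also have "\<dots> = (LINT t|lborel. f t * cnj (k t) * of_real (LINT t|lborel. (norm (g t))\<^sup>2))"
  proof (intro Bochner_Integration.integral_cong refl)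
    fix t :: 'a
    have "(LINT x|lborel. ?G (x, t)) = (LINT x|lborel. f t * cnj (k t) * of_real ((norm (g (t - x)))\<^sup>2))"
      by (intro Bochner_Integration.integral_cong refl) (simp add: complex_norm_square ac_simps del: of_real_power)
    also have "\<dots> = f t * cnj (k t) * of_real (LINT x|lborel. (norm (g (t - x)))\<^sup>2)"
      by (simp only: integral_mult_right_zero integral_complex_of_real)
    also have "(LINT x|lborel. (norm (g (t - x)))\<^sup>2) = (LINT x|lborel. (norm (g x))\<^sup>2)"
      using lborel_integral_affine[of "\<lambda>x. (norm (g x))\<^sup>2" "- 1" t] by simp
    finally show "(LINT x|lborel. ?G (x, t)) = f t * cnj (k t) * of_real (LINT t|lborel. (norm (g t))\<^sup>2)" .
  qed
  finally show ?thesis by (simp only: l2_bracket_def integral_mult_left_zero mult.commute)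
qed

section \<open>The Wigner transform and the Weyl form\<close>

text \<open>The conjugate of \<open>wigner h f\<close>, which is what the bracket multiplies with
  the symbol; it is linear in \<open>f\<close> and antilinear in \<open>h\<close>.\<close>

definition wig :: "('a::euclidean_space \<Rightarrow> complex) \<Rightarrow> ('a \<Rightarrow> complex) \<Rightarrow> 'a \<times> 'a \<Rightarrow> complex"
  where "wig h f u = (LINT t|lborel. cnj (h (fst u + t /\<^sub>R 2)) * f (fst u - t /\<^sub>R 2) * cis (2 * pi * (t \<bullet> snd u)))"

lemma cnj_wigner: "cnj (wigner h f u) = wig h f u"
  unfolding wigner_def wig_def split_beta
  by (simp add: cis_cnj flip: Bochner_Integration.integral_cnj)

definition weyl_form :: "('a::euclidean_space \<times> 'a \<Rightarrow> complex) \<Rightarrow> ('a \<Rightarrow> complex) \<Rightarrow> ('a \<Rightarrow> complex) \<Rightarrow> complex"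
  where "weyl_form \<sigma> f h = (LINT u|lborel. \<sigma> u * wig h f u)"

lemma weyl_op_eq: "\<phi> \<in> gelfand_shilov \<Longrightarrow> weyl_op \<sigma> f \<phi> = weyl_form \<sigma> f (\<lambda>x. cnj (\<phi> x))"
  by (simp add: weyl_op_def weyl_form_def l2_bracket_def cnj_wigner)

text \<open>The substitution \<open>t = 2 (x - y)\<close> turns \<open>x - t / 2\<close> into
  \<open>y\<close> and \<open>x + t / 2\<close> into \<open>- (y - 2 x)\<close>, so that
  \<open>h\<close> becomes a reflected window shifted by \<open>2 x\<close>. The Jacobian gives
  \<open>2 ^ DIM('a)\<close>.\<close>

lemma wig_eq_stf:
  fixes f h :: "'a::euclidean_space \<Rightarrow> complex"
  assumes [measurable]: "f \<in> borel_measurable borel" "h \<in> borel_measurable borel"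
  shows "wig h f u = 2 ^ DIM('a) * cis (4 * pi * (fst u \<bullet> snd u)) * stf (\<lambda>x. h (- x)) f (2 *\<^sub>R u)"
proof -
  obtain x \<xi> where u: "u = (x, \<xi>)" by (cases u)
  let ?G = "\<lambda>t. cnj (h (x + t /\<^sub>R 2)) * f (x - t /\<^sub>R 2) * cis (2 * pi * (t \<bullet> \<xi>))"
  have "wig h f u = \<bar>- 2\<bar> ^ DIM('a) *\<^sub>R (LINT y|lborel. ?G (2 *\<^sub>R x + (- 2) *\<^sub>R y))"
    unfolding wig_def u fst_conv snd_conv by (rule lborel_integral_affine) auto
  also have "(LINT y|lborel. ?G (2 *\<^sub>R x + (- 2) *\<^sub>R y))
      = (LINT y|lborel. cis (4 * pi * (x \<bullet> \<xi>)) * (f y * cnj (h (- (y - fst (2 *\<^sub>R u)))) * cis (- (2 * pi * (snd (2 *\<^sub>R u) \<bullet> y)))))"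
  proof (intro Bochner_Integration.integral_cong refl)
    fix y :: 'a
    have a: "x + (2 *\<^sub>R x + (- 2) *\<^sub>R y) /\<^sub>R 2 = - (y - fst (2 *\<^sub>R u))" "x - (2 *\<^sub>R x + (- 2) *\<^sub>R y) /\<^sub>R 2 = y"
      by (simp_all add: u scaleR_diff_right) (simp add: scaleR_2)
    have b: "cis (2 * pi * ((2 *\<^sub>R x + (- 2) *\<^sub>R y) \<bullet> \<xi>)) = cis (4 * pi * (x \<bullet> \<xi>)) * cis (- (2 * pi * (snd (2 *\<^sub>R u) \<bullet> y)))"
      unfolding cis_mult by (simp add: u inner_diff_left inner_commute algebra_simps)
    show "?G (2 *\<^sub>R x + (- 2) *\<^sub>R y) = cis (4 * pi * (x \<bullet> \<xi>)) * (f y * cnj (h (- (y - fst (2 *\<^sub>R u)))) * cis (- (2 * pi * (snd (2 *\<^sub>R u) \<bullet> y))))"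
      unfolding a b by (simp only: ac_simps)
  qed
  also have "\<dots> = cis (4 * pi * (x \<bullet> \<xi>)) * stf (\<lambda>x. h (- x)) f (2 *\<^sub>R u)"
    unfolding stf_def fourier_def by (simp only: integral_mult_right_zero)
  finally show ?thesis by (simp add: u scaleR_conv_of_real mult.assoc)
qed

lemma norm_wig:
  fixes f h :: "'a::euclidean_space \<Rightarrow> complex"
  assumes "f \<in> borel_measurable borel" "h \<in> borel_measurable borel"
  shows "norm (wig h f u) = 2 ^ DIM('a) * norm (stf (\<lambda>x. h (- x)) f (2 *\<^sub>R u))"
  unfolding wig_eq_stf[OF assms] by (simp add: norm_mult norm_power)

lemma wig_measurable [measurable]:
  assumes [measurable]: "f \<in> borel_measurable borel" "h \<in> borel_measurable borel"
  shows "wig h f \<in> borel_measurable borel"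
proof -
  have "(\<lambda>u. LINT t|lborel. cnj (h (fst u + t /\<^sub>R 2)) * f (fst u - t /\<^sub>R 2) * cis (2 * pi * (t \<bullet> snd u))) \<in> borel_measurable (borel \<Otimes>\<^sub>M borel)"
    by measurable
  then show ?thesis unfolding borel_prod wig_def[abs_def] .
qed

lemma rho_double_le: "rho (2 *\<^sub>R x) \<le> rho x"
  unfolding rho_def
proof (intro prod_mono conjI)
  fix b :: 'a
  have "(x \<bullet> b)\<^sup>2 \<le> (2 *\<^sub>R x \<bullet> b)\<^sup>2" by (simp add: power_mult_distrib)
  then show "1 / (1 + (2 *\<^sub>R x \<bullet> b)\<^sup>2) \<le> 1 / (1 + (x \<bullet> b)\<^sup>2)" by (intro frac_le) auto
qed auto

lemma wig_bound:
  fixes f h :: "'a::euclidean_space \<Rightarrow> complex"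
  assumes f: "f \<in> gelfand_shilov" and h: "h \<in> gelfand_shilov"
  obtains C where "\<And>u. norm (wig h f u) \<le> C * (rho (fst u) * rho (snd u))"
proof -
  obtain C where C: "0 \<le> C" "\<And>t. norm (f t) \<le> C * rho t ^ 2" "\<And>t. norm (h (- t)) \<le> C * rho t ^ 2"
    "\<And>z. norm (stf (\<lambda>x. h (- x)) f z) \<le> C * (rho (fst z) * rho (snd z))"
    by (rule gs_bounds1[OF f gs_reflect[OF h]]) (rule that)
  have "norm (wig h f u) \<le> (2 ^ DIM('a) * C) * (rho (fst u) * rho (snd u))" for u
  proof -
    have "norm (stf (\<lambda>x. h (- x)) f (2 *\<^sub>R u)) \<le> C * (rho (fst (2 *\<^sub>R u)) * rho (snd (2 *\<^sub>R u)))" by (rule C)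
    also have "\<dots> \<le> C * (rho (fst u) * rho (snd u))"
      using C(1) by (intro mult_left_mono mult_mono) (auto simp: rho_nonneg rho_double_le)
    finally show ?thesis unfolding norm_wig[OF f[THEN gs_measurable] h[THEN gs_measurable]] by simp
  qed
  then show ?thesis by (rule that)
qed

lemma wig_integrable:
  assumes "f \<in> gelfand_shilov" "h \<in> gelfand_shilov"
  shows "integrable lborel (wig h f)"
proof -
  obtain C where C: "\<And>u. norm (wig h f u) \<le> C * (rho (fst u) * rho (snd u))" by (rule wig_bound[OF assms]) (rule that)
  show ?thesis by (rule integrable_rho_rho[OF _ C]) (intro wig_measurable gs_measurable assms)
qed

lemma l2_bracket_commute: "l2_bracket f k = cnj (l2_bracket k f)"
  unfolding l2_bracket_def by (simp add: mult.commute flip: Bochner_Integration.integral_cnj)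

text \<open>For fixed \<open>h\<close> and \<open>u\<close>, \<open>wig h F u\<close> is a constant
  times the bracket of \<open>F\<close> with one fixed test function, so Moyal's identity recovers
  it from its values at the shifts of \<open>g\<close>.\<close>

lemma wig_inversion:
  fixes f g h :: "'a::euclidean_space \<Rightarrow> complex"
  assumes f: "f \<in> gelfand_shilov" and g: "g \<in> gelfand_shilov" and h: "h \<in> gelfand_shilov"
  shows "(LINT z|lborel. stf g f z * wig h (tf_shift z g) u) = of_real (LINT t|lborel. (norm (g t))\<^sup>2) * wig h f u"
proof -
  let ?c = "2 ^ DIM('a) * cis (4 * pi * (fst u \<bullet> snd u))"
  let ?k = "tf_shift (2 *\<^sub>R u) (\<lambda>x. h (- x))"
  have k: "?k \<in> gelfand_shilov" by (intro gs_tf_shift gs_reflect h)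
  have w: "wig h F u = ?c * l2_bracket F ?k" if "F \<in> gelfand_shilov" for F
    unfolding wig_eq_stf[OF gs_measurable[OF that] gs_measurable[OF h]] stf_eq_bracket ..
  have "(LINT z|lborel. stf g f z * wig h (tf_shift z g) u) = (LINT z|lborel. ?c * (stf g f z * cnj (stf g ?k z)))"
    unfolding w[OF gs_tf_shift[OF g]] unfolding l2_bracket_commute[of _ ?k] unfolding stf_eq_bracket[of g ?k, symmetric]
    by (simp only: ac_simps)
  also have "\<dots> = ?c * (LINT z|lborel. stf g f z * cnj (stf g ?k z))" by (simp only: integral_mult_right_zero)
  also have "\<dots> = of_real (LINT t|lborel. (norm (g t))\<^sup>2) * wig h f u"
    unfolding moyal[OF f g k] w[OF f] by (simp only: ac_simps)
  finally show ?thesis .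
qed

text \<open>Composing time-frequency shifts costs only a phase, which disappears in the norm; what
  remains is a translation of the argument.\<close>

lemma norm_stf_shift:
  fixes f g :: "'a::euclidean_space \<Rightarrow> complex"
  assumes [measurable]: "f \<in> borel_measurable borel" "g \<in> borel_measurable borel"
  shows "norm (stf (tf_shift a g) (tf_shift z f) v) = norm (stf g f (v + a - z))"
proof -
  let ?F = "\<lambda>t. tf_shift z f t * cnj (tf_shift v (tf_shift a g) t)"
  have [measurable]: "tf_shift z f \<in> borel_measurable borel" "tf_shift v (tf_shift a g) \<in> borel_measurable borel"
    unfolding tf_shift_def split_beta by measurable
  have "stf (tf_shift a g) (tf_shift z f) v = (LINT t|lborel. ?F (t + fst z))"
    unfolding stf_eq_bracket l2_bracket_def by (rule lborel_integral_shift[symmetric]) measurable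
  also have "\<dots> = (LINT t|lborel. cis (2 * pi * ((snd z - snd v) \<bullet> fst z - snd a \<bullet> (fst z - fst v))) *
      (f t * cnj (tf_shift (v + a - z) g t)))"
  proof (intro Bochner_Integration.integral_cong refl)
    fix t
    have e: "t + fst z - fst v - fst a = t - fst (v + a - z)" "t + fst z - fst z = t" by simp_all
    have c: "cis (2 * pi * (snd z \<bullet> (t + fst z))) * (cis (- (2 * pi * (snd v \<bullet> (t + fst z)))) * cis (- (2 * pi * (snd a \<bullet> (t + fst z - fst v)))))
       = cis (2 * pi * ((snd z - snd v) \<bullet> fst z - snd a \<bullet> (fst z - fst v))) * cis (- (2 * pi * (snd (v + a - z) \<bullet> t)))"
      unfolding cis_mult by (rule arg_cong[where f = cis]) (simp add: inner_diff_left inner_diff_right inner_add_left inner_add_right algebra_simps)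
    have "?F (t + fst z) = (cis (2 * pi * (snd z \<bullet> (t + fst z))) * (cis (- (2 * pi * (snd v \<bullet> (t + fst z)))) * cis (- (2 * pi * (snd a \<bullet> (t + fst z - fst v))))))
        * (f (t + fst z - fst z) * cnj (g (t + fst z - fst v - fst a)))"
      unfolding tf_shift_def split_beta complex_cnj_mult cis_cnj by (simp only: ac_simps)
    also have "\<dots> = cis (2 * pi * ((snd z - snd v) \<bullet> fst z - snd a \<bullet> (fst z - fst v))) *
        (f t * cnj (tf_shift (v + a - z) g t))"
      unfolding c e unfolding tf_shift_def split_beta complex_cnj_mult cis_cnj by (simp only: ac_simps)
    finally show "?F (t + fst z) = cis (2 * pi * ((snd z - snd v) \<bullet> fst z - snd a \<bullet> (fst z - fst v))) *
        (f t * cnj (tf_shift (v + a - z) g t))" .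
  qed
  also have "\<dots> = cis (2 * pi * ((snd z - snd v) \<bullet> fst z - snd a \<bullet> (fst z - fst v))) * stf g f (v + a - z)"
    unfolding stf_eq_bracket l2_bracket_def by (simp only: integral_mult_right_zero)
  finally show ?thesis by (simp add: norm_mult)
qed

lemma reflect_tf_shift: "(\<lambda>x. tf_shift w h (- x)) = tf_shift (- w) (\<lambda>x. h (- x))"
  by (simp add: tf_shift_def split_beta fun_eq_iff algebra_simps)

text \<open>Reflection turns the shift of \<open>h\<close> by \<open>w\<close> into one by
  \<open>- w\<close>, so both shifts move the argument in the same direction. Only
  \<open>w + z\<close> matters, and the \<open>L1\<close> norm becomes independent of
  \<open>w\<close> and \<open>z\<close>.\<close>

lemma norm_wig_shift:
  fixes f h :: "'a::euclidean_space \<Rightarrow> complex"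
  assumes [measurable]: "f \<in> borel_measurable borel" "h \<in> borel_measurable borel"
  shows "norm (wig (tf_shift w h) (tf_shift z f) u) = 2 ^ DIM('a) * norm (stf (\<lambda>x. h (- x)) f (2 *\<^sub>R u - (w + z)))"
proof -
  have m: "tf_shift z f \<in> borel_measurable borel" "tf_shift w h \<in> borel_measurable borel"
    unfolding tf_shift_def split_beta by measurable
  have m': "(\<lambda>x. h (- x)) \<in> borel_measurable borel" by measurable
  show ?thesis unfolding norm_wig[OF m] reflect_tf_shift norm_stf_shift[OF assms(1) m'] by (simp add: algebra_simps)
qed

lemma rho_rho_integral: "(LINT z|lborel. rho (fst z) * rho (snd (z :: 'a::euclidean_space \<times> 'a))) = rho_int TYPE('a) ^ 2"
  and rho_rho_integrable: "integrable lborel (\<lambda>z :: 'a::euclidean_space \<times> 'a. rho (fst z) * rho (snd z))"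
proof -
  have m: "(\<lambda>z :: 'a \<times> 'a. rho (fst z) * rho (snd z)) \<in> borel_measurable borel"
    unfolding borel_prod[symmetric] by measurable
  show i: "integrable lborel (\<lambda>z :: 'a \<times> 'a. rho (fst z) * rho (snd z))"
    by (rule integrable_lborel_pairI[OF m integrable_rho rho_nonneg integrable_rho rho_nonneg]) (simp add: rho_nonneg abs_mult)
  show "(LINT z|lborel. rho (fst z) * rho (snd (z :: 'a \<times> 'a))) = rho_int TYPE('a) ^ 2"
    unfolding lborel_integral_fst[OF i, symmetric] by (simp add: power2_eq_square)
qed

lemma
  fixes f h :: "'a::euclidean_space \<Rightarrow> complex"
  assumes f: "gs_bound A B S f" and h: "gs_bound A B S' h" and AB: "0 < A" "0 < B"
  shows wig_shift_integrable: "integrable lborel (wig (tf_shift w h) (tf_shift z f))"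
    and wig_shift_L1: "(LINT u|lborel. norm (wig (tf_shift w h) (tf_shift z f) u)) \<le> cstf A B TYPE('a) * S * S' * rho_int TYPE('a) ^ 2"
proof -
  have [measurable]: "f \<in> borel_measurable borel" "h \<in> borel_measurable borel"
    using f h by (auto intro: smooth_measurable gs_bound_smooth)
  have h': "gs_bound A B S' (\<lambda>x. h (- x))" using h by (rule gs_bound_reflect)
  let ?V = "stf (\<lambda>x. h (- x)) f" let ?D = "DIM('a \<times> 'a)"
  note bd = stf_bound[OF f h' AB]
  have Vm: "?V \<in> borel_measurable borel" by measurable
  have Vi: "integrable lborel ?V" by (rule integrable_rho_rho[OF Vm bd])
  have Vn: "(LINT v|lborel. norm (?V v)) \<le> cstf A B TYPE('a) * S * S' * rho_int TYPE('a) ^ 2"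
    unfolding rho_rho_integral[symmetric] integral_mult_right_zero[symmetric]
    using Vi rho_rho_integrable bd by (intro integral_mono) auto
  have m: "tf_shift z f \<in> borel_measurable borel" "tf_shift w h \<in> borel_measurable borel"
    unfolding tf_shift_def split_beta by measurable
  have eq: "norm (wig (tf_shift w h) (tf_shift z f) u) = 2 ^ DIM('a) * norm (?V (- (w + z) + 2 *\<^sub>R u))" for u
    unfolding norm_wig_shift[OF \<open>f \<in> borel_measurable borel\<close> \<open>h \<in> borel_measurable borel\<close>] by (simp add: algebra_simps)
  have i: "integrable lborel (\<lambda>u. norm (?V (- (w + z) + 2 *\<^sub>R u)))"
    using lborel_integrable_affine[of "\<lambda>v. norm (?V v)" 2 "- (w + z)"] Vi Vm by auto
  then have "integrable lborel (\<lambda>u. norm (wig (tf_shift w h) (tf_shift z f) u))" unfolding eq by simp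
  then show "integrable lborel (wig (tf_shift w h) (tf_shift z f))"
    using wig_measurable[OF m] by (subst integrable_norm_iff[symmetric]) auto
  have "(LINT v|lborel. norm (?V v)) = \<bar>2\<bar> ^ ?D *\<^sub>R (LINT u|lborel. norm (?V (- (w + z) + 2 *\<^sub>R u)))"
    by (rule lborel_integral_affine) (use Vm in auto)
  \<comment> \<open>The doubled argument gives the Jacobian \<open>2 ^ DIM('a \<times> 'a)\<close>,
    which is more than the factor \<open>2 ^ DIM('a)\<close> in the norm of
    \<open>wig\<close>.\<close>
  moreover have "2 ^ DIM('a) * (LINT u|lborel. norm (?V (- (w + z) + 2 *\<^sub>R u)))
      \<le> 2 ^ ?D * (LINT u|lborel. norm (?V (- (w + z) + 2 *\<^sub>R u)))"
    by (intro mult_right_mono power_increasing integral_nonneg_AE) auto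
  ultimately have "(LINT u|lborel. norm (wig (tf_shift w h) (tf_shift z f) u)) \<le> (LINT v|lborel. norm (?V v))"
    unfolding eq by simp
  with Vn show "(LINT u|lborel. norm (wig (tf_shift w h) (tf_shift z f) u)) \<le> cstf A B TYPE('a) * S * S' * rho_int TYPE('a) ^ 2"
    by linarith
qed

lemma integrable_bounded_mult:
  fixes \<sigma> w :: "'a::euclidean_space \<Rightarrow> complex"
  assumes "\<sigma> \<in> borel_measurable borel" "\<And>u. norm (\<sigma> u) \<le> M" "integrable lborel w"
  shows "integrable lborel (\<lambda>u. \<sigma> u * w u)"
    and "(LINT u|lborel. norm (\<sigma> u * w u)) \<le> M * (LINT u|lborel. norm (w u))"
proof -
  have [measurable]: "w \<in> borel_measurable borel" using borel_measurable_integrable[OF assms(3)] by simp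
  have n: "norm (\<sigma> u * w u) \<le> M * norm (w u)" for u
    unfolding norm_mult using assms(2) by (intro mult_right_mono) auto
  have i: "integrable lborel (\<lambda>u. M * norm (w u))" using assms(3) by (intro integrable_mult_right integrable_norm)
  show int: "integrable lborel (\<lambda>u. \<sigma> u * w u)"
    by (rule Bochner_Integration.integrable_bound[OF i])
       (use assms(1) n order.trans[OF n abs_ge_self] in auto)
  have "(LINT u|lborel. norm (\<sigma> u * w u)) \<le> (LINT u|lborel. M * norm (w u))" using int i n by (intro integral_mono) auto
  then show "(LINT u|lborel. norm (\<sigma> u * w u)) \<le> M * (LINT u|lborel. norm (w u))" by simp
qed

lemma wig_tf_shift_measurable:
  assumes [measurable]: "g \<in> borel_measurable borel" "h \<in> borel_measurable borel"
  shows "(\<lambda>x. wig h (tf_shift (fst x) g) (snd x)) \<in> borel_measurable (borel \<Otimes>\<^sub>M borel)"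
proof -
  have "(\<lambda>x. LINT t|lborel. cnj (h (fst (snd x) + t /\<^sub>R 2)) * (cis (2 * pi * (snd (fst x) \<bullet> (fst (snd x) - t /\<^sub>R 2))) * g (fst (snd x) - t /\<^sub>R 2 - fst (fst x)))
      * cis (2 * pi * (t \<bullet> snd (snd x)))) \<in> borel_measurable ((borel \<Otimes>\<^sub>M borel) \<Otimes>\<^sub>M (borel \<Otimes>\<^sub>M borel))"
    by measurable
  then show ?thesis unfolding borel_prod wig_def tf_shift_def split_beta .
qed

lemma weyl_form_tf_shift_measurable:
  assumes [measurable]: "\<sigma> \<in> borel_measurable borel" "g \<in> borel_measurable borel" "h \<in> borel_measurable borel"
  shows "(\<lambda>z. weyl_form \<sigma> (tf_shift z g) h) \<in> borel_measurable borel"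
proof -
  note [measurable] = wig_tf_shift_measurable[OF assms(2,3)]
  have "(\<lambda>(z, u). \<sigma> u * wig h (tf_shift z g) u) \<in> borel_measurable (borel \<Otimes>\<^sub>M lborel)"
    unfolding split_beta by measurable
  then show ?thesis unfolding weyl_form_def by (rule lborel.borel_measurable_lebesgue_integral)
qed

text \<open>This is \<open>wig_inversion\<close> integrated against the symbol. Fubini applies
  because the \<open>L1\<close> norm of \<open>wig h (tf_shift z g)\<close> is bounded uniformly in
  \<open>z\<close> and \<open>stf g f\<close> is integrable.\<close>

lemma weyl_form_inversion:
  fixes f g h :: "'a::euclidean_space \<Rightarrow> complex"
  assumes \<sigma>: "\<sigma> \<in> borel_measurable borel" "\<And>u. norm (\<sigma> u) \<le> M"
    and f: "f \<in> gelfand_shilov" and g: "g \<in> gelfand_shilov" and h: "h \<in> gelfand_shilov"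
  shows "(LINT z|lborel. stf g f z * weyl_form \<sigma> (tf_shift z g) h) = of_real (LINT t|lborel. (norm (g t))\<^sup>2) * weyl_form \<sigma> f h"
proof -
  note [measurable] = \<sigma>(1) f[THEN gs_measurable] g[THEN gs_measurable] h[THEN gs_measurable]
  obtain S S' where S: "gs_bound 1 1 S g" "gs_bound 1 1 S' h" using g h gelfand_shilovD zero_less_one by metis
  let ?c = "cstf 1 1 TYPE('a) * S * S' * rho_int TYPE('a) ^ 2"
  have h0: "tf_shift 0 h = h" by (simp add: tf_shift_def split_beta fun_eq_iff)
  have wi: "integrable lborel (wig h (tf_shift z g))" and wn: "(LINT u|lborel. norm (wig h (tf_shift z g) u)) \<le> ?c" for z
    using wig_shift_integrable[OF S, of 0 z] wig_shift_L1[OF S, of 0 z] by (simp_all add: h0)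
  have M: "0 \<le> M" using order.trans[OF norm_ge_zero \<sigma>(2)] .
  let ?F = "\<lambda>(z, u). stf g f z * (\<sigma> u * wig h (tf_shift z g) u)"
  have Fm: "?F \<in> borel_measurable (lborel \<Otimes>\<^sub>M lborel)"
    using wig_tf_shift_measurable[OF gs_measurable[OF g] gs_measurable[OF h]] by (simp add: split_beta) measurable
  have nm: "(LINT u|lborel. norm (?F (z, u))) \<le> norm (stf g f z) * (M * ?c)" for z
  proof -
    have "(LINT u|lborel. norm (?F (z, u))) = norm (stf g f z) * (LINT u|lborel. norm (\<sigma> u * wig h (tf_shift z g) u))"
      by (simp only: prod.case norm_mult[of "stf g f z"] integral_mult_right_zero)
    also have "\<dots> \<le> norm (stf g f z) * (M * (LINT u|lborel. norm (wig h (tf_shift z g) u)))"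
      by (intro mult_left_mono integrable_bounded_mult(2)[OF \<sigma> wi]) auto
    also have "\<dots> \<le> norm (stf g f z) * (M * ?c)" using M wn by (intro mult_left_mono) auto
    finally show ?thesis .
  qed
  have int: "integrable (lborel \<Otimes>\<^sub>M lborel) ?F"
  proof (rule lborel_pair.Fubini_integrable[OF Fm])
    show "AE z in lborel. integrable lborel (\<lambda>u. ?F (z, u))"
      using integrable_bounded_mult(1)[OF \<sigma> wi] by auto
    show "integrable lborel (\<lambda>z. LINT u|lborel. norm (?F (z, u)))"
    proof (rule Bochner_Integration.integrable_bound)
      show "integrable lborel (\<lambda>z. norm (stf g f z) * (M * ?c))"
        using stf_integrable[OF f g] by auto
      show "(\<lambda>z. LINT u|lborel. norm (?F (z, u))) \<in> borel_measurable lborel"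
        using Fm by measurable
      show "AE z in lborel. norm (LINT u|lborel. norm (?F (z, u))) \<le> norm (norm (stf g f z) * (M * ?c))"
      proof (rule AE_I2)
        fix z
        have "0 \<le> (LINT u|lborel. norm (?F (z, u)))" by (intro integral_nonneg_AE) auto
        then show "norm (LINT u|lborel. norm (?F (z, u))) \<le> norm (norm (stf g f z) * (M * ?c))"
          using nm[of z] by (simp only: real_norm_def)
      qed
    qed
  qed
  have "(LINT z|lborel. stf g f z * weyl_form \<sigma> (tf_shift z g) h) = (LINT z|lborel. LINT u|lborel. ?F (z, u))"
    unfolding weyl_form_def prod.case by (simp only: integral_mult_right_zero)
  also have "\<dots> = (LINT u|lborel. LINT z|lborel. ?F (z, u))"
    using int unfolding lborel_prod by (simp only: lborel_integral_fst lborel_integral_snd)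
  also have "\<dots> = (LINT u|lborel. of_real (LINT t|lborel. (norm (g t))\<^sup>2) * (\<sigma> u * wig h f u))"
  proof (intro Bochner_Integration.integral_cong refl)
    fix u :: "'a \<times> 'a"
    have "(LINT z|lborel. ?F (z, u)) = (LINT z|lborel. \<sigma> u * (stf g f z * wig h (tf_shift z g) u))"
      unfolding prod.case by (simp only: ac_simps)
    then show "(LINT z|lborel. ?F (z, u)) = of_real (LINT t|lborel. (norm (g t))\<^sup>2) * (\<sigma> u * wig h f u)"
      by (simp only: integral_mult_right_zero wig_inversion[OF f g h] mult.left_commute)
  qed
  finally show ?thesis unfolding weyl_form_def by (simp only: integral_mult_right_zero)
qed

section \<open>Almost diagonalisation of Weyl operators\<close>

definition wig_integrand ::
    "('a::euclidean_space \<Rightarrow> complex) \<Rightarrow> ('a \<Rightarrow> complex) \<Rightarrow> 'a \<times> 'a \<Rightarrow> 'a \<Rightarrow> complex"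
  where "wig_integrand h f u t = cnj (h (fst u + t /\<^sub>R 2)) * f (fst u - t /\<^sub>R 2) * cis (2 * pi * (t \<bullet> snd u))"

lemma wig_eq_integrand: "wig h f u = (LINT t|lborel. wig_integrand h f u t)"
  by (simp add: wig_def wig_integrand_def)

lemma wig_integrand_measurable [measurable]:
  assumes [measurable]: "f \<in> borel_measurable borel" "h \<in> borel_measurable borel"
  shows "wig_integrand h f u \<in> borel_measurable borel"
  unfolding wig_integrand_def[abs_def] by measurable

text \<open>The arguments of \<open>h\<close> and \<open>f\<close> differ by \<open>t\<close>, so
  their decay yields decay in \<open>t\<close> uniformly in \<open>u\<close>. This is the majorant
  for differentiating \<open>wig\<close> under the integral.\<close>

lemma wig_integrand_bound:
  fixes f h :: "'a::euclidean_space \<Rightarrow> complex"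
  assumes f: "f \<in> gelfand_shilov" and h: "h \<in> gelfand_shilov"
  obtains K where "\<And>u t. norm (wig_integrand h f u t) \<le> K * rho t"
proof -
  obtain C where C: "0 \<le> C" "\<And>t. norm (f t) \<le> C * rho t ^ 2" "\<And>t. norm (h t) \<le> C * rho t ^ 2"
    "\<And>z. norm (stf h f z) \<le> C * (rho (fst z) * rho (snd z))"
    by (rule gs_bounds1[OF f h]) (rule that)
  have "norm (wig_integrand h f u t) \<le> (C * C * 2 ^ DIM('a)) * rho t" for u t
  proof -
    let ?a = "fst u - t /\<^sub>R 2" let ?b = "fst u + t /\<^sub>R 2"
    have ab: "?b - ?a = t" by (simp flip: scaleR_add_left)
    have r: "rho ?b * rho ?a \<le> 2 ^ DIM('a) * rho t"
    proof -
      have "?b - t = ?a" using ab by (simp only: diff_eq_eq add.commute)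
      then show ?thesis using rho_shift_le[of ?b t] by (simp only:)
    qed
    have "norm (wig_integrand h f u t) = norm (h ?b) * norm (f ?a)"
      by (simp add: wig_integrand_def norm_mult)
    also have "\<dots> \<le> (C * rho ?b ^ 2) * (C * rho ?a ^ 2)"
      using C by (intro mult_mono) (auto intro!: mult_nonneg_nonneg)
    also have "\<dots> = C * C * ((rho ?b * rho ?a) * (rho ?b * rho ?a))" by (simp add: power2_eq_square)
    also have "\<dots> \<le> C * C * ((2 ^ DIM('a) * rho t) * (1 * 1))"
      using C(1) by (intro mult_left_mono mult_mono r rho_le_1) (auto intro!: mult_nonneg_nonneg rho_nonneg)
    finally show ?thesis by (simp add: ac_simps)
  qed
  then show ?thesis by (rule that)
qed

lemma wig_integrand_integrable:
  assumes "f \<in> gelfand_shilov" "h \<in> gelfand_shilov"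
  shows "integrable lborel (wig_integrand h f u)"
proof -
  obtain K where K: "\<And>u t. norm (wig_integrand h f u t) \<le> K * rho t"
    by (rule wig_integrand_bound[OF assms]) (rule that)
  show ?thesis by (rule integrable_rho_bound[OF _ K]) (intro wig_integrand_measurable gs_measurable assms)
qed

lemma wig_has_derivative_x:
  fixes f h :: "'a::euclidean_space \<Rightarrow> complex"
  assumes f: "f \<in> gelfand_shilov" and h: "h \<in> gelfand_shilov" and j: "j \<in> Basis"
  shows "((\<lambda>s. wig h f (u + s *\<^sub>R (j, 0))) has_vector_derivative
    wig (partial_deriv j h) f (u + s *\<^sub>R (j, 0)) + wig h (partial_deriv j f) (u + s *\<^sub>R (j, 0))) (at s)"
proof -
  have f': "partial_deriv j f \<in> gelfand_shilov" and h': "partial_deriv j h \<in> gelfand_shilov"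
    using f h j by (auto intro: gs_partial_deriv)
  note [measurable] = f[THEN gs_measurable] h[THEN gs_measurable] f'[THEN gs_measurable] h'[THEN gs_measurable]
  obtain K where K: "\<And>u t. norm (wig_integrand (partial_deriv j h) f u t) \<le> K * rho t"
    by (rule wig_integrand_bound[OF f h']) (rule that)
  obtain L where L: "\<And>u t. norm (wig_integrand h (partial_deriv j f) u t) \<le> L * rho t"
    by (rule wig_integrand_bound[OF f' h]) (rule that)
  let ?u = "\<lambda>s. u + s *\<^sub>R (j, 0)"
  have "((\<lambda>s. LINT t|lborel. wig_integrand h f (?u s) t) has_vector_derivative
      (LINT t|lborel. wig_integrand (partial_deriv j h) f (?u s) t + wig_integrand h (partial_deriv j f) (?u s) t)) (at s)"
  proof (rule has_vector_derivative_integral)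
    fix s t
    show "norm (wig_integrand (partial_deriv j h) f (?u s) t + wig_integrand h (partial_deriv j f) (?u s) t) \<le> (K + L) * rho t"
      using K[of "?u s" t] L[of "?u s" t] by (intro order.trans[OF norm_triangle_ineq]) (simp add: algebra_simps)
    have 1: "((\<lambda>s. cnj (h (fst u + t /\<^sub>R 2 + s *\<^sub>R j))) has_vector_derivative cnj (partial_deriv j h (fst u + t /\<^sub>R 2 + s *\<^sub>R j))) (at s)"
      by (rule bounded_linear.has_vector_derivative[OF bounded_linear_cnj has_vector_derivative_line[OF smooth_differentiable[OF gelfand_shilov_smooth[OF h]]]])
    have 2: "((\<lambda>s. f (fst u - t /\<^sub>R 2 + s *\<^sub>R j)) has_vector_derivative partial_deriv j f (fst u - t /\<^sub>R 2 + s *\<^sub>R j)) (at s)"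
      by (rule has_vector_derivative_line[OF smooth_differentiable[OF gelfand_shilov_smooth[OF f]]])
    from has_vector_derivative_mult[OF has_vector_derivative_mult[OF 1 2] has_vector_derivative_const[of "cis (2 * pi * (t \<bullet> snd u))"]]
    show "((\<lambda>s. wig_integrand h f (?u s) t) has_vector_derivative
        (wig_integrand (partial_deriv j h) f (?u s) t + wig_integrand h (partial_deriv j f) (?u s) t)) (at s)"
      unfolding wig_integrand_def by (simp add: algebra_simps)
  qed (use wig_integrand_integrable[OF f h] integrable_rho in \<open>auto simp: integrable_mult_right\<close>)
  then show ?thesis
    unfolding wig_eq_integrand
    using wig_integrand_integrable[OF f h'] wig_integrand_integrable[OF f' h] by simp
qed

lemma wig_has_derivative_xi:
  fixes f h :: "'a::euclidean_space \<Rightarrow> complex"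
  assumes f: "f \<in> gelfand_shilov" and h: "h \<in> gelfand_shilov" and j: "j \<in> Basis"
  shows "((\<lambda>s. wig h f (u + s *\<^sub>R (0, j))) has_vector_derivative
    (2 * of_real pi * \<i>) * (wig (mult_coord j h) f (u + s *\<^sub>R (0, j)) + (- 1) * wig h (mult_coord j f) (u + s *\<^sub>R (0, j)))) (at s)"
proof -
  have f': "mult_coord j f \<in> gelfand_shilov" and h': "mult_coord j h \<in> gelfand_shilov"
    using f h j by (auto intro: gs_mult_coord)
  note [measurable] = f[THEN gs_measurable] h[THEN gs_measurable] f'[THEN gs_measurable] h'[THEN gs_measurable]
  obtain K where K: "\<And>u t. norm (wig_integrand (mult_coord j h) f u t) \<le> K * rho t"
    by (rule wig_integrand_bound[OF f h']) (rule that)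
  obtain L where L: "\<And>u t. norm (wig_integrand h (mult_coord j f) u t) \<le> L * rho t"
    by (rule wig_integrand_bound[OF f' h]) (rule that)
  let ?u = "\<lambda>s. u + s *\<^sub>R (0, j)" let ?c = "2 * of_real pi * \<i> :: complex"
  let ?D = "\<lambda>s t. ?c * (wig_integrand (mult_coord j h) f (?u s) t + (- 1) * wig_integrand h (mult_coord j f) (?u s) t)"
  have "((\<lambda>s. LINT t|lborel. wig_integrand h f (?u s) t) has_vector_derivative (LINT t|lborel. ?D s t)) (at s)"
  proof (rule has_vector_derivative_integral)
    fix s t
    have "norm (?D s t) \<le> (2 * pi) * (norm (wig_integrand (mult_coord j h) f (?u s) t) + norm (wig_integrand h (mult_coord j f) (?u s) t))"
      using norm_triangle_ineq4[of "wig_integrand (mult_coord j h) f (?u s) t" "wig_integrand h (mult_coord j f) (?u s) t"]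
      by (simp add: norm_mult)
    also have "\<dots> \<le> (2 * pi) * (K * rho t + L * rho t)"
      by (intro mult_left_mono add_mono K L) auto
    finally show "norm (?D s t) \<le> (2 * pi * (K + L)) * rho t" by (simp add: algebra_simps)
    let ?A = "cnj (h (fst u + t /\<^sub>R 2)) * f (fst u - t /\<^sub>R 2) * cis (2 * pi * (t \<bullet> snd u))"
    let ?p = "2 * pi * (t \<bullet> j)"
    have "((\<lambda>s. ?A * cis (?p \<bullet> s)) has_derivative (\<lambda>y. ?A * (\<i> * of_real (?p \<bullet> y) * cis (?p \<bullet> s)))) (at s)"
      by (intro has_derivative_mult_right has_derivative_cis_inner)
    moreover have "wig_integrand h f (?u s) t = ?A * cis (?p \<bullet> s)" for s
      unfolding wig_integrand_def mult.assoc cis_mult by (simp add: inner_add_right algebra_simps)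
    moreover have "?D s t = \<i> * of_real ?p * (?A * cis (?p \<bullet> s))"
    proof -
      \<comment> \<open>The factor \<open>t \<bullet> j\<close> from the exponential is the
        difference of the coordinates of the two arguments, so it distributes over \<open>h\<close>
        and \<open>f\<close>.\<close>
      have tj: "t \<bullet> j = (fst u + t /\<^sub>R 2) \<bullet> j - (fst u - t /\<^sub>R 2) \<bullet> j"
        by (simp add: inner_add_left inner_diff_left)
      have "?D s t = \<i> * of_real ?p * wig_integrand h f (?u s) t"
        unfolding wig_integrand_def mult_coord_def tj by (simp add: algebra_simps)
      then show ?thesis by (simp only: calculation(2))
    qed
    ultimately show "((\<lambda>s. wig_integrand h f (?u s) t) has_vector_derivative ?D s t) (at s)"
      unfolding has_vector_derivative_def by (simp add: scaleR_conv_of_real ac_simps)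
  qed (use wig_integrand_integrable[OF f h] integrable_rho in \<open>auto simp: integrable_mult_right\<close>)
  then show ?thesis
    unfolding wig_eq_integrand
    using wig_integrand_integrable[OF f h'] wig_integrand_integrable[OF f' h] by simp
qed

lemma wig_continuous_line_x:
  assumes "f \<in> gelfand_shilov" "h \<in> gelfand_shilov" "j \<in> Basis"
  shows "continuous_on UNIV (\<lambda>s. wig h f (u + s *\<^sub>R (j, 0)))"
  using has_vector_derivative_continuous[OF wig_has_derivative_x[OF assms]]
  by (simp add: continuous_at_imp_continuous_on)

lemma wig_continuous_line_xi:
  assumes "f \<in> gelfand_shilov" "h \<in> gelfand_shilov" "j \<in> Basis"
  shows "continuous_on UNIV (\<lambda>s. wig h f (u + s *\<^sub>R (0, j)))"
  using has_vector_derivative_continuous[OF wig_has_derivative_xi[OF assms]]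
  by (simp add: continuous_at_imp_continuous_on)

text \<open>The directional derivative of \<open>\<sigma> * w\<close> integrates to zero. The symbol
  is only bounded, so integrability comes from \<open>w\<close> and \<open>w'\<close>.\<close>

lemma symbol_integration_by_parts:
  fixes \<sigma> w w' :: "'a::euclidean_space \<Rightarrow> complex"
  assumes \<sigma>: "smooth \<sigma>" "b \<in> Basis" "\<And>u. norm (\<sigma> u) \<le> M" "\<And>u. norm (partial_deriv b \<sigma> u) \<le> M'"
    and w: "integrable lborel w" "integrable lborel w'"
    and der: "\<And>u s. ((\<lambda>s. w (u + s *\<^sub>R b)) has_vector_derivative w' (u + s *\<^sub>R b)) (at s)"
    and cont: "\<And>u. continuous_on UNIV (\<lambda>s. w' (u + s *\<^sub>R b))"
  shows "(LINT u|lborel. partial_deriv b \<sigma> u * w u) + (LINT u|lborel. \<sigma> u * w' u) = 0"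
proof -
  have sm: "smooth (partial_deriv b \<sigma>)" using \<sigma> by (intro smooth_partial_deriv)
  note [measurable] = smooth_measurable[OF \<sigma>(1)] smooth_measurable[OF sm]
  note i = integrable_bounded_mult(1)[OF smooth_measurable[OF \<sigma>(1)] \<sigma>(3)]
  note i' = integrable_bounded_mult(1)[OF smooth_measurable[OF sm] \<sigma>(4)]
  have "(LINT u|lborel. partial_deriv b \<sigma> u * w u + \<sigma> u * w' u) = 0"
  proof (rule integral_directional_derivative[where f = "\<lambda>u. \<sigma> u * w u" and b = b])
    show "integrable lborel (\<lambda>u. \<sigma> u * w u)" "integrable lborel (\<lambda>u. partial_deriv b \<sigma> u * w u + \<sigma> u * w' u)"
      by (intro Bochner_Integration.integrable_add i i' w)+
    fix u s
    show "((\<lambda>s. \<sigma> (u + s *\<^sub>R b) * w (u + s *\<^sub>R b)) has_vector_derivative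
        (partial_deriv b \<sigma> (u + s *\<^sub>R b) * w (u + s *\<^sub>R b) + \<sigma> (u + s *\<^sub>R b) * w' (u + s *\<^sub>R b))) (at s)"
      using has_vector_derivative_mult[OF has_vector_derivative_line[OF smooth_differentiable[OF \<sigma>(1)]] der]
      by (simp add: add.commute)
    have l: "continuous_on UNIV (\<lambda>s. u + s *\<^sub>R b)" by (intro continuous_intros)
    have 1: "continuous_on UNIV (\<lambda>s. partial_deriv b \<sigma> (u + s *\<^sub>R b))" "continuous_on UNIV (\<lambda>s. \<sigma> (u + s *\<^sub>R b))"
      by (rule continuous_on_compose2[OF smooth_continuous[OF sm] l], simp)
         (rule continuous_on_compose2[OF smooth_continuous[OF \<sigma>(1)] l], simp)
    have 2: "continuous_on UNIV (\<lambda>s. w (u + s *\<^sub>R b))"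
      using has_vector_derivative_continuous[OF der] by (simp add: continuous_at_imp_continuous_on)
    show "continuous_on UNIV (\<lambda>s. partial_deriv b \<sigma> (u + s *\<^sub>R b) * w (u + s *\<^sub>R b) + \<sigma> (u + s *\<^sub>R b) * w' (u + s *\<^sub>R b))"
      by (intro continuous_on_add continuous_on_mult 1 2 cont)
  qed
  then show ?thesis
    by (simp only: Bochner_Integration.integral_add[OF i'[OF w(1)] i[OF w(2)]])
qed

context
  fixes \<sigma> :: "'a::euclidean_space \<times> 'a \<Rightarrow> complex" and M :: real
  assumes \<sigma>: "\<sigma> \<in> borel_measurable borel" "\<And>u. norm (\<sigma> u) \<le> M"
begin

lemma wig_add_right:
  assumes "f \<in> gelfand_shilov" "k \<in> gelfand_shilov" "h \<in> gelfand_shilov"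
  shows "wig h (\<lambda>t. f t + c * k t) u = wig h f u + c * wig h k u"
proof -
  have "wig h (\<lambda>t. f t + c * k t) u = (LINT t|lborel. wig_integrand h f u t + c * wig_integrand h k u t)"
    unfolding wig_eq_integrand
    by (intro Bochner_Integration.integral_cong refl) (simp add: wig_integrand_def algebra_simps)
  then show ?thesis
    unfolding wig_eq_integrand by (simp add: wig_integrand_integrable assms)
qed

lemma wig_add_left:
  assumes "f \<in> gelfand_shilov" "k \<in> gelfand_shilov" "h \<in> gelfand_shilov"
  shows "wig (\<lambda>t. h t + c * k t) f u = wig h f u + cnj c * wig k f u"
proof -
  have "wig (\<lambda>t. h t + c * k t) f u = (LINT t|lborel. wig_integrand h f u t + cnj c * wig_integrand k f u t)"
    unfolding wig_eq_integrand
    by (intro Bochner_Integration.integral_cong refl) (simp add: wig_integrand_def algebra_simps)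
  then show ?thesis
    unfolding wig_eq_integrand by (simp add: wig_integrand_integrable assms)
qed

lemma weyl_form_linear:
  assumes w: "integrable lborel w" "integrable lborel w'" and eq: "\<And>u. W u = w u + c * w' u"
  shows "(LINT u|lborel. \<sigma> u * W u) = (LINT u|lborel. \<sigma> u * w u) + c * (LINT u|lborel. \<sigma> u * w' u)"
proof -
  note i = integrable_bounded_mult(1)[OF \<sigma>]
  have "(LINT u|lborel. \<sigma> u * W u) = (LINT u|lborel. \<sigma> u * w u + c * (\<sigma> u * w' u))"
    by (simp add: eq algebra_simps)
  also have "\<dots> = (LINT u|lborel. \<sigma> u * w u) + (LINT u|lborel. c * (\<sigma> u * w' u))"
    by (intro Bochner_Integration.integral_add i w integrable_mult_right)
  finally show ?thesis by (simp only: integral_mult_right_zero)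
qed

lemma weyl_form_add_right:
  assumes "f \<in> gelfand_shilov" "k \<in> gelfand_shilov" "h \<in> gelfand_shilov"
  shows "weyl_form \<sigma> (\<lambda>t. f t + c * k t) h = weyl_form \<sigma> f h + c * weyl_form \<sigma> k h"
  unfolding weyl_form_def by (rule weyl_form_linear) (intro wig_integrable wig_add_right assms)+

lemma weyl_form_add_left:
  assumes "f \<in> gelfand_shilov" "k \<in> gelfand_shilov" "h \<in> gelfand_shilov"
  shows "weyl_form \<sigma> f (\<lambda>t. h t + c * k t) = weyl_form \<sigma> f h + cnj c * weyl_form \<sigma> f k"
  unfolding weyl_form_def by (rule weyl_form_linear) (intro wig_integrable wig_add_left assms)+

end

section \<open>Commutation relations for the Weyl form\<close>

lemma mult_coord_tf_shift:
  "mult_coord j (tf_shift z f) = (\<lambda>t. tf_shift z (mult_coord j f) t + of_real (fst z \<bullet> j) * tf_shift z f t)"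
  by (simp add: mult_coord_def tf_shift_def split_beta fun_eq_iff algebra_simps)

lemma partial_deriv_tf_shift:
  assumes f: "smooth f" and j: "j \<in> Basis"
  shows "partial_deriv j (tf_shift z f)
    = (\<lambda>t. tf_shift z (partial_deriv j f) t + (\<i> * of_real (2 * pi * (snd z \<bullet> j))) * tf_shift z f t)"
proof
  fix t
  let ?\<xi> = "(2 * pi) *\<^sub>R snd z"
  have "(tf_shift z f has_derivative (\<lambda>y. cis (?\<xi> \<bullet> t) * frechet_derivative (translate (fst z) f) (at t) y
      + (\<i> * of_real (?\<xi> \<bullet> y) * cis (?\<xi> \<bullet> t)) * translate (fst z) f t)) (at t)"
    unfolding tf_shift_eq modulate_def
    by (intro has_derivative_mult has_derivative_cis_inner smooth_has_derivative smooth_translate f)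
  from partial_deriv_eq[OF this, of j]
  have "partial_deriv j (tf_shift z f) t = cis (?\<xi> \<bullet> t) * partial_deriv j (translate (fst z) f) t
      + (\<i> * of_real (?\<xi> \<bullet> j) * cis (?\<xi> \<bullet> t)) * translate (fst z) f t"
    by (simp only: partial_deriv_def)
  then show "partial_deriv j (tf_shift z f) t
    = tf_shift z (partial_deriv j f) t + (\<i> * of_real (2 * pi * (snd z \<bullet> j))) * tf_shift z f t"
    unfolding partial_deriv_translate[OF f] unfolding tf_shift_eq modulate_def translate_def by (simp add: algebra_simps)
qed

context
  fixes \<sigma> :: "'a::euclidean_space \<times> 'a \<Rightarrow> complex" and M M' :: real and f h :: "'a \<Rightarrow> complex" and j :: 'a
  assumes \<sigma>: "smooth \<sigma>" "\<And>u. norm (\<sigma> u) \<le> M"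
    and f: "f \<in> gelfand_shilov" and h: "h \<in> gelfand_shilov" and j: "j \<in> Basis"
begin

text \<open>Integration by parts moves the position derivative of \<open>\<sigma>\<close> onto the
  shifted functions. Commuting it with the shifts leaves the frequencies of \<open>w\<close> and
  \<open>z\<close> as factors, which antilinearity in \<open>h\<close> gives opposite signs.\<close>

lemma weyl_form_partial_deriv:
  assumes \<sigma>': "\<And>u. norm (partial_deriv (j, 0) \<sigma> u) \<le> M'"
  shows "(\<i> * of_real (2 * pi * ((w - z) \<bullet> (0, j)))) * weyl_form \<sigma> (tf_shift z f) (tf_shift w h)
    = weyl_form (partial_deriv (j, 0) \<sigma>) (tf_shift z f) (tf_shift w h)
      + weyl_form \<sigma> (tf_shift z (partial_deriv j f)) (tf_shift w h)
      + weyl_form \<sigma> (tf_shift z f) (tf_shift w (partial_deriv j h))"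
proof -
  let ?f = "tf_shift z f" let ?h = "tf_shift w h"
  have b: "(j, 0) \<in> Basis" using j by (simp add: Basis_prod_def)
  note gs = gs_tf_shift[OF f, of z] gs_tf_shift[OF h, of w]
    gs_tf_shift[OF gs_partial_deriv[OF f j], of z] gs_tf_shift[OF gs_partial_deriv[OF h j], of w]
    gs_partial_deriv[OF gs_tf_shift[OF f] j, of z] gs_partial_deriv[OF gs_tf_shift[OF h] j, of w]
  have m: "\<sigma> \<in> borel_measurable borel" using \<sigma>(1) by (rule smooth_measurable)
  have "weyl_form (partial_deriv (j, 0) \<sigma>) ?f ?h
      + (LINT u|lborel. \<sigma> u * (wig (partial_deriv j ?h) ?f u + wig ?h (partial_deriv j ?f) u)) = 0"
    unfolding weyl_form_def
    by (rule symbol_integration_by_parts[OF \<sigma>(1) b \<sigma>(2) \<sigma>' wig_integrable[OF gs(1,2)] _ wig_has_derivative_x[OF gs(1,2) j]])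
       (intro Bochner_Integration.integrable_add wig_integrable gs continuous_on_add wig_continuous_line_x j)+
  moreover have "(LINT u|lborel. \<sigma> u * (wig (partial_deriv j ?h) ?f u + wig ?h (partial_deriv j ?f) u))
      = weyl_form \<sigma> ?f (partial_deriv j ?h) + 1 * weyl_form \<sigma> (partial_deriv j ?f) ?h"
    unfolding weyl_form_def by (rule weyl_form_linear[OF m \<sigma>(2)]) (auto intro: wig_integrable gs)
  moreover have "weyl_form \<sigma> ?f (partial_deriv j ?h) = weyl_form \<sigma> ?f (tf_shift w (partial_deriv j h))
      + cnj (\<i> * of_real (2 * pi * (snd w \<bullet> j))) * weyl_form \<sigma> ?f ?h"
    unfolding partial_deriv_tf_shift[OF gelfand_shilov_smooth[OF h] j] by (rule weyl_form_add_left[OF m \<sigma>(2)]) (rule gs)+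
  moreover have "weyl_form \<sigma> (partial_deriv j ?f) ?h = weyl_form \<sigma> (tf_shift z (partial_deriv j f)) ?h
      + (\<i> * of_real (2 * pi * (snd z \<bullet> j))) * weyl_form \<sigma> ?f ?h"
    unfolding partial_deriv_tf_shift[OF gelfand_shilov_smooth[OF f] j] by (rule weyl_form_add_right[OF m \<sigma>(2)]) (rule gs)+
  ultimately have "weyl_form (partial_deriv (j, 0) \<sigma>) ?f ?h + weyl_form \<sigma> (tf_shift z (partial_deriv j f)) ?h
      + weyl_form \<sigma> ?f (tf_shift w (partial_deriv j h))
      = (- cnj (\<i> * of_real (2 * pi * (snd w \<bullet> j))) - \<i> * of_real (2 * pi * (snd z \<bullet> j))) * weyl_form \<sigma> ?f ?h"
    by algebra
  moreover have "- cnj (\<i> * of_real (2 * pi * (snd w \<bullet> j))) - \<i> * of_real (2 * pi * (snd z \<bullet> j))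
      = \<i> * of_real (2 * pi * ((w - z) \<bullet> (0, j)))"
    by (simp add: inner_prod_def inner_diff_left algebra_simps)
  ultimately show ?thesis by (simp only:)
qed

text \<open>Dual to \<open>weyl_form_partial_deriv\<close>: a frequency derivative of the symbol
  becomes coordinate multiplication, and commutation leaves the positions of \<open>w\<close> and
  \<open>z\<close>. The coefficient \<open>\<i> / (2 * pi)\<close> inverts the factor
  \<open>- 2 * pi * \<i>\<close> from differentiating the Wigner transform.\<close>

lemma weyl_form_mult_coord:
  assumes \<sigma>': "\<And>u. norm (partial_deriv (0, j) \<sigma> u) \<le> M'"
  shows "of_real ((w - z) \<bullet> (j, 0)) * weyl_form \<sigma> (tf_shift z f) (tf_shift w h)
    = (\<i> / of_real (2 * pi)) * weyl_form (partial_deriv (0, j) \<sigma>) (tf_shift z f) (tf_shift w h)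
      + weyl_form \<sigma> (tf_shift z (mult_coord j f)) (tf_shift w h)
      - weyl_form \<sigma> (tf_shift z f) (tf_shift w (mult_coord j h))"
proof -
  let ?f = "tf_shift z f" let ?h = "tf_shift w h" let ?c = "2 * of_real pi * \<i> :: complex"
  have b: "(0, j) \<in> Basis" using j by (simp add: Basis_prod_def)
  note gs = gs_tf_shift[OF f, of z] gs_tf_shift[OF h, of w]
    gs_tf_shift[OF gs_mult_coord[OF f j], of z] gs_tf_shift[OF gs_mult_coord[OF h j], of w]
    gs_mult_coord[OF gs_tf_shift[OF f] j, of z] gs_mult_coord[OF gs_tf_shift[OF h] j, of w]
  have m: "\<sigma> \<in> borel_measurable borel" using \<sigma>(1) by (rule smooth_measurable)
  let ?W = "\<lambda>u. wig (mult_coord j ?h) ?f u + (- 1) * wig ?h (mult_coord j ?f) u"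
  have "weyl_form (partial_deriv (0, j) \<sigma>) ?f ?h + (LINT u|lborel. \<sigma> u * (?c * ?W u)) = 0"
    unfolding weyl_form_def
    by (rule symbol_integration_by_parts[OF \<sigma>(1) b \<sigma>(2) \<sigma>' wig_integrable[OF gs(1,2)] _ wig_has_derivative_xi[OF gs(1,2) j]])
       (intro Bochner_Integration.integrable_add integrable_mult_right wig_integrable gs continuous_on_add continuous_on_mult
          continuous_on_const wig_continuous_line_xi j)+
  moreover have "(LINT u|lborel. \<sigma> u * (?c * ?W u)) = ?c * (LINT u|lborel. \<sigma> u * ?W u)"
    by (simp only: mult.left_commute[of _ ?c] integral_mult_right_zero)
  moreover have "(LINT u|lborel. \<sigma> u * ?W u) = weyl_form \<sigma> ?f (mult_coord j ?h) + (- 1) * weyl_form \<sigma> (mult_coord j ?f) ?h"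
    unfolding weyl_form_def by (rule weyl_form_linear[OF m \<sigma>(2)]) (auto intro: wig_integrable gs)
  moreover have "weyl_form \<sigma> ?f (mult_coord j ?h) = weyl_form \<sigma> ?f (tf_shift w (mult_coord j h))
      + of_real (fst w \<bullet> j) * weyl_form \<sigma> ?f ?h"
    unfolding mult_coord_tf_shift
    by (subst weyl_form_add_left[OF m \<sigma>(2)], (rule gs)+) (simp only: complex_cnj_complex_of_real)
  moreover have "weyl_form \<sigma> (mult_coord j ?f) ?h = weyl_form \<sigma> (tf_shift z (mult_coord j f)) ?h
      + of_real (fst z \<bullet> j) * weyl_form \<sigma> ?f ?h"
    unfolding mult_coord_tf_shift by (rule weyl_form_add_right[OF m \<sigma>(2)]) (rule gs)+
  ultimately have eq: "weyl_form (partial_deriv (0, j) \<sigma>) ?f ?h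
      = - ?c * (weyl_form \<sigma> ?f (tf_shift w (mult_coord j h)) + of_real (fst w \<bullet> j) * weyl_form \<sigma> ?f ?h
        - (weyl_form \<sigma> (tf_shift z (mult_coord j f)) ?h + of_real (fst z \<bullet> j) * weyl_form \<sigma> ?f ?h))"
    by algebra
  have "(\<i> / of_real (2 * pi)) * (- ?c * X) = X" for X by (simp add: field_simps)
  then have "(\<i> / of_real (2 * pi)) * weyl_form (partial_deriv (0, j) \<sigma>) ?f ?h
      = weyl_form \<sigma> ?f (tf_shift w (mult_coord j h)) + of_real (fst w \<bullet> j) * weyl_form \<sigma> ?f ?h
        - (weyl_form \<sigma> (tf_shift z (mult_coord j f)) ?h + of_real (fst z \<bullet> j) * weyl_form \<sigma> ?f ?h)"
    unfolding eq .
  moreover have "of_real ((w - z) \<bullet> (j, 0)) = (of_real (fst w \<bullet> j) - of_real (fst z \<bullet> j) :: complex)"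
    by (simp add: inner_prod_def inner_diff_left)
  ultimately show ?thesis by algebra
qed

end

section \<open>Moments of the matrix of the Weyl form\<close>

lemma gs_mult_coord_funpow: "f \<in> gelfand_shilov \<Longrightarrow> j \<in> Basis \<Longrightarrow> (mult_coord j ^^ n) f \<in> gelfand_shilov"
  by (induction n) (auto intro: gs_mult_coord)

lemma gs_partial_deriv_funpow: "f \<in> gelfand_shilov \<Longrightarrow> j \<in> Basis \<Longrightarrow> (partial_deriv j ^^ n) f \<in> gelfand_shilov"
  by (induction n) (auto intro: gs_partial_deriv)

text \<open>Here \<open>p \<ge> 1\<close> enters: the factorials from the two windows carry exponent
  1 and are raised to the exponent \<open>p\<close> of the symbol before all three are
  merged.\<close>

lemma fact_powr_mult_le:
  assumes "1 \<le> p"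
  shows "fact a powr p * (fact b * fact c) \<le> (fact (a + b + c) powr p :: real)"
proof -
  have le: "fact n \<le> (fact n powr p :: real)" for n
    using powr_mono[OF assms, of "fact n"] by simp
  have "fact a powr p * (fact b * fact c) \<le> (fact a powr p * (fact b powr p * fact c powr p) :: real)"
    by (intro mult_left_mono mult_mono le) auto
  also have "\<dots> = (fact a * (fact b * fact c)) powr p" by (simp add: powr_mult)
  also have "\<dots> \<le> fact (a + b + c) powr p"
  proof (rule powr_mono2)
    have "fact a * (fact b * fact c) \<le> (fact a * fact (b + c) :: real)"
      by (intro mult_left_mono fact_mult_le) auto
    also have "\<dots> \<le> fact (a + (b + c))" by (rule fact_mult_le)
    finally show "fact a * (fact b * fact c) \<le> (fact (a + b + c) :: real)" by (simp add: add.assoc)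
  qed (use assms in auto)
  finally show ?thesis .
qed

lemma norm_weyl_form_le:
  fixes f h :: "'a::euclidean_space \<Rightarrow> complex"
  assumes "smooth \<sigma>" "\<And>u. norm (\<sigma> u) \<le> M" "gs_bound A B S f" "gs_bound A B S' h" "0 < A" "0 < B"
  shows "norm (weyl_form \<sigma> (tf_shift z f) (tf_shift w h)) \<le> M * (cstf A B TYPE('a) * S * S' * rho_int TYPE('a) ^ 2)"
proof -
  have M: "0 \<le> M" using order.trans[OF norm_ge_zero assms(2)] .
  have "norm (weyl_form \<sigma> (tf_shift z f) (tf_shift w h)) \<le> (LINT u|lborel. norm (\<sigma> u * wig (tf_shift w h) (tf_shift z f) u))"
    unfolding weyl_form_def by (rule integral_norm_bound)
  also have "\<dots> \<le> M * (LINT u|lborel. norm (wig (tf_shift w h) (tf_shift z f) u))"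
    by (intro integrable_bounded_mult(2) smooth_measurable wig_shift_integrable[OF assms(3,4)] assms)
  also have "\<dots> \<le> M * (cstf A B TYPE('a) * S * S' * rho_int TYPE('a) ^ 2)"
    by (intro mult_left_mono wig_shift_L1 M assms)
  finally show ?thesis .
qed

context
  fixes \<sigma> :: "'a::euclidean_space \<times> 'a \<Rightarrow> complex" and c Q p :: real
  assumes \<sigma>: "smooth \<sigma>"
    and bd: "\<And>b a u. b \<in> Basis \<Longrightarrow> norm ((partial_deriv b ^^ a) \<sigma> u) \<le> c * (Q ^ a * fact a powr p)"
    and p: "1 \<le> p" and Q: "0 < Q"
begin

text \<open>Position moments differentiate the symbol in frequency and multiply the windows by
  coordinates. With \<open>A = Q / 4\<close> and \<open>B = 4 / Q\<close> the rate
  \<open>2 * A + 2 / B\<close> of the windows equals the rate \<open>Q\<close> of the symbol, so all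
  slots of \<open>recursion_bound\<close> share one bound.\<close>

lemma weyl_form_decay_position:
  assumes f: "gs_bound (Q / 4) (4 / Q) Sf f" "f \<in> gelfand_shilov"
    and h: "gs_bound (Q / 4) (4 / Q) Sh h" "h \<in> gelfand_shilov" and j: "j \<in> Basis"
  shows "\<bar>(w - z) \<bullet> (j, 0)\<bar> ^ n * norm (weyl_form \<sigma> (tf_shift z f) (tf_shift w h))
    \<le> 3 ^ n * (c * (cstf (Q / 2) (4 / Q) TYPE('a) * Sf * Sh * rho_int TYPE('a) ^ 2) * (Q ^ n * fact n powr p))"
proof -
  let ?b = "(0, j) :: 'a \<times> 'a"
  have b: "?b \<in> Basis" using j by (simp add: Basis_prod_def)
  let ?\<sigma> = "\<lambda>a. (partial_deriv ?b ^^ a) \<sigma>" let ?f = "\<lambda>n. (mult_coord j ^^ n) f" let ?h = "\<lambda>n. (mult_coord j ^^ n) h"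
  let ?K = "cstf (Q / 2) (4 / Q) TYPE('a) * Sf * Sh * rho_int TYPE('a) ^ 2"
  have pos: "0 < Q / 4" "0 < 4 / Q" "0 < Q / 2" using Q by auto
  have R: "2 * (Q / 4) + 2 / (4 / Q) = Q" "2 * (Q / 4) = Q / 2" using Q by (auto simp: field_simps)
  note gf = gs_bound_mult_coord[OF f(1) pos(1,2) j, unfolded R(1), unfolded R(2)]
    and gh = gs_bound_mult_coord[OF h(1) pos(1,2) j, unfolded R(1), unfolded R(2)]
  have c: "0 \<le> c" using order.trans[OF norm_ge_zero bd[OF b, of 0]] by simp
  have K: "0 \<le> ?K" using gs_bound_nonneg[OF f(1)] gs_bound_nonneg[OF h(1)] cstf_nonneg[where 'a='a, OF pos(2)]
    by (intro mult_nonneg_nonneg) auto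
  define X where "X a b k = weyl_form (?\<sigma> a) (tf_shift z (?f b)) (tf_shift w (?h k))" for a b k
  have rec: "of_real ((w - z) \<bullet> (j, 0)) * X a b k
      = (\<i> / of_real (2 * pi)) * X (Suc a) b k + 1 * X a (Suc b) k + (- 1) * X a b (Suc k)" for a b k
    unfolding X_def
    using weyl_form_mult_coord[OF smooth_funpow[OF \<sigma> \<open>?b \<in> Basis\<close>] bd[OF \<open>?b \<in> Basis\<close>]
        gs_mult_coord_funpow[OF f(2) j] gs_mult_coord_funpow[OF h(2) j] j
        bd[OF \<open>?b \<in> Basis\<close>, of "Suc a", simplified funpow.simps o_apply]]
    by simp
  have Xb: "norm (X a b c') \<le> c * ?K * (Q ^ (a + b + c') * fact (a + b + c') powr p)" for a b c'
  proof -
    have "norm (X a b c') \<le> (c * (Q ^ a * fact a powr p)) * (cstf (Q / 2) (4 / Q) TYPE('a) * (Sf * Q ^ b * fact b) * (Sh * Q ^ c' * fact c') * rho_int TYPE('a) ^ 2)"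
      unfolding X_def
      by (intro norm_weyl_form_le[OF smooth_funpow[OF \<sigma> \<open>?b \<in> Basis\<close>] bd[OF \<open>?b \<in> Basis\<close>] gf gh pos(3,2)])
    also have "\<dots> = c * ?K * Q ^ (a + b + c') * (fact a powr p * (fact b * fact c'))"
      by (simp add: power_add ac_simps)
    also have "\<dots> \<le> c * ?K * Q ^ (a + b + c') * fact (a + b + c') powr p"
      using Q by (intro mult_left_mono fact_powr_mult_le p mult_nonneg_nonneg c K) auto
    finally show ?thesis by (simp add: ac_simps)
  qed
  have c0: "norm (\<i> / of_real (2 * pi) :: complex) \<le> 1" using pi_gt3 by (simp add: norm_divide norm_mult)
  have "norm (of_real ((w - z) \<bullet> (j, 0)) :: complex) ^ n * norm (X 0 0 0) \<le> 3 ^ n * (c * ?K * (Q ^ (n + 0 + 0 + 0) * fact (n + 0 + 0 + 0) powr p))"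
    by (rule recursion_bound[OF rec c0 _ _ Xb]) auto
  then show ?thesis by (simp add: X_def)
qed

text \<open>Now the windows are differentiated, at rate \<open>2 * B\<close>, so
  \<open>B = Q / 2\<close> matches the symbol.\<close>

lemma weyl_form_decay_frequency:
  assumes f: "gs_bound 1 (Q / 2) Sf f" "f \<in> gelfand_shilov"
    and h: "gs_bound 1 (Q / 2) Sh h" "h \<in> gelfand_shilov" and j: "j \<in> Basis"
  shows "\<bar>(w - z) \<bullet> (0, j)\<bar> ^ n * norm (weyl_form \<sigma> (tf_shift z f) (tf_shift w h))
    \<le> 3 ^ n * (c * (cstf 1 Q TYPE('a) * Sf * Sh * rho_int TYPE('a) ^ 2) * (Q ^ n * fact n powr p))"
proof -
  let ?b = "(j, 0) :: 'a \<times> 'a"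
  have b: "?b \<in> Basis" using j by (simp add: Basis_prod_def)
  let ?\<sigma> = "\<lambda>a. (partial_deriv ?b ^^ a) \<sigma>" let ?f = "\<lambda>n. (partial_deriv j ^^ n) f" let ?h = "\<lambda>n. (partial_deriv j ^^ n) h"
  let ?K = "cstf 1 Q TYPE('a) * Sf * Sh * rho_int TYPE('a) ^ 2"
  let ?\<tau> = "\<i> * of_real (2 * pi * ((w - z) \<bullet> (0, j))) :: complex"
  have pos: "0 < (1::real)" "0 < Q / 2" using Q by auto
  have R: "2 * (Q / 2) = Q" by simp
  note gf = gs_bound_partial_deriv[OF f(1) pos j, unfolded R] and gh = gs_bound_partial_deriv[OF h(1) pos j, unfolded R]
  have c: "0 \<le> c" using order.trans[OF norm_ge_zero bd[OF b, of 0]] by simp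
  have K: "0 \<le> ?K" using gs_bound_nonneg[OF f(1)] gs_bound_nonneg[OF h(1)] cstf_nonneg[where 'a='a, OF Q]
    by (intro mult_nonneg_nonneg) auto
  define X where "X a b k = weyl_form (?\<sigma> a) (tf_shift z (?f b)) (tf_shift w (?h k))" for a b k
  have rec: "?\<tau> * X a b k = 1 * X (Suc a) b k + 1 * X a (Suc b) k + 1 * X a b (Suc k)" for a b k
    unfolding X_def
    using weyl_form_partial_deriv[OF smooth_funpow[OF \<sigma> \<open>?b \<in> Basis\<close>] bd[OF \<open>?b \<in> Basis\<close>]
        gs_partial_deriv_funpow[OF f(2) j] gs_partial_deriv_funpow[OF h(2) j] j
        bd[OF \<open>?b \<in> Basis\<close>, of "Suc a", simplified funpow.simps o_apply]]
    by simp
  have Xb: "norm (X a b c') \<le> c * ?K * (Q ^ (a + b + c') * fact (a + b + c') powr p)" for a b c'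
  proof -
    have "norm (X a b c') \<le> (c * (Q ^ a * fact a powr p)) * (cstf 1 Q TYPE('a) * (Sf * Q ^ b * fact b) * (Sh * Q ^ c' * fact c') * rho_int TYPE('a) ^ 2)"
      unfolding X_def
      by (intro norm_weyl_form_le[OF smooth_funpow[OF \<sigma> \<open>?b \<in> Basis\<close>] bd[OF \<open>?b \<in> Basis\<close>] gf gh pos(1) Q])
    also have "\<dots> = c * ?K * Q ^ (a + b + c') * (fact a powr p * (fact b * fact c'))"
      by (simp add: power_add ac_simps)
    also have "\<dots> \<le> c * ?K * Q ^ (a + b + c') * fact (a + b + c') powr p"
      using Q by (intro mult_left_mono fact_powr_mult_le p mult_nonneg_nonneg c K) auto
    finally show ?thesis by (simp add: ac_simps)
  qed
  have "\<bar>(w - z) \<bullet> (0, j)\<bar> * 1 \<le> \<bar>(w - z) \<bullet> (0, j)\<bar> * (2 * pi)" using pi_gt3 by (intro mult_left_mono) auto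
  then have "\<bar>(w - z) \<bullet> (0, j)\<bar> \<le> norm ?\<tau>" by (simp add: norm_mult abs_mult ac_simps)
  then have "\<bar>(w - z) \<bullet> (0, j)\<bar> ^ n * norm (X 0 0 0) \<le> norm ?\<tau> ^ n * norm (X 0 0 0)"
    by (intro mult_right_mono power_mono) auto
  also have "\<dots> \<le> 3 ^ n * (c * ?K * (Q ^ (n + 0 + 0 + 0) * fact (n + 0 + 0 + 0) powr p))"
    by (rule recursion_bound[OF rec _ _ _ Xb]) auto
  finally show ?thesis by (simp add: X_def)
qed

text \<open>\<open>g\<close> is fixed and disappears into \<open>K\<close>; \<open>h\<close> enters
  linearly through \<open>S\<close>, which later becomes a seminorm of \<open>h\<close>.\<close>

lemma weyl_form_decay:
  assumes g: "g \<in> gelfand_shilov"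
  obtains A K where "0 < A" "0 \<le> K"
    "\<And>h S z w b n. h \<in> gelfand_shilov \<Longrightarrow> gs_bound A A S h \<Longrightarrow> b \<in> Basis \<Longrightarrow>
      \<bar>(w - z) \<bullet> b\<bar> ^ n * norm (weyl_form \<sigma> (tf_shift z g) (tf_shift w h)) \<le> K * S * ((3 * Q) ^ n * fact n powr p)"
proof -
  \<comment> \<open>Bounds at small rates imply those at larger ones, so the minimum of the four
    parameters serves position and frequency alike, and one pair \<open>A, A\<close> suffices for
    \<open>h\<close>.\<close>
  define A where "A = min (min (Q / 4) (4 / Q)) (min 1 (Q / 2))"
  have A: "0 < A" "A \<le> Q / 4" "A \<le> 4 / Q" "A \<le> 1" "A \<le> Q / 2" using Q by (auto simp: A_def)
  obtain Sg where "gs_bound A A Sg g" using g A gelfand_shilovD by blast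
  note g12 = gs_bound_mono[OF this A(1,2,1,3) order_refl] gs_bound_mono[OF this A(1,4,1,5) order_refl]
  define k1 where "k1 = c * (cstf (Q / 2) (4 / Q) TYPE('a) * Sg * rho_int TYPE('a) ^ 2)"
  define k2 where "k2 = c * (cstf 1 Q TYPE('a) * Sg * rho_int TYPE('a) ^ 2)"
  have "0 \<le> c"
  proof -
    obtain b :: "'a \<times> 'a" where "b \<in> Basis" using nonempty_Basis by blast
    from order.trans[OF norm_ge_zero bd[OF this, of 0]] show ?thesis by simp
  qed
  then have k: "0 \<le> k1" "0 \<le> k2" unfolding k1_def k2_def
    using gs_bound_nonneg[OF g12(1)] cstf_nonneg[where 'a='a and B = "4 / Q"] cstf_nonneg[where 'a='a and B = Q] Q
    by (auto intro!: mult_nonneg_nonneg)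
  show ?thesis
  proof (rule that[OF A(1)])
    show "0 \<le> k1 + k2" using k by simp
    fix h :: "'a \<Rightarrow> complex" and S and z w b :: "'a \<times> 'a" and n assume h: "h \<in> gelfand_shilov" "gs_bound A A S h" and b: "b \<in> Basis"
    note h12 = gs_bound_mono[OF h(2) A(1,2,1,3) order_refl] gs_bound_mono[OF h(2) A(1,4,1,5) order_refl]
    have S: "0 \<le> S" using h(2) by (rule gs_bound_nonneg)
    let ?E = "(3 * Q) ^ n * fact n powr p"
    have E: "0 \<le> ?E" using Q by simp
    have le: "k' * S * ?E \<le> (k1 + k2) * S * ?E" if "k' \<le> k1 + k2" for k'
      using that S E by (intro mult_right_mono) auto
    from b consider j where "j \<in> Basis" "b = (j, 0)" | j where "j \<in> Basis" "b = (0, j)"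
      by (auto simp: Basis_prod_def)
    then show "\<bar>(w - z) \<bullet> b\<bar> ^ n * norm (weyl_form \<sigma> (tf_shift z g) (tf_shift w h)) \<le> (k1 + k2) * S * ?E"
    proof cases
      case 1
      have "\<bar>(w - z) \<bullet> b\<bar> ^ n * norm (weyl_form \<sigma> (tf_shift z g) (tf_shift w h)) \<le> k1 * S * ?E"
        unfolding 1(2) using weyl_form_decay_position[OF g12(1) g h12(1) h(1) 1(1), of w z n]
        by (simp only: k1_def power_mult_distrib ac_simps)
      then show ?thesis using le[of k1] k by linarith
    next
      case 2
      have "\<bar>(w - z) \<bullet> b\<bar> ^ n * norm (weyl_form \<sigma> (tf_shift z g) (tf_shift w h)) \<le> k2 * S * ?E"
        unfolding 2(2) using weyl_form_decay_frequency[OF g12(2) g h12(2) h(1) 2(1), of w z n]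
        by (simp only: k2_def power_mult_distrib ac_simps)
      then show ?thesis using le[of k2] k by linarith
    qed
  qed
qed

end

text \<open>Taking \<open>p\<close>-th roots makes the factorial plain: with
  \<open>t = (y / R) powr (1 / p)\<close> all \<open>t ^ n / n!\<close> lie below one number
  \<open>L\<close>. Halving \<open>t\<close> inserts a geometric factor, so the exponential series
  gives \<open>exp (t / 2) \<le> 2 * L\<close>, and the \<open>p\<close>-th power of this is the
  claim.\<close>

lemma factorial_decay:
  fixes X K R y p :: real
  assumes p: "1 \<le> p" and R: "0 < R" and y: "0 \<le> y" and X: "0 \<le> X"
    and bd: "\<And>n. y ^ n * X \<le> K * (R ^ n * fact n powr p)"
  shows "X \<le> K * 2 powr p * exp (- (p / 2 * (y / R) powr (1 / p)))"
proof (cases "X = 0")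
  case True
  then have "0 \<le> K" using bd[of 0] by simp
  then show ?thesis using True by simp
next
  case False
  with X have X: "0 < X" by simp
  with bd[of 0] have K: "0 < K" by (simp add: order.strict_trans2)
  define t where "t = (y / R) powr (1 / p)"
  define L where "L = (K / X) powr (1 / p)"
  have t: "0 \<le> t" by (simp add: t_def)
  have tn: "(t ^ n) powr p = (t powr p) ^ n" for n
    by (induction n) (auto simp: powr_mult t)
  have "t ^ n / fact n \<le> L" for n
  proof -
    have "(t ^ n / fact n) powr p = (t powr p) ^ n / fact n powr p"
      using t by (simp add: powr_divide tn)
    also have "t powr p = y / R" using p y R by (simp add: t_def powr_powr)
    also have "(y / R) ^ n / fact n powr p \<le> K / X"
    proof -
      have "y ^ n * X \<le> K * (R ^ n * fact n powr p)" by (rule bd)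
      then show ?thesis using X R by (simp add: power_divide divide_le_eq pos_le_divide_eq field_simps)
    qed
    finally have "((t ^ n / fact n) powr p) powr (1 / p) \<le> L"
      unfolding L_def using p by (intro powr_mono2) auto
    then show ?thesis using p t by (simp add: powr_powr)
  qed
  then have le: "(t / 2) ^ n / fact n \<le> L * (1 / 2) ^ n" for n
    by (simp add: power_divide field_simps)
  have ex: "exp u = (\<Sum>n. u ^ n / fact n)" "summable (\<lambda>n. u ^ n / fact n)" for u :: real
    using summable_exp[of u] by (simp_all add: exp_def divide_inverse mult.commute)
  have "exp (t / 2) = (\<Sum>n. (t / 2) ^ n / fact n)" by (rule ex)
  also have "\<dots> \<le> (\<Sum>n. L * (1 / 2) ^ n)"
  proof (rule suminf_le[OF le])
    show "summable (\<lambda>n. (t / 2) ^ n / fact n)" by (rule ex)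
    show "summable (\<lambda>n. L * (1 / 2) ^ n)" by (intro summable_mult summable_geometric) simp
  qed
  also have "\<dots> = 2 * L" by (simp add: suminf_mult suminf_geometric)
  finally have "exp (t / 2) powr p \<le> (2 * L) powr p" using p by (intro powr_mono2) auto
  also have "\<dots> = 2 powr p * (K / X)" using p X K by (simp add: L_def powr_mult powr_powr)
  also have "exp (t / 2) powr p = exp (p / 2 * t)" by (simp add: powr_def)
  finally have le: "exp (p / 2 * t) \<le> 2 powr p * (K / X)" .
  have "X = X * exp (p / 2 * t) * exp (- (p / 2 * t))" by (simp add: mult.assoc exp_add[symmetric])
  also have "\<dots> \<le> X * (2 powr p * (K / X)) * exp (- (p / 2 * t))"
    using X by (intro mult_right_mono mult_left_mono le) auto
  also have "X * (2 powr p * (K / X)) = K * 2 powr p" using X by simp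
  finally show ?thesis unfolding t_def .
qed

text \<open>For \<open>y > 1\<close> a single term of the exponential series suffices, its order
  \<open>N\<close> being chosen with \<open>m \<le> q * N\<close>.\<close>

lemma poly_le_exp_powr:
  fixes \<delta> q :: real
  assumes "0 < \<delta>" "0 < q"
  obtains C where "0 \<le> C" "\<And>y. 0 \<le> y \<Longrightarrow> 1 + y ^ m \<le> C * exp (\<delta> * y powr q)"
proof -
  obtain N :: nat where N: "real m \<le> q * real N"
    using real_arch_simple[of "real m / q"] assms by (auto simp: field_simps)
  define C where "C = 2 + fact N / \<delta> ^ N"
  have C: "0 \<le> C" "2 \<le> C" using assms by (auto simp: C_def)
  have "1 + y ^ m \<le> C * exp (\<delta> * y powr q)" if y: "0 \<le> y" for y
  proof (cases "y \<le> 1")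
    case True
    then have "1 + y ^ m \<le> 2 * 1" using y by (simp add: power_le_one)
    also have "\<dots> \<le> C * exp (\<delta> * y powr q)" using C assms by (intro mult_mono) auto
    finally show ?thesis .
  next
    case False
    then have "y ^ m = y powr real m" by (simp add: powr_realpow)
    also have "\<dots> \<le> y powr (q * real N)" using False N by (intro powr_mono) auto
    also have "\<dots> = (y powr q) ^ N" using False by (simp add: powr_powr[symmetric] powr_realpow)
    also have "\<dots> \<le> fact N / \<delta> ^ N * exp (\<delta> * y powr q)"
    proof -
      have "(\<delta> * y powr q) ^ N / fact N \<le> (\<Sum>n. (\<delta> * y powr q) ^ n / fact n)"
        using sum_le_suminf[OF summable_exp[of "\<delta> * y powr q"], of "{N}"] assms
        by (simp add: divide_inverse mult.commute)
      also have "\<dots> = exp (\<delta> * y powr q)" by (simp add: exp_def divide_inverse mult.commute)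
      finally show ?thesis using assms by (simp add: power_mult_distrib field_simps)
    qed
    finally have "1 + y ^ m \<le> 1 * exp (\<delta> * y powr q) + fact N / \<delta> ^ N * exp (\<delta> * y powr q)"
      using assms by (intro add_mono) auto
    also have "\<dots> \<le> C * exp (\<delta> * y powr q)" unfolding C_def by (simp add: algebra_simps)
    finally show ?thesis .
  qed
  with C(1) show ?thesis by (rule that)
qed

lemma rho_prod: "rho z = rho (fst z) * rho (snd z)"
proof -
  have i: "inj_on (\<lambda>u. (u, 0)) Basis" "inj_on (\<lambda>u. (0, u)) Basis" by (auto intro: inj_onI)
  have d: "(\<lambda>u. (u, 0)) ` Basis \<inter> (\<lambda>u. (0, u)) ` Basis = {}" by auto
  show ?thesis
    unfolding rho_def Basis_prod_def
    by (subst prod.union_disjoint[OF _ _ d]) (auto simp: prod.reindex i inner_prod_def)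
qed

lemma norm_le_max:
  fixes \<zeta> :: "'a::euclidean_space" and y :: real
  assumes "\<And>c. c \<in> Basis \<Longrightarrow> \<bar>\<zeta> \<bullet> c\<bar> \<le> y"
  shows "norm \<zeta> \<le> DIM('a) * y"
  using order.trans[OF norm_le_l1 sum_mono[of Basis "\<lambda>c. \<bar>\<zeta> \<bullet> c\<bar>" "\<lambda>_. y"]] assms by simp

text \<open>Everything is measured in the largest coordinate \<open>y\<close> of
  \<open>\<zeta>\<close>. The moments give decay at rate
  \<open>p / 2 * (1 / R) powr (1 / p)\<close>, and \<open>norm \<zeta> \<le> DIM('a) * y\<close>
  limits the cost of the weight to \<open>\<epsilon> * DIM('a) powr (1 / p)\<close>. The positive
  difference \<open>\<delta>\<close> still beats the polynomial
  \<open>1 / rho \<zeta>\<close>.\<close>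

lemma weighted_decay:
  fixes v :: "'a::euclidean_space \<Rightarrow> real"
  assumes v: "\<And>\<zeta>. 0 \<le> v \<zeta>" "\<And>\<zeta>. v \<zeta> \<le> Cv * exp (\<epsilon> * norm \<zeta> powr (1 / p))"
    and p: "1 \<le> p" and R: "0 < R" and \<epsilon>: "0 \<le> \<epsilon>" "\<epsilon> * DIM('a) powr (1 / p) < p / 2 * (1 / R) powr (1 / p)"
  obtains C where "0 \<le> C" "\<And>\<zeta> X K. 0 \<le> X \<Longrightarrow> 0 \<le> K \<Longrightarrow>
    (\<And>b n. b \<in> Basis \<Longrightarrow> \<bar>\<zeta> \<bullet> b\<bar> ^ n * X \<le> K * (R ^ n * fact n powr p)) \<Longrightarrow> X * v \<zeta> \<le> C * K * rho \<zeta>"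
proof -
  define \<delta> where "\<delta> = p / 2 * (1 / R) powr (1 / p) - \<epsilon> * DIM('a) powr (1 / p)"
  have \<delta>: "0 < \<delta>" using \<epsilon> by (simp add: \<delta>_def)
  have Cv: "0 \<le> Cv" using order.trans[OF v(1) v(2), of 0] p by (simp add: zero_le_mult_iff)
  obtain C where C: "0 \<le> C" "\<And>y. 0 \<le> y \<Longrightarrow> 1 + y ^ (2 * (1 * DIM('a))) \<le> C * exp (\<delta> * y powr (1 / p))"
    using poly_le_exp_powr[OF \<delta>, of "1 / p" "2 * (1 * DIM('a))"] p by auto
  show ?thesis
  proof (rule that)
    show "0 \<le> 2 powr p * Cv * (2 ^ DIM('a) * C)" using C Cv by auto
    fix \<zeta> :: 'a and X K
    assume X: "0 \<le> X" and K: "0 \<le> K" and bd: "\<And>b n. b \<in> Basis \<Longrightarrow> \<bar>\<zeta> \<bullet> b\<bar> ^ n * X \<le> K * (R ^ n * fact n powr p)"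
    obtain b where b: "b \<in> Basis" "\<And>c. c \<in> Basis \<Longrightarrow> \<bar>\<zeta> \<bullet> c\<bar> \<le> \<bar>\<zeta> \<bullet> b\<bar>"
      "1 / rho \<zeta> ^ 1 \<le> 2 ^ (1 * DIM('a)) * (1 + \<bar>\<zeta> \<bullet> b\<bar> ^ (2 * (1 * DIM('a))))"
      by (rule inverse_rho_le_max[of \<zeta> 1]) (rule that)
    let ?y = "\<bar>\<zeta> \<bullet> b\<bar>"
    have 1: "X \<le> K * 2 powr p * exp (- (p / 2 * (?y / R) powr (1 / p)))"
      by (rule factorial_decay[OF p R _ X bd[OF b(1)]]) auto
    have "norm \<zeta> powr (1 / p) \<le> (DIM('a) * ?y) powr (1 / p)"
      using norm_le_max[OF b(2)] p by (intro powr_mono2) auto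
    then have 2: "v \<zeta> \<le> Cv * exp (\<epsilon> * (DIM('a) powr (1 / p) * ?y powr (1 / p)))"
      using Cv \<epsilon>(1) by (intro order.trans[OF v(2)] mult_left_mono) (auto simp: powr_mult intro: mult_left_mono)
    have "1 / rho \<zeta> \<le> 2 ^ DIM('a) * (C * exp (\<delta> * ?y powr (1 / p)))"
      using order.trans[OF b(3) mult_left_mono[OF C(2)[of ?y]]] by simp
    then have 3: "1 \<le> 2 ^ DIM('a) * (C * exp (\<delta> * ?y powr (1 / p))) * rho \<zeta>"
      using rho_pos[of \<zeta>] by (simp add: pos_divide_le_eq)
    have e: "exp (- (p / 2 * (?y / R) powr (1 / p))) * exp (\<epsilon> * (DIM('a) powr (1 / p) * ?y powr (1 / p))) = exp (- \<delta> * ?y powr (1 / p))"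
      using R by (simp add: exp_add[symmetric] \<delta>_def powr_divide algebra_simps)
    have "X * v \<zeta> \<le> (K * 2 powr p * exp (- (p / 2 * (?y / R) powr (1 / p)))) * (Cv * exp (\<epsilon> * (DIM('a) powr (1 / p) * ?y powr (1 / p))))"
      using K v(1) by (intro mult_mono 1 2) auto
    also have "\<dots> = K * 2 powr p * Cv * exp (- \<delta> * ?y powr (1 / p)) * 1" unfolding e[symmetric] by (simp only: ac_simps)
    also have "\<dots> \<le> K * 2 powr p * Cv * exp (- \<delta> * ?y powr (1 / p)) * (2 ^ DIM('a) * (C * exp (\<delta> * ?y powr (1 / p))) * rho \<zeta>)"
      using K Cv by (intro mult_left_mono 3) auto
    also have "\<dots> = 2 powr p * Cv * (2 ^ DIM('a) * C) * K * rho \<zeta>"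
      by (simp add: exp_minus field_simps)
    finally show "X * v \<zeta> \<le> 2 powr p * Cv * (2 ^ DIM('a) * C) * K * rho \<zeta>" .
  qed
qed

text \<open>Cut \<open>z\<close> into \<open>n\<close> equal pieces of norm at most 1, with
  \<open>n\<close> about \<open>norm z\<close>: by submultiplicativity \<open>v z\<close> is at most
  the \<open>n\<close>-th power of a bound of \<open>v\<close> on the unit ball, which exists by
  compactness.\<close>

lemma submult_weight_exponential:
  fixes v :: "'a::euclidean_space \<Rightarrow> real"
  assumes v: "submult_weight v"
  obtains C a where "0 \<le> a" "\<And>z. v z \<le> C * exp (a * norm z)"
proof -
  have cont: "continuous_on UNIV v" and pos: "\<And>z. 0 < v z" and v0: "v 0 = 1" and sub: "\<And>z w. v (z + w) \<le> v z * v w"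
    using v by (auto simp: submult_weight_def)
  obtain M where M: "\<And>z. norm z \<le> 1 \<Longrightarrow> v z \<le> M"
  proof -
    have "compact (v ` cball 0 1)" using cont by (intro compact_continuous_image continuous_on_subset[OF cont]) auto
    then have "bdd_above (v ` cball 0 1)" by (intro bounded_imp_bdd_above compact_imp_bounded)
    then obtain M where "\<forall>x\<in>cball 0 1. v x \<le> M" unfolding bdd_above_def by auto
    then show ?thesis by (intro that[of M]) auto
  qed
  have M1: "1 \<le> M" using M[of 0] v0 by simp
  have pow: "v (real n *\<^sub>R w) \<le> M ^ n" if "norm w \<le> 1" for n w
  proof (induction n)
    case (Suc n)
    have "v (real (Suc n) *\<^sub>R w) \<le> v (real n *\<^sub>R w) * v w" using sub[of "real n *\<^sub>R w" w] by (simp add: algebra_simps)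
    also have "\<dots> \<le> M ^ n * M" using Suc M[OF that] pos M1 by (intro mult_mono) (auto simp: less_imp_le)
    finally show ?case by (simp add: mult.commute)
  qed (simp add: v0)
  have "v z \<le> M * exp (ln M * norm z)" for z
  proof -
    \<comment> \<open>The successor makes \<open>n\<close> positive and at least
      \<open>norm z\<close>; the excess of at most 1 is paid by the factor \<open>M\<close> in front
      of the exponential.\<close>
    define n where "n = Suc (nat \<lfloor>norm z\<rfloor>)"
    have n: "norm z \<le> real n" "real n \<le> norm z + 1" "0 < real n"
      unfolding n_def using norm_ge_zero[of z] by linarith+
    have "norm (z /\<^sub>R real n) \<le> 1" using n by (simp add: field_simps)
    from pow[OF this, of n] have "v z \<le> M ^ n" using n by simp
    also have "\<dots> = M powr real n" using M1 by (simp add: powr_realpow)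
    also have "\<dots> \<le> M powr (norm z + 1)" using n M1 by (intro powr_mono) auto
    also have "\<dots> = M * M powr norm z" using M1 by (simp add: powr_add)
    also have "\<dots> = M * exp (ln M * norm z)" using M1 by (simp add: powr_def mult.commute)
    finally show ?thesis .
  qed
  then show ?thesis using that[of "ln M" M] M1 by auto
qed

section \<open>Mixed Lebesgue norms\<close>

lemma ennreal_powr_simps [simp]:
  "0 < a \<Longrightarrow> ennreal_powr 0 a = 0" "ennreal_powr \<infinity> a = \<infinity>" "ennreal_powr top a = top"
  "0 \<le> r \<Longrightarrow> ennreal_powr (ennreal r) a = ennreal (r powr a)"
  by (auto simp: ennreal_powr_def)

lemma ennreal_powr_mono: "x \<le> y \<Longrightarrow> 0 \<le> a \<Longrightarrow> ennreal_powr x a \<le> ennreal_powr y a"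
  by (cases x; cases y) (auto simp: powr_mono2 top_unique)

lemma ennreal_powr_inverse: "0 < a \<Longrightarrow> ennreal_powr (ennreal_powr x a) (1 / a) = x"
  by (cases x) (auto simp: powr_powr)

lemma ennreal_powr_inverse': "0 < a \<Longrightarrow> ennreal_powr (ennreal_powr x (1 / a)) a = x"
  by (cases x) (auto simp: powr_powr)

lemma ennreal_powr_cmult: "0 < c \<Longrightarrow> 0 < a \<Longrightarrow> ennreal_powr (ennreal c * x) a = ennreal (c powr a) * ennreal_powr x a"
  by (cases x) (auto simp: ennreal_mult[symmetric] powr_mult ennreal_mult_top)

lemma ennreal_powr_measurable [measurable (raw)]:
  assumes [measurable]: "f \<in> borel_measurable M"
  shows "(\<lambda>x. ennreal_powr (f x) a) \<in> borel_measurable M"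
  unfolding ennreal_powr_def by measurable

lemma lp_enorm_le_iff:
  fixes f :: "'a \<Rightarrow> ennreal"
  assumes "p \<noteq> \<infinity>" "1 \<le> p" "0 \<le> n"
  shows "lp_enorm M p f \<le> ennreal n \<longleftrightarrow> (\<integral>\<^sup>+x. ennreal_powr (f x) (enn2real p) \<partial>M) \<le> ennreal (n powr enn2real p)"
proof -
  have r: "1 \<le> enn2real p" using assms by (cases p) auto
  let ?r = "enn2real p" let ?A = "\<integral>\<^sup>+x. ennreal_powr (f x) ?r \<partial>M"
  have "ennreal_powr ?A (1 / ?r) \<le> ennreal n \<longleftrightarrow> ?A \<le> ennreal (n powr ?r)"
  proof
    assume "ennreal_powr ?A (1 / ?r) \<le> ennreal n"
    from ennreal_powr_mono[OF this, of ?r] show "?A \<le> ennreal (n powr ?r)"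
      using r assms(3) by (simp add: ennreal_powr_inverse')
  next
    assume "?A \<le> ennreal (n powr ?r)"
    from ennreal_powr_mono[OF this, of "1 / ?r"] show "ennreal_powr ?A (1 / ?r) \<le> ennreal n"
      using r assms(3) by (simp add: powr_powr)
  qed
  then show ?thesis using assms(1) by (simp add: lp_enorm_def)
qed

lemma lp_enorm_AE_mono:
  assumes f: "f \<in> borel_measurable M" and le: "AE x in M. f x \<le> g x"
  shows "lp_enorm M p f \<le> lp_enorm M p g"
proof (cases "p = \<infinity>")
  case True
  then show ?thesis using f le by (simp add: lp_enorm_def esssup_AE_mono)
next
  case False
  have "(\<integral>\<^sup>+x. ennreal_powr (f x) (enn2real p) \<partial>M) \<le> (\<integral>\<^sup>+x. ennreal_powr (g x) (enn2real p) \<partial>M)"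
    using le by (intro nn_integral_mono_AE) (auto elim!: eventually_mono intro: ennreal_powr_mono)
  then show ?thesis using False by (simp add: lp_enorm_def ennreal_powr_mono)
qed

lemma lp_enorm_cmult_le:
  fixes f :: "'a \<Rightarrow> ennreal"
  assumes f: "f \<in> borel_measurable M" and c: "0 < c" and p: "1 \<le> p"
  shows "lp_enorm M p (\<lambda>x. ennreal c * f x) \<le> ennreal c * lp_enorm M p f"
proof (cases "p = \<infinity>")
  case True
  have "esssup M (\<lambda>x. ennreal c * f x) \<le> ennreal c * esssup M f"
    using esssup_AE[where M = M and f = f] f by (intro esssup_I) (auto elim!: eventually_mono intro: mult_left_mono)
  then show ?thesis using True by (simp add: lp_enorm_def)
next
  case False
  let ?r = "enn2real p"
  have r: "1 \<le> ?r" using p False by (cases p) auto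
  have "(\<integral>\<^sup>+x. ennreal_powr (ennreal c * f x) ?r \<partial>M) = ennreal (c powr ?r) * (\<integral>\<^sup>+x. ennreal_powr (f x) ?r \<partial>M)"
    using c r f by (simp add: ennreal_powr_cmult nn_integral_cmult)
  moreover have "ennreal_powr (ennreal (c powr ?r) * A) (1 / ?r) = ennreal c * ennreal_powr A (1 / ?r)" for A
    using c r by (subst ennreal_powr_cmult) (auto simp: powr_powr)
  ultimately show ?thesis using False by (simp add: lp_enorm_def)
qed

text \<open>The constant is pulled out of the measurable function \<open>f / c\<close>, which lies
  below \<open>g\<close>. The larger function may then be a section of a Lebesgue measurable
  function, whose measurability is not known.\<close>

lemma lp_enorm_le_cmult:
  fixes f g :: "'a \<Rightarrow> ennreal"
  assumes f: "f \<in> borel_measurable M" and le: "\<And>x. f x \<le> ennreal c * g x" and c: "0 < c" and p: "1 \<le> p"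
  shows "lp_enorm M p f \<le> ennreal c * lp_enorm M p g"
proof -
  have 1: "ennreal c * ennreal (1 / c) = 1" using c by (simp add: ennreal_mult[symmetric])
  then have cc: "ennreal c * (ennreal (1 / c) * x) = x" for x by (simp add: mult.assoc[symmetric])
  have le': "ennreal (1 / c) * f x \<le> g x" for x
  proof -
    have "ennreal (1 / c) * f x \<le> ennreal (1 / c) * (ennreal c * g x)" by (intro mult_left_mono le) simp
    also have "\<dots> = g x" using 1 by (simp add: mult.assoc[symmetric] mult.commute)
    finally show ?thesis .
  qed
  have "lp_enorm M p f = lp_enorm M p (\<lambda>x. ennreal c * (ennreal (1 / c) * f x))" by (simp only: cc)
  also have "\<dots> \<le> ennreal c * lp_enorm M p (\<lambda>x. ennreal (1 / c) * f x)"
    using f c p by (intro lp_enorm_cmult_le) auto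
  also have "\<dots> \<le> ennreal c * lp_enorm M p g"
    using f le' by (intro mult_left_mono lp_enorm_AE_mono) auto
  finally show ?thesis .
qed

text \<open>The sets on which \<open>f\<close> differs from \<open>g\<close> lie in a null set and
  are therefore measurable for the completed measure, whatever \<open>f\<close> is.\<close>

lemma lebesgue_measurable_AE:
  fixes f g :: "'a::euclidean_space \<Rightarrow> ennreal"
  assumes g[measurable]: "g \<in> borel_measurable borel" and eq: "AE x in lborel. f x = g x"
  shows "f \<in> borel_measurable lebesgue"
proof (rule measurableI)
  fix A :: "ennreal set" assume A: "A \<in> sets borel"
  have g': "g \<in> borel_measurable lebesgue" by (rule measurable_completion) simp
  have 1: "Measurable.pred lebesgue (\<lambda>x. g x \<in> A)" using g' A by measurable
  have 2: "Measurable.pred lebesgue (\<lambda>x. f x \<noteq> g x \<and> f x \<in> A)"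
    by (rule sets_completion_AE) (use eq in \<open>auto elim!: eventually_mono\<close>)
  have 3: "Measurable.pred lebesgue (\<lambda>x. f x \<noteq> g x \<and> f x \<notin> A)"
    by (rule sets_completion_AE) (use eq in \<open>auto elim!: eventually_mono\<close>)
  have "Measurable.pred lebesgue (\<lambda>x. (g x \<in> A \<or> (f x \<noteq> g x \<and> f x \<in> A)) \<and> \<not> (f x \<noteq> g x \<and> f x \<notin> A))"
    using 1 2 3 by measurable
  moreover have "(\<lambda>x. (g x \<in> A \<or> (f x \<noteq> g x \<and> f x \<in> A)) \<and> \<not> (f x \<noteq> g x \<and> f x \<notin> A)) = (\<lambda>x. f x \<in> A)"
    by (auto simp: fun_eq_iff)
  ultimately show "f -` A \<inter> space lebesgue \<in> sets lebesgue"
    by (simp add: pred_def vimage_def)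
qed simp

lemma lp_enorm_lebesgue:
  fixes f g :: "'a::euclidean_space \<Rightarrow> ennreal"
  assumes g: "g \<in> borel_measurable borel" and eq: "AE x in lborel. f x = g x"
  shows "lp_enorm lebesgue p f = lp_enorm lborel p g"
proof (cases "p = \<infinity>")
  case True
  have f': "f \<in> borel_measurable lebesgue" by (rule lebesgue_measurable_AE[OF g eq])
  have g': "g \<in> borel_measurable lebesgue" by (rule measurable_completion) (use g in simp)
  have "esssup lebesgue f = esssup lebesgue g"
    by (rule esssup_AE_cong[OF f' g' AE_completion[OF eq]])
  also have "\<dots> = esssup lborel g"
    using g g' by (simp add: esssup_eq_AE AE_completion_iff)
  finally show ?thesis using True by (simp add: lp_enorm_def)
next
  case False
  have "(\<integral>\<^sup>+x. ennreal_powr (f x) (enn2real p) \<partial>lebesgue) = (\<integral>\<^sup>+x. ennreal_powr (g x) (enn2real p) \<partial>lborel)"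
    unfolding nn_integral_completion using eq by (intro nn_integral_cong_AE) (auto elim!: eventually_mono)
  then show ?thesis using False by (simp add: lp_enorm_def)
qed

text \<open>For \<open>p = \<infinity>\<close>, the essential supremum exceeds \<open>c\<close> iff
  the set where \<open>F\<close> exceeds \<open>c\<close> has nonzero measure, and that measure
  depends measurably on \<open>\<xi>\<close> by Tonelli.\<close>

lemma lp_enorm_measurable:
  fixes F :: "'a::euclidean_space \<Rightarrow> 'b::euclidean_space \<Rightarrow> ennreal"
  assumes [measurable]: "(\<lambda>(x, \<xi>). F x \<xi>) \<in> borel_measurable (borel \<Otimes>\<^sub>M borel)"
  shows "(\<lambda>\<xi>. lp_enorm lborel p (\<lambda>x. F x \<xi>)) \<in> borel_measurable borel"
proof (cases "p = \<infinity>")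
  case True
  have sec: "(\<lambda>x. F x \<xi>) \<in> borel_measurable lborel" for \<xi> by measurable
  have iff: "c < esssup lborel (\<lambda>x. F x \<xi>) \<longleftrightarrow> emeasure lborel {x \<in> space lborel. c < F x \<xi>} \<noteq> 0" for c \<xi>
  proof
    assume "c < esssup lborel (\<lambda>x. F x \<xi>)"
    from esssup_pos_measure[OF sec this] show "emeasure lborel {x \<in> space lborel. c < F x \<xi>} \<noteq> 0" by simp
  next
    assume ne: "emeasure lborel {x \<in> space lborel. c < F x \<xi>} \<noteq> 0"
    show "c < esssup lborel (\<lambda>x. F x \<xi>)"
    proof (rule ccontr)
      assume "\<not> c < esssup lborel (\<lambda>x. F x \<xi>)"
      then have "AE x in lborel. F x \<xi> \<le> c"
        using esssup_AE[where M = lborel and f = "\<lambda>x. F x \<xi>"] by (auto elim!: eventually_mono)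
      then have "emeasure lborel {x \<in> space lborel. \<not> F x \<xi> \<le> c} = 0"
        by (subst AE_iff_measurable[symmetric, OF _ refl]) auto
      with ne show False by (simp add: not_le)
    qed
  qed
  have "(\<lambda>\<xi>. esssup lborel (\<lambda>x. F x \<xi>)) \<in> borel_measurable borel"
  proof (rule borel_measurableI_greater)
    fix c :: ennreal
    have "(\<lambda>\<xi>. \<integral>\<^sup>+x. indicator {x. c < F x \<xi>} x \<partial>lborel) \<in> borel_measurable borel"
    proof -
      have "(\<lambda>\<xi>. \<integral>\<^sup>+x. (if c < F x \<xi> then 1 else 0) \<partial>lborel) \<in> borel_measurable borel" by measurable
      then show ?thesis by (simp add: indicator_def of_bool_def)
    qed
    moreover have "(\<integral>\<^sup>+x. indicator {x. c < F x \<xi>} x \<partial>lborel) = emeasure lborel {x \<in> space lborel. c < F x \<xi>}" for \<xi>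
      by (subst nn_integral_indicator) auto
    ultimately have [measurable]: "(\<lambda>\<xi>. emeasure lborel {x \<in> space lborel. c < F x \<xi>}) \<in> borel_measurable borel" by simp
    show "{\<xi> \<in> space borel. c < esssup lborel (\<lambda>x. F x \<xi>)} \<in> sets borel"
      unfolding iff by measurable
  qed
  then show ?thesis using True by (simp add: lp_enorm_def)
next
  case False
  then show ?thesis by (simp add: lp_enorm_def)
qed

text \<open>The choice \<open>t = (q / i) powr (1 / r)\<close> makes the two terms equal; for
  \<open>q = 0\<close> letting \<open>t\<close> tend to 0 gives \<open>J = 0\<close>. This family of
  linear bounds stands in for Hoelder's inequality and is the source of the constant 2 in
  Minkowski's.\<close>

lemma power_mean_bound:
  fixes J q i r :: real
  assumes J: "0 \<le> J" and q: "0 \<le> q" and i: "0 < i" and r: "1 \<le> r"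
    and bd: "\<And>t. 0 < t \<Longrightarrow> J \<le> t * i + t powr (1 - r) * q"
  shows "J powr r \<le> 2 powr r * i powr (r - 1) * q"
proof (cases "q = 0")
  case True
  have "J \<le> 0"
  proof (rule field_le_epsilon)
    fix e :: real assume "0 < e"
    then show "J \<le> 0 + e" using bd[of "e / i"] i True by simp
  qed
  then show ?thesis using J True by simp
next
  case False
  with q have q: "0 < q" by simp
  define t where "t = (q / i) powr (1 / r)"
  have t: "0 < t" using q i by (simp add: t_def)
  have tr: "t powr r = q / i" using q i r by (simp add: t_def powr_powr)
  have "t powr (1 - r) * q = t * (q / t powr r)" using t by (simp add: powr_diff)
  also have "\<dots> = t * i" using q i by (simp add: tr)
  finally have "J \<le> 2 * (t * i)" using bd[OF t] by (simp add: mult.commute)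
  then have "J powr r \<le> (2 * (t * i)) powr r" using J r by (intro powr_mono2) auto
  also have "\<dots> = 2 powr r * (q / i * i powr r)" using t i by (simp add: powr_mult tr)
  also have "q / i * i powr r = i powr (r - 1) * q" using i by (simp add: powr_diff)
  finally show ?thesis by (simp add: mult.assoc)
qed

lemma ennreal_power_mean_bound:
  fixes J Q :: ennreal and i r :: real
  assumes i: "0 < i" and r: "1 \<le> r"
    and bd: "\<And>t. 0 < t \<Longrightarrow> J \<le> ennreal (t * i) + ennreal (t powr (1 - r)) * Q"
  shows "ennreal_powr J r \<le> ennreal (2 powr r * i powr (r - 1)) * Q"
proof (cases Q)
  case top
  then show ?thesis using i by (simp add: ennreal_mult_top)
next
  case (real q)
  have "J \<le> ennreal (1 * i) + ennreal (1 powr (1 - r)) * ennreal q" using bd[of 1] real by simp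
  also have "\<dots> < top" by (simp add: ennreal_mult[symmetric] ennreal_plus[symmetric] real i less_imp_le del: ennreal_plus)
  finally obtain j where j: "J = ennreal j" "0 \<le> j" by (cases J) auto
  have "j \<le> t * i + t powr (1 - r) * q" if t: "0 < t" for t
  proof -
    have "ennreal j \<le> ennreal (t * i + t powr (1 - r) * q)"
      using bd[OF t] i t real j by (simp add: ennreal_mult ennreal_plus)
    then show ?thesis using i t real(1) by (subst (asm) ennreal_le_iff) auto
  qed
  from power_mean_bound[OF j(2) real(1) i r this] show ?thesis
    using j real by (simp add: ennreal_mult[symmetric])
qed

text \<open>Either \<open>f \<le> t * n\<close>, or \<open>f = f powr (1 - r) * f powr r\<close>,
  where the first factor is at most \<open>(t * n) powr (1 - r)\<close> because
  \<open>1 - r \<le> 0\<close>.\<close>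

lemma ennreal_young:
  assumes t: "0 < t" and n: "0 < n" and r: "1 \<le> r"
  shows "f \<le> ennreal t * ennreal n + ennreal (t powr (1 - r)) * (ennreal (n powr (1 - r)) * ennreal_powr f r)"
proof (cases f)
  case top
  then show ?thesis using t n by (simp add: ennreal_mult_top)
next
  case (real x)
  have "x \<le> t * n + t powr (1 - r) * (n powr (1 - r) * x powr r)"
  proof (cases "x \<le> t * n")
    case True
    then show ?thesis by (simp add: add_increasing2)
  next
    case False
    then have x: "0 < x" using False mult_pos_pos[OF t n] by linarith
    have "x = x powr (1 - r) * x powr r" using x by (simp add: powr_add[symmetric])
    also have "\<dots> \<le> (t * n) powr (1 - r) * x powr r"
      using False t n r x by (intro mult_right_mono powr_mono2') auto
    also have "\<dots> = t powr (1 - r) * (n powr (1 - r) * x powr r)" using t n by (simp add: powr_mult)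
    finally have "x \<le> t powr (1 - r) * (n powr (1 - r) * x powr r)" .
    then show ?thesis using mult_pos_pos[OF t n] by linarith
  qed
  then show ?thesis using real t n by (simp add: ennreal_mult[symmetric] ennreal_plus[symmetric] ennreal_leI del: ennreal_plus)
qed

text \<open>\<open>n y\<close> acts as a density in \<open>y\<close>: \<open>ennreal_young\<close>
  with this \<open>n\<close> bounds the \<open>r\<close>-th power of the integral by a multiple of
  the integral of \<open>n powr (1 - r) * f powr r\<close>, whose \<open>x\<close>-integral is at
  most \<open>n y\<close> for almost every \<open>y\<close>. Tonelli then concludes. For
  \<open>p = \<infinity>\<close> the two almost-everywhere quantifiers are exchanged
  instead.\<close>

lemma minkowski_real:
  fixes f :: "'b::euclidean_space \<Rightarrow> 'a::euclidean_space \<Rightarrow> ennreal" and n :: "'b \<Rightarrow> real"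
  assumes f[measurable]: "(\<lambda>(y, x). f y x) \<in> borel_measurable (borel \<Otimes>\<^sub>M borel)" and n[measurable]: "n \<in> borel_measurable borel"
    and npos: "\<And>y. 0 < n y" and i: "(\<integral>\<^sup>+y. ennreal (n y) \<partial>lborel) = ennreal i" "0 < i" and p: "1 \<le> p"
    and bd: "AE y in lborel. lp_enorm lborel p (f y) \<le> ennreal (n y)"
  shows "lp_enorm lborel p (\<lambda>x. \<integral>\<^sup>+y. f y x \<partial>lborel) \<le> ennreal (2 * i)"
proof (cases "p = \<infinity>")
  case True
  have "AE y in lborel. AE x in lborel. f y x \<le> ennreal (n y)"
    using bd
  proof eventually_elim
    case (elim y)
    show ?case using esssup_AE[where M = lborel and f = "f y"] elim True by (auto simp: lp_enorm_def elim!: eventually_mono)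
  qed
  moreover have "{x \<in> space (lborel \<Otimes>\<^sub>M lborel). f (fst x) (snd x) \<le> ennreal (n (fst x))} \<in> sets (lborel \<Otimes>\<^sub>M lborel)"
  proof -
    have [measurable]: "(\<lambda>x. f (fst x) (snd x)) \<in> borel_measurable (lborel \<Otimes>\<^sub>M lborel)"
      using f by (simp add: split_beta')
    show ?thesis by measurable
  qed
  ultimately have "AE x in lborel. AE y in lborel. f y x \<le> ennreal (n y)"
    by (subst (asm) lborel_pair.AE_commute) simp_all
  then have "AE x in lborel. (\<integral>\<^sup>+y. f y x \<partial>lborel) \<le> ennreal i"
    unfolding i(1)[symmetric] by eventually_elim (rule nn_integral_mono_AE)
  then have "esssup lborel (\<lambda>x. \<integral>\<^sup>+y. f y x \<partial>lborel) \<le> ennreal i" by (intro esssup_I) auto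
  also have "\<dots> \<le> ennreal (2 * i)" using i by (intro ennreal_leI) auto
  finally show ?thesis using True by (simp add: lp_enorm_def)
next
  case False
  let ?r = "enn2real p"
  have r: "1 \<le> ?r" using p False by (cases p) auto
  define Q where "Q x = (\<integral>\<^sup>+y. ennreal (n y powr (1 - ?r)) * ennreal_powr (f y x) ?r \<partial>lborel)" for x
  let ?J = "\<lambda>x. \<integral>\<^sup>+y. f y x \<partial>lborel"
  have J: "ennreal_powr (?J x) ?r \<le> ennreal (2 powr ?r * i powr (?r - 1)) * Q x" for x
  proof (rule ennreal_power_mean_bound[OF i(2) r])
    fix t :: real assume t: "0 < t"
    have "?J x \<le> (\<integral>\<^sup>+y. ennreal t * ennreal (n y) + ennreal (t powr (1 - ?r)) * (ennreal (n y powr (1 - ?r)) * ennreal_powr (f y x) ?r) \<partial>lborel)"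
      by (intro nn_integral_mono ennreal_young t npos r)
    also have "\<dots> = ennreal t * ennreal i + ennreal (t powr (1 - ?r)) * Q x"
      unfolding Q_def i(1)[symmetric] by (subst nn_integral_add) (auto simp: nn_integral_cmult)
    finally show "?J x \<le> ennreal (t * i) + ennreal (t powr (1 - ?r)) * Q x"
      using t i by (simp add: ennreal_mult)
  qed
  have "(\<integral>\<^sup>+x. Q x \<partial>lborel) = (\<integral>\<^sup>+y. \<integral>\<^sup>+x. ennreal (n y powr (1 - ?r)) * ennreal_powr (f y x) ?r \<partial>lborel \<partial>lborel)"
    unfolding Q_def by (rule lborel_pair.Fubini'[symmetric]) measurable
  also have "\<dots> = (\<integral>\<^sup>+y. ennreal (n y powr (1 - ?r)) * (\<integral>\<^sup>+x. ennreal_powr (f y x) ?r \<partial>lborel) \<partial>lborel)"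
    by (simp add: nn_integral_cmult)
  also have "\<dots> \<le> (\<integral>\<^sup>+y. ennreal (n y) \<partial>lborel)"
  proof (rule nn_integral_mono_AE, use bd in eventually_elim)
    fix y assume "lp_enorm lborel p (f y) \<le> ennreal (n y)"
    then have "(\<integral>\<^sup>+x. ennreal_powr (f y x) ?r \<partial>lborel) \<le> ennreal (n y powr ?r)"
      using npos[of y] False p by (subst (asm) lp_enorm_le_iff) auto
    then have "ennreal (n y powr (1 - ?r)) * (\<integral>\<^sup>+x. ennreal_powr (f y x) ?r \<partial>lborel) \<le> ennreal (n y powr (1 - ?r)) * ennreal (n y powr ?r)"
      by (intro mult_left_mono) auto
    also have "\<dots> = ennreal (n y)" using npos[of y] by (simp add: ennreal_mult[symmetric] powr_add[symmetric])
    finally show "ennreal (n y powr (1 - ?r)) * (\<integral>\<^sup>+x. ennreal_powr (f y x) ?r \<partial>lborel) \<le> ennreal (n y)" .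
  qed
  finally have Qi: "(\<integral>\<^sup>+x. Q x \<partial>lborel) \<le> ennreal i" using i by simp
  have "(\<integral>\<^sup>+x. ennreal_powr (?J x) ?r \<partial>lborel) \<le> (\<integral>\<^sup>+x. ennreal (2 powr ?r * i powr (?r - 1)) * Q x \<partial>lborel)"
    by (intro nn_integral_mono J)
  also have "\<dots> = ennreal (2 powr ?r * i powr (?r - 1)) * (\<integral>\<^sup>+x. Q x \<partial>lborel)"
    unfolding Q_def by (rule nn_integral_cmult) measurable
  also have "\<dots> \<le> ennreal (2 powr ?r * i powr (?r - 1)) * ennreal i" by (intro mult_left_mono Qi) auto
  also have "\<dots> = ennreal ((2 * i) powr ?r)"
    using i by (simp add: ennreal_mult[symmetric] powr_mult powr_diff)
  finally show ?thesis using i False p by (subst lp_enorm_le_iff) auto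
qed

lemma rho_int_pos: "0 < rho_int TYPE('a::euclidean_space)"
proof -
  have "\<not> (AE y in lborel. rho (y::'a) = 0)"
  proof
    assume "AE y in lborel. rho (y::'a) = 0"
    then have "AE y in (lborel :: 'a measure). False"
    proof eventually_elim
      case (elim y)
      then show False using rho_pos[of y] by simp
    qed
    then show False by (simp add: AE_iff_measurable[OF _ refl])
  qed
  then have "rho_int TYPE('a) \<noteq> 0"
    using integral_nonneg_eq_0_iff_AE[OF integrable_rho[where 'a='a]] rho_nonneg by auto
  then show ?thesis using rho_int_nonneg[where 'a='a] by simp
qed

lemma nn_integral_rho: "(\<integral>\<^sup>+y. ennreal (rho (y::'a::euclidean_space)) \<partial>lborel) = ennreal (rho_int TYPE('a))"
  by (rule nn_integral_eq_integral[OF integrable_rho]) (simp add: rho_nonneg)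

text \<open>\<open>minkowski_real\<close> wants a positive real density, whereas \<open>N\<close>
  may vanish, and may be infinite on a null set. Adding \<open>\<delta> * rho\<close> repairs
  positivity at a cost proportional to \<open>\<delta>\<close>, which is then made arbitrarily
  small.\<close>

lemma minkowski:
  fixes f :: "'b::euclidean_space \<Rightarrow> 'a::euclidean_space \<Rightarrow> ennreal" and N :: "'b \<Rightarrow> ennreal"
  assumes f: "(\<lambda>(y, x). f y x) \<in> borel_measurable (borel \<Otimes>\<^sub>M borel)" and N[measurable]: "N \<in> borel_measurable borel"
    and p: "1 \<le> p" and bd: "\<And>y. lp_enorm lborel p (f y) \<le> N y"
  shows "lp_enorm lborel p (\<lambda>x. \<integral>\<^sup>+y. f y x \<partial>lborel) \<le> 2 * (\<integral>\<^sup>+y. N y \<partial>lborel)"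
proof (cases "(\<integral>\<^sup>+y. N y \<partial>lborel) = \<infinity>")
  case True
  then show ?thesis by (simp add: ennreal_mult_top)
next
  case False
  let ?L = "lp_enorm lborel p (\<lambda>x. \<integral>\<^sup>+y. f y x \<partial>lborel)" let ?R = "rho_int TYPE('b)"
  obtain I where I: "(\<integral>\<^sup>+y. N y \<partial>lborel) = ennreal I" "0 \<le> I" using False by (cases "\<integral>\<^sup>+y. N y \<partial>lborel") auto
  have fin: "AE y in lborel. N y \<noteq> \<infinity>" by (rule nn_integral_noteq_infinite) (use False in auto)
  note Rr = nn_integral_rho[where 'a='b] and R = rho_int_pos[where 'a='b]
  have step: "?L \<le> ennreal (2 * (I + \<delta> * ?R))" if \<delta>: "0 < \<delta>" for \<delta>
  proof (rule minkowski_real[OF f _ _ _ _ p])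
    show "(\<lambda>y. enn2real (N y) + \<delta> * rho y) \<in> borel_measurable borel" by measurable
    show "0 < enn2real (N y) + \<delta> * rho y" for y using \<delta> rho_pos[of y] by (simp add: add_nonneg_pos)
    have "(\<integral>\<^sup>+y. ennreal (enn2real (N y) + \<delta> * rho y) \<partial>lborel) = (\<integral>\<^sup>+y. N y + ennreal \<delta> * ennreal (rho y) \<partial>lborel)"
      using fin
      by (intro nn_integral_cong_AE) (auto elim!: eventually_mono simp: ennreal_plus ennreal_mult \<delta> less_imp_le rho_nonneg ennreal_enn2real_if)
    also have "\<dots> = ennreal I + ennreal \<delta> * ennreal ?R"
      by (subst nn_integral_add) (auto simp: nn_integral_cmult I Rr)
    also have "\<dots> = ennreal (I + \<delta> * ?R)" using I \<delta> R by (simp add: ennreal_plus ennreal_mult)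
    finally show "(\<integral>\<^sup>+y. ennreal (enn2real (N y) + \<delta> * rho y) \<partial>lborel) = ennreal (I + \<delta> * ?R)" .
    show "0 < I + \<delta> * ?R" using I \<delta> R by (simp add: add_nonneg_pos)
    show "AE y in lborel. lp_enorm lborel p (f y) \<le> ennreal (enn2real (N y) + \<delta> * rho y)"
      using fin
    proof eventually_elim
      case (elim y)
      have "N y = ennreal (enn2real (N y))" using elim by (simp add: ennreal_enn2real_if)
      also have "\<dots> \<le> ennreal (enn2real (N y) + \<delta> * rho y)" using \<delta> rho_nonneg[of y] by (intro ennreal_leI) auto
      finally show ?case using bd[of y] by (rule order.trans[rotated])
    qed
  qed
  have "?L \<le> ennreal (2 * I)"
  proof (rule ennreal_le_epsilon)
    fix e :: real assume e: "0 < e"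
    have "?L \<le> ennreal (2 * (I + e / (2 * ?R) * ?R))" using e R by (intro step) auto
    also have "\<dots> = ennreal (2 * I) + ennreal e" using e I R by (simp add: ennreal_plus[symmetric] algebra_simps del: ennreal_plus)
    finally show "?L \<le> ennreal (2 * I) + ennreal e" .
  qed
  then show ?thesis using I by (simp add: ennreal_mult)
qed

section \<open>Translations and the weight \<open>rho\<close> in Lebesgue norms\<close>

lemma lp_enorm_shift:
  fixes f :: "'a::euclidean_space \<Rightarrow> ennreal"
  assumes f[measurable]: "f \<in> borel_measurable borel"
  shows "lp_enorm lborel p (\<lambda>x. f (x - a)) = lp_enorm lborel p f"
proof (cases "p = \<infinity>")
  case True
  have "(AE x in lborel. f (x - a) \<le> c) \<longleftrightarrow> (AE x in lborel. f x \<le> c)" for c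
  proof -
    have "(AE x in lborel. f x \<le> c) \<longleftrightarrow> (AE x in distr lborel borel (\<lambda>x. - a + x). f x \<le> c)"
      unfolding lborel_distr_plus ..
    also have "\<dots> \<longleftrightarrow> (AE x in lborel. f (- a + x) \<le> c)" by (subst AE_distr_iff) auto
    finally show ?thesis by simp
  qed
  then show ?thesis using True by (simp add: lp_enorm_def esssup_eq_AE)
next
  case False
  have "(\<integral>\<^sup>+x. ennreal_powr (f (x - a)) r \<partial>lborel) = (\<integral>\<^sup>+x. ennreal_powr (f x) r \<partial>lborel)" for r
    using nn_integral_lborel_shift[of "\<lambda>x. ennreal_powr (f x) r" "- a"] by simp
  then show ?thesis using False by (simp add: lp_enorm_def)
qed

text \<open>Hoelder's inequality for the fixed function \<open>rho\<close>: Young's inequality with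
  \<open>n = 1\<close>, multiplied by \<open>rho \<le> 1\<close>, has the form required by
  \<open>ennreal_power_mean_bound\<close> with \<open>i\<close> the integral of
  \<open>rho\<close>.\<close>

lemma lp_enorm_rho_integral:
  assumes p: "1 \<le> p"
  obtains C where "0 < C"
    "\<And>f :: 'a::euclidean_space \<Rightarrow> ennreal. f \<in> borel_measurable borel \<Longrightarrow>
      (\<integral>\<^sup>+x. f x * ennreal (rho x) \<partial>lborel) \<le> ennreal C * lp_enorm lborel p f"
proof (cases "p = \<infinity>")
  case True
  have "(\<integral>\<^sup>+x. f x * ennreal (rho x) \<partial>lborel) \<le> ennreal (rho_int TYPE('a)) * lp_enorm lborel p f"
    if [measurable]: "f \<in> borel_measurable borel" for f :: "'a \<Rightarrow> ennreal"
  proof -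
    have "(\<integral>\<^sup>+x. f x * ennreal (rho x) \<partial>lborel) \<le> (\<integral>\<^sup>+x. esssup lborel f * ennreal (rho x) \<partial>(lborel :: 'a measure))"
      by (rule nn_integral_mono_AE)
        (use esssup_AE[where M = lborel and f = f] in \<open>auto elim!: eventually_mono intro: mult_right_mono\<close>)
    also have "\<dots> = esssup lborel f * ennreal (rho_int TYPE('a))"
      by (simp add: nn_integral_cmult nn_integral_rho)
    finally show ?thesis using True by (simp add: lp_enorm_def mult.commute)
  qed
  then show ?thesis using that rho_int_pos by blast
next
  case False
  let ?r = "enn2real p" let ?R = "rho_int TYPE('a)"
  have r: "1 \<le> ?r" using p False by (cases p) auto
  let ?C = "(2 powr ?r * ?R powr (?r - 1)) powr (1 / ?r)"
  have "(\<integral>\<^sup>+x. f x * ennreal (rho x) \<partial>lborel) \<le> ennreal ?C * lp_enorm lborel p f"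
    if [measurable]: "f \<in> borel_measurable borel" for f :: "'a \<Rightarrow> ennreal"
  proof -
    let ?Q = "\<integral>\<^sup>+x. ennreal_powr (f x) ?r \<partial>lborel" let ?J = "\<integral>\<^sup>+x. f x * ennreal (rho x) \<partial>lborel"
    have "ennreal_powr ?J ?r \<le> ennreal (2 powr ?r * ?R powr (?r - 1)) * ?Q"
    proof (rule ennreal_power_mean_bound[OF rho_int_pos r])
      fix t :: real assume t: "0 < t"
      have "f x * ennreal (rho x) \<le> ennreal t * ennreal (rho x) + ennreal (t powr (1 - ?r)) * ennreal_powr (f x) ?r" for x
      proof -
        have "f x \<le> ennreal t + ennreal (t powr (1 - ?r)) * ennreal_powr (f x) ?r"
          using ennreal_young[OF t _ r, of 1 "f x"] by simp
        then have "f x * ennreal (rho x) \<le> (ennreal t + ennreal (t powr (1 - ?r)) * ennreal_powr (f x) ?r) * ennreal (rho x)"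
          by (rule mult_right_mono) simp
        also have "\<dots> = ennreal t * ennreal (rho x) + ennreal (t powr (1 - ?r)) * ennreal_powr (f x) ?r * ennreal (rho x)"
          by (rule distrib_right)
        also have "\<dots> \<le> ennreal t * ennreal (rho x) + ennreal (t powr (1 - ?r)) * ennreal_powr (f x) ?r * 1"
          by (intro add_left_mono mult_left_mono) (auto simp: rho_le_1)
        finally show ?thesis by simp
      qed
      then have "?J \<le> (\<integral>\<^sup>+x. ennreal t * ennreal (rho x) + ennreal (t powr (1 - ?r)) * ennreal_powr (f x) ?r \<partial>lborel)"
        by (rule nn_integral_mono)
      also have "\<dots> = ennreal t * ennreal ?R + ennreal (t powr (1 - ?r)) * ?Q"
        by (subst nn_integral_add) (auto simp: nn_integral_cmult nn_integral_rho)
      finally show "?J \<le> ennreal (t * ?R) + ennreal (t powr (1 - ?r)) * ?Q"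
        using t by (simp add: ennreal_mult rho_int_nonneg)
    qed
    from ennreal_powr_mono[OF this, of "1 / ?r"]
    have "?J \<le> ennreal_powr (ennreal (2 powr ?r * ?R powr (?r - 1)) * ?Q) (1 / ?r)"
      using r by (simp add: ennreal_powr_inverse)
    also have "\<dots> = ennreal ?C * ennreal_powr ?Q (1 / ?r)"
      using r rho_int_pos[where 'a='a] by (intro ennreal_powr_cmult) auto
    finally show ?thesis using False by (simp add: lp_enorm_def)
  qed
  moreover have "0 < ?C" using rho_int_pos[where 'a='a] by simp
  ultimately show ?thesis using that by blast
qed

lemma lp_enorm_rho_finite:
  assumes p: "1 \<le> p"
  shows "lp_enorm lborel p (\<lambda>x::'a::euclidean_space. ennreal (rho x)) < \<infinity>"
proof (cases "p = \<infinity>")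
  case True
  have "esssup lborel (\<lambda>x::'a. ennreal (rho x)) \<le> 1" by (intro esssup_I AE_I2) (auto simp: rho_le_1)
  then show ?thesis using True by (simp add: lp_enorm_def order.strict_trans1)
next
  case False
  let ?r = "enn2real p"
  have r: "1 \<le> ?r" using p False by (cases p) auto
  have "ennreal_powr (ennreal (rho (x::'a))) ?r \<le> ennreal (rho x)" for x
  proof -
    have "rho x powr ?r \<le> rho x powr 1" using r rho_pos[of x] rho_le_1[of x] by (intro powr_mono') auto
    then show ?thesis using rho_pos[of x] by (simp add: ennreal_leI)
  qed
  then have "(\<integral>\<^sup>+x. ennreal_powr (ennreal (rho x)) ?r \<partial>(lborel :: 'a measure)) \<le> (\<integral>\<^sup>+x. ennreal (rho x) \<partial>(lborel :: 'a measure))"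
    by (rule nn_integral_mono)
  also have "\<dots> < top" by (simp add: nn_integral_rho)
  finally have "(\<integral>\<^sup>+x. ennreal_powr (ennreal (rho x)) ?r \<partial>(lborel :: 'a measure)) < top" .
  then show ?thesis using False
    by (cases "\<integral>\<^sup>+x. ennreal_powr (ennreal (rho x)) ?r \<partial>(lborel :: 'a measure)") (auto simp: lp_enorm_def less_top)
qed

text \<open>The norm of \<open>mod_enorm\<close> taken over \<open>lborel\<close>, for Borel
  integrands: every section is then measurable and Tonelli applies directly.\<close>

definition mixed_enorm :: "ennreal \<Rightarrow> ennreal \<Rightarrow> ('a::euclidean_space \<times> 'b::euclidean_space \<Rightarrow> ennreal) \<Rightarrow> ennreal"
  where "mixed_enorm p q F = lp_enorm lborel q (\<lambda>\<xi>. lp_enorm lborel p (\<lambda>x. F (x, \<xi>)))"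

lemma section_measurable:
  fixes F :: "'a::euclidean_space \<times> 'b::euclidean_space \<Rightarrow> ennreal"
  assumes F: "F \<in> borel_measurable borel"
  shows "(\<lambda>x. F (x, \<xi>)) \<in> borel_measurable borel"
proof -
  have [measurable]: "F \<in> borel_measurable (borel \<Otimes>\<^sub>M borel)" using F by (simp add: borel_prod)
  show ?thesis by measurable
qed

lemma section_enorm_measurable:
  fixes F :: "'a::euclidean_space \<times> 'b::euclidean_space \<Rightarrow> ennreal"
  assumes F: "F \<in> borel_measurable borel"
  shows "(\<lambda>\<xi>. lp_enorm lborel p (\<lambda>x. F (x, \<xi>))) \<in> borel_measurable borel"
  using F by (intro lp_enorm_measurable) (simp add: borel_prod)

lemma mixed_enorm_mono:
  assumes "F \<in> borel_measurable borel" "\<And>z. F z \<le> G z"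
  shows "mixed_enorm p q F \<le> mixed_enorm p q G"
  unfolding mixed_enorm_def using assms
  by (intro lp_enorm_AE_mono AE_I2) (auto simp: section_measurable section_enorm_measurable)

lemma mixed_enorm_cmult_le:
  assumes F: "F \<in> borel_measurable borel" and c: "0 < c" and p: "1 \<le> p" "1 \<le> q"
  shows "mixed_enorm p q (\<lambda>z. ennreal c * F z) \<le> ennreal c * mixed_enorm p q F"
  unfolding mixed_enorm_def
  using F c p by (intro lp_enorm_le_cmult lp_enorm_cmult_le) (auto simp: section_measurable intro!: section_enorm_measurable)

lemma mixed_enorm_rho_finite:
  assumes p: "1 \<le> p" "1 \<le> q"
  shows "mixed_enorm p q (\<lambda>z::'a::euclidean_space \<times> 'b::euclidean_space. ennreal (rho z)) < \<infinity>"
proof -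
  let ?A = "lp_enorm lborel p (\<lambda>x::'a. ennreal (rho x))" let ?B = "lp_enorm lborel q (\<lambda>x::'b. ennreal (rho x))"
  have m: "(\<lambda>z::'a \<times> 'b. ennreal (rho z)) \<in> borel_measurable borel" by measurable
  have "lp_enorm lborel p (\<lambda>x::'a. ennreal (rho (x, \<xi>))) \<le> ennreal (rho \<xi>) * ?A" for \<xi> :: 'b
    by (rule lp_enorm_le_cmult[OF _ _ rho_pos p(1)])
      (auto simp: rho_prod ennreal_mult rho_nonneg mult.commute intro!: section_measurable)
  moreover obtain a where a: "?A = ennreal a" "0 \<le> a"
    using lp_enorm_rho_finite[OF p(1), where 'a='a] by (cases ?A) auto
  ultimately have bd: "lp_enorm lborel p (\<lambda>x::'a. ennreal (rho (x, \<xi>))) \<le> ennreal (a + 1) * ennreal (rho \<xi>)" for \<xi> :: 'b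
  proof -
    have "lp_enorm lborel p (\<lambda>x::'a. ennreal (rho (x, \<xi>))) \<le> ennreal (rho \<xi>) * ennreal a"
      using \<open>\<And>\<xi>. lp_enorm lborel p (\<lambda>x::'a. ennreal (rho (x, \<xi>))) \<le> ennreal (rho \<xi>) * ?A\<close>[of \<xi>] a by simp
    also have "\<dots> \<le> ennreal (rho \<xi>) * ennreal (a + 1)" by (intro mult_left_mono ennreal_leI) auto
    finally show ?thesis by (simp add: mult.commute)
  qed
  have "mixed_enorm p q (\<lambda>z::'a \<times> 'b. ennreal (rho z)) \<le> ennreal (a + 1) * ?B"
    unfolding mixed_enorm_def using a p bd
    by (intro lp_enorm_le_cmult) (auto intro!: section_enorm_measurable)
  also have "\<dots> < \<infinity>" using lp_enorm_rho_finite[OF p(2), where 'a='b] by (simp add: ennreal_mult_less_top)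
  finally show ?thesis .
qed

lemma mixed_enorm_rho_integral:
  assumes p: "1 \<le> p" "1 \<le> q" and F: "F \<in> borel_measurable borel"
    and fin: "mixed_enorm p q F < \<infinity>"
  shows "(\<integral>\<^sup>+z. F z * ennreal (rho z) \<partial>(lborel :: ('a::euclidean_space \<times> 'b::euclidean_space) measure)) < \<infinity>"
proof -
  obtain C where C: "0 < C" "\<And>f :: 'a \<Rightarrow> ennreal. f \<in> borel_measurable borel \<Longrightarrow>
      (\<integral>\<^sup>+x. f x * ennreal (rho x) \<partial>lborel) \<le> ennreal C * lp_enorm lborel p f"
    by (rule lp_enorm_rho_integral[OF p(1)]) (rule that)
  obtain D where D: "0 < D" "\<And>f :: 'b \<Rightarrow> ennreal. f \<in> borel_measurable borel \<Longrightarrow>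
      (\<integral>\<^sup>+x. f x * ennreal (rho x) \<partial>lborel) \<le> ennreal D * lp_enorm lborel q f"
    by (rule lp_enorm_rho_integral[OF p(2)]) (rule that)
  have [measurable]: "F \<in> borel_measurable (borel \<Otimes>\<^sub>M borel)" using F by (simp add: borel_prod)
  note [measurable] = section_enorm_measurable[OF F]
  have "(\<integral>\<^sup>+z. F z * ennreal (rho z) \<partial>lborel) = (\<integral>\<^sup>+\<xi>. \<integral>\<^sup>+x. F (x, \<xi>) * ennreal (rho (x, \<xi>)) \<partial>lborel \<partial>lborel)"
    unfolding lborel_prod[symmetric]
    by (rule lborel_pair.nn_integral_snd[symmetric])
      (use F in \<open>simp add: borel_prod lborel_prod\<close>)
  also have "\<dots> = (\<integral>\<^sup>+\<xi>. (\<integral>\<^sup>+x. F (x, \<xi>) * ennreal (rho x) \<partial>lborel) * ennreal (rho \<xi>) \<partial>lborel)"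
    by (subst nn_integral_multc[symmetric]) (auto simp: rho_prod ennreal_mult rho_nonneg mult.assoc)
  also have "\<dots> \<le> (\<integral>\<^sup>+\<xi>. ennreal C * lp_enorm lborel p (\<lambda>x. F (x, \<xi>)) * ennreal (rho \<xi>) \<partial>lborel)"
    by (intro nn_integral_mono mult_right_mono C section_measurable F) simp
  also have "\<dots> = ennreal C * (\<integral>\<^sup>+\<xi>. lp_enorm lborel p (\<lambda>x. F (x, \<xi>)) * ennreal (rho \<xi>) \<partial>lborel)"
    by (subst nn_integral_cmult[symmetric]) (auto simp: mult.assoc)
  also have "\<dots> \<le> ennreal C * (ennreal D * mixed_enorm p q F)"
    unfolding mixed_enorm_def by (intro mult_left_mono D section_enorm_measurable F) simp
  also have "\<dots> < \<infinity>" using fin by (simp add: ennreal_mult_less_top)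
  finally show ?thesis .
qed

text \<open>After reflection the convolution superposes translates \<open>F (w - y)\<close> with
  weights \<open>rho y\<close>, and translations preserve the norms. Minkowski's inequality is used
  once in \<open>x\<close> and once in \<open>\<xi>\<close>, hence \<open>4 = 2 * 2\<close>.\<close>

lemma mixed_enorm_convolution:
  fixes F :: "'a::euclidean_space \<times> 'b::euclidean_space \<Rightarrow> ennreal"
  assumes p: "1 \<le> p" "1 \<le> q" and F: "F \<in> borel_measurable borel"
  shows "mixed_enorm p q (\<lambda>w. \<integral>\<^sup>+z. F z * ennreal (rho (w - z)) \<partial>lborel)
    \<le> ennreal (4 * rho_int TYPE('a \<times> 'b)) * mixed_enorm p q F"
proof -
  define N where "N \<xi> = lp_enorm lborel p (\<lambda>x. F (x, \<xi>))" for \<xi>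
  have [measurable]: "N \<in> borel_measurable borel" unfolding N_def by (rule section_enorm_measurable[OF F])
  have [measurable]: "F \<in> borel_measurable (borel \<Otimes>\<^sub>M borel)" using F by (simp add: borel_prod)
  have [measurable]: "(rho :: 'a \<times> 'b \<Rightarrow> real) \<in> borel_measurable (borel \<Otimes>\<^sub>M borel)" by (simp add: borel_prod)
  have conv: "(\<integral>\<^sup>+z. F z * ennreal (rho (w - z)) \<partial>lborel) = (\<integral>\<^sup>+y. ennreal (rho y) * F (w - y) \<partial>lborel)" for w
    using nn_integral_lborel_reflect[of "\<lambda>y. ennreal (rho y) * F (w - y)" w] F by (simp add: mult.commute)
  have Gm: "(\<lambda>w. \<integral>\<^sup>+z. F z * ennreal (rho (w - z)) \<partial>lborel) \<in> borel_measurable borel"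
  proof -
    have "(\<lambda>(w, z). F z * ennreal (rho (w - z))) \<in> borel_measurable (borel \<Otimes>\<^sub>M borel)"
      using F by measurable
    then show ?thesis by (intro lborel.borel_measurable_nn_integral) simp
  qed
  have inner: "lp_enorm lborel p (\<lambda>x. \<integral>\<^sup>+z. F z * ennreal (rho ((x, \<xi>) - z)) \<partial>lborel)
      \<le> ennreal 2 * (\<integral>\<^sup>+y. ennreal (rho y) * N (\<xi> - snd y) \<partial>(lborel :: ('a \<times> 'b) measure))" for \<xi>
    unfolding conv ennreal_numeral
  proof (rule minkowski[OF _ _ p(1)])
    have "(\<lambda>(y, x). ennreal (rho y) * F (x - fst y, \<xi> - snd y)) \<in> borel_measurable ((borel \<Otimes>\<^sub>M borel) \<Otimes>\<^sub>M borel)"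
      by measurable
    then show "(\<lambda>(y, x). ennreal (rho y) * F ((x, \<xi>) - y)) \<in> borel_measurable (borel \<Otimes>\<^sub>M borel)"
      by (simp add: borel_prod minus_prod_def)
    have "(\<lambda>y :: 'a \<times> 'b. ennreal (rho y) * N (\<xi> - snd y)) \<in> borel_measurable (borel \<Otimes>\<^sub>M borel)" by measurable
    then show "(\<lambda>y :: 'a \<times> 'b. ennreal (rho y) * N (\<xi> - snd y)) \<in> borel_measurable borel" by (simp add: borel_prod)
    fix y :: "'a \<times> 'b"
    have "lp_enorm lborel p (\<lambda>x. ennreal (rho y) * F ((x, \<xi>) - y))
        \<le> ennreal (rho y) * lp_enorm lborel p (\<lambda>x. F (x - fst y, \<xi> - snd y))"
      unfolding minus_prod_def fst_conv snd_conv
      by (rule lp_enorm_cmult_le[OF _ rho_pos p(1)]) measurable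
    also have "lp_enorm lborel p (\<lambda>x. F (x - fst y, \<xi> - snd y)) = N (\<xi> - snd y)"
      unfolding N_def by (rule lp_enorm_shift[OF section_measurable[OF F]])
    finally show "lp_enorm lborel p (\<lambda>x. ennreal (rho y) * F ((x, \<xi>) - y)) \<le> ennreal (rho y) * N (\<xi> - snd y)" .
  qed
  have "mixed_enorm p q (\<lambda>w. \<integral>\<^sup>+z. F z * ennreal (rho (w - z)) \<partial>lborel)
      \<le> ennreal 2 * lp_enorm lborel q (\<lambda>\<xi>. \<integral>\<^sup>+y. ennreal (rho y) * N (\<xi> - snd y) \<partial>(lborel :: ('a \<times> 'b) measure))"
    unfolding mixed_enorm_def
    by (rule lp_enorm_le_cmult[OF _ inner _ p(2)]) (use section_enorm_measurable[OF Gm] in auto)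
  also have "\<dots> \<le> ennreal 2 * (2 * (\<integral>\<^sup>+y. ennreal (rho y) * lp_enorm lborel q N \<partial>(lborel :: ('a \<times> 'b) measure)))"
  proof (intro mult_left_mono minkowski[OF _ _ p(2)])
    have "(\<lambda>(y :: 'a \<times> 'b, \<xi>). ennreal (rho y) * N (\<xi> - snd y)) \<in> borel_measurable ((borel \<Otimes>\<^sub>M borel) \<Otimes>\<^sub>M borel)" by measurable
    then show "(\<lambda>(y :: 'a \<times> 'b, \<xi>). ennreal (rho y) * N (\<xi> - snd y)) \<in> borel_measurable (borel \<Otimes>\<^sub>M borel)"
      by (simp add: borel_prod)
    fix y :: "'a \<times> 'b"
    have "lp_enorm lborel q (\<lambda>\<xi>. ennreal (rho y) * N (\<xi> - snd y)) \<le> ennreal (rho y) * lp_enorm lborel q (\<lambda>\<xi>. N (\<xi> - snd y))"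
      by (rule lp_enorm_cmult_le[OF _ rho_pos p(2)]) measurable
    also have "lp_enorm lborel q (\<lambda>\<xi>. N (\<xi> - snd y)) = lp_enorm lborel q N"
      by (rule lp_enorm_shift) measurable
    finally show "lp_enorm lborel q (\<lambda>\<xi>. ennreal (rho y) * N (\<xi> - snd y)) \<le> ennreal (rho y) * lp_enorm lborel q N" .
  qed auto
  also have "(\<integral>\<^sup>+y. ennreal (rho y) * lp_enorm lborel q N \<partial>(lborel :: ('a \<times> 'b) measure)) = ennreal (rho_int TYPE('a \<times> 'b)) * lp_enorm lborel q N"
    by (subst nn_integral_multc) (auto simp: nn_integral_rho)
  also have "ennreal 2 * (2 * (ennreal (rho_int TYPE('a \<times> 'b)) * lp_enorm lborel q N))
      = ennreal (4 * rho_int TYPE('a \<times> 'b)) * lp_enorm lborel q N"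
    using rho_int_nonneg[where 'a="'a \<times> 'b"] by (simp add: ennreal_mult mult.assoc[symmetric])
  finally show ?thesis unfolding mixed_enorm_def N_def[abs_def] .
qed

section \<open>Weights\<close>

text \<open>\<open>M z = (SUP y. m y / v (z - y))\<close> is the least majorant of \<open>m\<close>
  that is moderate with constant exactly 1; moderateness of \<open>m\<close> keeps it below
  \<open>C * m\<close>. With constant 1, \<open>M (z + h)\<close> is squeezed between
  \<open>M z / v h\<close> and \<open>v h * M z\<close>, so continuity of \<open>v\<close> at 0
  makes \<open>M\<close> continuous.\<close>

lemma moderate_weight_regular:
  fixes v m :: "'a::euclidean_space \<Rightarrow> real"
  assumes v: "submult_weight v" and m: "m \<in> moderate_weights v"
  obtains M C where "continuous_on UNIV M" "0 < C" "\<And>z. 0 < M z" "\<And>z. m z \<le> M z" "\<And>z. M z \<le> C * m z"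
    "\<And>z \<zeta>. M (z + \<zeta>) \<le> v z * M \<zeta>"
proof -
  have vc: "continuous_on UNIV v" and vp: "\<And>z. 0 < v z" and v0: "v 0 = 1" and vm: "\<And>z. v (- z) = v z"
    and vs: "\<And>z w. v (z + w) \<le> v z * v w"
    using v by (auto simp: submult_weight_def)
  obtain C where C: "0 < C" "\<And>z \<zeta>. m (z + \<zeta>) \<le> C * v z * m \<zeta>" and mp: "\<And>z. 0 < m z"
    using m by (auto simp: moderate_weights_def)
  define M where "M z = (SUP y. m y / v (z - y))" for z
  have bd: "m y / v (z - y) \<le> C * m z" for y z
  proof -
    have "m y \<le> C * v (y - z) * m z" using C(2)[of "y - z" z] by simp
    also have "v (y - z) = v (z - y)" using vm[of "z - y"] by simp
    finally show ?thesis using vp[of "z - y"] by (simp add: pos_divide_le_eq ac_simps)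
  qed
  then have bdd: "bdd_above (range (\<lambda>y. m y / v (z - y)))" for z by (auto intro!: bdd_aboveI)
  have up: "m y / v (z - y) \<le> M z" for y z unfolding M_def by (intro cSUP_upper bdd) auto
  have mM: "m z \<le> M z" for z using up[of z z] v0 by simp
  have MC: "M z \<le> C * m z" for z unfolding M_def by (intro cSUP_least bd) auto
  have pos: "0 < M z" for z using mp[of z] mM[of z] by linarith
  have sub: "M (z + \<zeta>) \<le> v z * M \<zeta>" for z \<zeta>
    unfolding M_def[of "z + \<zeta>"]
  proof (rule cSUP_least)
    fix y
    have "v (\<zeta> - y) \<le> v z * v (z + \<zeta> - y)"
      using vs[of "- z" "z + \<zeta> - y"] by (simp add: vm)
    then have "m y / v (z + \<zeta> - y) \<le> v z * (m y / v (\<zeta> - y))"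
      using vp mp[of y] by (simp add: divide_simps mult_left_mono ac_simps)
    also have "\<dots> \<le> v z * M \<zeta>" using up vp[of z] by (intro mult_left_mono) auto
    finally show "m y / v (z + \<zeta> - y) \<le> v z * M \<zeta>" .
  qed simp
  have "isCont M z" for z
    unfolding isCont_def
  proof (rule LIM_offset_zero_cancel, rule tendsto_sandwich)
    have lv: "(v \<longlongrightarrow> 1) (at 0)" 
    proof -
      have "isCont v 0" using vc by (simp add: continuous_on_eq_continuous_at)
      then show ?thesis by (simp add: isCont_def v0)
    qed
    show "((\<lambda>h. M z / v h) \<longlongrightarrow> M z) (at 0)" using tendsto_divide[OF tendsto_const lv, of "M z"] by simp
    show "((\<lambda>h. v h * M z) \<longlongrightarrow> M z) (at 0)" using tendsto_mult[OF lv tendsto_const, of "M z"] by simp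
    show "\<forall>\<^sub>F h in at 0. M z / v h \<le> M (z + h)"
      using sub[of "- h" "z + h" for h] vp by (simp add: pos_divide_le_eq vm mult.commute)
    show "\<forall>\<^sub>F h in at 0. M (z + h) \<le> v h * M z"
      using sub[of h z for h] by (simp add: add.commute)
  qed
  then have "continuous_on UNIV M" by (simp add: continuous_on_eq_continuous_at)
  then show ?thesis using that C(1) pos mM MC sub by blast
qed

text \<open>The Borel integrand is on the smaller side, so \<open>lp_enorm_le_cmult\<close> applies
  section by section and no Borel representative of \<open>m\<close> has to be chosen.\<close>

lemma mixed_enorm_le_lebesgue:
  fixes f :: "'a::euclidean_space \<times> 'b::euclidean_space \<Rightarrow> real" and m M :: "'a \<times> 'b \<Rightarrow> real"
  assumes f: "f \<in> borel_measurable borel" "\<And>z. 0 \<le> f z" and M: "M \<in> borel_measurable borel"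
    and C: "0 < C" "\<And>z. 0 \<le> m z" "\<And>z. M z \<le> C * m z" and p: "1 \<le> p" "1 \<le> q"
  shows "mixed_enorm p q (\<lambda>z. ennreal (f z * M z))
    \<le> ennreal C * lp_enorm lebesgue q (\<lambda>\<xi>. lp_enorm lebesgue p (\<lambda>x. ennreal (f (x, \<xi>) * m (x, \<xi>))))"
proof -
  have F: "(\<lambda>z. ennreal (f z * M z)) \<in> borel_measurable borel" using f M by measurable
  have le: "ennreal (f z * M z) \<le> ennreal C * ennreal (f z * m z)" for z
    using C f(2)[of z] mult_left_mono[OF C(3) f(2), of z z]
    by (subst ennreal_mult[symmetric]) (auto intro!: ennreal_leI simp: ac_simps)
  have inner: "lp_enorm lborel p (\<lambda>x. ennreal (f (x, \<xi>) * M (x, \<xi>)))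
      \<le> ennreal C * lp_enorm lebesgue p (\<lambda>x. ennreal (f (x, \<xi>) * m (x, \<xi>)))" for \<xi>
  proof -
    have s: "(\<lambda>x. ennreal (f (x, \<xi>) * M (x, \<xi>))) \<in> borel_measurable borel" by (rule section_measurable[OF F])
    have "lp_enorm lborel p (\<lambda>x. ennreal (f (x, \<xi>) * M (x, \<xi>))) = lp_enorm lebesgue p (\<lambda>x. ennreal (f (x, \<xi>) * M (x, \<xi>)))"
      by (rule lp_enorm_lebesgue[symmetric, OF s]) simp
    also have "\<dots> \<le> ennreal C * lp_enorm lebesgue p (\<lambda>x. ennreal (f (x, \<xi>) * m (x, \<xi>)))"
      by (rule lp_enorm_le_cmult[OF _ le C(1) p(1)]) (rule measurable_completion, use s in simp)
    finally show ?thesis .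
  qed
  have s: "(\<lambda>\<xi>. lp_enorm lborel p (\<lambda>x. ennreal (f (x, \<xi>) * M (x, \<xi>)))) \<in> borel_measurable borel"
    by (rule section_enorm_measurable[OF F])
  have "mixed_enorm p q (\<lambda>z. ennreal (f z * M z)) = lp_enorm lebesgue q (\<lambda>\<xi>. lp_enorm lborel p (\<lambda>x. ennreal (f (x, \<xi>) * M (x, \<xi>))))"
    unfolding mixed_enorm_def by (rule lp_enorm_lebesgue[symmetric, OF s]) simp
  also have "\<dots> \<le> ennreal C * lp_enorm lebesgue q (\<lambda>\<xi>. lp_enorm lebesgue p (\<lambda>x. ennreal (f (x, \<xi>) * m (x, \<xi>))))"
    by (rule lp_enorm_le_cmult[OF _ inner C(1) p(2)]) (rule measurable_completion, use s in simp)
  finally show ?thesis .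
qed

text \<open>\<open>P\<close> may define a non-measurable set, while exchanging the almost-everywhere
  quantifiers needs measurability; so the exceptional set is first enlarged to a measurable null
  set.\<close>

lemma AE_lborel_sections:
  assumes "AE z in (lborel :: ('a::euclidean_space \<times> 'b::euclidean_space) measure). P z"
  shows "AE \<xi> in lborel. AE x in lborel. P (x, \<xi>)"
proof -
  have "AE z in (lborel :: 'a measure) \<Otimes>\<^sub>M (lborel :: 'b measure). P z" unfolding lborel_prod by (rule assms)
  then obtain N where N: "N \<in> null_sets ((lborel :: 'a measure) \<Otimes>\<^sub>M (lborel :: 'b measure))"
      "{x\<in>space ((lborel :: 'a measure) \<Otimes>\<^sub>M (lborel :: 'b measure)). \<not> P x} \<subseteq> N"
    unfolding eventually_ae_filter by blast
  have "AE z in (lborel :: 'a measure) \<Otimes>\<^sub>M (lborel :: 'b measure). z \<notin> N"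
    using N(1) by (rule AE_not_in)
  from lborel_pair.AE_pair[OF this] have "AE x in lborel. AE \<xi> in lborel. (x, \<xi>) \<notin> N" .
  then have "AE \<xi> in lborel. AE x in lborel. (x, \<xi>) \<notin> N"
  proof (subst (asm) lborel_pair.AE_commute)
    have "{x \<in> space (lborel \<Otimes>\<^sub>M lborel). (fst x, snd x) \<notin> N} = space (lborel \<Otimes>\<^sub>M lborel) - N" by auto
    then show "{x \<in> space (lborel \<Otimes>\<^sub>M lborel). (fst x, snd x) \<notin> N} \<in> sets (lborel \<Otimes>\<^sub>M lborel)"
      using sets.compl_sets[OF null_setsD2[OF N(1)]] by simp
  qed
  then show ?thesis
    by eventually_elim (erule eventually_mono, use N(2) in \<open>auto simp: space_pair_measure\<close>)
qed

text \<open>Now \<open>m\<close> is on the smaller side, where measurability matters. It is replaced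
  by a Borel representative, which agrees with it almost everywhere on almost every section.\<close>

lemma lebesgue_le_mixed_enorm:
  fixes f :: "'a::euclidean_space \<times> 'b::euclidean_space \<Rightarrow> real" and m M :: "'a \<times> 'b \<Rightarrow> real"
  assumes f: "f \<in> borel_measurable borel" "\<And>z. 0 \<le> f z" and M: "M \<in> borel_measurable borel"
    and m: "m \<in> borel_measurable lebesgue" "\<And>z. m z \<le> M z"
  shows "lp_enorm lebesgue q (\<lambda>\<xi>. lp_enorm lebesgue p (\<lambda>x. ennreal (f (x, \<xi>) * m (x, \<xi>))))
    \<le> mixed_enorm p q (\<lambda>z. ennreal (f z * M z))"
proof -
  obtain m' where m': "m' \<in> borel_measurable lborel" "AE z in lborel. m z = m' z"
    using completion_ex_borel_measurable_real[OF m(1)] by auto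
  \<comment> \<open>The representative \<open>m'\<close> agrees with \<open>m\<close> only almost
    everywhere; the minimum secures \<open>n \<le> M\<close> at every point, as
    \<open>mixed_enorm_mono\<close> requires.\<close>
  define n where "n z = min (m' z) (M z)" for z
  have [measurable]: "n \<in> borel_measurable borel" unfolding n_def using m'(1) M by measurable
  note [measurable] = f(1) M
  have F: "(\<lambda>z. ennreal (f z * n z)) \<in> borel_measurable borel" by measurable
  have "AE z in lborel. m z = n z"
    using m'(2)
  proof eventually_elim
    case (elim z)
    then show ?case using m(2)[of z] by (simp add: n_def min_def)
  qed
  from AE_lborel_sections[OF this]
  have "AE \<xi> in lborel. lp_enorm lebesgue p (\<lambda>x. ennreal (f (x, \<xi>) * m (x, \<xi>))) = lp_enorm lborel p (\<lambda>x. ennreal (f (x, \<xi>) * n (x, \<xi>)))"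
  proof eventually_elim
    case (elim \<xi>)
    show ?case
      by (rule lp_enorm_lebesgue[OF section_measurable[OF F]]) (use elim in eventually_elim, simp)
  qed
  from lp_enorm_lebesgue[OF section_enorm_measurable[OF F] this]
  have "lp_enorm lebesgue q (\<lambda>\<xi>. lp_enorm lebesgue p (\<lambda>x. ennreal (f (x, \<xi>) * m (x, \<xi>)))) = mixed_enorm p q (\<lambda>z. ennreal (f z * n z))"
    by (simp add: mixed_enorm_def)
  also have "\<dots> \<le> mixed_enorm p q (\<lambda>z. ennreal (f z * M z))"
    by (rule mixed_enorm_mono[OF F]) (auto simp: n_def intro!: ennreal_leI mult_left_mono f(2))
  finally show ?thesis .
qed

text \<open>Raise \<open>x ^ n / n! \<le> exp x\<close> to the power \<open>1 - s\<close>, with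
  \<open>x\<close> chosen such that \<open>x powr (1 - s) = C / Q\<close>.\<close>

lemma fact_powr_less_one_bound:
  fixes s C Q :: real
  assumes s: "s < 1" and pos: "0 < C" "0 < Q"
  shows "C ^ n * fact n powr s \<le> exp ((C / Q) powr (1 / (1 - s)) * (1 - s)) * (Q ^ n * fact n)"
proof -
  define x where "x = (C / Q) powr (1 / (1 - s))"
  have x: "0 < x" using pos by (simp add: x_def)
  have "x ^ n / fact n \<le> exp x"
  proof -
    have "(\<lambda>n. x ^ n / fact n) sums exp x" using exp_converges[of x] by (simp add: divide_inverse mult.commute)
    from sum_le_suminf[OF sums_summable[OF this], of "{n}"] sums_unique[OF this] x show ?thesis by simp
  qed
  then have "x ^ n \<le> exp x * fact n" by (simp add: pos_divide_le_eq)
  then have "(x ^ n) powr (1 - s) \<le> (exp x * fact n) powr (1 - s)" using s x by (intro powr_mono2) auto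
  also have "(x ^ n) powr (1 - s) = (C / Q) ^ n"
    using s pos x by (simp add: x_def powr_realpow[symmetric] powr_powr)
  also have "(exp x * fact n) powr (1 - s) = exp (x * (1 - s)) * fact n powr (1 - s)"
    by (simp add: powr_mult exp_powr_real)
  finally have le: "(C / Q) ^ n \<le> exp (x * (1 - s)) * fact n powr (1 - s)" .
  have "C ^ n * fact n powr s = (C / Q) ^ n * (Q ^ n * fact n powr s)" using pos by (simp add: power_divide)
  also have "\<dots> \<le> exp (x * (1 - s)) * fact n powr (1 - s) * (Q ^ n * fact n powr s)"
    using pos by (intro mult_right_mono le) auto
  also have "\<dots> = exp (x * (1 - s)) * (Q ^ n * (fact n powr (1 - s) * fact n powr s))" by (simp only: ac_simps)
  also have "fact n powr (1 - s) * fact n powr s = (fact n :: real)" by (simp add: powr_add[symmetric])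
  finally show ?thesis by (simp add: x_def)
qed

text \<open>The moments of \<open>weyl_form_decay\<close> have rate \<open>3 * Q\<close>, so
  \<open>weighted_decay\<close> is used with \<open>R = 3 * Q\<close>; this explains the smallness
  condition on \<open>\<epsilon>\<close>. The constant \<open>S\<close> is specialised to the
  seminorm of \<open>h\<close>.\<close>

lemma weyl_form_weighted_decay_of:
  fixes \<sigma> :: "'a::euclidean_space \<times> 'a \<Rightarrow> complex" and v :: "'a \<times> 'a \<Rightarrow> real"
  assumes \<sigma>: "smooth \<sigma>" "\<And>b n u. b \<in> Basis \<Longrightarrow> norm ((partial_deriv b ^^ n) \<sigma> u) \<le> c * (Q ^ n * fact n powr p)"
    and p: "1 \<le> p" and Q: "0 < Q"
    and v: "\<And>\<zeta>. 0 \<le> v \<zeta>" "\<And>\<zeta>. v \<zeta> \<le> Cv * exp (\<epsilon> * norm \<zeta> powr (1 / p))"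
    and \<epsilon>: "0 \<le> \<epsilon>" "\<epsilon> * DIM('a \<times> 'a) powr (1 / p) < p / 2 * (1 / (3 * Q)) powr (1 / p)"
    and g: "g \<in> gelfand_shilov"
  obtains A K where "0 < A" "0 \<le> K" "\<And>h z w. h \<in> gelfand_shilov \<Longrightarrow>
    norm (weyl_form \<sigma> (tf_shift z g) (tf_shift w h)) * v (w - z) \<le> K * gs_seminorm A A h * rho (w - z)"
proof -
  obtain A K where A: "0 < A" "0 \<le> K" "\<And>h S z w b n. h \<in> gelfand_shilov \<Longrightarrow> gs_bound A A S h \<Longrightarrow> b \<in> Basis \<Longrightarrow>
      \<bar>(w - z) \<bullet> b\<bar> ^ n * norm (weyl_form \<sigma> (tf_shift z g) (tf_shift w h)) \<le> K * S * ((3 * Q) ^ n * fact n powr p)"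
    by (rule weyl_form_decay[OF \<sigma> p Q g]) (assumption, rule that)
  have R: "0 < 3 * Q" using Q by simp
  obtain C where C: "0 \<le> C" "\<And>\<zeta> X K. 0 \<le> X \<Longrightarrow> 0 \<le> K \<Longrightarrow>
    (\<And>b n. b \<in> Basis \<Longrightarrow> \<bar>\<zeta> \<bullet> b\<bar> ^ n * X \<le> K * ((3 * Q) ^ n * fact n powr p)) \<Longrightarrow> X * v \<zeta> \<le> C * K * rho \<zeta>"
    by (rule weighted_decay[OF v p R \<epsilon>]) blast
  show ?thesis
  proof (rule that[OF A(1) mult_nonneg_nonneg[OF C(1) A(2)]])
    fix h :: "'a \<Rightarrow> complex" and z w :: "'a \<times> 'a" assume h: "h \<in> gelfand_shilov"
    note b = gs_bound_seminorm[OF A(1,1) h]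
    have "norm (weyl_form \<sigma> (tf_shift z g) (tf_shift w h)) * v (w - z) \<le> C * (K * gs_seminorm A A h) * rho (w - z)"
      by (rule C(2)[OF norm_ge_zero mult_nonneg_nonneg[OF A(2) gs_bound_nonneg[OF b]] A(3)[OF h b]])
    then show "norm (weyl_form \<sigma> (tf_shift z g) (tf_shift w h)) * v (w - z) \<le> C * K * gs_seminorm A A h * rho (w - z)"
      by (simp add: ac_simps)
  qed
qed

text \<open>For \<open>s < 1\<close> the derivatives of \<open>\<sigma>\<close> are bounded by \<open>c Q\<^sup>n n!\<close> for every \<open>Q > 0\<close>, so the form
  decays faster than any exponential and \<open>v\<close>, which is at most exponential, needs no assumption.\<close>

lemma weyl_form_weighted_decay:
  fixes \<sigma> :: "'a::euclidean_space \<times> 'a \<Rightarrow> complex" and v :: "'a \<times> 'a \<Rightarrow> real"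
  assumes \<sigma>: "smooth \<sigma>" "\<And>b n u. b \<in> Basis \<Longrightarrow> norm ((partial_deriv b ^^ n) \<sigma> u) \<le> c * (C ^ n * fact n powr s)"
    and c: "0 < c" "0 < C"
    and v: "submult_weight v" and vs: "1 \<le> s \<Longrightarrow> \<forall>\<epsilon>>0. \<exists>c>0. \<forall>z. v z \<le> c * exp (\<epsilon> * norm z powr (1 / s))"
    and g: "g \<in> gelfand_shilov"
  obtains A K where "0 < A" "0 \<le> K" "\<And>h z w. h \<in> gelfand_shilov \<Longrightarrow>
    norm (weyl_form \<sigma> (tf_shift z g) (tf_shift w h)) * v (w - z) \<le> K * gs_seminorm A A h * rho (w - z)"
proof (cases "1 \<le> s")
  case True
  let ?D = "DIM('a \<times> 'a) powr (1 / s)" let ?r = "s / 2 * (1 / (3 * C)) powr (1 / s)"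
  have D: "0 < ?D" by (simp del: DIM_prod)
  have r: "0 < ?r" using True c by simp
  \<comment> \<open>Half of the critical value \<open>?r / ?D\<close>; the growth hypothesis on
    \<open>v\<close> admits every positive \<open>\<epsilon>\<close>.\<close>
  define \<epsilon> where "\<epsilon> = ?r / (2 * ?D)"
  have \<epsilon>: "0 < \<epsilon>" "\<epsilon> * ?D < ?r" using D r by (auto simp: \<epsilon>_def)
  obtain Cv where Cv: "\<And>z. v z \<le> Cv * exp (\<epsilon> * norm z powr (1 / s))" using vs[OF True] \<epsilon>(1) by blast
  have v0: "0 \<le> v z" for z using v unfolding submult_weight_def by (meson less_imp_le)
  show ?thesis
    by (rule weyl_form_weighted_decay_of[OF \<sigma> True c(2) v0 Cv less_imp_le[OF \<epsilon>(1)] \<epsilon>(2) g]) (assumption, rule that)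
next
  case False
  then have s: "s < 1" by simp
  obtain Cv a where a: "0 \<le> a" "\<And>z. v z \<le> Cv * exp (a * norm z)"
    by (rule submult_weight_exponential[OF v]) (rule that)
  \<comment> \<open>Chosen so that \<open>1 / (6 * Q)\<close>, the decay rate available at exponent
    1 with \<open>R = 3 * Q\<close>, exceeds the cost \<open>a * DIM('a \<times> 'a)\<close> of the
    weight by 1.\<close>
  define Q where "Q = 1 / (6 * (a * DIM('a \<times> 'a) + 1))"
  have "0 \<le> a * DIM('a \<times> 'a)" using a by (simp del: DIM_prod)
  then have Q: "0 < Q" "1 / (6 * Q) = a * DIM('a \<times> 'a) + 1" by (auto simp: Q_def simp del: DIM_prod intro!: divide_pos_pos)
  have bd: "norm ((partial_deriv b ^^ n) \<sigma> u) \<le> c * exp ((C / Q) powr (1 / (1 - s)) * (1 - s)) * (Q ^ n * fact n powr 1)"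
    if "b \<in> Basis" for b n u
    using \<sigma>(2)[OF that, of n u] mult_left_mono[OF fact_powr_less_one_bound[OF s c(2) Q(1), of n] less_imp_le[OF c(1)]]
    by (simp add: mult.assoc)
  have v0: "0 \<le> v z" for z using v unfolding submult_weight_def by (meson less_imp_le)
  have v1: "v z \<le> Cv * exp (a * norm z powr (1 / 1))" for z using a(2)[of z] by simp
  have "a * DIM('a \<times> 'a) powr (1 / 1) < 1 / 2 * (1 / (3 * Q)) powr (1 / 1)"
    using Q by (simp del: DIM_prod)
  from weyl_form_weighted_decay_of[OF \<sigma>(1) bd order_refl Q(1) v0 v1 a(1) this g] that show ?thesis
    by blast
qed

text \<open>The transform of test functions decays at every exponential rate, so \<open>Q\<close>
  can be adapted to whatever exponential bound \<open>v\<close> has.\<close>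

lemma stf_weighted_decay:
  fixes f g :: "'a::euclidean_space \<Rightarrow> complex"
  assumes v: "submult_weight v" and f: "f \<in> gelfand_shilov" and g: "g \<in> gelfand_shilov"
  obtains K where "0 \<le> K" "\<And>z. norm (stf g f z) * v z \<le> K * rho z"
proof -
  obtain Cv a where a: "0 \<le> a" "\<And>z. v z \<le> Cv * exp (a * norm z)"
    by (rule submult_weight_exponential[OF v]) (rule that)
  define Q where "Q = 1 / (2 * (a * DIM('a \<times> 'a) + 1))"
  have "0 \<le> a * DIM('a \<times> 'a)" using a by (simp del: DIM_prod)
  then have Q: "0 < Q" "1 / (2 * Q) = a * DIM('a \<times> 'a) + 1" by (auto simp: Q_def simp del: DIM_prod intro!: divide_pos_pos)
  have v0: "0 \<le> v z" for z using v unfolding submult_weight_def by (meson less_imp_le)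
  have v1: "v z \<le> Cv * exp (a * norm z powr (1 / 1))" for z using a(2)[of z] by simp
  have "a * DIM('a \<times> 'a) powr (1 / 1) < 1 / 2 * (1 / Q) powr (1 / 1)"
    using Q by (simp del: DIM_prod)
  then obtain C where C: "0 \<le> C" "\<And>\<zeta> X K. 0 \<le> X \<Longrightarrow> 0 \<le> K \<Longrightarrow>
    (\<And>b n. b \<in> Basis \<Longrightarrow> \<bar>\<zeta> \<bullet> b\<bar> ^ n * X \<le> K * (Q ^ n * fact n powr 1)) \<Longrightarrow> X * v \<zeta> \<le> C * K * rho \<zeta>"
    by (rule weighted_decay[OF v0 v1 order_refl Q(1) a(1)]) blast
  obtain K where K: "0 \<le> K" "\<And>z b n. b \<in> Basis \<Longrightarrow> \<bar>z \<bullet> b\<bar> ^ n * norm (stf g f z) \<le> K * (Q ^ n * fact n)"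
    using stf_exponential_decay[OF f g Q(1)] by blast
  show ?thesis
    by (rule that[OF mult_nonneg_nonneg[OF C(1) K(1)] C(2)[OF norm_ge_zero K(1)]]) (use K(2) in simp)
qed

section \<open>The extended operator\<close>

text \<open>Conjugating a shifted window flips the sign of its frequency. In this form the
  continuity of \<open>u\<close> along time-frequency shifts applies.\<close>

lemma stft_eq_tf_shift: "stft g u z = u (tf_shift (fst z, - snd z) (\<lambda>t. cnj (g t)))"
  by (simp add: stft_def pairing_def cnj_tf_shift)

lemma stft_measurable:
  fixes g :: "'a::euclidean_space \<Rightarrow> complex"
  assumes u: "u \<in> gs_dual" and g: "g \<in> gelfand_shilov"
  shows "stft g u \<in> borel_measurable borel"
proof -
  have "continuous_on UNIV (\<lambda>z :: 'a \<times> 'a. (fst z, - snd z))" by (intro continuous_intros)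
  from continuous_on_compose2[OF continuous_gs_dual_tf_shift[OF u gs_cnj[OF g]] this]
  have "continuous_on UNIV (stft g u)" unfolding stft_eq_tf_shift[abs_def] by simp
  then show ?thesis by (rule continuous_on_borel_measurable)
qed

text \<open>A continuous function that is nonzero somewhere is nonzero on an open set, which is not
  null. This number is the divisor in \<open>weyl_ext\<close>.\<close>

lemma gs_L2_pos:
  fixes g :: "'a::euclidean_space \<Rightarrow> complex"
  assumes g: "g \<in> gelfand_shilov" and ne: "g \<noteq> (\<lambda>t. 0)"
  shows "0 < (LINT t|lborel. (norm (g t))\<^sup>2)"
proof -
  obtain C where C: "0 \<le> C" "\<And>t. norm (g t) \<le> C * rho t ^ 2" by (rule gs_bounds1[OF g g]) (rule that)
  note [measurable] = gs_measurable[OF g]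
  have int: "integrable lborel (\<lambda>t. (norm (g t))\<^sup>2)"
  proof (rule Bochner_Integration.integrable_bound)
    show "integrable lborel (\<lambda>t. C * norm (g t))" using gs_integrable[OF g] by auto
    show "AE t in lborel. norm ((norm (g t))\<^sup>2) \<le> norm (C * norm (g t))"
    proof (rule AE_I2)
      fix t
      have "norm (g t) \<le> C * 1" using C rho_le_1[of t] rho_nonneg[of t]
        by (intro order.trans[OF C(2)] mult_left_mono) (auto intro: power_le_one)
      then show "norm ((norm (g t))\<^sup>2) \<le> norm (C * norm (g t))"
        using C(1) by (simp add: power2_eq_square mult_right_mono)
    qed
  qed measurable
  have "(LINT t|lborel. (norm (g t))\<^sup>2) \<noteq> 0"
  proof
    assume "(LINT t|lborel. (norm (g t))\<^sup>2) = 0"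
    then have ae: "AE t in lborel. g t = 0"
      using integral_nonneg_eq_0_iff_AE[OF int] by simp
    have op: "open {t. g t \<noteq> 0}"
      using smooth_continuous[OF gelfand_shilov_smooth[OF g]] by (intro open_Collect_neq) auto
    moreover have "{t. g t \<noteq> 0} \<noteq> {}" using ne by auto
    ultimately have "\<not> negligible {t. g t \<noteq> 0}" by (rule open_not_negligible)
    moreover have "{t. g t \<noteq> 0} \<in> null_sets lborel"
      using ae op by (subst AE_iff_null_sets) auto
    ultimately show False by (auto simp: negligible_iff_null_sets dest: null_sets_completionI)
  qed
  then show ?thesis by (simp add: less_le integral_nonneg_AE)
qed

lemma stft_gs_embed:
  assumes "g \<in> gelfand_shilov"
  shows "stft g (gs_embed f) z = stf g f z"
  using gs_cnj[OF gs_tf_shift[OF assms]] by (simp add: stft_def pairing_def gs_embed_def stf_eq_bracket)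

lemma gs_embed_dual:
  fixes f :: "'a::euclidean_space \<Rightarrow> complex"
  assumes f: "f \<in> gelfand_shilov"
  shows "gs_embed f \<in> gs_dual"
proof -
  have eq: "gs_embed f \<phi> = (LINT x|lborel. f x * \<phi> x)" if "\<phi> \<in> gelfand_shilov" for \<phi>
    using that by (simp add: gs_embed_def l2_bracket_def)
  note [measurable] = gs_measurable[OF f]
  define k where "k = cdec 1 DIM('a)"
  have bd: "norm (f x * \<phi> x) \<le> k * gs_seminorm 1 1 \<phi> * norm (f x)" if \<phi>: "\<phi> \<in> gelfand_shilov" for \<phi> x
  proof -
    note b = gs_bound_seminorm[OF zero_less_one zero_less_one \<phi>]
    have "norm (\<phi> x) \<le> k * gs_seminorm 1 1 \<phi> * rho x ^ 2"
      unfolding k_def by (rule gs_bound_decay0[OF b]) auto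
    also have "\<dots> \<le> k * gs_seminorm 1 1 \<phi> * 1"
      using gs_bound_nonneg[OF b] rho_le_1[of x] rho_nonneg[of x]
      by (intro mult_left_mono) (auto simp: k_def cdec_def power_le_one)
    finally have "norm (\<phi> x) \<le> k * gs_seminorm 1 1 \<phi>" by simp
    from mult_left_mono[OF this norm_ge_zero[of "f x"]] show ?thesis by (simp add: norm_mult ac_simps)
  qed
  have int: "integrable lborel (\<lambda>x. f x * \<phi> x)" if \<phi>: "\<phi> \<in> gelfand_shilov" for \<phi>
  proof (rule Bochner_Integration.integrable_bound)
    show "integrable lborel (\<lambda>x. k * gs_seminorm 1 1 \<phi> * norm (f x))" using gs_integrable[OF f] by auto
    show "AE x in lborel. norm (f x * \<phi> x) \<le> norm (k * gs_seminorm 1 1 \<phi> * norm (f x))"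
      using bd[OF \<phi>] by (intro AE_I2) (simp add: order.trans[OF _ abs_ge_self])
    note [measurable] = gs_measurable[OF \<phi>]
    show "(\<lambda>x. f x * \<phi> x) \<in> borel_measurable lborel" by measurable
  qed
  have 1: "gs_embed f (\<lambda>x. \<phi> x + \<psi> x) = gs_embed f \<phi> + gs_embed f \<psi>"
    if "\<phi> \<in> gelfand_shilov" "\<psi> \<in> gelfand_shilov" for \<phi> \<psi>
    using that Bochner_Integration.integral_add[OF int[OF that(1)] int[OF that(2)]] by (simp add: eq gs_add distrib_left)
  have 2: "gs_embed f (\<lambda>x. a * \<phi> x) = a * gs_embed f \<phi>" if "\<phi> \<in> gelfand_shilov" for a \<phi>
    using that by (simp add: eq gs_cmult mult.left_commute)
  have 3: "norm (gs_embed f \<phi>) \<le> (k * (LINT x|lborel. norm (f x))) * gs_seminorm 1 1 \<phi>" if \<phi>: "\<phi> \<in> gelfand_shilov" for \<phi>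
  proof -
    have "norm (gs_embed f \<phi>) \<le> (LINT x|lborel. norm (f x * \<phi> x))"
      unfolding eq[OF \<phi>] by (rule integral_norm_bound)
    also have "\<dots> \<le> (LINT x|lborel. k * gs_seminorm 1 1 \<phi> * norm (f x))"
      by (rule integral_mono) (use gs_integrable[OF f] bd[OF \<phi>] int[OF \<phi>] in auto)
    finally have "norm (gs_embed f \<phi>) \<le> (LINT x|lborel. k * gs_seminorm 1 1 \<phi> * norm (f x))" .
    then show ?thesis by (simp add: ac_simps)
  qed
  have 4: "\<exists>A>0. \<exists>B>0. \<exists>K. \<forall>\<phi>\<in>gelfand_shilov. norm (gs_embed f \<phi>) \<le> K * gs_seminorm A B \<phi>"
    using 3 zero_less_one by blast
  have 5: "gs_embed f \<phi> = 0" if "\<phi> \<notin> gelfand_shilov" for \<phi> using that by (simp add: gs_embed_def)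
  show ?thesis
    unfolding gs_dual_def using 1 2 4 5 by blast
qed

text \<open>Elements of \<open>gs_dual\<close> are linear in the test function while
  \<open>weyl_form\<close> is antilinear in its second argument, hence the conjugate of
  \<open>\<phi>\<close>. A divergent Bochner integral has value 0; on the modulation space
  convergence is shown in \<open>integrand_integrable\<close>.\<close>

definition weyl_ext ::
    "('a::euclidean_space \<times> 'a \<Rightarrow> complex) \<Rightarrow> ('a \<Rightarrow> complex) \<Rightarrow> (('a \<Rightarrow> complex) \<Rightarrow> complex) \<Rightarrow> ('a \<Rightarrow> complex) \<Rightarrow> complex"
  where "weyl_ext \<sigma> g u = (\<lambda>\<phi>. if \<phi> \<in> gelfand_shilov
    then (LINT z|lborel. stft g u z * weyl_form \<sigma> (tf_shift z g) (\<lambda>x. cnj (\<phi> x))) / of_real (LINT t|lborel. (norm (g t))\<^sup>2)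
    else 0)"

lemma weyl_ext_cmult: "weyl_ext \<sigma> g (\<lambda>\<phi>. a * u \<phi>) = (\<lambda>\<phi>. a * weyl_ext \<sigma> g u \<phi>)"
proof
  fix \<phi>
  have "stft g (\<lambda>\<phi>. a * u \<phi>) z = a * stft g u z" for z by (simp add: stft_def pairing_def)
  then show "weyl_ext \<sigma> g (\<lambda>\<phi>. a * u \<phi>) \<phi> = a * weyl_ext \<sigma> g u \<phi>"
    by (simp add: weyl_ext_def mult.assoc)
qed

context
  fixes \<sigma> :: "'a::euclidean_space \<times> 'a \<Rightarrow> complex" and g :: "'a \<Rightarrow> complex" and v M :: "'a \<times> 'a \<Rightarrow> real"
    and A K b :: real and p q :: ennreal
  assumes \<sigma>: "smooth \<sigma>" "\<And>u. norm (\<sigma> u) \<le> b" and g: "g \<in> gelfand_shilov" "g \<noteq> (\<lambda>t. 0)"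
    and M: "continuous_on UNIV M" "\<And>z. 0 < M z" "\<And>z \<zeta>. M (z + \<zeta>) \<le> v z * M \<zeta>"
    and AK: "0 < A" "0 \<le> K"
    and decay: "\<And>h z w. h \<in> gelfand_shilov \<Longrightarrow>
      norm (weyl_form \<sigma> (tf_shift z g) (tf_shift w h)) * v (w - z) \<le> K * gs_seminorm A A h * rho (w - z)"
    and pq: "1 \<le> p" "1 \<le> q"
begin

private abbreviation Vm where "Vm u \<equiv> (\<lambda>z. ennreal (norm (stft g u z) * M z))"
private abbreviation gsq where "gsq \<equiv> (LINT t|lborel. (norm (g t))\<^sup>2)"

private lemma M_measurable [measurable]: "M \<in> borel_measurable borel"
  by (rule continuous_on_borel_measurable[OF M(1)])

private lemma Vm_measurable: "u \<in> gs_dual \<Longrightarrow> Vm u \<in> borel_measurable borel"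
  using stft_measurable[OF _ g(1)] by measurable

private lemma seminorm_nonneg: "h \<in> gelfand_shilov \<Longrightarrow> 0 \<le> gs_seminorm A A h"
  using gs_bound_nonneg[OF gs_bound_seminorm[OF AK(1,1)]] .

text \<open>By \<open>M w \<le> v (w - z) * M z\<close> the weight at the output point
  \<open>w\<close> is paid by the weight at \<open>z\<close> and by \<open>v (w - z)\<close>, which
  the decay of the matrix absorbs.\<close>

private lemma integrand_bound:
  assumes h: "h \<in> gelfand_shilov"
  shows "norm (stft g u z * weyl_form \<sigma> (tf_shift z g) (tf_shift w h)) * M w
    \<le> K * gs_seminorm A A h * (norm (stft g u z) * M z * rho (w - z))"
proof -
  let ?B = "norm (weyl_form \<sigma> (tf_shift z g) (tf_shift w h))"
  have "?B * M w \<le> ?B * (v (w - z) * M z)" using M(3)[of "w - z" z] by (intro mult_left_mono) auto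
  also have "\<dots> = (?B * v (w - z)) * M z" by simp
  also have "\<dots> \<le> (K * gs_seminorm A A h * rho (w - z)) * M z"
    using M(2)[of z] by (intro mult_right_mono decay h) auto
  finally have "norm (stft g u z) * (?B * M w) \<le> norm (stft g u z) * ((K * gs_seminorm A A h * rho (w - z)) * M z)"
    by (rule mult_left_mono) simp
  then show ?thesis by (simp add: norm_mult ac_simps)
qed

private lemma nn_integral_bound:
  assumes u: "u \<in> gs_dual" and h: "h \<in> gelfand_shilov"
  shows "(\<integral>\<^sup>+z. ennreal (norm (stft g u z * weyl_form \<sigma> (tf_shift z g) (tf_shift w h))) \<partial>lborel) * ennreal (M w)
    \<le> ennreal (K * gs_seminorm A A h) * (\<integral>\<^sup>+z. Vm u z * ennreal (rho (w - z)) \<partial>lborel)"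
proof -
  note [measurable] = stft_measurable[OF u g(1)]
    weyl_form_tf_shift_measurable[OF smooth_measurable[OF \<sigma>(1)] gs_measurable[OF g(1)] gs_measurable[OF gs_tf_shift[OF h]]]
  have "(\<integral>\<^sup>+z. ennreal (norm (stft g u z * weyl_form \<sigma> (tf_shift z g) (tf_shift w h))) \<partial>lborel) * ennreal (M w)
      = (\<integral>\<^sup>+z. ennreal (norm (stft g u z * weyl_form \<sigma> (tf_shift z g) (tf_shift w h))) * ennreal (M w) \<partial>lborel)"
    by (rule nn_integral_multc[symmetric]) measurable
  also have "\<dots> \<le> (\<integral>\<^sup>+z. ennreal (K * gs_seminorm A A h) * (Vm u z * ennreal (rho (w - z))) \<partial>lborel)"
  proof (rule nn_integral_mono)
    fix z
    have "ennreal (norm (stft g u z * weyl_form \<sigma> (tf_shift z g) (tf_shift w h))) * ennreal (M w)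
        = ennreal (norm (stft g u z * weyl_form \<sigma> (tf_shift z g) (tf_shift w h)) * M w)"
      using M(2)[of w] by (simp add: ennreal_mult)
    also have "\<dots> \<le> ennreal (K * gs_seminorm A A h * (norm (stft g u z) * M z * rho (w - z)))"
      by (intro ennreal_leI integrand_bound h)
    also have "\<dots> = ennreal (K * gs_seminorm A A h) * (Vm u z * ennreal (rho (w - z)))"
      using AK seminorm_nonneg[OF h] M(2)[of z] rho_nonneg[of "w - z"] by (simp add: ennreal_mult)
    finally show "ennreal (norm (stft g u z * weyl_form \<sigma> (tf_shift z g) (tf_shift w h))) * ennreal (M w)
        \<le> ennreal (K * gs_seminorm A A h) * (Vm u z * ennreal (rho (w - z)))" .
  qed
  also have "\<dots> = ennreal (K * gs_seminorm A A h) * (\<integral>\<^sup>+z. Vm u z * ennreal (rho (w - z)) \<partial>lborel)"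
    by (rule nn_integral_cmult) measurable
  finally show ?thesis .
qed

private lemma tf_shift_zero: "tf_shift 0 h = h"
  by (simp add: tf_shift_def split_beta fun_eq_iff)

private lemma integrand_integrable:
  assumes u: "u \<in> gs_dual" and fin: "mixed_enorm p q (Vm u) < \<infinity>"
  obtains D where "0 \<le> D"
    "\<And>h. h \<in> gelfand_shilov \<Longrightarrow> integrable lborel (\<lambda>z. stft g u z * weyl_form \<sigma> (tf_shift z g) h)"
    "\<And>h. h \<in> gelfand_shilov \<Longrightarrow> norm (LINT z|lborel. stft g u z * weyl_form \<sigma> (tf_shift z g) h) \<le> D * gs_seminorm A A h"
proof -
  have "(\<integral>\<^sup>+z. Vm u z * ennreal (rho z) \<partial>lborel) < \<infinity>"
    by (rule mixed_enorm_rho_integral[OF pq Vm_measurable[OF u] fin])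
  then obtain I where I: "(\<integral>\<^sup>+z. Vm u z * ennreal (rho z) \<partial>lborel) = ennreal I" "0 \<le> I"
    by (cases "\<integral>\<^sup>+z. Vm u z * ennreal (rho z) \<partial>lborel") auto
  define D where "D = K * I / M 0"
  have D: "0 \<le> D" using AK I M(2)[of 0] by (simp add: D_def)
  have *: "(\<integral>\<^sup>+z. ennreal (norm (stft g u z * weyl_form \<sigma> (tf_shift z g) h)) \<partial>lborel) \<le> ennreal (D * gs_seminorm A A h)"
    if h: "h \<in> gelfand_shilov" for h
  proof -
    let ?L = "\<integral>\<^sup>+z. ennreal (norm (stft g u z * weyl_form \<sigma> (tf_shift z g) h)) \<partial>lborel"
    \<comment> \<open>At \<open>w = 0\<close> the shift of \<open>h\<close> is trivial and the
      convolution becomes the integral against \<open>rho\<close>, finite by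
      \<open>mixed_enorm_rho_integral\<close>.\<close>
    have "?L * ennreal (M 0) \<le> ennreal (K * gs_seminorm A A h) * ennreal I"
      using nn_integral_bound[OF u h, of 0] by (simp add: tf_shift_zero rho_minus I)
    then have "?L * ennreal (M 0) * ennreal (1 / M 0) \<le> ennreal (K * gs_seminorm A A h) * ennreal I * ennreal (1 / M 0)"
      by (rule mult_right_mono) simp
    moreover have "?L * ennreal (M 0) * ennreal (1 / M 0) = ?L"
      using M(2)[of 0] by (simp add: mult.assoc ennreal_mult[symmetric])
    moreover have "ennreal (K * gs_seminorm A A h) * ennreal I * ennreal (1 / M 0) = ennreal (D * gs_seminorm A A h)"
      using AK seminorm_nonneg[OF h] I M(2)[of 0] by (simp add: ennreal_mult[symmetric] D_def ac_simps)
    ultimately show ?thesis by simp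
  qed
  show ?thesis
  proof (rule that[OF D])
    fix h :: "'a \<Rightarrow> complex" assume h: "h \<in> gelfand_shilov"
    note [measurable] = stft_measurable[OF u g(1)]
      weyl_form_tf_shift_measurable[OF smooth_measurable[OF \<sigma>(1)] gs_measurable[OF g(1)] gs_measurable[OF h]]
    show int: "integrable lborel (\<lambda>z. stft g u z * weyl_form \<sigma> (tf_shift z g) h)"
      by (rule integrableI_bounded) (measurable, rule order.strict_trans1[OF *[OF h]], simp)
    have "ennreal (norm (LINT z|lborel. stft g u z * weyl_form \<sigma> (tf_shift z g) h)) \<le> ennreal (D * gs_seminorm A A h)"
      by (rule order.trans[OF integral_norm_bound_ennreal[OF int] *[OF h]])
    then show "norm (LINT z|lborel. stft g u z * weyl_form \<sigma> (tf_shift z g) h) \<le> D * gs_seminorm A A h"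
      using D seminorm_nonneg[OF h] by (subst (asm) ennreal_le_iff) auto
  qed
qed

private lemma weyl_form_cnj_add:
  assumes "\<phi> \<in> gelfand_shilov" "\<psi> \<in> gelfand_shilov"
  shows "weyl_form \<sigma> (tf_shift z g) (\<lambda>x. cnj (\<phi> x + \<psi> x))
    = weyl_form \<sigma> (tf_shift z g) (\<lambda>x. cnj (\<phi> x)) + weyl_form \<sigma> (tf_shift z g) (\<lambda>x. cnj (\<psi> x))"
  using weyl_form_add_left[OF smooth_measurable[OF \<sigma>(1)] \<sigma>(2) gs_tf_shift[OF g(1), of z] gs_cnj[OF assms(2)] gs_cnj[OF assms(1)], of 1] by simp

private lemma weyl_form_cnj_cmult:
  assumes "\<phi> \<in> gelfand_shilov"
  shows "weyl_form \<sigma> (tf_shift z g) (\<lambda>x. cnj (a * \<phi> x)) = a * weyl_form \<sigma> (tf_shift z g) (\<lambda>x. cnj (\<phi> x))"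
  using weyl_form_add_left[OF smooth_measurable[OF \<sigma>(1)] \<sigma>(2) gs_tf_shift[OF g(1), of z] gs_cnj[OF assms] gs_cnj[OF assms], of "cnj a - 1"]
  by (simp add: algebra_simps)

private lemma seminorm_cnj_le: "\<phi> \<in> gelfand_shilov \<Longrightarrow> gs_seminorm A A (\<lambda>x. cnj (\<phi> x)) \<le> gs_seminorm A A \<phi>"
  by (rule gs_seminorm_le[OF AK(1,1) gs_bound_cnj[OF gs_bound_seminorm[OF AK(1,1)]]])

lemma weyl_ext_dual:
  assumes u: "u \<in> gs_dual" and fin: "mixed_enorm p q (Vm u) < \<infinity>"
  shows "weyl_ext \<sigma> g u \<in> gs_dual"
proof -
  obtain D where D: "0 \<le> D"
    "\<And>h. h \<in> gelfand_shilov \<Longrightarrow> integrable lborel (\<lambda>z. stft g u z * weyl_form \<sigma> (tf_shift z g) h)"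
    "\<And>h. h \<in> gelfand_shilov \<Longrightarrow> norm (LINT z|lborel. stft g u z * weyl_form \<sigma> (tf_shift z g) h) \<le> D * gs_seminorm A A h"
    by (rule integrand_integrable[OF u fin]) (rule that)
  note n = gs_L2_pos[OF g]
  have 1: "weyl_ext \<sigma> g u (\<lambda>x. \<phi> x + \<psi> x) = weyl_ext \<sigma> g u \<phi> + weyl_ext \<sigma> g u \<psi>"
    if "\<phi> \<in> gelfand_shilov" "\<psi> \<in> gelfand_shilov" for \<phi> \<psi>
    using that Bochner_Integration.integral_add[OF D(2)[OF gs_cnj[OF that(1)]] D(2)[OF gs_cnj[OF that(2)]]]
    by (simp add: weyl_ext_def gs_add weyl_form_cnj_add[simplified] distrib_left add_divide_distrib)
  have 2: "weyl_ext \<sigma> g u (\<lambda>x. a * \<phi> x) = a * weyl_ext \<sigma> g u \<phi>" if "\<phi> \<in> gelfand_shilov" for a \<phi>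
    using that by (simp add: weyl_ext_def gs_cmult weyl_form_cnj_cmult[simplified] mult.left_commute[of _ a])
  have 3: "norm (weyl_ext \<sigma> g u \<phi>) \<le> D / gsq * gs_seminorm A A \<phi>" if \<phi>: "\<phi> \<in> gelfand_shilov" for \<phi>
  proof -
    have "norm (weyl_ext \<sigma> g u \<phi>) = norm (LINT z|lborel. stft g u z * weyl_form \<sigma> (tf_shift z g) (\<lambda>x. cnj (\<phi> x))) / gsq"
      using n \<phi> by (simp add: weyl_ext_def norm_divide)
    also have "\<dots> \<le> D * gs_seminorm A A \<phi> / gsq"
      using n by (intro divide_right_mono order.trans[OF D(3)[OF gs_cnj[OF \<phi>]]] mult_left_mono seminorm_cnj_le \<phi> D(1)) auto
    finally show ?thesis by simp
  qed
  have 4: "\<exists>A>0. \<exists>B>0. \<exists>K. \<forall>\<phi>\<in>gelfand_shilov. norm (weyl_ext \<sigma> g u \<phi>) \<le> K * gs_seminorm A B \<phi>"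
    using 3 AK(1) by blast
  have 5: "weyl_ext \<sigma> g u \<phi> = 0" if "\<phi> \<notin> gelfand_shilov" for \<phi> using that by (simp add: weyl_ext_def)
  show ?thesis
    unfolding gs_dual_def using 1 2 4 5 by blast
qed

lemma weyl_ext_bounded:
  obtains c where "0 < c" "\<And>u. u \<in> gs_dual \<Longrightarrow> mixed_enorm p q (Vm u) < \<infinity> \<Longrightarrow>
    mixed_enorm p q (Vm (weyl_ext \<sigma> g u)) \<le> ennreal c * mixed_enorm p q (Vm u)"
proof -
  note n = gs_L2_pos[OF g]
  \<comment> \<open>The summand 1 makes \<open>k\<close> positive even if \<open>K = 0\<close>, as
    \<open>mixed_enorm_cmult_le\<close> requires.\<close>
  define k where "k = K * gs_seminorm A A g / gsq + 1"
  have k: "0 < k" using n AK seminorm_nonneg[OF g(1)] by (simp add: k_def add_nonneg_pos)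
  let ?R = "4 * rho_int TYPE('a \<times> 'a)"
  have R: "0 < ?R" using rho_int_pos[where 'a="'a \<times> 'a"] by simp
  show ?thesis
  proof (rule that[OF mult_pos_pos[OF k R]])
    fix u :: "('a \<Rightarrow> complex) \<Rightarrow> complex" assume u: "u \<in> gs_dual" and fin: "mixed_enorm p q (Vm u) < \<infinity>"
    let ?G = "\<lambda>w. \<integral>\<^sup>+z. Vm u z * ennreal (rho (w - z)) \<partial>lborel"
    obtain D where int: "\<And>h. h \<in> gelfand_shilov \<Longrightarrow> integrable lborel (\<lambda>z. stft g u z * weyl_form \<sigma> (tf_shift z g) h)"
      by (rule integrand_integrable[OF u fin]) (rule that)
    have pt: "Vm (weyl_ext \<sigma> g u) w \<le> ennreal k * ?G w" for w
    proof -
      let ?L = "\<integral>\<^sup>+z. ennreal (norm (stft g u z * weyl_form \<sigma> (tf_shift z g) (tf_shift w g))) \<partial>lborel"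
      let ?I = "LINT z|lborel. stft g u z * weyl_form \<sigma> (tf_shift z g) (tf_shift w g)"
      have "stft g (weyl_ext \<sigma> g u) w = ?I / of_real gsq"
        using gs_cnj[OF gs_tf_shift[OF g(1), of w]] by (simp add: stft_def pairing_def weyl_ext_def)
      then have "norm (stft g (weyl_ext \<sigma> g u) w) * M w = 1 / gsq * (norm ?I * M w)" using n by (simp add: norm_divide)
      then have "Vm (weyl_ext \<sigma> g u) w = ennreal (1 / gsq) * (ennreal (norm ?I) * ennreal (M w))"
        using n M(2)[of w] by (simp add: ennreal_mult[symmetric])
      also have "\<dots> \<le> ennreal (1 / gsq) * (?L * ennreal (M w))"
        by (intro mult_left_mono mult_right_mono integral_norm_bound_ennreal int gs_tf_shift g(1)) auto
      also have "\<dots> \<le> ennreal (1 / gsq) * (ennreal (K * gs_seminorm A A g) * ?G w)"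
        by (intro mult_left_mono nn_integral_bound[OF u g(1)]) auto
      also have "\<dots> = ennreal (1 / gsq * (K * gs_seminorm A A g)) * ?G w"
        using n AK seminorm_nonneg[OF g(1)] by (subst ennreal_mult) (auto simp: mult.assoc)
      also have "\<dots> \<le> ennreal k * ?G w"
        by (intro mult_right_mono ennreal_leI) (auto simp: k_def)
      finally show ?thesis .
    qed
    have Gm: "?G \<in> borel_measurable borel"
    proof -
      have "(\<lambda>(w, z). Vm u z * ennreal (rho (w - z))) \<in> borel_measurable (borel \<Otimes>\<^sub>M lborel)"
        using stft_measurable[OF u g(1)] by measurable
      then show ?thesis by (intro lborel.borel_measurable_nn_integral) simp
    qed
    have "mixed_enorm p q (Vm (weyl_ext \<sigma> g u)) \<le> mixed_enorm p q (\<lambda>w. ennreal k * ?G w)"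
      by (rule mixed_enorm_mono[OF Vm_measurable[OF weyl_ext_dual[OF u fin]] pt])
    also have "\<dots> \<le> ennreal k * mixed_enorm p q ?G"
      by (rule mixed_enorm_cmult_le[OF Gm k pq])
    also have "\<dots> \<le> ennreal k * (ennreal ?R * mixed_enorm p q (Vm u))"
      by (intro mult_left_mono mixed_enorm_convolution pq Vm_measurable u) simp
    also have "\<dots> = ennreal (k * ?R) * mixed_enorm p q (Vm u)"
      using k R by (simp add: ennreal_mult mult.assoc)
    finally show "mixed_enorm p q (Vm (weyl_ext \<sigma> g u)) \<le> ennreal (k * ?R) * mixed_enorm p q (Vm u)" .
  qed
qed

lemma weyl_ext_add:
  assumes u: "u \<in> gs_dual" "mixed_enorm p q (Vm u) < \<infinity>" and w: "w \<in> gs_dual" "mixed_enorm p q (Vm w) < \<infinity>"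
  shows "weyl_ext \<sigma> g (\<lambda>\<phi>. u \<phi> + w \<phi>) = (\<lambda>\<phi>. weyl_ext \<sigma> g u \<phi> + weyl_ext \<sigma> g w \<phi>)"
proof
  fix \<phi>
  obtain D where iu: "\<And>h. h \<in> gelfand_shilov \<Longrightarrow> integrable lborel (\<lambda>z. stft g u z * weyl_form \<sigma> (tf_shift z g) h)"
    by (rule integrand_integrable[OF u]) (rule that)
  obtain D where iw: "\<And>h. h \<in> gelfand_shilov \<Longrightarrow> integrable lborel (\<lambda>z. stft g w z * weyl_form \<sigma> (tf_shift z g) h)"
    by (rule integrand_integrable[OF w]) (rule that)
  have "stft g (\<lambda>\<phi>. u \<phi> + w \<phi>) z = stft g u z + stft g w z" for z by (simp add: stft_def pairing_def)
  then show "weyl_ext \<sigma> g (\<lambda>\<phi>. u \<phi> + w \<phi>) \<phi> = weyl_ext \<sigma> g u \<phi> + weyl_ext \<sigma> g w \<phi>"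
    using Bochner_Integration.integral_add[OF iu iw, OF gs_cnj gs_cnj, of \<phi> \<phi>]
    by (simp add: weyl_ext_def distrib_right add_divide_distrib)
qed

text \<open>On an embedded \<open>f\<close>, \<open>stft\<close> is \<open>stf\<close>, and
  \<open>weyl_form_inversion\<close> produces exactly the factor that the divisor cancels.\<close>

lemma weyl_ext_gs_embed:
  assumes f: "f \<in> gelfand_shilov"
  shows "weyl_ext \<sigma> g (gs_embed f) = weyl_op \<sigma> f"
proof
  fix \<phi>
  show "weyl_ext \<sigma> g (gs_embed f) \<phi> = weyl_op \<sigma> f \<phi>"
  proof (cases "\<phi> \<in> gelfand_shilov")
    case True
    have "gsq \<noteq> 0" using gs_L2_pos[OF g] by simp
    then show ?thesis
      using True weyl_form_inversion[OF smooth_measurable[OF \<sigma>(1)] \<sigma>(2) f g(1) gs_cnj[OF True]]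
      by (simp add: weyl_ext_def stft_gs_embed[OF g(1)] weyl_op_eq)
  next
    case False
    then show ?thesis by (simp add: weyl_ext_def weyl_op_def)
  qed
qed

end

text \<open>With \<open>M z \<le> v z * M 0\<close>, the decay in \<open>stf_weighted_decay\<close>
  absorbs the weight and leaves a multiple of \<open>rho\<close>, whose mixed norm is finite for all
  exponents.\<close>

lemma mixed_enorm_gs_embed_finite:
  fixes f g :: "'a::euclidean_space \<Rightarrow> complex"
  assumes g: "g \<in> gelfand_shilov" and f: "f \<in> gelfand_shilov" and v: "submult_weight v"
    and M: "continuous_on UNIV M" "\<And>z. 0 < M z" "\<And>z \<zeta>. M (z + \<zeta>) \<le> v z * M \<zeta>" and pq: "1 \<le> p" "1 \<le> q"
  shows "mixed_enorm p q (\<lambda>z. ennreal (norm (stft g (gs_embed f) z) * M z)) < \<infinity>"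
proof -
  obtain K where K: "0 \<le> K" "\<And>z. norm (stf g f z) * v z \<le> K * rho z"
    by (rule stf_weighted_decay[OF v f g]) (rule that)
  define k where "k = K * M 0 + 1"
  have k: "0 < k" using K(1) M(2)[of 0] by (simp add: k_def add_nonneg_pos)
  have "norm (stft g (gs_embed f) z) * M z \<le> k * rho z" for z
  proof -
    have "norm (stf g f z) * M z \<le> norm (stf g f z) * (v z * M 0)"
      using M(3)[of z 0] by (intro mult_left_mono) auto
    also have "\<dots> = (norm (stf g f z) * v z) * M 0" by simp
    also have "\<dots> \<le> (K * rho z) * M 0" using M(2)[of 0] by (intro mult_right_mono K) auto
    also have "\<dots> \<le> k * rho z" using rho_nonneg[of z] by (simp add: k_def algebra_simps)
    finally show ?thesis by (simp add: stft_gs_embed[OF g])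
  qed
  then have pt: "ennreal (norm (stft g (gs_embed f) z) * M z) \<le> ennreal k * ennreal (rho z)" for z
    using k rho_nonneg[of z] by (subst ennreal_mult[symmetric]) (auto intro: ennreal_leI)
  have "(\<lambda>z. ennreal (norm (stft g (gs_embed f) z) * M z)) \<in> borel_measurable borel"
    using stft_measurable[OF gs_embed_dual[OF f] g] continuous_on_borel_measurable[OF M(1)] by measurable
  from mixed_enorm_mono[OF this pt]
  have "mixed_enorm p q (\<lambda>z. ennreal (norm (stft g (gs_embed f) z) * M z)) \<le> mixed_enorm p q (\<lambda>z::'a \<times> 'a. ennreal k * ennreal (rho z))" .
  also have "\<dots> \<le> ennreal k * mixed_enorm p q (\<lambda>z::'a \<times> 'a. ennreal (rho z))"
    by (rule mixed_enorm_cmult_le[OF _ k pq]) measurable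
  also have "\<dots> < \<infinity>" using mixed_enorm_rho_finite[OF pq, where 'a='a and 'b='a] by (simp add: ennreal_mult_less_top)
  finally show ?thesis .
qed

theorem proposition4p6:
  fixes s :: real
    and \<sigma> :: "(real ^ 'd) \<times> (real ^ 'd) \<Rightarrow> complex"
    and v m :: "(real ^ 'd) \<times> (real ^ 'd) \<Rightarrow> real"
    and p q :: ennreal
    and g :: "real ^ 'd \<Rightarrow> complex"
  assumes "s \<ge> 1 / 2"
    and "smooth \<sigma>"
    and "\<exists>c>0. \<exists>C>0. \<forall>z \<alpha>.
           norm (mi_deriv \<alpha> \<sigma> z) \<le> c * C ^ mi_size \<alpha> * mi_fact \<alpha> powr s"
    and "submult_weight v"
    and "m \<in> moderate_weights v"
    and "s \<ge> 1 \<Longrightarrow> \<forall>\<epsilon>>0. \<exists>c>0. \<forall>z. v z \<le> c * exp (\<epsilon> * norm z powr (1 / s))"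
    and "1 \<le> p" and "1 \<le> q"
    and "g \<in> gelfand_shilov" and "g \<noteq> (\<lambda>t. 0)"
  shows "\<exists>T. mod_bounded_operator g m p q T \<and> extends_weyl_op g m p q \<sigma> T"
proof -
  note \<sigma> = assms(2) and v = assms(4) and m = assms(5) and pq = assms(7,8) and g = assms(9,10)
  obtain c C where c: "0 < c" "0 < C" and sym: "\<And>z \<alpha>. norm (mi_deriv \<alpha> \<sigma> z) \<le> c * C ^ mi_size \<alpha> * mi_fact \<alpha> powr s"
    using assms(3) by blast
  \<comment> \<open>For a pure power of one direction \<open>mi_fact\<close> is \<open>n!\<close>;
    this is the form in which the recursion differentiates the symbol.\<close>
  have pd: "norm ((partial_deriv b ^^ n) \<sigma> u) \<le> c * (C ^ n * fact n powr s)" if "b \<in> Basis" for b n u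
    using sym[of "mi_single b n" u] that by (simp add: mi_deriv_single[OF \<sigma>] mi_size_single mi_fact_single mult.assoc)
  obtain b0 :: "(real ^ 'd) \<times> (real ^ 'd)" where "b0 \<in> Basis" using nonempty_Basis by blast
  from pd[OF this, of 0] have \<sigma>_bd: "norm (\<sigma> u) \<le> c" for u by simp
  obtain A K where AK: "0 < A" "0 \<le> K" and decay: "\<And>h z w. h \<in> gelfand_shilov \<Longrightarrow>
      norm (weyl_form \<sigma> (tf_shift z g) (tf_shift w h)) * v (w - z) \<le> K * gs_seminorm A A h * rho (w - z)"
    by (rule weyl_form_weighted_decay[OF \<sigma> pd c v assms(6) g(1)]) (assumption, assumption, rule that)
  obtain M B where M: "continuous_on UNIV M" "\<And>z. 0 < M z" "\<And>z \<zeta>. M (z + \<zeta>) \<le> v z * M \<zeta>"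
    and B: "0 < B" "\<And>z. m z \<le> M z" "\<And>z. M z \<le> B * m z"
    by (rule moderate_weight_regular[OF v m]) (rule that)
  let ?Vm = "\<lambda>u z. ennreal (norm (stft g u z) * M z)" and ?T = "weyl_ext \<sigma> g"
  have m0: "0 \<le> m z" "m \<in> borel_measurable lebesgue" for z
    using m by (simp_all add: moderate_weights_def less_imp_le del: split_paired_All)
  have meas: "(\<lambda>z. norm (stft g u z)) \<in> borel_measurable borel" "M \<in> borel_measurable borel" if "u \<in> gs_dual" for u
    using stft_measurable[OF that g(1)] continuous_on_borel_measurable[OF M(1)] by measurable
  \<comment> \<open>The given norm with weight \<open>m\<close> and the Borel norm with weight
    \<open>M\<close> are compared in both directions, here and in \<open>upper\<close>, so that the
    estimate for \<open>M\<close> transfers back to \<open>m\<close>.\<close>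
  have lower: "mixed_enorm p q (?Vm u) \<le> ennreal B * mod_enorm g m p q u" if u: "u \<in> gs_dual" for u
    unfolding mod_enorm_def
    by (rule mixed_enorm_le_lebesgue[OF meas(1)[OF u] norm_ge_zero meas(2)[OF u] B(1) m0(1) B(3) pq])
  have upper: "mod_enorm g m p q u \<le> mixed_enorm p q (?Vm u)" if u: "u \<in> gs_dual" for u
    unfolding mod_enorm_def
    by (rule lebesgue_le_mixed_enorm[OF meas(1)[OF u] norm_ge_zero meas(2)[OF u] m0(2) B(2)])
  have modD: "u \<in> gs_dual" "mixed_enorm p q (?Vm u) < \<infinity>" if "u \<in> mod_space g m p q" for u
  proof -
    show u: "u \<in> gs_dual" using that by (simp add: mod_space_def)
    have "ennreal B * mod_enorm g m p q u < \<infinity>" using that by (simp add: mod_space_def ennreal_mult_less_top)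
    then show "mixed_enorm p q (?Vm u) < \<infinity>" by (rule order.strict_trans1[OF lower[OF u]])
  qed
  note ext = \<sigma> \<sigma>_bd g M AK decay pq
  obtain k where k: "0 < k" "\<And>u. u \<in> gs_dual \<Longrightarrow> mixed_enorm p q (?Vm u) < \<infinity> \<Longrightarrow>
    mixed_enorm p q (?Vm (?T u)) \<le> ennreal k * mixed_enorm p q (?Vm u)"
    by (rule weyl_ext_bounded[OF ext]) (assumption, rule that)
  have T_dual: "?T u \<in> gs_dual" if "u \<in> mod_space g m p q" for u
    by (rule weyl_ext_dual[OF ext modD[OF that]])
  have T_bd: "mod_enorm g m p q (?T u) \<le> ennreal (k * B) * mod_enorm g m p q u" if u: "u \<in> mod_space g m p q" for u
  proof -
    have "mod_enorm g m p q (?T u) \<le> ennreal k * mixed_enorm p q (?Vm u)"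
      by (rule order.trans[OF upper[OF T_dual[OF u]] k(2)[OF modD[OF u]]])
    also have "\<dots> \<le> ennreal k * (ennreal B * mod_enorm g m p q u)"
      by (intro mult_left_mono lower modD(1)[OF u]) simp
    finally show ?thesis using k(1) B(1) by (simp add: ennreal_mult mult.assoc)
  qed
  have fin: "ennreal (k * B) * mod_enorm g m p q u < \<infinity>" if "u \<in> mod_space g m p q" for u
    using that by (simp add: mod_space_def ennreal_mult_less_top)
  have T_space: "?T u \<in> mod_space g m p q" if u: "u \<in> mod_space g m p q" for u
    using T_dual[OF u] order.strict_trans1[OF T_bd[OF u] fin[OF u]] by (simp add: mod_space_def)
  have T_norm: "mod_norm g m p q (?T u) \<le> k * B * mod_norm g m p q u" if u: "u \<in> mod_space g m p q" for u
    using enn2real_mono[OF T_bd[OF u]] fin[OF u] k(1) B(1) by (simp add: mod_norm_def enn2real_mult)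
  have "mod_bounded_operator g m p q ?T"
    unfolding mod_bounded_operator_def
  proof (intro conjI ballI allI)
    fix u w assume "u \<in> mod_space g m p q" "w \<in> mod_space g m p q"
    then show "?T (\<lambda>\<phi>. u \<phi> + w \<phi>) = (\<lambda>\<phi>. ?T u \<phi> + ?T w \<phi>)" by (intro weyl_ext_add[OF ext] modD)
  next
    show "?T (\<lambda>\<phi>. a * u \<phi>) = (\<lambda>\<phi>. a * ?T u \<phi>)" for a u by (rule weyl_ext_cmult)
  next
    show "\<exists>K. \<forall>u\<in>mod_space g m p q. mod_norm g m p q (?T u) \<le> K * mod_norm g m p q u" using T_norm by blast
  qed (rule T_space)
  moreover have "extends_weyl_op g m p q \<sigma> ?T"
    unfolding extends_weyl_op_def
  proof (intro ballI conjI)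
    fix f :: "real ^ 'd \<Rightarrow> complex" assume f: "f \<in> gelfand_shilov"
    have "mod_enorm g m p q (gs_embed f) < \<infinity>"
      by (rule order.strict_trans1[OF upper[OF gs_embed_dual[OF f]] mixed_enorm_gs_embed_finite[OF g(1) f v M pq]])
    then show "gs_embed f \<in> mod_space g m p q" using gs_embed_dual[OF f] by (simp add: mod_space_def)
    show "?T (gs_embed f) = weyl_op \<sigma> f" by (rule weyl_ext_gs_embed[OF ext f])
  qed
  ultimately show ?thesis by blast
qed

end
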